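(* Let $A$ be an Artin algebra and $n\ge 2$ an integer. Then $\mathcal S_n(A)$ is of finite type if and only if there is a bi-generator $M$ of $\mathcal S_n(A)$ such that $\operatorname{gl.dim}\operatorname{End}_{T_n(A)}(M)\le 2$.
   Context: For an Artin algebra $B$, $B\text{-mod}$ is the category of finitely generated left $B$-modules, $\operatorname{add}(M)$ is the full subcategory of direct summands of finite direct sums of copies of $M$, and $D: A^{op}\text{-mod}\to A\text{-mod}$ is the standard duality. An additive full subcategory of $B\text{-mod}$ closed under direct summands is of finite type if it contains only finitely many isomorphism classes of indecomposable $B$-modules. A $B$-module $M\in B\text{-mod}$ is a $B$-generator if each projective module in $B\text{-mod}$ is in $\operatorname{add}(M)$. $T_n(A)$ is the algebra of upper triangular $n\times n$ matrices over $A$. $\operatorname{Mor}_n(A)$ is the category whose objects $X_{(\phi_i)}$ are sequences $X_n\xrightarrow{\phi_{n-1}}X_{n-1}\to\cdots\xrightarrow{\phi_1}X_1$ of $A$-maps in $A\text{-mod}$, and whose morphisms are $n$-tuples of $A$-maps commuting with the structure maps. It is identified with $T_n(A)\text{-mod}$: $X_{(\phi_i)}$ corresponds to $\bigoplus_i X_i$, where $(a_{ij})$ sends $(x_i)_i$ to the column with $i$-th entry $a_{ii}x_i+\sum_{j>i}a_{ij}\phi_i\cdots\phi_{j-1}(x_j)$. $\mathcal S_n(A)$ is the full subcategory of $\operatorname{Mor}_n(A)$ of objects with all $\phi_i$ ($1\le i\le n-1$) monomorphisms. For $N\in A\text{-mod}$ and $1\le i\le n$, $\mathbf m_i(N)\in\operatorname{Mor}_n(A)$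 has $j$-th branch $N$ for $j\le i$ and $0$ for $j>i$, with $j$-th structure map $\operatorname{id}_N$ for $j<i$ and $0$ for $j\ge i$; $\mathbf m(N)=\bigoplus_{1\le i\le n}\mathbf m_i(N)$. A bi-generator of $\mathcal S_n(A)$ is a $T_n(A)$-generator $M$ such that $M\in\mathcal S_n(A)$ and $\mathbf m(D(A_A))\in\operatorname{add}(M)$. *)

theory Defs
  imports
    "HOL-Algebra.Module"
    "HOL-Algebra.QuotRing"
    "HOL-Library.FuncSet"
    "HOL-Library.Extended_Nat"
begin

section \<open>Modules over noncommutative rings\<close>

text \<open>The locale \<^locale>\<open>Module.module\<close> of the library asks for a commutative ring of scalars;
  this is the same notion over an arbitrary ring.  Modules are carried by the library record type
  \<^typ>\<open>('b, 'm) module\<close>, whose fields for multiplication and unit are never used.\<close>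

locale left_module = R?: ring + M?: abelian_group M for M (structure) +
  assumes smult_closed:
      "\<lbrakk>a \<in> carrier R; x \<in> carrier M\<rbrakk> \<Longrightarrow> a \<odot>\<^bsub>M\<^esub> x \<in> carrier M"
    and smult_l_distr:
      "\<lbrakk>a \<in> carrier R; b \<in> carrier R; x \<in> carrier M\<rbrakk> \<Longrightarrow>
        (a \<oplus> b) \<odot>\<^bsub>M\<^esub> x = a \<odot>\<^bsub>M\<^esub> x \<oplus>\<^bsub>M\<^esub> b \<odot>\<^bsub>M\<^esub> x"
    and smult_r_distr:
      "\<lbrakk>a \<in> carrier R; x \<in> carrier M; y \<in> carrier M\<rbrakk> \<Longrightarrow>
        a \<odot>\<^bsub>M\<^esub> (x \<oplus>\<^bsub>M\<^esub> y) = a \<odot>\<^bsub>M\<^esub> x \<oplus>\<^bsub>M\<^esub> a \<odot>\<^bsub>M\<^esub> y"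
    and smult_assoc:
      "\<lbrakk>a \<in> carrier R; b \<in> carrier R; x \<in> carrier M\<rbrakk> \<Longrightarrow>
        (a \<otimes> b) \<odot>\<^bsub>M\<^esub> x = a \<odot>\<^bsub>M\<^esub> (b \<odot>\<^bsub>M\<^esub> x)"
    and smult_one: "x \<in> carrier M \<Longrightarrow> \<one> \<odot>\<^bsub>M\<^esub> x = x"

definition mod_hom ::
    "('b, 'c) ring_scheme \<Rightarrow> ('b, 'm, 'd) module_scheme \<Rightarrow> ('b, 'k, 'e) module_scheme \<Rightarrow> ('m \<Rightarrow> 'k) set"
  where "mod_hom B M N = {f \<in> carrier M \<rightarrow> carrier N.
    (\<forall>x\<in>carrier M. \<forall>y\<in>carrier M. f (x \<oplus>\<^bsub>M\<^esub> y) = f x \<oplus>\<^bsub>N\<^esub> f y) \<and>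
    (\<forall>b\<in>carrier B. \<forall>x\<in>carrier M. f (b \<odot>\<^bsub>M\<^esub> x) = b \<odot>\<^bsub>N\<^esub> f x)}"

definition mod_iso ::
    "('b, 'c) ring_scheme \<Rightarrow> ('b, 'm, 'd) module_scheme \<Rightarrow> ('b, 'k, 'e) module_scheme \<Rightarrow> bool"
  where "mod_iso B M N \<longleftrightarrow> (\<exists>f\<in>mod_hom B M N. bij_betw f (carrier M) (carrier N))"

definition fin_gen :: "('b, 'c) ring_scheme \<Rightarrow> ('b, 'm, 'd) module_scheme \<Rightarrow> bool"
  where "fin_gen B M \<longleftrightarrow> (\<exists>S. finite S \<and> S \<subseteq> carrier M \<and>
    carrier M = {\<Oplus>\<^bsub>M\<^esub>s\<in>S. c s \<odot>\<^bsub>M\<^esub> s | c. c \<in> S \<rightarrow> carrier B})"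

text \<open>The objects of \<open>B\<close>-mod, with carriers in an arbitrary type.\<close>

definition fg_module :: "('b, 'c) ring_scheme \<Rightarrow> ('b, 'm, 'd) module_scheme \<Rightarrow> bool"
  where "fg_module B M \<longleftrightarrow> left_module B M \<and> fin_gen B M"

text \<open>Quantification over all objects of \<open>B\<close>-mod needs a fixed carrier type.  The type below is large
  enough: a module with \<open>k\<close> generators is a quotient of \<open>B^k\<close>, so its elements can be taken
  to be sets of coefficient sequences.  See \<open>fg_module_realised\<close>.\<close>

type_synonym 'b fg_mod = "('b, (nat \<Rightarrow> 'b) set) module"

lemma fg_module_realised:
  fixes B :: "('b, 'c) ring_scheme" and M :: "('b, 'm, 'd) module_scheme"
  assumes fg: "fg_module B M"
  shows "\<exists>N :: 'b fg_mod. fg_module B N \<and> mod_iso B M N"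
proof -
  from fg interpret M: left_module B M by (simp add: fg_module_def)
  from fg obtain S where S: "finite S" "S \<subseteq> carrier M"
    and gen: "carrier M = {\<Oplus>\<^bsub>M\<^esub>s\<in>S. c s \<odot>\<^bsub>M\<^esub> s | c. c \<in> S \<rightarrow> carrier B}"
    by (auto simp: fg_module_def fin_gen_def)
  obtain e :: "'m \<Rightarrow> nat" where e: "inj_on e S"
    using finite_imp_inj_to_nat_seg[OF S(1)] by blast
  define F where "F m = {c :: nat \<Rightarrow> 'b. (\<forall>s\<in>S. c (e s) \<in> carrier B) \<and>
    (\<Oplus>\<^bsub>M\<^esub>s\<in>S. c (e s) \<odot>\<^bsub>M\<^esub> s) = m}" for m
  have ne: "F m \<noteq> {}" if m: "m \<in> carrier M" for m
  proof -
    from m gen obtain c where c: "c \<in> S \<rightarrow> carrier B" "m = (\<Oplus>\<^bsub>M\<^esub>s\<in>S. c s \<odot>\<^bsub>M\<^esub> s)" by auto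
    have "(\<Oplus>\<^bsub>M\<^esub>s\<in>S. c (inv_into S e (e s)) \<odot>\<^bsub>M\<^esub> s) = (\<Oplus>\<^bsub>M\<^esub>s\<in>S. c s \<odot>\<^bsub>M\<^esub> s)"
      by (rule M.M.finsum_cong') (use S c e M.smult_closed in \<open>auto simp: Pi_iff\<close>)
    hence "(\<lambda>k. c (inv_into S e k)) \<in> F m"
      using c e by (auto simp: F_def)
    thus ?thesis by blast
  qed
  have inj: "inj_on F (carrier M)"
  proof (rule inj_onI)
    fix x y assume "x \<in> carrier M" "y \<in> carrier M" "F x = F y"
    moreover obtain c where "c \<in> F x" using ne \<open>x \<in> carrier M\<close> by blast
    ultimately have "c \<in> F x" "c \<in> F y" by auto
    thus "x = y" by (simp add: F_def)
  qed
  define G where "G = inv_into (carrier M) F"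
  have GF [simp]: "G (F x) = x" if "x \<in> carrier M" for x
    using inj that by (simp add: G_def)
  define N :: "'b fg_mod" where "N = \<lparr>carrier = F ` carrier M, mult = undefined, one = undefined,
    zero = F \<zero>\<^bsub>M\<^esub>, add = (\<lambda>x y. F (G x \<oplus>\<^bsub>M\<^esub> G y)), smult = (\<lambda>b x. F (b \<odot>\<^bsub>M\<^esub> G x))\<rparr>"
  have N [simp]: "carrier N = F ` carrier M" "\<zero>\<^bsub>N\<^esub> = F \<zero>\<^bsub>M\<^esub>"
    "x \<oplus>\<^bsub>N\<^esub> y = F (G x \<oplus>\<^bsub>M\<^esub> G y)" "b \<odot>\<^bsub>N\<^esub> x = F (b \<odot>\<^bsub>M\<^esub> G x)" for x y b
    by (simp_all add: N_def)
  have ab: "abelian_group N"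
  proof (rule abelian_groupI)
    fix x assume "x \<in> carrier N"
    then obtain m where m: "m \<in> carrier M" "x = F m" by auto
    hence "F (\<ominus>\<^bsub>M\<^esub> m) \<oplus>\<^bsub>N\<^esub> x = \<zero>\<^bsub>N\<^esub>" by (simp add: M.M.l_neg)
    thus "\<exists>y\<in>carrier N. y \<oplus>\<^bsub>N\<^esub> x = \<zero>\<^bsub>N\<^esub>" using m by force
  qed (auto simp: M.M.a_ac)
  have lm: "left_module B N"
    by (intro left_module.intro left_module_axioms.intro M.R.ring_axioms ab)
      (auto simp: M.smult_closed M.smult_l_distr M.smult_r_distr M.smult_assoc M.smult_one)
  interpret N: left_module B N by (rule lm)
  have sum: "(\<Oplus>\<^bsub>N\<^esub>t\<in>T. F (g t)) = F (\<Oplus>\<^bsub>M\<^esub>t\<in>T. g t)"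
    if "finite T" "g \<in> T \<rightarrow> carrier M" for T and g :: "'m \<Rightarrow> 'm"
    using that
  proof (induction rule: finite_induct)
    case (insert t T)
    have "F \<circ> g \<in> T \<rightarrow> carrier N" "F (g t) \<in> carrier N" using insert.prems by auto
    hence "(\<Oplus>\<^bsub>N\<^esub>t\<in>insert t T. F (g t)) = F (g t) \<oplus>\<^bsub>N\<^esub> (\<Oplus>\<^bsub>N\<^esub>t\<in>T. F (g t))"
      using insert.hyps by (intro N.M.finsum_insert) (auto simp: Pi_iff)
    also have "\<dots> = F (\<Oplus>\<^bsub>M\<^esub>t\<in>insert t T. g t)"
      using insert by (simp add: M.M.finsum_insert Pi_iff)
    finally show ?case .
  qed simp
  have sum': "(\<Oplus>\<^bsub>N\<^esub>t\<in>F ` S. c t \<odot>\<^bsub>N\<^esub> t) = F (\<Oplus>\<^bsub>M\<^esub>s\<in>S. c (F s) \<odot>\<^bsub>M\<^esub> s)"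
    if c: "\<And>s. s \<in> S \<Longrightarrow> c (F s) \<in> carrier B" for c
  proof -
    have "(\<Oplus>\<^bsub>N\<^esub>t\<in>F ` S. c t \<odot>\<^bsub>N\<^esub> t) = (\<Oplus>\<^bsub>N\<^esub>s\<in>S. c (F s) \<odot>\<^bsub>N\<^esub> F s)"
      by (rule N.M.finsum_reindex) (use S c M.smult_closed inj in \<open>auto intro: inj_on_subset\<close>)
    also have "\<dots> = (\<Oplus>\<^bsub>N\<^esub>s\<in>S. F (c (F s) \<odot>\<^bsub>M\<^esub> s))"
      by (rule N.M.finsum_cong') (use S c M.smult_closed in \<open>auto simp: subset_iff\<close>)
    also have "\<dots> = F (\<Oplus>\<^bsub>M\<^esub>s\<in>S. c (F s) \<odot>\<^bsub>M\<^esub> s)"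
      by (rule sum) (use S c M.smult_closed in \<open>auto simp: subset_iff\<close>)
    finally show ?thesis .
  qed
  have "fin_gen B N"
    unfolding fin_gen_def
  proof (intro exI[of _ "F ` S"] conjI)
    show "carrier N = {\<Oplus>\<^bsub>N\<^esub>s\<in>F ` S. c s \<odot>\<^bsub>N\<^esub> s | c. c \<in> F ` S \<rightarrow> carrier B}"
    proof (intro Set.set_eqI iffI)
      fix x assume "x \<in> carrier N"
      then obtain c where c: "c \<in> S \<rightarrow> carrier B" "x = F (\<Oplus>\<^bsub>M\<^esub>s\<in>S. c s \<odot>\<^bsub>M\<^esub> s)"
        using gen by auto
      have "(\<Oplus>\<^bsub>M\<^esub>s\<in>S. c s \<odot>\<^bsub>M\<^esub> s) = (\<Oplus>\<^bsub>M\<^esub>s\<in>S. c (G (F s)) \<odot>\<^bsub>M\<^esub> s)"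
        by (rule M.M.finsum_cong') (use S c M.smult_closed in \<open>auto simp: subset_iff Pi_iff\<close>)
      moreover have cS: "c (G (F s)) \<in> carrier B" if "s \<in> S" for s
        using that S c by (auto simp: subset_iff)
      ultimately have "x = (\<Oplus>\<^bsub>N\<^esub>t\<in>F ` S. c (G t) \<odot>\<^bsub>N\<^esub> t)"
        using sum'[of "c \<circ> G"] c by simp
      thus "x \<in> {\<Oplus>\<^bsub>N\<^esub>s\<in>F ` S. c s \<odot>\<^bsub>N\<^esub> s | c. c \<in> F ` S \<rightarrow> carrier B}"
        using cS by (intro CollectI exI[of _ "c \<circ> G"]) auto
    next
      fix x assume "x \<in> {\<Oplus>\<^bsub>N\<^esub>s\<in>F ` S. c s \<odot>\<^bsub>N\<^esub> s | c. c \<in> F ` S \<rightarrow> carrier B}"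
      then obtain c where c: "c \<in> F ` S \<rightarrow> carrier B" "x = (\<Oplus>\<^bsub>N\<^esub>s\<in>F ` S. c s \<odot>\<^bsub>N\<^esub> s)" by blast
      have "x \<in> F ` carrier M"
        unfolding c(2) using c(1) S
        by (subst sum') (auto intro!: imageI M.M.finsum_closed M.smult_closed)
      thus "x \<in> carrier N" by simp
    qed
  qed (use S in auto)
  moreover have "mod_iso B M N"
    unfolding mod_iso_def using inj
    by (intro bexI[of _ F]) (auto simp: mod_hom_def bij_betw_def M.smult_closed)
  ultimately show ?thesis using lm by (auto simp: fg_module_def)
qed

text \<open>Direct sum of the finite family \<open>(X i)\<close>, \<open>i \<in> I\<close>.\<close>

definition dsum :: "nat set \<Rightarrow> (nat \<Rightarrow> ('b, 'm) module) \<Rightarrow> ('b, nat \<Rightarrow> 'm) module"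
  where "dsum I X = \<lparr>
    carrier = (\<Pi>\<^sub>E i\<in>I. carrier (X i)),
    mult = undefined,
    one = undefined,
    zero = (\<lambda>i\<in>I. \<zero>\<^bsub>X i\<^esub>),
    add = (\<lambda>x y. \<lambda>i\<in>I. x i \<oplus>\<^bsub>X i\<^esub> y i),
    smult = (\<lambda>b x. \<lambda>i\<in>I. b \<odot>\<^bsub>X i\<^esub> x i)\<rparr>"

definition internal_dsum ::
    "('b, 'c) ring_scheme \<Rightarrow> ('b, 'm) module \<Rightarrow> 'm set \<Rightarrow> 'm set \<Rightarrow> bool"
  where "internal_dsum B M U V \<longleftrightarrow> submodule U B M \<and> submodule V B M \<and>
    U <+>\<^bsub>M\<^esub> V = carrier M \<and> U \<inter> V = {\<zero>\<^bsub>M\<^esub>}"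

text \<open>\<open>in_add B M X\<close> means \<open>X \<in> add(M)\<close>: the module \<open>X\<close> is isomorphic to a direct summand of
  some \<open>M^k\<close>.\<close>

definition in_add :: "('b, 'c) ring_scheme \<Rightarrow> ('b, 'm) module \<Rightarrow> ('b, 'k) module \<Rightarrow> bool"
  where "in_add B M X \<longleftrightarrow> (\<exists>(k::nat) U V. internal_dsum B (dsum {..<k} (\<lambda>_. M)) U V \<and>
    mod_iso B X ((dsum {..<k} (\<lambda>_. M))\<lparr>carrier := U\<rparr>))"

definition indecomposable :: "('b, 'c) ring_scheme \<Rightarrow> ('b, 'm) module \<Rightarrow> bool"
  where "indecomposable B M \<longleftrightarrow> carrier M \<noteq> {\<zero>\<^bsub>M\<^esub>} \<and>
    (\<forall>U V. internal_dsum B M U V \<longrightarrow> U = {\<zero>\<^bsub>M\<^esub>} \<or> V = {\<zero>\<^bsub>M\<^esub>})"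

definition finite_type :: "('b, 'c) ring_scheme \<Rightarrow> ('b, 'm) module set \<Rightarrow> bool"
  where "finite_type B \<C> \<longleftrightarrow> (let \<I> = {X \<in> \<C>. indecomposable B X}
    in finite (\<I> // {(X, Y). X \<in> \<I> \<and> Y \<in> \<I> \<and> mod_iso B X Y}))"

section \<open>Projective modules and global dimension\<close>

text \<open>Projective object of \<open>B\<close>-mod, where \<open>P\<close> is itself finitely generated.\<close>

definition projective :: "('b, 'c) ring_scheme \<Rightarrow> ('b, 'm) module \<Rightarrow> bool"
  where "projective B P \<longleftrightarrow> fg_module B P \<and>
    (\<forall>(X :: 'b fg_mod) (Y :: 'b fg_mod). fg_module B X \<and> fg_module B Y \<longrightarrow>
      (\<forall>p\<in>mod_hom B X Y. \<forall>f\<in>mod_hom B P Y. p ` carrier X = carrier Y \<longrightarrow>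
        (\<exists>g\<in>mod_hom B P X. \<forall>x\<in>carrier P. p (g x) = f x)))"

definition generator :: "('b, 'c) ring_scheme \<Rightarrow> ('b, 'm) module \<Rightarrow> bool"
  where "generator B M \<longleftrightarrow> fg_module B M \<and> (\<forall>P :: 'b fg_mod. projective B P \<longrightarrow> in_add B M P)"

text \<open>An exact sequence \<open>\<dots> \<rightarrow> P 1 \<rightarrow> P 0 \<rightarrow> X \<rightarrow> 0\<close> with augmentation \<open>d 0\<close> and differentials
  \<open>d (i + 1) : P (i + 1) \<rightarrow> P i\<close>.\<close>

definition proj_resolution ::
    "('b, 'c) ring_scheme \<Rightarrow> 'b fg_mod \<Rightarrow> (nat \<Rightarrow> 'b fg_mod) \<Rightarrow>
      (nat \<Rightarrow> (nat \<Rightarrow> 'b) set \<Rightarrow> (nat \<Rightarrow> 'b) set) \<Rightarrow> bool"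
  where "proj_resolution B X P d \<longleftrightarrow>
    (\<forall>i. projective B (P i)) \<and>
    d 0 \<in> mod_hom B (P 0) X \<and> d 0 ` carrier (P 0) = carrier X \<and>
    (\<forall>i. d (Suc i) \<in> mod_hom B (P (Suc i)) (P i)) \<and>
    a_kernel (P 0) X (d 0) = d 1 ` carrier (P 1) \<and>
    (\<forall>i. a_kernel (P (Suc i)) (P i) (d (Suc i)) = d (Suc (Suc i)) ` carrier (P (Suc (Suc i))))"

definition proj_dim :: "('b, 'c) ring_scheme \<Rightarrow> 'b fg_mod \<Rightarrow> enat"
  where "proj_dim B X = Inf {enat m | m.
    \<exists>P d. proj_resolution B X P d \<and> (\<forall>i>m. carrier (P i) = {\<zero>\<^bsub>P i\<^esub>})}"

text \<open>Global dimension of an Artin algebra: the supremum of the projective dimensions of the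
  objects of \<open>B\<close>-mod.\<close>

definition gl_dim :: "('b, 'c) ring_scheme \<Rightarrow> enat"
  where "gl_dim B = (SUP X\<in>{X :: 'b fg_mod. fg_module B X}. proj_dim B X)"

text \<open>Multiplication in \<open>End_B(M)\<close> is composition.  Endomorphisms are \<^const>\<open>undefined\<close> outside the
  carrier, so that each one is represented by a single HOL function.\<close>

definition End_ring :: "('b, 'c) ring_scheme \<Rightarrow> ('b, 'm) module \<Rightarrow> ('m \<Rightarrow> 'm) ring"
  where "End_ring B M = \<lparr>
    carrier = mod_hom B M M \<inter> extensional (carrier M),
    mult = compose (carrier M),
    one = (\<lambda>x\<in>carrier M. x),
    zero = (\<lambda>x\<in>carrier M. \<zero>\<^bsub>M\<^esub>),
    add = (\<lambda>f g. \<lambda>x\<in>carrier M. f x \<oplus>\<^bsub>M\<^esub> g x)\<rparr>"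

section \<open>Artin algebras and the standard duality\<close>

definition artinian_cring :: "('r, 'c) ring_scheme \<Rightarrow> bool"
  where "artinian_cring R \<longleftrightarrow> cring R \<and>
    (\<forall>I :: nat \<Rightarrow> 'r set. (\<forall>k. ideal (I k) R \<and> I (Suc k) \<subseteq> I k) \<longrightarrow> (\<exists>m. \<forall>k\<ge>m. I k = I m))"

definition artin_algebra :: "('r, 'c) ring_scheme \<Rightarrow> ('r, 'a) module \<Rightarrow> bool"
  where "artin_algebra R A \<longleftrightarrow> artinian_cring R \<and> ring A \<and> Module.module R A \<and>
    (\<forall>r\<in>carrier R. \<forall>a\<in>carrier A. \<forall>b\<in>carrier A.
      (r \<odot>\<^bsub>A\<^esub> a) \<otimes>\<^bsub>A\<^esub> b = r \<odot>\<^bsub>A\<^esub> (a \<otimes>\<^bsub>A\<^esub> b) \<and>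
      a \<otimes>\<^bsub>A\<^esub> (r \<odot>\<^bsub>A\<^esub> b) = r \<odot>\<^bsub>A\<^esub> (a \<otimes>\<^bsub>A\<^esub> b)) \<and>
    fin_gen R A"

definition rad :: "('r, 'c) ring_scheme \<Rightarrow> 'r set"
  where "rad R = carrier R \<inter> \<Inter>{I. maximalideal I R}"

text \<open>The \<open>R\<close>-module \<open>R/I\<close>.\<close>

definition quot_module :: "'r ring \<Rightarrow> 'r set \<Rightarrow> ('r, 'r set) module"
  where "quot_module R I = ring.extend (R Quot I)
    (module.fields (\<lambda>r X. (I +>\<^bsub>R\<^esub> r) \<otimes>\<^bsub>R Quot I\<^esub> X))"

text \<open>Testing injectivity on finitely generated modules is no restriction over a commutative
  artinian ring, by Baer's criterion.\<close>

definition injective :: "('r, 'c) ring_scheme \<Rightarrow> ('r, 'e) module \<Rightarrow> bool"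
  where "injective R E \<longleftrightarrow>
    (\<forall>(X :: 'r fg_mod) (Y :: 'r fg_mod). fg_module R X \<and> fg_module R Y \<longrightarrow>
      (\<forall>i\<in>mod_hom R X Y. \<forall>f\<in>mod_hom R X E. inj_on i (carrier X) \<longrightarrow>
        (\<exists>g\<in>mod_hom R Y E. \<forall>x\<in>carrier X. g (i x) = f x)))"

definition injective_envelope :: "('r, 'c) ring_scheme \<Rightarrow> ('r, 's) module \<Rightarrow> ('r, 'e) module \<Rightarrow> bool"
  where "injective_envelope R S E \<longleftrightarrow> left_module R E \<and> injective R E \<and>
    (\<exists>\<iota>\<in>mod_hom R S E. inj_on \<iota> (carrier S) \<and>
      (\<forall>U. submodule U R E \<and> U \<noteq> {\<zero>\<^bsub>E\<^esub>} \<longrightarrow> U \<inter> \<iota> ` carrier S \<noteq> {\<zero>\<^bsub>E\<^esub>}))"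

text \<open>The right module \<open>A_A\<close>, as a left module over the opposite ring of \<open>A\<close>.\<close>

definition regular_right :: "('a, 'c) ring_scheme \<Rightarrow> ('a, 'a) module"
  where "regular_right A = \<lparr>carrier = carrier A, mult = undefined, one = undefined,
    zero = \<zero>\<^bsub>A\<^esub>, add = add A, smult = (\<lambda>a x. x \<otimes>\<^bsub>A\<^esub> a)\<rparr>"

definition restrict_scalars :: "('r, 'a) module \<Rightarrow> ('a, 'm) module \<Rightarrow> ('r, 'm) module"
  where "restrict_scalars A X = \<lparr>carrier = carrier X, mult = undefined, one = undefined,
    zero = \<zero>\<^bsub>X\<^esub>, add = add X, smult = (\<lambda>r x. (r \<odot>\<^bsub>A\<^esub> \<one>\<^bsub>A\<^esub>) \<odot>\<^bsub>X\<^esub> x)\<rparr>"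

text \<open>The standard duality \<open>D = Hom_R(-, E)\<close>, where \<open>E\<close> is an injective envelope of \<open>R/rad R\<close>,
  on a right \<open>A\<close>-module \<open>X\<close>.  The left action on \<open>D X\<close> is \<open>(a f)(x) = f(x a)\<close>.\<close>

definition duality ::
    "('r, 'c) ring_scheme \<Rightarrow> ('r, 'a) module \<Rightarrow> ('r, 'e) module \<Rightarrow> ('a, 'm) module \<Rightarrow> ('a, 'm \<Rightarrow> 'e) module"
  where "duality R A E X = \<lparr>
    carrier = mod_hom R (restrict_scalars A X) E \<inter> extensional (carrier X),
    mult = undefined,
    one = undefined,
    zero = (\<lambda>x\<in>carrier X. \<zero>\<^bsub>E\<^esub>),
    add = (\<lambda>f g. \<lambda>x\<in>carrier X. f x \<oplus>\<^bsub>E\<^esub> g x),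
    smult = (\<lambda>a f. \<lambda>x\<in>carrier X. f (a \<odot>\<^bsub>X\<^esub> x))\<rparr>"

section \<open>Triangular matrices and the morphism category\<close>

definition tri_ring :: "nat \<Rightarrow> ('a, 'c) ring_scheme \<Rightarrow> (nat \<Rightarrow> nat \<Rightarrow> 'a) ring"
  where "tri_ring n A = \<lparr>
    carrier = {a. \<forall>i j. if 1 \<le> i \<and> i \<le> j \<and> j \<le> n then a i j \<in> carrier A else a i j = \<zero>\<^bsub>A\<^esub>},
    mult = (\<lambda>a b i j. \<Oplus>\<^bsub>A\<^esub>k\<in>{1..n}. a i k \<otimes>\<^bsub>A\<^esub> b k j),
    one = (\<lambda>i j. if i = j \<and> i \<in> {1..n} then \<one>\<^bsub>A\<^esub> else \<zero>\<^bsub>A\<^esub>),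
    zero = (\<lambda>i j. \<zero>\<^bsub>A\<^esub>),
    add = (\<lambda>a b i j. a i j \<oplus>\<^bsub>A\<^esub> b i j)\<rparr>"

text \<open>Objects of \<open>Mor_n(A)\<close>: modules \<open>branch X i\<close> for \<open>1 \<le> i \<le> n\<close> and structure maps
  \<open>smap X i : branch X (i + 1) \<rightarrow> branch X i\<close> for \<open>1 \<le> i < n\<close>; values at other indices are
  irrelevant.\<close>

record ('a, 'm) mor =
  branch :: "nat \<Rightarrow> ('a, 'm) module"
  smap :: "nat \<Rightarrow> 'm \<Rightarrow> 'm"

definition Mor :: "nat \<Rightarrow> ('a, 'c) ring_scheme \<Rightarrow> ('a, 'm) mor set"
  where "Mor n A = {X. (\<forall>i\<in>{1..n}. fg_module A (branch X i)) \<and>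
    (\<forall>i\<in>{1..<n}. smap X i \<in> mod_hom A (branch X (Suc i)) (branch X i))}"

text \<open>The identification of \<open>Mor_n(A)\<close> with \<open>T_n(A)\<close>-mod.  The composite
  \<open>\<phi>_i \<dots> \<phi>_(j-1) : X_j \<rightarrow> X_i\<close> is \<open>foldr \<phi> [i..<j]\<close>, the identity for \<open>j = i\<close>.\<close>

definition tri_module :: "nat \<Rightarrow> ('a, 'm) mor \<Rightarrow> (nat \<Rightarrow> nat \<Rightarrow> 'a, nat \<Rightarrow> 'm) module"
  where "tri_module n X = \<lparr>
    carrier = (\<Pi>\<^sub>E i\<in>{1..n}. carrier (branch X i)),
    mult = undefined,
    one = undefined,
    zero = (\<lambda>i\<in>{1..n}. \<zero>\<^bsub>branch X i\<^esub>),
    add = (\<lambda>x y. \<lambda>i\<in>{1..n}. x i \<oplus>\<^bsub>branch X i\<^esub> y i),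
    smult = (\<lambda>a x. \<lambda>i\<in>{1..n}. a i i \<odot>\<^bsub>branch X i\<^esub> x i \<oplus>\<^bsub>branch X i\<^esub>
      (\<Oplus>\<^bsub>branch X i\<^esub>j\<in>{i<..n}. a i j \<odot>\<^bsub>branch X i\<^esub> foldr (smap X) [i..<j] (x j)))\<rparr>"

text \<open>The monomorphism category \<open>S_n(A)\<close>.\<close>

definition Smon :: "nat \<Rightarrow> ('a, 'c) ring_scheme \<Rightarrow> ('a, 'm) mor set"
  where "Smon n A = {X \<in> Mor n A. \<forall>i\<in>{1..<n}. inj_on (smap X i) (carrier (branch X (Suc i)))}"

definition mi :: "nat \<Rightarrow> ('a, 'm) module \<Rightarrow> ('a, 'm) mor"
  where "mi i N = \<lparr>
    branch = (\<lambda>j. if j \<le> i then N else N\<lparr>carrier := {\<zero>\<^bsub>N\<^esub>}\<rparr>),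
    smap = (\<lambda>j x. if j < i then x else \<zero>\<^bsub>N\<^esub>)\<rparr>"

definition mor_dsum :: "nat set \<Rightarrow> (nat \<Rightarrow> ('a, 'm) mor) \<Rightarrow> ('a, nat \<Rightarrow> 'm) mor"
  where "mor_dsum I X = \<lparr>
    branch = (\<lambda>j. dsum I (\<lambda>i. branch (X i) j)),
    smap = (\<lambda>j x. \<lambda>i\<in>I. smap (X i) j (x i))\<rparr>"

definition mm :: "nat \<Rightarrow> ('a, 'm) module \<Rightarrow> ('a, nat \<Rightarrow> 'm) mor"
  where "mm n N = mor_dsum {1..n} (\<lambda>i. mi i N)"

text \<open>Here \<open>D\<close> stands for the module \<open>D(A_A)\<close>.\<close>

definition bi_generator ::
    "nat \<Rightarrow> ('a, 'c) ring_scheme \<Rightarrow> ('a, 'd) module \<Rightarrow> ('a, 'm) mor \<Rightarrow> bool"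
  where "bi_generator n A D M \<longleftrightarrow> generator (tri_ring n A) (tri_module n M) \<and> M \<in> Smon n A \<and>
    in_add (tri_ring n A) (tri_module n M) (tri_module n (mm n D))"

end

theory Submission imports Defs begin

text \<open>Write \<open>T = T_n(A)\<close> and \<open>\<Gamma> = End_T(M)\<close>. A \<open>T\<close>-module belongs to \<open>S_n(A)\<close> iff its structure maps
  are injective, a property inherited by submodules and direct sums.

  If \<open>S_n(A)\<close> is of finite type, let \<open>M\<close> be the direct sum of its indecomposables. Then \<open>add(M)\<close> contains
  every submodule of every \<open>M^k\<close>. The second syzygy of a \<open>\<Gamma>\<close>-module has the form \<open>Hom(Y, M)\<close> with
  \<open>Y\<close> a submodule of some \<open>M^k\<close>, hence it is projective.

  Conversely let \<open>M\<close> be a bi-generator with \<open>gl.dim \<Gamma> \<le> 2\<close> and let \<open>X\<close> be in \<open>S_n(A)\<close>. Applying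
  \<open>Hom(-, M)\<close> to a free presentation of \<open>X\<close> shows that \<open>Hom(X, M)\<close> is a second syzygy, so it is
  projective, and a dual basis gives a map \<open>f : X \<rightarrow> M^k\<close> through which all maps \<open>X \<rightarrow> M\<close> factor,
  together with an idempotent of \<open>M^k\<close> fixing the image of \<open>f\<close>. As \<open>add(M)\<close> contains \<open>m(D(A_A))\<close>,
  which detects monomorphisms and images within \<open>S_n(A)\<close>, the map \<open>f\<close> is a split monomorphism. So \<open>X\<close>
  lies in \<open>add(M)\<close>, which has finitely many indecomposables by Fitting's lemma.\<close>

text \<open>Multiplication in \<open>End_ring\<close> is composition, so \<Gamma> acts on M from the
  left and the functor at hand is the contravariant Hom(-, M). It sends M^k to the free module
  \<Gamma>^k and T to M itself, which is \<Gamma>-projective because M is a generator. Projectivity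
  of Hom(X, M) yields an approximation X -> M^k and an idempotent, but no exactness. An injective
  cogenerator of all T-modules cannot be used to supply it, since its structure maps need not be
  injective; m(D(A_A)) lies in S_n(A) and replaces it, at the price of a detection argument along
  the chain of structure maps. All finiteness goes back to R: Hopkins' theorem gives R finite
  length, from which the finite length of A, T and \<Gamma> over themselves and, by counting
  annihilators, that of Hom_R(A, E) are derived. The modules have carriers of many types, which is
  why summands are expressed by pairs of maps.\<close>

lemma (in left_module) smult_zero_right [simp]:
  assumes "a \<in> carrier R" shows "a \<odot>\<^bsub>M\<^esub> \<zero>\<^bsub>M\<^esub> = \<zero>\<^bsub>M\<^esub>"
proof -
  have "a \<odot>\<^bsub>M\<^esub> \<zero>\<^bsub>M\<^esub> \<oplus>\<^bsub>M\<^esub> a \<odot>\<^bsub>M\<^esub> \<zero>\<^bsub>M\<^esub> = a \<odot>\<^bsub>M\<^esub> \<zero>\<^bsub>M\<^esub> \<oplus>\<^bsub>M\<^esub> \<zero>\<^bsub>M\<^esub>"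
    using assms smult_r_distr[of a "\<zero>\<^bsub>M\<^esub>" "\<zero>\<^bsub>M\<^esub>"] by (simp add: smult_closed)
  thus ?thesis using assms by (simp add: smult_closed del: M.r_zero)
qed

lemma (in left_module) smult_zero_left [simp]:
  assumes "x \<in> carrier M" shows "\<zero> \<odot>\<^bsub>M\<^esub> x = \<zero>\<^bsub>M\<^esub>"
proof -
  have "\<zero> \<odot>\<^bsub>M\<^esub> x \<oplus>\<^bsub>M\<^esub> \<zero> \<odot>\<^bsub>M\<^esub> x = \<zero> \<odot>\<^bsub>M\<^esub> x \<oplus>\<^bsub>M\<^esub> \<zero>\<^bsub>M\<^esub>"
    using assms smult_l_distr[of "\<zero>" "\<zero>" x] by (simp add: smult_closed)
  thus ?thesis using assms by (simp add: smult_closed del: M.r_zero)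
qed

lemma (in left_module) smult_minus_left:
  assumes "a \<in> carrier R" "x \<in> carrier M" shows "(\<ominus> a) \<odot>\<^bsub>M\<^esub> x = \<ominus>\<^bsub>M\<^esub> (a \<odot>\<^bsub>M\<^esub> x)"
proof -
  have "(\<ominus> a) \<odot>\<^bsub>M\<^esub> x \<oplus>\<^bsub>M\<^esub> a \<odot>\<^bsub>M\<^esub> x = \<zero>\<^bsub>M\<^esub>"
    using assms smult_l_distr[of "\<ominus> a" a x] by (simp add: R.l_neg)
  thus ?thesis using assms by (metis M.minus_equality smult_closed R.a_inv_closed)
qed

lemma (in left_module) smult_minus_right:
  assumes "a \<in> carrier R" "x \<in> carrier M" shows "a \<odot>\<^bsub>M\<^esub> (\<ominus>\<^bsub>M\<^esub> x) = \<ominus>\<^bsub>M\<^esub> (a \<odot>\<^bsub>M\<^esub> x)"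
proof -
  have "a \<odot>\<^bsub>M\<^esub> (\<ominus>\<^bsub>M\<^esub> x) \<oplus>\<^bsub>M\<^esub> a \<odot>\<^bsub>M\<^esub> x = \<zero>\<^bsub>M\<^esub>"
    using assms smult_r_distr[of a "\<ominus>\<^bsub>M\<^esub> x" x] by (simp add: M.l_neg)
  thus ?thesis using assms by (metis M.minus_equality smult_closed M.a_inv_closed)
qed

text \<open>Closure under negatives follows from closure under the scalar
  \<open>\<ominus> \<one>\<close>, which keeps this introduction rule to four conditions.\<close>

lemma (in left_module) submoduleI:
  assumes "U \<subseteq> carrier M" "\<zero>\<^bsub>M\<^esub> \<in> U" "\<And>x y. \<lbrakk>x \<in> U; y \<in> U\<rbrakk> \<Longrightarrow> x \<oplus>\<^bsub>M\<^esub> y \<in> U"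
    "\<And>a x. \<lbrakk>a \<in> carrier R; x \<in> U\<rbrakk> \<Longrightarrow> a \<odot>\<^bsub>M\<^esub> x \<in> U"
  shows "submodule U R M"
proof -
  have "\<ominus>\<^bsub>M\<^esub> x \<in> U" if "x \<in> U" for x
    using assms(4)[of "\<ominus> \<one>" x] that assms(1) smult_minus_left[of \<one> x] smult_one[of x] by auto
  thus ?thesis
    by (intro submodule.intro subgroup.intro submodule_axioms.intro)
      (use assms in \<open>simp_all flip: a_inv_def\<close>)
qed

section \<open>Submodules and module homomorphisms\<close>

lemma submodule_subset: "submodule U B M \<Longrightarrow> U \<subseteq> carrier M"
  using subgroup.subset by (fastforce simp: submodule_def)

lemma submodule_mem: "\<lbrakk>submodule U B M; x \<in> U\<rbrakk> \<Longrightarrow> x \<in> carrier M"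
  using submodule_subset by blast

lemma submodule_zero: "submodule U B M \<Longrightarrow> \<zero>\<^bsub>M\<^esub> \<in> U"
  using subgroup.one_closed by (force simp: submodule_def)

lemma submodule_add: "\<lbrakk>submodule U B M; x \<in> U; y \<in> U\<rbrakk> \<Longrightarrow> x \<oplus>\<^bsub>M\<^esub> y \<in> U"
  using subgroup.m_closed by (force simp: submodule_def)

lemma submodule_smult: "\<lbrakk>submodule U B M; a \<in> carrier B; x \<in> U\<rbrakk> \<Longrightarrow> a \<odot>\<^bsub>M\<^esub> x \<in> U"
  using submodule.smult_closed by metis

lemma submodule_minus: "\<lbrakk>submodule U B M; x \<in> U\<rbrakk> \<Longrightarrow> \<ominus>\<^bsub>M\<^esub> x \<in> U"
  using subgroup.m_inv_closed by (force simp: submodule_def a_inv_def)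

lemma submodule_diff: "\<lbrakk>submodule U B M; x \<in> U; y \<in> U\<rbrakk> \<Longrightarrow> x \<ominus>\<^bsub>M\<^esub> y \<in> U"
  by (simp add: a_minus_def submodule_add submodule_minus)

lemma left_moduleI:
  assumes "ring B" "abelian_group M"
    "\<And>a x. \<lbrakk>a \<in> carrier B; x \<in> carrier M\<rbrakk> \<Longrightarrow> a \<odot>\<^bsub>M\<^esub> x \<in> carrier M"
    "\<And>a b x. \<lbrakk>a \<in> carrier B; b \<in> carrier B; x \<in> carrier M\<rbrakk> \<Longrightarrow>
      (a \<oplus>\<^bsub>B\<^esub> b) \<odot>\<^bsub>M\<^esub> x = a \<odot>\<^bsub>M\<^esub> x \<oplus>\<^bsub>M\<^esub> b \<odot>\<^bsub>M\<^esub> x"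
    "\<And>a x y. \<lbrakk>a \<in> carrier B; x \<in> carrier M; y \<in> carrier M\<rbrakk> \<Longrightarrow>
      a \<odot>\<^bsub>M\<^esub> (x \<oplus>\<^bsub>M\<^esub> y) = a \<odot>\<^bsub>M\<^esub> x \<oplus>\<^bsub>M\<^esub> a \<odot>\<^bsub>M\<^esub> y"
    "\<And>a b x. \<lbrakk>a \<in> carrier B; b \<in> carrier B; x \<in> carrier M\<rbrakk> \<Longrightarrow>
      (a \<otimes>\<^bsub>B\<^esub> b) \<odot>\<^bsub>M\<^esub> x = a \<odot>\<^bsub>M\<^esub> (b \<odot>\<^bsub>M\<^esub> x)"
    "\<And>x. x \<in> carrier M \<Longrightarrow> \<one>\<^bsub>B\<^esub> \<odot>\<^bsub>M\<^esub> x = x"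
  shows "left_module B M"
  by (intro left_module.intro left_module_axioms.intro assms)

lemma submodule_left_module:
  assumes "left_module B M" "submodule U B M"
  shows "left_module B (M\<lparr>carrier := U\<rparr>)"
proof -
  interpret M: left_module B M by fact
  note U = submodule_mem[OF assms(2)] submodule_zero[OF assms(2)] submodule_add[OF assms(2)]
    submodule_smult[OF assms(2)] submodule_minus[OF assms(2)]
  have "abelian_group (M\<lparr>carrier := U\<rparr>)"
  proof (rule abelian_groupI)
    fix x assume "x \<in> carrier (M\<lparr>carrier := U\<rparr>)"
    thus "\<exists>y\<in>carrier (M\<lparr>carrier := U\<rparr>). y \<oplus>\<^bsub>M\<lparr>carrier := U\<rparr>\<^esub> x = \<zero>\<^bsub>M\<lparr>carrier := U\<rparr>\<^esub>"
      using U by (intro bexI[of _ "\<ominus>\<^bsub>M\<^esub> x"]) (auto simp: M.M.l_neg)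
  qed (use U in \<open>auto simp: M.M.a_ac\<close>)
  thus ?thesis
    by (intro left_moduleI M.R.ring_axioms)
      (use U in \<open>auto simp: M.smult_l_distr M.smult_r_distr M.smult_assoc M.smult_one\<close>)
qed

lemma mod_homI:
  assumes "\<And>x. x \<in> carrier M \<Longrightarrow> f x \<in> carrier N"
    "\<And>x y. \<lbrakk>x \<in> carrier M; y \<in> carrier M\<rbrakk> \<Longrightarrow> f (x \<oplus>\<^bsub>M\<^esub> y) = f x \<oplus>\<^bsub>N\<^esub> f y"
    "\<And>b x. \<lbrakk>b \<in> carrier B; x \<in> carrier M\<rbrakk> \<Longrightarrow> f (b \<odot>\<^bsub>M\<^esub> x) = b \<odot>\<^bsub>N\<^esub> f x"
  shows "f \<in> mod_hom B M N"
  using assms by (auto simp: mod_hom_def)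

lemma mod_hom_closed: "\<lbrakk>f \<in> mod_hom B M N; x \<in> carrier M\<rbrakk> \<Longrightarrow> f x \<in> carrier N"
  by (auto simp: mod_hom_def)

lemma mod_hom_add:
  "\<lbrakk>f \<in> mod_hom B M N; x \<in> carrier M; y \<in> carrier M\<rbrakk> \<Longrightarrow> f (x \<oplus>\<^bsub>M\<^esub> y) = f x \<oplus>\<^bsub>N\<^esub> f y"
  by (auto simp: mod_hom_def)

lemma mod_hom_smult:
  "\<lbrakk>f \<in> mod_hom B M N; b \<in> carrier B; x \<in> carrier M\<rbrakk> \<Longrightarrow> f (b \<odot>\<^bsub>M\<^esub> x) = b \<odot>\<^bsub>N\<^esub> f x"
  by (auto simp: mod_hom_def)

lemma additive_zero:
  assumes "abelian_group M" "abelian_group N" "f \<in> carrier M \<rightarrow> carrier N"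
    "\<And>x y. \<lbrakk>x \<in> carrier M; y \<in> carrier M\<rbrakk> \<Longrightarrow> f (x \<oplus>\<^bsub>M\<^esub> y) = f x \<oplus>\<^bsub>N\<^esub> f y"
  shows "f \<zero>\<^bsub>M\<^esub> = \<zero>\<^bsub>N\<^esub>"
proof -
  interpret M: abelian_group M by fact
  interpret N: abelian_group N by fact
  have "f \<zero>\<^bsub>M\<^esub> \<oplus>\<^bsub>N\<^esub> f \<zero>\<^bsub>M\<^esub> = f \<zero>\<^bsub>M\<^esub>" "f \<zero>\<^bsub>M\<^esub> \<in> carrier N"
    using assms(3) assms(4)[of "\<zero>\<^bsub>M\<^esub>" "\<zero>\<^bsub>M\<^esub>"] by auto
  thus ?thesis using N.add.l_cancel_one by blast
qed

text \<open>Stated for additive maps without scalars, because it is also applied to scalar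
  multiplication in either argument and to identity maps between modules over different
  rings.\<close>

lemma additive_finsum:
  assumes "abelian_group M" "abelian_group N" "f \<in> carrier M \<rightarrow> carrier N"
    "\<And>x y. \<lbrakk>x \<in> carrier M; y \<in> carrier M\<rbrakk> \<Longrightarrow> f (x \<oplus>\<^bsub>M\<^esub> y) = f x \<oplus>\<^bsub>N\<^esub> f y"
    and "g \<in> I \<rightarrow> carrier M"
  shows "f (finsum M g I) = (\<Oplus>\<^bsub>N\<^esub>i\<in>I. f (g i))"
proof -
  interpret M: abelian_group M by fact
  interpret N: abelian_group N by fact
  show ?thesis using assms(5)
  proof (induction I rule: infinite_finite_induct)
    case (insert x F)
    have "f (finsum M g (insert x F)) = f (g x) \<oplus>\<^bsub>N\<^esub> f (finsum M g F)"
      using insert assms(4) M.finsum_closed[of g F] by (simp add: M.finsum_insert Pi_iff)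
    also have "\<dots> = (\<Oplus>\<^bsub>N\<^esub>i\<in>insert x F. f (g i))"
      using insert assms(3) by (subst N.finsum_insert) (auto simp: Pi_iff)
    finally show ?case .
  qed (use additive_zero[OF assms(1-4)] in \<open>auto simp: M.finsum_infinite N.finsum_infinite\<close>)
qed

lemma left_module_abelian [dest]: "left_module B M \<Longrightarrow> abelian_group M"
  by (simp add: left_module_def)

lemma left_module_ring [dest]: "left_module B M \<Longrightarrow> ring B"
  by (simp add: left_module_def)

lemma mod_hom_zero:
  "\<lbrakk>left_module B M; left_module B N; f \<in> mod_hom B M N\<rbrakk> \<Longrightarrow> f \<zero>\<^bsub>M\<^esub> = \<zero>\<^bsub>N\<^esub>"
  by (rule additive_zero) (auto simp: mod_hom_def)

lemma mod_hom_finsum: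
  "\<lbrakk>left_module B M; left_module B N; f \<in> mod_hom B M N; g \<in> I \<rightarrow> carrier M\<rbrakk> \<Longrightarrow>
    f (finsum M g I) = (\<Oplus>\<^bsub>N\<^esub>i\<in>I. f (g i))"
  by (rule additive_finsum) (auto simp: mod_hom_def)

lemma mod_hom_minus:
  assumes "left_module B M" "left_module B N" "f \<in> mod_hom B M N" "x \<in> carrier M"
  shows "f (\<ominus>\<^bsub>M\<^esub> x) = \<ominus>\<^bsub>N\<^esub> f x"
proof -
  interpret M: left_module B M by fact
  interpret N: left_module B N by fact
  have "f (\<ominus>\<^bsub>M\<^esub> x) \<oplus>\<^bsub>N\<^esub> f x = \<zero>\<^bsub>N\<^esub>"
    using assms mod_hom_add[OF assms(3), of "\<ominus>\<^bsub>M\<^esub> x" x] by (simp add: M.M.l_neg mod_hom_zero)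
  thus ?thesis using assms by (metis N.M.minus_equality M.M.a_inv_closed mod_hom_closed)
qed

lemma mod_hom_diff:
  assumes "left_module B M" "left_module B N" "f \<in> mod_hom B M N" "x \<in> carrier M" "y \<in> carrier M"
  shows "f (x \<ominus>\<^bsub>M\<^esub> y) = f x \<ominus>\<^bsub>N\<^esub> f y"
proof -
  interpret M: left_module B M by fact
  show ?thesis using assms by (simp add: a_minus_def mod_hom_add mod_hom_minus)
qed

lemma (in abelian_group) minus_eq_zero_iff:
  "\<lbrakk>x \<in> carrier G; y \<in> carrier G\<rbrakk> \<Longrightarrow> x \<ominus> y = \<zero> \<longleftrightarrow> x = y"
  by (metis a_minus_def minus_equality minus_minus r_neg a_inv_closed)

lemma (in abelian_group) add_minus_cancel:
  "\<lbrakk>x \<in> carrier G; y \<in> carrier G\<rbrakk> \<Longrightarrow> y \<oplus> (x \<ominus> y) = x"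
  "\<lbrakk>x \<in> carrier G; y \<in> carrier G\<rbrakk> \<Longrightarrow> (x \<ominus> y) \<oplus> y = x"
  by (simp_all add: a_minus_def a_assoc l_neg a_lcomm[of y x] r_neg)

lemma mod_hom_inj_iff:
  assumes "left_module B M" "left_module B N" "f \<in> mod_hom B M N"
  shows "inj_on f (carrier M) \<longleftrightarrow> (\<forall>x\<in>carrier M. f x = \<zero>\<^bsub>N\<^esub> \<longrightarrow> x = \<zero>\<^bsub>M\<^esub>)"
proof -
  interpret M: left_module B M by fact
  interpret N: left_module B N by fact
  show ?thesis
  proof (intro iffI ballI impI inj_onI)
    fix x assume "inj_on f (carrier M)" "x \<in> carrier M" "f x = \<zero>\<^bsub>N\<^esub>"
    thus "x = \<zero>\<^bsub>M\<^esub>" using mod_hom_zero[OF assms] by (metis inj_onD M.M.zero_closed)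
  next
    fix x y assume *: "\<forall>x\<in>carrier M. f x = \<zero>\<^bsub>N\<^esub> \<longrightarrow> x = \<zero>\<^bsub>M\<^esub>" "x \<in> carrier M" "y \<in> carrier M" "f x = f y"
    hence "f (x \<ominus>\<^bsub>M\<^esub> y) = \<zero>\<^bsub>N\<^esub>"
      using mod_hom_diff[OF assms] assms(3) by (simp add: N.M.minus_eq_zero_iff mod_hom_closed)
    hence "x \<ominus>\<^bsub>M\<^esub> y = \<zero>\<^bsub>M\<^esub>" using * by simp
    thus "x = y" using * by (simp add: M.M.minus_eq_zero_iff)
  qed
qed

lemma mod_hom_id: "(\<lambda>x. x) \<in> mod_hom B M M"
  by (auto simp: mod_hom_def)

lemma mod_hom_comp: "\<lbrakk>f \<in> mod_hom B M N; g \<in> mod_hom B N K\<rbrakk> \<Longrightarrow> (\<lambda>x. g (f x)) \<in> mod_hom B M K"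
  by (auto simp: mod_hom_def Pi_iff)

lemma mod_hom_cong:
  assumes "left_module B M" "f \<in> mod_hom B M N" "\<And>x. x \<in> carrier M \<Longrightarrow> g x = f x"
  shows "g \<in> mod_hom B M N"
proof -
  interpret M: left_module B M by fact
  show ?thesis using assms by (auto simp: mod_hom_def M.smult_closed)
qed

lemma mod_hom_const_zero:
  assumes "left_module B N" shows "(\<lambda>x. \<zero>\<^bsub>N\<^esub>) \<in> mod_hom B M N"
proof -
  interpret N: left_module B N by fact
  show ?thesis by (rule mod_homI) auto
qed

lemma mod_hom_sum:
  assumes "left_module B N" "f \<in> mod_hom B M N" "g \<in> mod_hom B M N"
  shows "(\<lambda>x. f x \<oplus>\<^bsub>N\<^esub> g x) \<in> mod_hom B M N"
proof -
  interpret N: left_module B N by fact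
  show ?thesis using assms(2,3)
    by (intro mod_homI) (auto simp: mod_hom_add mod_hom_smult mod_hom_closed N.smult_r_distr N.M.a_ac)
qed

lemma mod_hom_difference:
  assumes "left_module B N" "f \<in> mod_hom B M N" "g \<in> mod_hom B M N"
  shows "(\<lambda>x. f x \<ominus>\<^bsub>N\<^esub> g x) \<in> mod_hom B M N"
proof -
  interpret N: left_module B N by fact
  have "(\<lambda>x. \<ominus>\<^bsub>N\<^esub> g x) \<in> mod_hom B M N"
    using assms(3) by (intro mod_homI)
      (auto simp: mod_hom_add mod_hom_smult mod_hom_closed N.smult_minus_right N.M.minus_add)
  from mod_hom_sum[OF assms(1,2) this] show ?thesis by (simp add: a_minus_def)
qed

lemma mod_hom_finsum_pointwise:
  assumes "left_module B N" "\<And>i. i \<in> I \<Longrightarrow> f i \<in> mod_hom B M N"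
  shows "(\<lambda>x. \<Oplus>\<^bsub>N\<^esub>i\<in>I. f i x) \<in> mod_hom B M N"
proof -
  interpret N: left_module B N by fact
  show ?thesis
  proof (rule mod_homI)
    fix x assume "x \<in> carrier M"
    thus "(\<Oplus>\<^bsub>N\<^esub>i\<in>I. f i x) \<in> carrier N"
      using mod_hom_closed[OF assms(2)] by (intro N.M.finsum_closed) auto
  next
    fix x y assume xy: "x \<in> carrier M" "y \<in> carrier M"
    have "(\<Oplus>\<^bsub>N\<^esub>i\<in>I. f i (x \<oplus>\<^bsub>M\<^esub> y)) = (\<Oplus>\<^bsub>N\<^esub>i\<in>I. f i x \<oplus>\<^bsub>N\<^esub> f i y)"
      using xy assms(2) by (intro N.M.finsum_cong') (auto simp: mod_hom_add[OF assms(2)] mod_hom_closed[OF assms(2)])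
    also have "\<dots> = (\<Oplus>\<^bsub>N\<^esub>i\<in>I. f i x) \<oplus>\<^bsub>N\<^esub> (\<Oplus>\<^bsub>N\<^esub>i\<in>I. f i y)"
      using xy assms(2) by (intro N.M.finsum_addf) (auto simp: mod_hom_add[OF assms(2)] mod_hom_closed[OF assms(2)])
    finally show "(\<Oplus>\<^bsub>N\<^esub>i\<in>I. f i (x \<oplus>\<^bsub>M\<^esub> y)) = (\<Oplus>\<^bsub>N\<^esub>i\<in>I. f i x) \<oplus>\<^bsub>N\<^esub> (\<Oplus>\<^bsub>N\<^esub>i\<in>I. f i y)" .
  next
    fix b x assume bx: "b \<in> carrier B" "x \<in> carrier M"
    have "b \<odot>\<^bsub>N\<^esub> (\<Oplus>\<^bsub>N\<^esub>i\<in>I. f i x) = (\<Oplus>\<^bsub>N\<^esub>i\<in>I. b \<odot>\<^bsub>N\<^esub> f i x)"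
      using bx assms(2) by (intro additive_finsum N.M.abelian_group_axioms)
        (auto simp: N.smult_closed N.smult_r_distr mod_hom_closed[OF assms(2)])
    also have "\<dots> = (\<Oplus>\<^bsub>N\<^esub>i\<in>I. f i (b \<odot>\<^bsub>M\<^esub> x))"
      using bx assms(2) by (intro N.M.finsum_cong') (auto simp: mod_hom_smult[OF assms(2)] mod_hom_closed[OF assms(2)] N.smult_closed)
    finally show "(\<Oplus>\<^bsub>N\<^esub>i\<in>I. f i (b \<odot>\<^bsub>M\<^esub> x)) = b \<odot>\<^bsub>N\<^esub> (\<Oplus>\<^bsub>N\<^esub>i\<in>I. f i x)" by simp
  qed
qed

lemma (in left_module) smult_finsum:
  assumes "a \<in> carrier R" "g \<in> I \<rightarrow> carrier M"
  shows "a \<odot>\<^bsub>M\<^esub> (\<Oplus>\<^bsub>M\<^esub>i\<in>I. g i) = (\<Oplus>\<^bsub>M\<^esub>i\<in>I. a \<odot>\<^bsub>M\<^esub> g i)"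
  using assms by (intro additive_finsum M.abelian_group_axioms) (auto simp: smult_closed smult_r_distr)

lemma (in left_module) finsum_smult:
  assumes "x \<in> carrier M" "g \<in> I \<rightarrow> carrier R"
  shows "(\<Oplus>i\<in>I. g i) \<odot>\<^bsub>M\<^esub> x = (\<Oplus>\<^bsub>M\<^esub>i\<in>I. g i \<odot>\<^bsub>M\<^esub> x)"
  using assms by (intro additive_finsum[of R M "\<lambda>b. b \<odot>\<^bsub>M\<^esub> x"] M.abelian_group_axioms R.abelian_group_axioms)
    (auto simp: smult_closed smult_l_distr)

lemma submodule_carrier: "left_module B M \<Longrightarrow> submodule (carrier M) B M"
proof -
  assume "left_module B M"
  then interpret M: left_module B M .
  show ?thesis by (rule M.submoduleI) (auto simp: M.smult_closed)
qed

lemma submodule_zero_set: "left_module B M \<Longrightarrow> submodule {\<zero>\<^bsub>M\<^esub>} B M"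
proof -
  assume "left_module B M"
  then interpret M: left_module B M .
  show ?thesis by (rule M.submoduleI) auto
qed

lemma submodule_Inter:
  assumes "left_module B M" "\<U> \<noteq> {}" "\<And>U. U \<in> \<U> \<Longrightarrow> submodule U B M"
  shows "submodule (\<Inter>\<U>) B M"
proof -
  interpret M: left_module B M by fact
  show ?thesis
    by (rule M.submoduleI)
      (use assms(2) submodule_zero[OF assms(3)] submodule_add[OF assms(3)] submodule_smult[OF assms(3)]
        submodule_mem[OF assms(3)] in auto)
qed

lemma submodule_Int:
  "\<lbrakk>left_module B M; submodule U B M; submodule V B M\<rbrakk> \<Longrightarrow> submodule (U \<inter> V) B M"
  using submodule_Inter[of B M "{U, V}"] by auto

lemma submodule_image:
  assumes "left_module B M" "left_module B N" "f \<in> mod_hom B M N" "submodule U B M"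
  shows "submodule (f ` U) B N"
proof -
  interpret N: left_module B N by fact
  show ?thesis
  proof (rule N.submoduleI)
    show "f ` U \<subseteq> carrier N" using assms by (auto dest: submodule_mem mod_hom_closed)
    show "\<zero>\<^bsub>N\<^esub> \<in> f ` U" using mod_hom_zero[OF assms(1-3)] submodule_zero[OF assms(4)] by force
    fix x y assume "x \<in> f ` U" "y \<in> f ` U"
    then obtain u v where "u \<in> U" "v \<in> U" "x = f u" "y = f v" by auto
    thus "x \<oplus>\<^bsub>N\<^esub> y \<in> f ` U"
      using mod_hom_add[OF assms(3), of u v] submodule_add[OF assms(4)] submodule_mem[OF assms(4)]
      by (intro image_eqI[of _ _ "u \<oplus>\<^bsub>M\<^esub> v"]) auto
  next
    fix a x assume "x \<in> f ` U" "a \<in> carrier B"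
    then obtain u where "u \<in> U" "x = f u" by auto
    thus "a \<odot>\<^bsub>N\<^esub> x \<in> f ` U"
      using mod_hom_smult[OF assms(3), of a u] submodule_smult[OF assms(4)] submodule_mem[OF assms(4)] \<open>a \<in> carrier B\<close>
      by (intro image_eqI[of _ _ "a \<odot>\<^bsub>M\<^esub> u"]) auto
  qed
qed

lemma submodule_preimage:
  assumes "left_module B M" "left_module B N" "f \<in> mod_hom B M N" "submodule U B N"
  shows "submodule {x \<in> carrier M. f x \<in> U} B M"
proof -
  interpret M: left_module B M by fact
  show ?thesis
    by (rule M.submoduleI) (use assms(3) mod_hom_zero[OF assms(1-3)] submodule_zero[OF assms(4)] in
        \<open>auto simp: mod_hom_add mod_hom_smult submodule_add[OF assms(4)] submodule_smult[OF assms(4)] M.smult_closed\<close>)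
qed

lemma submodule_kernel:
  assumes "left_module B M" "left_module B N" "f \<in> mod_hom B M N"
  shows "submodule {x \<in> carrier M. f x = \<zero>\<^bsub>N\<^esub>} B M"
  using submodule_preimage[OF assms submodule_zero_set[OF assms(2)]] by simp

lemma set_addI: "\<lbrakk>u \<in> U; v \<in> V\<rbrakk> \<Longrightarrow> u \<oplus>\<^bsub>M\<^esub> v \<in> U <+>\<^bsub>M\<^esub> V"
  by (auto simp: set_add_def')

lemma set_addE:
  assumes "x \<in> U <+>\<^bsub>M\<^esub> V" obtains u v where "u \<in> U" "v \<in> V" "x = u \<oplus>\<^bsub>M\<^esub> v"
  using assms by (auto simp: set_add_def')

lemma submodule_set_add:
  assumes "left_module B M" "submodule U B M" "submodule V B M"
  shows "submodule (U <+>\<^bsub>M\<^esub> V) B M"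
proof -
  interpret M: left_module B M by fact
  note U = submodule_mem[OF assms(2)] and V = submodule_mem[OF assms(3)]
  show ?thesis
  proof (rule M.submoduleI)
    show "U <+>\<^bsub>M\<^esub> V \<subseteq> carrier M" by (auto elim!: set_addE intro: U V)
    show "\<zero>\<^bsub>M\<^esub> \<in> U <+>\<^bsub>M\<^esub> V"
      using set_addI[OF submodule_zero[OF assms(2)] submodule_zero[OF assms(3)], of M] by simp
  next
    fix x y assume "x \<in> U <+>\<^bsub>M\<^esub> V" "y \<in> U <+>\<^bsub>M\<^esub> V"
    then obtain u v u' v' where uv: "u \<in> U" "v \<in> V" "u' \<in> U" "v' \<in> V" "x = u \<oplus>\<^bsub>M\<^esub> v" "y = u' \<oplus>\<^bsub>M\<^esub> v'"
      by (elim set_addE)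
    hence "x \<oplus>\<^bsub>M\<^esub> y = (u \<oplus>\<^bsub>M\<^esub> u') \<oplus>\<^bsub>M\<^esub> (v \<oplus>\<^bsub>M\<^esub> v')"
      by (simp add: U V M.M.a_ac)
    thus "x \<oplus>\<^bsub>M\<^esub> y \<in> U <+>\<^bsub>M\<^esub> V"
      using uv by (simp add: set_addI submodule_add[OF assms(2)] submodule_add[OF assms(3)])
  next
    fix a x assume a: "a \<in> carrier B" "x \<in> U <+>\<^bsub>M\<^esub> V"
    then obtain u v where uv: "u \<in> U" "v \<in> V" "x = u \<oplus>\<^bsub>M\<^esub> v" by (elim set_addE)
    hence "a \<odot>\<^bsub>M\<^esub> x = a \<odot>\<^bsub>M\<^esub> u \<oplus>\<^bsub>M\<^esub> a \<odot>\<^bsub>M\<^esub> v" using a by (simp add: U V M.smult_r_distr)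
    thus "a \<odot>\<^bsub>M\<^esub> x \<in> U <+>\<^bsub>M\<^esub> V"
      using uv a by (simp add: set_addI submodule_smult[OF assms(2)] submodule_smult[OF assms(3)])
  qed
qed

lemma submodule_set_add_upper:
  assumes "left_module B M" "submodule U B M" "submodule V B M"
  shows "U \<subseteq> U <+>\<^bsub>M\<^esub> V" "V \<subseteq> U <+>\<^bsub>M\<^esub> V"
proof -
  interpret M: left_module B M by fact
  note U = submodule_mem[OF assms(2)] and V = submodule_mem[OF assms(3)]
  show "U \<subseteq> U <+>\<^bsub>M\<^esub> V"
  proof
    fix u assume "u \<in> U"
    from set_addI[OF this submodule_zero[OF assms(3)], of M] U[OF this] show "u \<in> U <+>\<^bsub>M\<^esub> V" by simp
  qed
  show "V \<subseteq> U <+>\<^bsub>M\<^esub> V"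
  proof
    fix v assume "v \<in> V"
    from set_addI[OF submodule_zero[OF assms(2)] this, of M] V[OF this] show "v \<in> U <+>\<^bsub>M\<^esub> V" by simp
  qed
qed

lemma set_add_least:
  "\<lbrakk>submodule W B M; U \<subseteq> W; V \<subseteq> W\<rbrakk> \<Longrightarrow> U <+>\<^bsub>M\<^esub> V \<subseteq> W"
  by (auto elim!: set_addE intro!: submodule_add)

lemma submodule_submodule_iff:
  assumes "left_module B M" "submodule U B M"
  shows "submodule V B (M\<lparr>carrier := U\<rparr>) \<longleftrightarrow> submodule V B M \<and> V \<subseteq> U"
proof -
  interpret M: left_module B M by fact
  interpret U: left_module B "M\<lparr>carrier := U\<rparr>" by (rule submodule_left_module[OF assms])
  show ?thesis
  proof
    assume V: "submodule V B (M\<lparr>carrier := U\<rparr>)"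
    show "submodule V B M \<and> V \<subseteq> U"
      using submodule_subset[OF V] submodule_zero[OF V] submodule_add[OF V] submodule_smult[OF V]
        submodule_subset[OF assms(2)]
      by (intro conjI M.submoduleI) auto
  next
    assume V: "submodule V B M \<and> V \<subseteq> U"
    thus "submodule V B (M\<lparr>carrier := U\<rparr>)"
      by (intro U.submoduleI) (auto simp: submodule_zero submodule_add submodule_smult)
  qed
qed

lemma mod_hom_submodule_iff:
  assumes "f \<in> carrier M \<rightarrow> U" "submodule U B N"
  shows "f \<in> mod_hom B M (N\<lparr>carrier := U\<rparr>) \<longleftrightarrow> f \<in> mod_hom B M N"
  using assms submodule_subset[OF assms(2)] by (auto simp: mod_hom_def Pi_iff)

lemma mod_hom_restrict_submodule:
  "\<lbrakk>f \<in> mod_hom B M N; submodule U B M\<rbrakk> \<Longrightarrow> f \<in> mod_hom B (M\<lparr>carrier := U\<rparr>) N"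
  using submodule_subset[of U B M] by (auto simp: mod_hom_def subset_iff)

lemma mod_hom_inverse:
  assumes "left_module B M" "f \<in> mod_hom B M N" "bij_betw f (carrier M) (carrier N)"
  shows "the_inv_into (carrier M) f \<in> mod_hom B N M"
proof -
  interpret M: left_module B M by fact
  let ?g = "the_inv_into (carrier M) f"
  have inj: "inj_on f (carrier M)" and surj: "f ` carrier M = carrier N" using assms(3) by (auto simp: bij_betw_def)
  have g: "?g y \<in> carrier M" "f (?g y) = y" if "y \<in> carrier N" for y
    using that inj surj by (auto simp: f_the_inv_into_f the_inv_into_into)
  have eq: "?g y = x" if "x \<in> carrier M" "f x = y" for x y
    using that inj by (auto simp: the_inv_into_f_f)
  show ?thesis
  proof (rule mod_homI)
    fix x y assume "x \<in> carrier N" "y \<in> carrier N"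
    thus "?g (x \<oplus>\<^bsub>N\<^esub> y) = ?g x \<oplus>\<^bsub>M\<^esub> ?g y" by (intro eq) (simp_all add: g mod_hom_add[OF assms(2)])
  next
    fix b x assume "b \<in> carrier B" "x \<in> carrier N"
    thus "?g (b \<odot>\<^bsub>N\<^esub> x) = b \<odot>\<^bsub>M\<^esub> ?g x"
      by (intro eq) (simp_all add: g mod_hom_smult[OF assms(2)] M.smult_closed)
  qed (rule g)
qed

lemma mod_iso_sym: "\<lbrakk>left_module B M; mod_iso B M N\<rbrakk> \<Longrightarrow> mod_iso B N M"
  unfolding mod_iso_def using mod_hom_inverse bij_betw_the_inv_into by metis

lemma mod_iso_refl: "mod_iso B M M"
  unfolding mod_iso_def by (intro bexI[of _ "\<lambda>x. x"] mod_hom_id) (simp add: bij_betw_def)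

lemma mod_iso_trans: "\<lbrakk>mod_iso B M N; mod_iso B N K\<rbrakk> \<Longrightarrow> mod_iso B M K"
proof -
  assume "mod_iso B M N" "mod_iso B N K"
  then obtain f g where "f \<in> mod_hom B M N" "bij_betw f (carrier M) (carrier N)"
    "g \<in> mod_hom B N K" "bij_betw g (carrier N) (carrier K)" by (auto simp: mod_iso_def)
  thus ?thesis unfolding mod_iso_def
    using mod_hom_comp bij_betw_trans[of f "carrier M" "carrier N" g "carrier K"]
    by (intro bexI[of _ "\<lambda>x. g (f x)"]) (auto simp: comp_def)
qed

text \<open>The operations on cosets are defined through chosen representatives \<open>G\<close>.
  The choice shows only in the facts \<open>add\<close> and \<open>smult\<close>, where
  \<open>GU\<close> places the error in U. Just the surjection and its kernel are exported, which is
  all that factorisation arguments refer to.\<close>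

lemma quotient_exists:
  fixes M :: "('b, 'm, 'd) module_scheme"
  assumes "left_module B M" "submodule U B M"
  shows "\<exists>(Q :: ('b, 'm set) module) p. left_module B Q \<and> p \<in> mod_hom B M Q \<and>
    p ` carrier M = carrier Q \<and> (\<forall>x\<in>carrier M. p x = \<zero>\<^bsub>Q\<^esub> \<longleftrightarrow> x \<in> U)"
proof -
  interpret M: left_module B M by fact
  define F where "F x = {y \<in> carrier M. y \<ominus>\<^bsub>M\<^esub> x \<in> U}" for x
  note [simp] = submodule_mem[OF assms(2)] submodule_zero[OF assms(2)]
  have sub: "F x \<subseteq> F y" if xy: "x \<in> carrier M" "y \<in> carrier M" "x \<ominus>\<^bsub>M\<^esub> y \<in> U" for x y
  proof
    fix z assume z: "z \<in> F x"
    hence zc: "z \<in> carrier M" by (simp add: F_def)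
    have "(z \<ominus>\<^bsub>M\<^esub> x) \<oplus>\<^bsub>M\<^esub> (x \<ominus>\<^bsub>M\<^esub> y) = z \<oplus>\<^bsub>M\<^esub> ((\<ominus>\<^bsub>M\<^esub> x) \<oplus>\<^bsub>M\<^esub> x) \<oplus>\<^bsub>M\<^esub> \<ominus>\<^bsub>M\<^esub> y"
      using zc xy by (simp add: a_minus_def M.M.a_assoc del: M.M.l_neg)
    also have "\<dots> = z \<ominus>\<^bsub>M\<^esub> y" using zc xy by (simp add: M.M.l_neg a_minus_def)
    finally show "z \<in> F y" using z submodule_add[OF assms(2) _ xy(3), of "z \<ominus>\<^bsub>M\<^esub> x"] by (simp add: F_def)
  qed
  have F: "F x = F y \<longleftrightarrow> x \<ominus>\<^bsub>M\<^esub> y \<in> U" if xy: "x \<in> carrier M" "y \<in> carrier M" for x y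
  proof
    assume "F x = F y"
    moreover have "x \<in> F x" using xy by (simp add: F_def M.M.minus_eq_zero_iff[THEN iffD2])
    ultimately show "x \<ominus>\<^bsub>M\<^esub> y \<in> U" by (simp add: F_def)
  next
    assume d: "x \<ominus>\<^bsub>M\<^esub> y \<in> U"
    have "\<ominus>\<^bsub>M\<^esub> (x \<ominus>\<^bsub>M\<^esub> y) = y \<ominus>\<^bsub>M\<^esub> x" using xy by (simp add: a_minus_def M.M.minus_add M.M.a_comm)
    with submodule_minus[OF assms(2) d] show "F x = F y" using sub[OF xy d] sub[OF xy(2,1)] by simp
  qed
  define G where "G X = (SOME x. x \<in> carrier M \<and> F x = X)" for X
  have G: "G (F x) \<in> carrier M" "F (G (F x)) = F x" if "x \<in> carrier M" for x
    using someI[of "\<lambda>y. y \<in> carrier M \<and> F y = F x" x] that by (auto simp: G_def)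
  have GU: "G (F x) \<ominus>\<^bsub>M\<^esub> x \<in> U" if "x \<in> carrier M" for x
    using F[OF G(1)[OF that] that] G(2)[OF that] by simp
  define Q :: "('b, 'm set) module" where "Q = \<lparr>carrier = F ` carrier M, mult = undefined, one = undefined,
    zero = F \<zero>\<^bsub>M\<^esub>, add = (\<lambda>x y. F (G x \<oplus>\<^bsub>M\<^esub> G y)), smult = (\<lambda>b x. F (b \<odot>\<^bsub>M\<^esub> G x))\<rparr>"
  have Q: "carrier Q = F ` carrier M" "\<zero>\<^bsub>Q\<^esub> = F \<zero>\<^bsub>M\<^esub>" by (simp_all add: Q_def)
  have add: "F x \<oplus>\<^bsub>Q\<^esub> F y = F (x \<oplus>\<^bsub>M\<^esub> y)" if xy: "x \<in> carrier M" "y \<in> carrier M" for x y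
  proof -
    have "G (F x) \<ominus>\<^bsub>M\<^esub> x \<in> U" "G (F y) \<ominus>\<^bsub>M\<^esub> y \<in> U" using xy G GU by auto
    hence "(G (F x) \<ominus>\<^bsub>M\<^esub> x) \<oplus>\<^bsub>M\<^esub> (G (F y) \<ominus>\<^bsub>M\<^esub> y) \<in> U" by (rule submodule_add[OF assms(2)])
    moreover have "(G (F x) \<ominus>\<^bsub>M\<^esub> x) \<oplus>\<^bsub>M\<^esub> (G (F y) \<ominus>\<^bsub>M\<^esub> y) = (G (F x) \<oplus>\<^bsub>M\<^esub> G (F y)) \<ominus>\<^bsub>M\<^esub> (x \<oplus>\<^bsub>M\<^esub> y)"
      using xy G by (simp add: a_minus_def M.M.minus_add M.M.a_ac)
    ultimately show ?thesis using xy G by (simp add: Q_def F)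
  qed
  have smult: "b \<odot>\<^bsub>Q\<^esub> F x = F (b \<odot>\<^bsub>M\<^esub> x)" if xy: "x \<in> carrier M" "b \<in> carrier B" for x b
  proof -
    have "G (F x) \<ominus>\<^bsub>M\<^esub> x \<in> U" using xy GU by auto
    hence "b \<odot>\<^bsub>M\<^esub> (G (F x) \<ominus>\<^bsub>M\<^esub> x) \<in> U" by (rule submodule_smult[OF assms(2) xy(2)])
    moreover have "b \<odot>\<^bsub>M\<^esub> (G (F x) \<ominus>\<^bsub>M\<^esub> x) = b \<odot>\<^bsub>M\<^esub> G (F x) \<ominus>\<^bsub>M\<^esub> b \<odot>\<^bsub>M\<^esub> x"
      using xy G by (simp add: a_minus_def M.smult_r_distr M.smult_minus_right)
    ultimately show ?thesis using xy G by (simp add: Q_def F M.smult_closed)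
  qed
  have ab: "abelian_group Q"
  proof (rule abelian_groupI)
    fix x assume "x \<in> carrier Q"
    then obtain m where m: "m \<in> carrier M" "x = F m" by (auto simp: Q)
    hence "F (\<ominus>\<^bsub>M\<^esub> m) \<oplus>\<^bsub>Q\<^esub> x = \<zero>\<^bsub>Q\<^esub>" by (simp add: M.M.l_neg add Q)
    thus "\<exists>y\<in>carrier Q. y \<oplus>\<^bsub>Q\<^esub> x = \<zero>\<^bsub>Q\<^esub>" using m Q by force
  qed (auto simp: Q add M.M.a_ac)
  have "left_module B Q"
    by (rule left_moduleI[OF M.R.ring_axioms ab])
      (auto simp: Q add smult M.smult_closed M.smult_l_distr M.smult_r_distr M.smult_assoc M.smult_one)
  moreover have "F \<in> mod_hom B M Q" by (rule mod_homI) (auto simp: Q add smult)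
  moreover have "F x = \<zero>\<^bsub>Q\<^esub> \<longleftrightarrow> x \<in> U" if "x \<in> carrier M" for x
  proof -
    have "x \<ominus>\<^bsub>M\<^esub> \<zero>\<^bsub>M\<^esub> = x"
      using that M.M.add_minus_cancel(2)[of x "\<zero>\<^bsub>M\<^esub>"] by (metis M.M.minus_closed M.M.r_zero M.M.zero_closed)
    thus ?thesis using that by (simp add: Q F)
  qed
  ultimately show ?thesis using Q by (intro exI[of _ Q] exI[of _ F]) auto
qed

definition reg :: "('b, 'c) ring_scheme \<Rightarrow> ('b, 'b) module"
  where "reg B = \<lparr>carrier = carrier B, mult = undefined, one = undefined,
    zero = \<zero>\<^bsub>B\<^esub>, add = add B, smult = mult B\<rparr>"

lemma reg_simps [simp]: "carrier (reg B) = carrier B" "\<zero>\<^bsub>reg B\<^esub> = \<zero>\<^bsub>B\<^esub>"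
  "x \<oplus>\<^bsub>reg B\<^esub> y = x \<oplus>\<^bsub>B\<^esub> y" "x \<odot>\<^bsub>reg B\<^esub> y = x \<otimes>\<^bsub>B\<^esub> y"
  by (simp_all add: reg_def)

lemma reg_left_module: assumes "ring B" shows "left_module B (reg B)"
proof -
  interpret ring B by fact
  have "abelian_group (reg B)"
  proof (rule abelian_groupI)
    fix x assume "x \<in> carrier (reg B)"
    thus "\<exists>y\<in>carrier (reg B). y \<oplus>\<^bsub>reg B\<^esub> x = \<zero>\<^bsub>reg B\<^esub>" by (intro bexI[of _ "\<ominus>\<^bsub>B\<^esub> x"]) (auto simp: l_neg)
  qed (auto simp: a_ac)
  thus ?thesis by (intro left_moduleI assms) (auto simp: l_distr r_distr m_assoc)
qed

subsection \<open>Finite direct sums\<close>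

lemma dsum_simps [simp]:
  "carrier (dsum I X) = (\<Pi>\<^sub>E i\<in>I. carrier (X i))" "\<zero>\<^bsub>dsum I X\<^esub> = (\<lambda>i\<in>I. \<zero>\<^bsub>X i\<^esub>)"
  "x \<oplus>\<^bsub>dsum I X\<^esub> y = (\<lambda>i\<in>I. x i \<oplus>\<^bsub>X i\<^esub> y i)" "b \<odot>\<^bsub>dsum I X\<^esub> x = (\<lambda>i\<in>I. b \<odot>\<^bsub>X i\<^esub> x i)"
  by (simp_all add: dsum_def)

lemma dsum_left_module:
  assumes "ring B" "\<And>i. i \<in> I \<Longrightarrow> left_module B (X i)"
  shows "left_module B (dsum I X)"
proof -
  let ?D = "dsum I X"
  interpret ring B by fact
  note lm = assms(2)
  note ag = left_module_abelian[OF lm]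
  have "abelian_group ?D"
  proof (rule abelian_groupI)
    fix x y z assume "x \<in> carrier ?D" "y \<in> carrier ?D" "z \<in> carrier ?D"
    thus "x \<oplus>\<^bsub>?D\<^esub> y \<oplus>\<^bsub>?D\<^esub> z = x \<oplus>\<^bsub>?D\<^esub> (y \<oplus>\<^bsub>?D\<^esub> z)"
      using abelian_monoid.a_assoc[OF abelian_group.axioms(1)[OF ag]] by (auto simp: PiE_iff intro!: restrict_ext)
  next
    fix x y assume "x \<in> carrier ?D" "y \<in> carrier ?D"
    thus "x \<oplus>\<^bsub>?D\<^esub> y = y \<oplus>\<^bsub>?D\<^esub> x"
      using abelian_monoid.a_comm[OF abelian_group.axioms(1)[OF ag]] by (auto simp: PiE_iff intro!: restrict_ext)
  next
    fix x y assume "x \<in> carrier ?D" "y \<in> carrier ?D"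
    thus "x \<oplus>\<^bsub>?D\<^esub> y \<in> carrier ?D"
      using abelian_monoid.a_closed[OF abelian_group.axioms(1)[OF ag]] by (auto simp: PiE_iff)
  next
    show "\<zero>\<^bsub>?D\<^esub> \<in> carrier ?D"
      using abelian_monoid.zero_closed[OF abelian_group.axioms(1)[OF ag]] by (auto simp: PiE_iff)
  next
    fix x assume x: "x \<in> carrier ?D"
    thus "\<zero>\<^bsub>?D\<^esub> \<oplus>\<^bsub>?D\<^esub> x = x"
      using abelian_monoid.l_zero[OF abelian_group.axioms(1)[OF ag]]
      by (intro extensionalityI[of _ I]) (auto simp: PiE_iff)
    show "\<exists>y\<in>carrier ?D. y \<oplus>\<^bsub>?D\<^esub> x = \<zero>\<^bsub>?D\<^esub>"
      using x abelian_group.l_neg[OF ag] abelian_group.a_inv_closed[OF ag]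
      by (intro bexI[of _ "\<lambda>i\<in>I. \<ominus>\<^bsub>X i\<^esub> x i"]) (auto simp: PiE_iff intro!: restrict_ext)
  qed
  thus ?thesis
  proof (rule left_moduleI[OF assms(1)])
    fix a x assume "a \<in> carrier B" "x \<in> carrier ?D"
    thus "a \<odot>\<^bsub>?D\<^esub> x \<in> carrier ?D" using left_module.smult_closed[OF lm] by (auto simp: PiE_iff)
  next
    fix a b x assume "a \<in> carrier B" "b \<in> carrier B" "x \<in> carrier ?D"
    thus "(a \<oplus>\<^bsub>B\<^esub> b) \<odot>\<^bsub>?D\<^esub> x = a \<odot>\<^bsub>?D\<^esub> x \<oplus>\<^bsub>?D\<^esub> b \<odot>\<^bsub>?D\<^esub> x"
      using left_module.smult_l_distr[OF lm] by (auto simp: PiE_iff intro!: restrict_ext)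
  next
    fix a b x assume "a \<in> carrier B" "b \<in> carrier B" "x \<in> carrier ?D"
    thus "(a \<otimes>\<^bsub>B\<^esub> b) \<odot>\<^bsub>?D\<^esub> x = a \<odot>\<^bsub>?D\<^esub> (b \<odot>\<^bsub>?D\<^esub> x)"
      using left_module.smult_assoc[OF lm] by (auto simp: PiE_iff intro!: restrict_ext)
  next
    fix a x y assume "a \<in> carrier B" "x \<in> carrier ?D" "y \<in> carrier ?D"
    thus "a \<odot>\<^bsub>?D\<^esub> (x \<oplus>\<^bsub>?D\<^esub> y) = a \<odot>\<^bsub>?D\<^esub> x \<oplus>\<^bsub>?D\<^esub> a \<odot>\<^bsub>?D\<^esub> y"
      using left_module.smult_r_distr[OF lm] by (auto simp: PiE_iff intro!: restrict_ext)
  next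
    fix x assume "x \<in> carrier ?D"
    thus "\<one>\<^bsub>B\<^esub> \<odot>\<^bsub>?D\<^esub> x = x"
      using left_module.smult_one[OF lm] by (intro extensionalityI[of _ I]) (auto simp: PiE_iff)
  qed
qed

lemma dsum_proj: "i \<in> I \<Longrightarrow> (\<lambda>v. v i) \<in> mod_hom B (dsum I X) (X i)"
  by (rule mod_homI) auto

text \<open>The universal property of a product. Elements of a direct sum are extensional functions,
  whence the first conjunct.\<close>

lemma mod_hom_dsum_iff:
  assumes "left_module B M"
  shows "f \<in> mod_hom B M (dsum I X) \<longleftrightarrow>
    (\<forall>x\<in>carrier M. f x \<in> extensional I) \<and> (\<forall>i\<in>I. (\<lambda>x. f x i) \<in> mod_hom B M (X i))"
proof -
  interpret M: left_module B M by fact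
  show ?thesis
  proof (intro iffI conjI ballI)
    fix i assume "f \<in> mod_hom B M (dsum I X)" "i \<in> I"
    thus "(\<lambda>x. f x i) \<in> mod_hom B M (X i)" by (rule mod_hom_comp[OF _ dsum_proj])
  next
    fix x assume "f \<in> mod_hom B M (dsum I X)" "x \<in> carrier M"
    hence "f x \<in> carrier (dsum I X)" by (rule mod_hom_closed)
    thus "f x \<in> extensional I" by (simp add: PiE_iff)
  next
    assume *: "(\<forall>x\<in>carrier M. f x \<in> extensional I) \<and> (\<forall>i\<in>I. (\<lambda>x. f x i) \<in> mod_hom B M (X i))"
    hence ext: "\<And>x. x \<in> carrier M \<Longrightarrow> f x \<in> extensional I"
      and h: "\<And>i. i \<in> I \<Longrightarrow> (\<lambda>x. f x i) \<in> mod_hom B M (X i)" by blast+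
    show "f \<in> mod_hom B M (dsum I X)"
    proof (rule mod_homI)
      fix x assume "x \<in> carrier M"
      thus "f x \<in> carrier (dsum I X)" using ext mod_hom_closed[OF h] by (simp add: PiE_iff)
    next
      fix x y assume "x \<in> carrier M" "y \<in> carrier M"
      thus "f (x \<oplus>\<^bsub>M\<^esub> y) = f x \<oplus>\<^bsub>dsum I X\<^esub> f y"
        using ext mod_hom_add[OF h] by (intro extensionalityI[of _ I]) simp_all
    next
      fix b x assume "b \<in> carrier B" "x \<in> carrier M"
      thus "f (b \<odot>\<^bsub>M\<^esub> x) = b \<odot>\<^bsub>dsum I X\<^esub> f x"
        using ext mod_hom_smult[OF h] by (intro extensionalityI[of _ I]) (simp_all add: M.smult_closed)
    qed
  qed
qed

lemma mod_hom_dsumI: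
  assumes "left_module B M" "\<And>i. i \<in> I \<Longrightarrow> f i \<in> mod_hom B M (X i)"
  shows "(\<lambda>x. \<lambda>i\<in>I. f i x) \<in> mod_hom B M (dsum I X)"
  using assms by (subst mod_hom_dsum_iff) auto

definition dinj :: "nat set \<Rightarrow> (nat \<Rightarrow> ('b, 'm) module) \<Rightarrow> nat \<Rightarrow> 'm \<Rightarrow> nat \<Rightarrow> 'm"
  where "dinj I X i x = (\<lambda>j\<in>I. if j = i then x else \<zero>\<^bsub>X j\<^esub>)"

lemma dinj_hom:
  assumes "\<And>i. i \<in> I \<Longrightarrow> left_module B (X i)" "i \<in> I"
  shows "dinj I X i \<in> mod_hom B (X i) (dsum I X)"
proof -
  have *: "(\<lambda>x. if j = i then x else \<zero>\<^bsub>X j\<^esub>) \<in> mod_hom B (X i) (X j)" if "j \<in> I" for j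
    using mod_hom_const_zero[OF assms(1)[OF that]] mod_hom_id by (cases "j = i") auto
  have eq: "dinj I X i = (\<lambda>x. \<lambda>j\<in>I. if j = i then x else \<zero>\<^bsub>X j\<^esub>)" by (simp add: dinj_def fun_eq_iff)
  show ?thesis unfolding eq by (rule mod_hom_dsumI[OF assms(1)[OF assms(2)] *])
qed

lemma dinj_closed:
  assumes "\<And>i. i \<in> I \<Longrightarrow> left_module B (X i)" "i \<in> I" "x \<in> carrier (X i)"
  shows "dinj I X i x \<in> carrier (dsum I X)"
  using mod_hom_closed[OF dinj_hom[where B = B and I = I and X = X, OF assms(1,2)] assms(3)] by simp

lemma finsum_dsum_apply:
  assumes "ring B" "\<And>i. i \<in> I \<Longrightarrow> left_module B (X i)" "g \<in> J \<rightarrow> carrier (dsum I X)" "i \<in> I"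
  shows "finsum (dsum I X) g J i = (\<Oplus>\<^bsub>X i\<^esub>j\<in>J. g j i)"
  using mod_hom_finsum[OF dsum_left_module[OF assms(1)] assms(2)[OF assms(4)] dsum_proj[OF assms(4)] assms(3)]
    assms(2) by simp

lemma (in abelian_group) finsum_delta:
  assumes "finite I" "i \<in> I" "x \<in> carrier G"
  shows "(\<Oplus>j\<in>I. if j = i then x else \<zero>) = x"
  using add.finprod_singleton[OF assms(2,1), of "\<lambda>_. x"] assms(3) by (simp add: eq_commute)

lemma dsum_decompose:
  assumes "ring B" "\<And>i. i \<in> I \<Longrightarrow> left_module B (X i)" "finite I" "v \<in> carrier (dsum I X)"
  shows "v = (\<Oplus>\<^bsub>dsum I X\<^esub>i\<in>I. dinj I X i (v i))"
proof -
  interpret D: left_module B "dsum I X" using dsum_left_module[OF assms(1,2)] by simp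
  have v: "v i \<in> carrier (X i)" if "i \<in> I" for i using assms(4) that by auto
  have cl: "(\<lambda>i. dinj I X i (v i)) \<in> I \<rightarrow> carrier (dsum I X)"
    using dinj_closed[where B = B and I = I and X = X, OF assms(2) _ v] by (rule Pi_I)
  show ?thesis
  proof (rule extensionalityI[of _ I])
    show "v \<in> extensional I" using assms(4) by (auto simp: PiE_iff)
    show "(\<Oplus>\<^bsub>dsum I X\<^esub>i\<in>I. dinj I X i (v i)) \<in> extensional I"
      using D.M.finsum_closed[OF cl] by (auto simp: PiE_iff)
    fix i assume i: "i \<in> I"
    interpret X: left_module B "X i" using assms(2)[OF i] .
    have "(\<Oplus>\<^bsub>dsum I X\<^esub>i\<in>I. dinj I X i (v i)) i = (\<Oplus>\<^bsub>X i\<^esub>j\<in>I. dinj I X j (v j) i)"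
      by (rule finsum_dsum_apply[OF assms(1,2) cl i]) auto
    also have "\<dots> = (\<Oplus>\<^bsub>X i\<^esub>j\<in>I. if j = i then v i else \<zero>\<^bsub>X i\<^esub>)"
      using i v by (intro X.M.finsum_cong') (auto simp: dinj_def)
    also have "\<dots> = v i" using X.M.finsum_delta[OF assms(3) i v[OF i]] .
    finally show "v i = (\<Oplus>\<^bsub>dsum I X\<^esub>i\<in>I. dinj I X i (v i)) i" by simp
  qed
qed

lemma mod_hom_dsum_decompose:
  assumes "\<And>i. i \<in> I \<Longrightarrow> left_module B (X i)" "finite I" "left_module B N"
    and f: "f \<in> mod_hom B (dsum I X) N" and v: "v \<in> carrier (dsum I X)"
  shows "f v = (\<Oplus>\<^bsub>N\<^esub>i\<in>I. f (dinj I X i (v i)))"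
proof -
  have B: "ring B" using assms(3) by blast
  have cl: "(\<lambda>i. dinj I X i (v i)) \<in> I \<rightarrow> carrier (dsum I X)"
  proof (rule Pi_I)
    fix i assume i: "i \<in> I"
    hence "v i \<in> carrier (X i)" using v by auto
    thus "dinj I X i (v i) \<in> carrier (dsum I X)"
      using dinj_closed[where B = B and I = I and X = X, OF assms(1) i] by simp
  qed
  show ?thesis
    using mod_hom_finsum[OF dsum_left_module[OF B assms(1)] assms(3) f cl]
      dsum_decompose[OF B assms(1,2) v] by simp
qed

lemma mod_hom_copair:
  assumes "left_module B N" "\<And>i. i \<in> I \<Longrightarrow> f i \<in> mod_hom B (X i) N"
  shows "(\<lambda>v. \<Oplus>\<^bsub>N\<^esub>i\<in>I. f i (v i)) \<in> mod_hom B (dsum I X) N"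
  by (rule mod_hom_finsum_pointwise[OF assms(1)]) (rule mod_hom_comp[OF dsum_proj assms(2)])

lemma copair_dinj:
  assumes "left_module B N" "\<And>i. i \<in> I \<Longrightarrow> left_module B (X i)" "\<And>i. i \<in> I \<Longrightarrow> f i \<in> mod_hom B (X i) N"
    "finite I" "i \<in> I" "x \<in> carrier (X i)"
  shows "(\<Oplus>\<^bsub>N\<^esub>j\<in>I. f j (dinj I X i x j)) = f i x"
proof -
  interpret N: left_module B N by fact
  have "(\<Oplus>\<^bsub>N\<^esub>j\<in>I. f j (dinj I X i x j)) = (\<Oplus>\<^bsub>N\<^esub>j\<in>I. if j = i then f i x else \<zero>\<^bsub>N\<^esub>)"
    using assms(5,6) mod_hom_zero[OF assms(2) assms(1) assms(3)] mod_hom_closed[OF assms(3)]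
    by (intro N.M.finsum_cong') (auto simp: dinj_def)
  also have "\<dots> = f i x" using N.M.finsum_delta[OF assms(4,5) mod_hom_closed[OF assms(3)[OF assms(5)] assms(6)]] .
  finally show ?thesis .
qed

subsection \<open>Generation\<close>

text \<open>An intersection and not a set of linear combinations, so that inclusions are proved by
  exhibiting one submodule (\<open>span_least\<close>). The link with \<open>fin_gen\<close> is
  \<open>span_eq_combinations\<close>.\<close>

definition span :: "('b, 'c) ring_scheme \<Rightarrow> ('b, 'm, 'd) module_scheme \<Rightarrow> 'm set \<Rightarrow> 'm set"
  where "span B M S = \<Inter>{W. submodule W B M \<and> S \<subseteq> W}"

lemma span_submodule:
  assumes "left_module B M" "S \<subseteq> carrier M" shows "submodule (span B M S) B M"
  unfolding span_def using submodule_carrier[OF assms(1)] assms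
  by (intro submodule_Inter) auto

lemma span_upper: "S \<subseteq> span B M S" by (auto simp: span_def)

lemma span_least: "\<lbrakk>submodule W B M; S \<subseteq> W\<rbrakk> \<Longrightarrow> span B M S \<subseteq> W" by (auto simp: span_def)

lemma submodule_finsum:
  assumes "left_module B M" "submodule W B M" "g \<in> I \<rightarrow> W"
  shows "finsum M g I \<in> W"
proof -
  interpret M: left_module B M by fact
  show ?thesis using assms(3)
  proof (induction I rule: infinite_finite_induct)
    case (insert x F)
    have "g \<in> F \<rightarrow> carrier M" "g x \<in> carrier M" using insert.prems submodule_mem[OF assms(2)] by auto
    thus ?case using insert submodule_add[OF assms(2)] by (simp add: M.M.finsum_insert)
  qed (simp_all add: M.M.finsum_infinite submodule_zero[OF assms(2)])
qed

lemma span_eq_combinations: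
  assumes "left_module B M" "finite S" "S \<subseteq> carrier M"
  shows "span B M S = {\<Oplus>\<^bsub>M\<^esub>s\<in>S. c s \<odot>\<^bsub>M\<^esub> s | c. c \<in> S \<rightarrow> carrier B}" (is "_ = ?W")
proof (intro equalityI span_least)
  interpret M: left_module B M by fact
  have cl: "(\<lambda>s. c s \<odot>\<^bsub>M\<^esub> s) \<in> S \<rightarrow> carrier M" if "c \<in> S \<rightarrow> carrier B" for c
    using that assms(3) by (auto intro!: M.smult_closed)
  show "submodule ?W B M"
  proof (rule M.submoduleI)
    show "?W \<subseteq> carrier M" using cl by (auto intro!: M.M.finsum_closed)
    have "(\<Oplus>\<^bsub>M\<^esub>s\<in>S. \<zero>\<^bsub>B\<^esub> \<odot>\<^bsub>M\<^esub> s) = (\<Oplus>\<^bsub>M\<^esub>s\<in>S. \<zero>\<^bsub>M\<^esub>)" using assms(3) by (intro M.M.finsum_cong') auto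
    thus "\<zero>\<^bsub>M\<^esub> \<in> ?W" by (intro CollectI exI[of _ "\<lambda>_. \<zero>\<^bsub>B\<^esub>"]) (auto simp: M.M.finsum_zero)
  next
    fix x y assume "x \<in> ?W" "y \<in> ?W"
    then obtain c d where c: "c \<in> S \<rightarrow> carrier B" "x = (\<Oplus>\<^bsub>M\<^esub>s\<in>S. c s \<odot>\<^bsub>M\<^esub> s)"
      and d: "d \<in> S \<rightarrow> carrier B" "y = (\<Oplus>\<^bsub>M\<^esub>s\<in>S. d s \<odot>\<^bsub>M\<^esub> s)" by blast
    have "x \<oplus>\<^bsub>M\<^esub> y = (\<Oplus>\<^bsub>M\<^esub>s\<in>S. c s \<odot>\<^bsub>M\<^esub> s \<oplus>\<^bsub>M\<^esub> d s \<odot>\<^bsub>M\<^esub> s)"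
      using M.M.finsum_addf[OF cl[OF c(1)] cl[OF d(1)]] c(2) d(2) by simp
    also have "\<dots> = (\<Oplus>\<^bsub>M\<^esub>s\<in>S. (c s \<oplus>\<^bsub>B\<^esub> d s) \<odot>\<^bsub>M\<^esub> s)"
      using c(1) d(1) assms(3) by (intro M.M.finsum_cong') (simp_all add: M.smult_closed M.smult_l_distr Pi_iff subset_iff)
    finally show "x \<oplus>\<^bsub>M\<^esub> y \<in> ?W"
      using c(1) d(1) by (intro CollectI exI[of _ "\<lambda>s. c s \<oplus>\<^bsub>B\<^esub> d s"]) auto
  next
    fix b x assume b: "b \<in> carrier B" and "x \<in> ?W"
    then obtain c where c: "c \<in> S \<rightarrow> carrier B" "x = (\<Oplus>\<^bsub>M\<^esub>s\<in>S. c s \<odot>\<^bsub>M\<^esub> s)" by blast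
    have "b \<odot>\<^bsub>M\<^esub> x = (\<Oplus>\<^bsub>M\<^esub>s\<in>S. b \<odot>\<^bsub>M\<^esub> (c s \<odot>\<^bsub>M\<^esub> s))" using M.smult_finsum[OF b cl[OF c(1)]] c(2) by simp
    also have "\<dots> = (\<Oplus>\<^bsub>M\<^esub>s\<in>S. (b \<otimes>\<^bsub>B\<^esub> c s) \<odot>\<^bsub>M\<^esub> s)"
      using c(1) b assms(3) by (intro M.M.finsum_cong') (simp_all add: M.smult_closed M.smult_assoc Pi_iff subset_iff)
    finally show "b \<odot>\<^bsub>M\<^esub> x \<in> ?W"
      using c(1) b by (intro CollectI exI[of _ "\<lambda>s. b \<otimes>\<^bsub>B\<^esub> c s"]) auto
  qed
  show "S \<subseteq> ?W"
  proof
    fix x assume x: "x \<in> S"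
    have "(\<Oplus>\<^bsub>M\<^esub>s\<in>S. (if s = x then \<one>\<^bsub>B\<^esub> else \<zero>\<^bsub>B\<^esub>) \<odot>\<^bsub>M\<^esub> s) = (\<Oplus>\<^bsub>M\<^esub>s\<in>S. if s = x then x else \<zero>\<^bsub>M\<^esub>)"
      using assms(3) x by (intro M.M.finsum_cong') (auto simp: M.smult_one subset_iff)
    also have "\<dots> = x" using x assms by (intro M.M.finsum_delta) auto
    finally show "x \<in> ?W"
      by (intro CollectI exI[of _ "\<lambda>s. if s = x then \<one>\<^bsub>B\<^esub> else \<zero>\<^bsub>B\<^esub>"]) auto
  qed
  show "?W \<subseteq> span B M S"
  proof
    fix x assume "x \<in> ?W"
    then obtain c where c: "c \<in> S \<rightarrow> carrier B" "x = (\<Oplus>\<^bsub>M\<^esub>s\<in>S. c s \<odot>\<^bsub>M\<^esub> s)" by blast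
    show "x \<in> span B M S"
      unfolding c(2) using c(1) span_upper[of S B M] assms(3)
      by (intro submodule_finsum[OF assms(1) span_submodule[OF assms(1,3)]] Pi_I
        submodule_smult[OF span_submodule[OF assms(1,3)]]) (simp_all add: Pi_iff subset_iff)
  qed
qed

lemma fin_gen_iff_span:
  assumes "left_module B M"
  shows "fin_gen B M \<longleftrightarrow> (\<exists>S. finite S \<and> S \<subseteq> carrier M \<and> span B M S = carrier M)"
proof -
  have "finite S \<and> S \<subseteq> carrier M \<and> span B M S = carrier M \<longleftrightarrow> finite S \<and> S \<subseteq> carrier M \<and>
    carrier M = {\<Oplus>\<^bsub>M\<^esub>s\<in>S. c s \<odot>\<^bsub>M\<^esub> s | c. c \<in> S \<rightarrow> carrier B}" for S
  proof (cases "finite S \<and> S \<subseteq> carrier M")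
    case True
    hence eq: "span B M S = {\<Oplus>\<^bsub>M\<^esub>s\<in>S. c s \<odot>\<^bsub>M\<^esub> s | c. c \<in> S \<rightarrow> carrier B}"
      using span_eq_combinations[OF assms] by blast
    show ?thesis unfolding eq using eq_commute by blast
  qed blast
  thus ?thesis by (simp only: fin_gen_def)
qed

lemma span_image:
  assumes "left_module B M" "left_module B N" "f \<in> mod_hom B M N" "S \<subseteq> carrier M"
  shows "f ` span B M S = span B N (f ` S)"
proof
  have S: "f ` S \<subseteq> carrier N" using assms(4) mod_hom_closed[OF assms(3)] by auto
  have "span B M S \<subseteq> {x \<in> carrier M. f x \<in> span B N (f ` S)}"
    by (rule span_least[OF submodule_preimage[OF assms(1-3) span_submodule[OF assms(2) S]]])
      (use assms(4) span_upper[of "f ` S" B N] in auto)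
  thus "f ` span B M S \<subseteq> span B N (f ` S)" by blast
  show "span B N (f ` S) \<subseteq> f ` span B M S"
    by (rule span_least[OF submodule_image[OF assms(1-3) span_submodule[OF assms(1,4)]]])
      (rule image_mono[OF span_upper])
qed

lemma fin_gen_image:
  assumes "left_module B M" "left_module B N" "f \<in> mod_hom B M N" "f ` carrier M = carrier N" "fin_gen B M"
  shows "fin_gen B N"
proof -
  obtain S where S: "finite S" "S \<subseteq> carrier M" "span B M S = carrier M"
    using assms(5) fin_gen_iff_span[OF assms(1)] by blast
  have "f ` S \<subseteq> carrier N" using S(2) assms(4) by blast
  moreover have "span B N (f ` S) = carrier N"
    using span_image[OF assms(1-3) S(2)] unfolding S(3) assms(4) by (rule sym)
  ultimately show ?thesis
    unfolding fin_gen_iff_span[OF assms(2)] using S(1) by blast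
qed

section \<open>Free modules of finite rank\<close>

abbreviation free :: "('b, 'c) ring_scheme \<Rightarrow> nat \<Rightarrow> ('b, nat \<Rightarrow> 'b) module"
  where "free B k \<equiv> dsum {..<k} (\<lambda>_. reg B)"

lemma free_left_module: "ring B \<Longrightarrow> left_module B (free B k)"
  by (rule dsum_left_module[OF _ reg_left_module])

lemma mod_hom_reg:
  assumes "left_module B M" "x \<in> carrier M" shows "(\<lambda>b. b \<odot>\<^bsub>M\<^esub> x) \<in> mod_hom B (reg B) M"
proof -
  interpret M: left_module B M by fact
  show ?thesis using assms(2) by (intro mod_homI) (simp_all add: M.smult_closed M.smult_l_distr M.smult_assoc)
qed

definition basis :: "('b, 'c) ring_scheme \<Rightarrow> nat \<Rightarrow> nat \<Rightarrow> nat \<Rightarrow> 'b"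
  where "basis B k i = dinj {..<k} (\<lambda>_. reg B) i \<one>\<^bsub>B\<^esub>"

lemma basis_closed: "\<lbrakk>ring B; i < k\<rbrakk> \<Longrightarrow> basis B k i \<in> carrier (free B k)"
  unfolding basis_def
  by (rule dinj_closed[where B = B]) (simp_all add: reg_left_module ring.is_monoid monoid.one_closed)

text \<open>The map out of a free module with prescribed values x on the basis. It is later read in
  a second way: \<open>comb (End_mod M) k v c\<close> is the value at v of the map M^k -> M whose
  row of components is c.\<close>

definition comb :: "('b, 'm, 'd) module_scheme \<Rightarrow> nat \<Rightarrow> (nat \<Rightarrow> 'm) \<Rightarrow> (nat \<Rightarrow> 'b) \<Rightarrow> 'm"
  where "comb M k x c = (\<Oplus>\<^bsub>M\<^esub>i\<in>{..<k}. c i \<odot>\<^bsub>M\<^esub> x i)"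

lemma comb_hom:
  assumes "left_module B M" "\<And>i. i < k \<Longrightarrow> x i \<in> carrier M"
  shows "comb M k x \<in> mod_hom B (free B k) M"
proof -
  have "comb M k x = (\<lambda>v. \<Oplus>\<^bsub>M\<^esub>i\<in>{..<k}. (\<lambda>b. b \<odot>\<^bsub>M\<^esub> x i) (v i))" by (simp add: comb_def fun_eq_iff)
  moreover have "(\<lambda>v. \<Oplus>\<^bsub>M\<^esub>i\<in>{..<k}. (\<lambda>b. b \<odot>\<^bsub>M\<^esub> x i) (v i)) \<in> mod_hom B (free B k) M"
    by (rule mod_hom_copair[OF assms(1)], rule mod_hom_reg[OF assms(1)]) (simp add: assms(2))
  ultimately show ?thesis by simp
qed

lemma comb_basis:
  assumes "left_module B M" "\<And>i. i < k \<Longrightarrow> x i \<in> carrier M" "i < k"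
  shows "comb M k x (basis B k i) = x i"
proof -
  interpret M: left_module B M by fact
  show ?thesis
    unfolding comb_def basis_def
    by (subst copair_dinj[OF assms(1), where f = "\<lambda>i b. b \<odot>\<^bsub>M\<^esub> x i"])
      (use assms(3) mod_hom_reg[OF assms(1) assms(2)] in
        \<open>simp_all add: reg_left_module M.R.ring_axioms M.smult_one assms(2)\<close>)
qed

lemma mod_hom_free_eq_comb:
  assumes "left_module B M" "f \<in> mod_hom B (free B k) M" "c \<in> carrier (free B k)"
  shows "f c = comb M k (\<lambda>i. f (basis B k i)) c"
proof -
  interpret M: left_module B M by fact
  interpret F: left_module B "free B k" by (rule free_left_module) (rule M.R.ring_axioms)
  have c: "c i \<in> carrier B" if "i < k" for i using assms(3) that by auto
  have *: "dinj {..<k} (\<lambda>_. reg B) i (c i) = c i \<odot>\<^bsub>free B k\<^esub> basis B k i" if "i < k" for i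
    using mod_hom_smult[OF dinj_hom[of "{..<k}" B "\<lambda>_. reg B" i], of "c i" "\<one>\<^bsub>B\<^esub>"] that c[OF that]
    by (simp add: basis_def reg_left_module M.R.ring_axioms)
  have "f c = (\<Oplus>\<^bsub>M\<^esub>i\<in>{..<k}. f (dinj {..<k} (\<lambda>_. reg B) i (c i)))"
    by (rule mod_hom_dsum_decompose[OF _ _ assms]) (simp_all add: reg_left_module M.R.ring_axioms)
  also have "\<dots> = comb M k (\<lambda>i. f (basis B k i)) c"
    unfolding comb_def
    using * c basis_closed[OF M.R.ring_axioms] mod_hom_smult[OF assms(2)] mod_hom_closed[OF assms(2)]
    by (intro M.M.finsum_cong') (auto simp del: dsum_simps intro!: M.smult_closed)
  finally show ?thesis .
qed

lemma comb_image:
  assumes "left_module B M" "\<And>i. i < k \<Longrightarrow> x i \<in> carrier M"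
  shows "comb M k x ` carrier (free B k) = span B M (x ` {..<k})"
proof
  interpret M: left_module B M by fact
  note F = free_left_module[OF M.R.ring_axioms, of k]
  have x: "x ` {..<k} \<subseteq> carrier M" using assms(2) by auto
  show "span B M (x ` {..<k}) \<subseteq> comb M k x ` carrier (free B k)"
  proof (rule span_least)
    show "submodule (comb M k x ` carrier (free B k)) B M"
      by (rule submodule_image[OF F assms(1) comb_hom[OF assms] submodule_carrier[OF F]])
    show "x ` {..<k} \<subseteq> comb M k x ` carrier (free B k)"
    proof
      fix y assume "y \<in> x ` {..<k}"
      then obtain i where "i < k" "y = x i" by auto
      thus "y \<in> comb M k x ` carrier (free B k)"
        using comb_basis[OF assms \<open>i < k\<close>] basis_closed[OF M.R.ring_axioms, of i k]
        by (intro image_eqI[of _ _ "basis B k i"]) simp_all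
    qed
  qed
  show "comb M k x ` carrier (free B k) \<subseteq> span B M (x ` {..<k})"
  proof (intro subsetI, elim imageE)
    fix y c assume c: "c \<in> carrier (free B k)" and y: "y = comb M k x c"
    have xs: "x i \<in> span B M (x ` {..<k})" if "i < k" for i
      using that span_upper[of "x ` {..<k}" B M] by auto
    show "y \<in> span B M (x ` {..<k})"
      unfolding y comb_def using c xs
      by (intro submodule_finsum[OF assms(1) span_submodule[OF assms(1) x]] Pi_I
        submodule_smult[OF span_submodule[OF assms(1) x]]) (simp_all add: PiE_iff)
  qed
qed

lemma fin_gen_iff_free:
  assumes "left_module B M"
  shows "fin_gen B M \<longleftrightarrow> (\<exists>k x. (\<forall>i<k. x i \<in> carrier M) \<and> comb M k x ` carrier (free B k) = carrier M)"
proof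
  assume "fin_gen B M"
  then obtain S where S: "finite S" "S \<subseteq> carrier M" "span B M S = carrier M"
    using fin_gen_iff_span[OF assms] by blast
  obtain x where x: "bij_betw x {..<card S} S"
    using ex_bij_betw_nat_finite[OF S(1)] by (auto simp: atLeast0LessThan)
  hence xS: "x ` {..<card S} = S" by (simp add: bij_betw_def)
  hence xm: "x i \<in> carrier M" if "i < card S" for i using S(2) that by blast
  show "\<exists>k x. (\<forall>i<k. x i \<in> carrier M) \<and> comb M k x ` carrier (free B k) = carrier M"
    using comb_image[OF assms xm] xm S(3) xS by (intro exI[of _ "card S"] exI[of _ x]) simp
next
  assume "\<exists>k x. (\<forall>i<k. x i \<in> carrier M) \<and> comb M k x ` carrier (free B k) = carrier M"
  then obtain k x where x: "\<And>i. i < k \<Longrightarrow> x i \<in> carrier M" "comb M k x ` carrier (free B k) = carrier M" by blast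
  show "fin_gen B M"
    unfolding fin_gen_iff_span[OF assms]
    using comb_image[OF assms x(1)] x by (intro exI[of _ "x ` {..<k}"]) (simp add: image_subset_iff)
qed

lemma free_fin_gen:
  assumes "ring B" shows "fin_gen B (free B k)"
proof -
  note F = free_left_module[OF assms, of k]
  have "comb (free B k) k (basis B k) ` carrier (free B k) = carrier (free B k)"
    by (subst image_cong[OF refl mod_hom_free_eq_comb[OF F mod_hom_id, symmetric]]) (simp_all del: dsum_simps)
  thus ?thesis unfolding fin_gen_iff_free[OF F] using basis_closed[OF assms] by blast
qed

subsection \<open>Modules of finite length\<close>

text \<open>Finite length, phrased by a strictly increasing rank on submodules: this saves composition series.\<close>

definition fin_len :: "('b, 'c) ring_scheme \<Rightarrow> ('b, 'm, 'd) module_scheme \<Rightarrow> bool"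
  where "fin_len B M \<longleftrightarrow> (\<exists>r :: 'm set \<Rightarrow> nat. \<forall>U V. submodule U B M \<longrightarrow> submodule V B M \<longrightarrow> U \<subset> V \<longrightarrow> r U < r V)"

lemma fin_lenE:
  assumes "fin_len B M"
  obtains r :: "'m set \<Rightarrow> nat" where "\<And>U V. \<lbrakk>submodule U B M; submodule V B M; U \<subset> V\<rbrakk> \<Longrightarrow> r U < r V"
  using assms by (auto simp: fin_len_def)

text \<open>The rank of U is the rank of \<open>F U\<close> plus the rank of \<open>G U\<close>; a
  strict inclusion must show in at least one of them. An image and an intersection with a kernel are
  the typical pair.\<close>

lemma fin_len_transfer2:
  assumes "fin_len B1 M1" "fin_len B2 M2"
    and F: "\<And>U. submodule U B M \<Longrightarrow> submodule (F U) B1 M1"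
    and G: "\<And>U. submodule U B M \<Longrightarrow> submodule (G U) B2 M2"
    and mono: "\<And>U V. \<lbrakk>submodule U B M; submodule V B M; U \<subseteq> V\<rbrakk> \<Longrightarrow> F U \<subseteq> F V \<and> G U \<subseteq> G V"
    and strict: "\<And>U V. \<lbrakk>submodule U B M; submodule V B M; U \<subseteq> V; F U = F V; G U = G V\<rbrakk> \<Longrightarrow> V \<subseteq> U"
  shows "fin_len B M"
proof -
  obtain r where r: "\<And>U V. \<lbrakk>submodule U B1 M1; submodule V B1 M1; U \<subset> V\<rbrakk> \<Longrightarrow> r U < (r V :: nat)"
    using fin_lenE[OF assms(1)] by blast
  obtain s where s: "\<And>U V. \<lbrakk>submodule U B2 M2; submodule V B2 M2; U \<subset> V\<rbrakk> \<Longrightarrow> s U < (s V :: nat)"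
    using fin_lenE[OF assms(2)] by blast
  have "r (F U) + s (G U) < r (F V) + s (G V)" if "submodule U B M" "submodule V B M" "U \<subset> V" for U V
  proof -
    have le: "F U \<subseteq> F V" "G U \<subseteq> G V" and ne: "F U \<subset> F V \<or> G U \<subset> G V"
      using mono[OF that(1,2)] strict[OF that(1,2)] that(3) by blast+
    have "r (F U) \<le> r (F V)" using r[OF F F, OF that(1,2)] le by (cases "F U = F V") (auto simp: psubset_eq)
    moreover have "s (G U) \<le> s (G V)" using s[OF G G, OF that(1,2)] le by (cases "G U = G V") (auto simp: psubset_eq)
    moreover have "r (F U) < r (F V) \<or> s (G U) < s (G V)"
      using ne r[OF F F, OF that(1,2)] s[OF G G, OF that(1,2)] by blast
    ultimately show ?thesis by linarith
  qed
  thus ?thesis unfolding fin_len_def by (intro exI[of _ "\<lambda>U. r (F U) + s (G U)"]) blast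
qed

text \<open>The case F = G: a doubled rank is still strictly increasing.\<close>

lemma fin_len_transfer:
  assumes "fin_len B1 M1"
    and "\<And>U. submodule U B M \<Longrightarrow> submodule (F U) B1 M1"
    and "\<And>U V. \<lbrakk>submodule U B M; submodule V B M; U \<subseteq> V\<rbrakk> \<Longrightarrow> F U \<subseteq> F V"
    and "\<And>U V. \<lbrakk>submodule U B M; submodule V B M; U \<subseteq> V; F U = F V\<rbrakk> \<Longrightarrow> V \<subseteq> U"
  shows "fin_len B M"
proof (rule fin_len_transfer2[where F = F and G = F, OF assms(1,1)])
  fix U V assume "submodule U B M" "submodule V B M" "U \<subseteq> V"
  from assms(3)[OF this] show "F U \<subseteq> F V \<and> F U \<subseteq> F V" by simp
qed (rule assms(2,4); assumption)+

lemma fin_len_mono: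
  assumes "fin_len B1 M1" "\<And>U. submodule U B M \<Longrightarrow> submodule U B1 M1" shows "fin_len B M"
  by (rule fin_len_transfer[where F = "\<lambda>U. U", OF assms]) auto

lemma fin_len_submodule:
  assumes "left_module B M" "fin_len B M" "submodule U B M"
  shows "fin_len B (M\<lparr>carrier := U\<rparr>)"
  using submodule_submodule_iff[OF assms(1,3)] by (intro fin_len_mono[OF assms(2)]) blast

lemma fin_len_inj:
  assumes "left_module B M" "left_module B N" "f \<in> mod_hom B M N" "inj_on f (carrier M)" "fin_len B N"
  shows "fin_len B M"
proof (rule fin_len_transfer[where F = "\<lambda>U. f ` U", OF assms(5)])
  fix U assume "submodule U B M" thus "submodule (f ` U) B N" by (rule submodule_image[OF assms(1-3)])
next
  fix U V assume "submodule U B M" "submodule V B M" "f ` U = f ` V"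
  hence "U = V" using inj_on_image_eq_iff[OF assms(4)] submodule_subset by metis
  thus "V \<subseteq> U" by simp
qed blast

lemma fin_len_image:
  assumes "left_module B M" "left_module B N" "f \<in> mod_hom B M N" "f ` carrier M = carrier N" "fin_len B M"
  shows "fin_len B N"
proof (rule fin_len_transfer[where F = "\<lambda>U. {x \<in> carrier M. f x \<in> U}", OF assms(5)])
  fix U assume "submodule U B N"
  thus "submodule {x \<in> carrier M. f x \<in> U} B M" by (rule submodule_preimage[OF assms(1-3)])
next
  fix U V assume U: "submodule U B N" "submodule V B N"
    and eq: "{x \<in> carrier M. f x \<in> U} = {x \<in> carrier M. f x \<in> V}"
  show "V \<subseteq> U"
  proof
    fix y assume y: "y \<in> V"
    then obtain x where "x \<in> carrier M" "y = f x" using submodule_mem[OF U(2)] assms(4) by blast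
    thus "y \<in> U" using y eq by blast
  qed
qed blast

text \<open>Two nested submodules with the same image under f and the same intersection with the
  kernel coincide: an element of the larger one is corrected by an element of the smaller one with
  the same image.\<close>

lemma fin_len_extension:
  assumes "left_module B M" "left_module B N" "f \<in> mod_hom B M N" "fin_len B N"
    "fin_len B (M\<lparr>carrier := {x \<in> carrier M. f x = \<zero>\<^bsub>N\<^esub>}\<rparr>)"
  shows "fin_len B M"
proof -
  interpret M: left_module B M by fact
  interpret N: left_module B N by fact
  let ?K = "{x \<in> carrier M. f x = \<zero>\<^bsub>N\<^esub>}"
  note K = submodule_kernel[OF assms(1-3)]
  show ?thesis
  proof (rule fin_len_transfer2[where F = "\<lambda>U. f ` U" and G = "\<lambda>U. U \<inter> ?K", OF assms(4,5)])
    fix U assume U: "submodule U B M"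
    show "submodule (f ` U) B N" by (rule submodule_image[OF assms(1-3) U])
    show "submodule (U \<inter> ?K) B (M\<lparr>carrier := ?K\<rparr>)"
      using submodule_Int[OF assms(1) U K] submodule_submodule_iff[OF assms(1) K] by blast
  next
    fix U V assume U: "submodule U B M" and V: "submodule V B M" and UV: "U \<subseteq> V"
      and eq: "f ` U = f ` V" "U \<inter> ?K = V \<inter> ?K"
    show "V \<subseteq> U"
    proof
      fix v assume v: "v \<in> V"
      then obtain u where u: "u \<in> U" "f u = f v" using eq(1) by (metis imageE imageI)
      have m: "u \<in> carrier M" "v \<in> carrier M" using u v submodule_mem[OF U] submodule_mem[OF V] by auto
      have "v \<ominus>\<^bsub>M\<^esub> u \<in> V" using submodule_diff[OF V v] u UV by blast
      moreover have "f (v \<ominus>\<^bsub>M\<^esub> u) = \<zero>\<^bsub>N\<^esub>"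
        using mod_hom_diff[OF assms(1-3) m(2,1)] u m mod_hom_closed[OF assms(3)] by (simp add: N.M.minus_eq_zero_iff)
      ultimately have "v \<ominus>\<^bsub>M\<^esub> u \<in> U" using eq(2) m by auto
      from submodule_add[OF U u(1) this] show "v \<in> U" using m by (simp add: M.M.add_minus_cancel)
    qed
  qed blast
qed

lemma fin_len_zero: "\<lbrakk>left_module B M; carrier M = {\<zero>\<^bsub>M\<^esub>}\<rbrakk> \<Longrightarrow> fin_len B M"
  unfolding fin_len_def
  by (intro exI[of _ "\<lambda>_. 0"] allI impI) (metis psubset_eq submodule_subset submodule_zero subset_singletonD empty_iff)

text \<open>Induction by extensions: the kernel of forgetting the new coordinate embeds into that
  coordinate.\<close>

lemma fin_len_dsum:
  assumes "ring B" "finite I" "\<And>i. i \<in> I \<Longrightarrow> left_module B (X i)" "\<And>i. i \<in> I \<Longrightarrow> fin_len B (X i)"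
  shows "fin_len B (dsum I X)"
  using assms(2-4)
proof (induction I rule: finite_induct)
  case empty
  show ?case
    by (rule fin_len_zero[OF dsum_left_module[OF assms(1)]]) auto
next
  case (insert i I)
  have lm: "left_module B (dsum (insert i I) X)" "left_module B (dsum I X)"
    using insert.prems by (auto intro!: dsum_left_module[OF assms(1)])
  have h: "(\<lambda>v. \<lambda>j\<in>I. v j) \<in> mod_hom B (dsum (insert i I) X) (dsum I X)"
    by (rule mod_hom_dsumI[OF lm(1)]) (rule dsum_proj, simp)
  let ?K = "{x \<in> carrier (dsum (insert i I) X). (\<lambda>j\<in>I. x j) = \<zero>\<^bsub>dsum I X\<^esub>}"
  have K: "submodule ?K B (dsum (insert i I) X)" by (rule submodule_kernel[OF lm h])
  have "fin_len B ((dsum (insert i I) X)\<lparr>carrier := ?K\<rparr>)"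
  proof (rule fin_len_inj[where f = "\<lambda>v. v i"])
    show "left_module B ((dsum (insert i I) X)\<lparr>carrier := ?K\<rparr>)" by (rule submodule_left_module[OF lm(1) K])
    show "left_module B (X i)" "fin_len B (X i)" using insert.prems by auto
    show "(\<lambda>v. v i) \<in> mod_hom B ((dsum (insert i I) X)\<lparr>carrier := ?K\<rparr>) (X i)"
      by (rule mod_hom_restrict_submodule[OF dsum_proj K]) simp
    show "inj_on (\<lambda>v. v i) (carrier ((dsum (insert i I) X)\<lparr>carrier := ?K\<rparr>))"
    proof (rule inj_onI)
      fix x y assume x: "x \<in> carrier ((dsum (insert i I) X)\<lparr>carrier := ?K\<rparr>)"
        and y: "y \<in> carrier ((dsum (insert i I) X)\<lparr>carrier := ?K\<rparr>)" and e: "x i = y i"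
      have "(\<lambda>j\<in>I. x j) = (\<lambda>j\<in>I. y j)" using x y by simp
      hence "x j = y j" if "j \<in> I" for j using that by (metis restrict_apply')
      thus "x = y" using x y e by (intro extensionalityI[of _ "insert i I"]) (auto simp: PiE_iff)
    qed
  qed
  moreover have "fin_len B (dsum I X)" using insert by simp
  ultimately show ?case by (intro fin_len_extension[OF lm h])
qed

lemma fin_len_free: "\<lbrakk>ring B; fin_len B (reg B)\<rbrakk> \<Longrightarrow> fin_len B (free B k)"
  by (rule fin_len_dsum) (simp_all add: reg_left_module)

lemma fg_fin_len:
  assumes "fin_len B (reg B)" "left_module B M" "fin_gen B M"
  shows "fin_len B M"
proof -
  interpret M: left_module B M by fact
  obtain k x where x: "\<forall>i<k. x i \<in> carrier M" "comb M k x ` carrier (free B k) = carrier M"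
    using assms(3) fin_gen_iff_free[OF assms(2)] by blast
  show ?thesis
    by (rule fin_len_image[OF free_left_module assms(2) comb_hom[OF assms(2)] x(2) fin_len_free])
      (use x(1) assms(1) M.R.ring_axioms in auto)
qed

text \<open>Choose a finite set whose span has the largest rank; ranks of spans are bounded by that
  of the carrier. Adjoining a further element cannot enlarge the span.\<close>

lemma fin_len_fin_gen:
  assumes "left_module B M" "fin_len B M"
  shows "fin_gen B M"
proof -
  interpret M: left_module B M by fact
  obtain r where r: "\<And>U V. \<lbrakk>submodule U B M; submodule V B M; U \<subset> V\<rbrakk> \<Longrightarrow> r U < (r V :: nat)"
    using fin_lenE[OF assms(2)] by blast
  let ?P = "\<lambda>S. finite S \<and> S \<subseteq> carrier M"
  have bd: "r (span B M S) \<le> r (carrier M)" if "?P S" for S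
  proof -
    have *: "submodule (span B M S) B M" using that by (intro span_submodule[OF assms(1)]) auto
    show ?thesis using r[OF _ submodule_carrier[OF assms(1)]] submodule_subset[OF *] *
      by (cases "span B M S = carrier M") (auto simp: psubset_eq intro: less_imp_le)
  qed
  have "\<exists>S. ?P S \<and> (\<forall>T. ?P T \<longrightarrow> r (span B M T) \<le> r (span B M S))"
    by (rule ex_has_greatest_nat[where k = "{}" and b = "Suc (r (carrier M))"]) (use bd in \<open>auto simp: less_Suc_eq_le\<close>)
  then obtain S where S: "?P S" "\<And>T. ?P T \<Longrightarrow> r (span B M T) \<le> r (span B M S)" by blast
  have sub: "submodule (span B M T) B M" if "?P T" for T using that by (intro span_submodule[OF assms(1)]) auto
  have "carrier M \<subseteq> span B M S"
  proof
    fix x assume x: "x \<in> carrier M"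
    have T: "?P (insert x S)" using S(1) x by simp
    have le: "span B M S \<subseteq> span B M (insert x S)"
      using span_upper[of "insert x S" B M] by (intro span_least sub[OF T]) blast
    have "\<not> span B M S \<subset> span B M (insert x S)" using r[OF sub[OF S(1)] sub[OF T]] S(2)[OF T] by linarith
    thus "x \<in> span B M S" using le span_upper[of "insert x S" B M] by blast
  qed
  hence "span B M S = carrier M" using submodule_subset[OF sub[OF S(1)]] by blast
  thus ?thesis unfolding fin_gen_iff_span[OF assms(1)] using S(1) by blast
qed

text \<open>The noetherian property in the form used for presentations: the generators are indexed
  by an initial segment, so that \<open>comb\<close> applies, and their span is taken in the ambient
  module.\<close>

lemma submodule_generators:
  assumes F: "left_module B F" "fin_len B F" and K: "submodule K B F"
  obtains b :: nat and g where "\<And>j. j < b \<Longrightarrow> g j \<in> K" "span B F (g ` {..<b}) = K"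
proof -
  note lK = submodule_left_module[OF F(1) K]
  have "fin_gen B (F\<lparr>carrier := K\<rparr>)" by (rule fin_len_fin_gen[OF lK fin_len_submodule[OF F K]])
  then obtain S where S: "finite S" "S \<subseteq> K" "span B (F\<lparr>carrier := K\<rparr>) S = K"
    unfolding fin_gen_iff_span[OF lK] by auto
  have SF: "S \<subseteq> carrier F" using S(2) submodule_subset[OF K] by (rule subset_trans)
  \<comment> \<open>The spans inside K and inside F are intersections over different families of
    submodules; cutting down with K compares them.\<close>
  have "submodule (span B F S \<inter> K) B (F\<lparr>carrier := K\<rparr>)"
    using submodule_Int[OF F(1) span_submodule[OF F(1) SF] K] submodule_submodule_iff[OF F(1) K] by blast
  from span_least[OF this, of S] have "K \<subseteq> span B F S" using S span_upper[of S B F] by blast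
  moreover have "span B F S \<subseteq> K" by (rule span_least[OF K S(2)])
  ultimately have sp: "span B F S = K" by blast
  obtain g where "bij_betw g {..<card S} S"
    using ex_bij_betw_nat_finite[OF S(1)] by (auto simp: atLeast0LessThan)
  hence gS: "g ` {..<card S} = S" by (simp add: bij_betw_def)
  show thesis by (rule that[of "card S" g]) (use S(2) gS sp in auto)
qed

subsection \<open>Retracts\<close>

text \<open>A direct summand up to isomorphism, given by maps instead of subsets: the two carriers
  may have different types, and transitivity is composition. \<open>in_add_iff_retract\<close>
  recovers \<open>in_add\<close>.\<close>

definition retract :: "('b, 'c) ring_scheme \<Rightarrow> ('b, 'm, 'd) module_scheme \<Rightarrow> ('b, 'k, 'e) module_scheme \<Rightarrow> bool"
  where "retract B X Y \<longleftrightarrow> (\<exists>i\<in>mod_hom B X Y. \<exists>p\<in>mod_hom B Y X. \<forall>x\<in>carrier X. p (i x) = x)"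

lemma retractI:
  "\<lbrakk>i \<in> mod_hom B X Y; p \<in> mod_hom B Y X; \<And>x. x \<in> carrier X \<Longrightarrow> p (i x) = x\<rbrakk> \<Longrightarrow> retract B X Y"
  unfolding retract_def by blast

lemma retract_refl: "retract B X X"
  by (rule retractI[OF mod_hom_id mod_hom_id]) (rule refl)

lemma retract_trans:
  assumes "retract B X Y" "retract B Y Z" shows "retract B X Z"
proof -
  obtain i p where ip: "i \<in> mod_hom B X Y" "p \<in> mod_hom B Y X" "\<forall>x\<in>carrier X. p (i x) = x"
    using assms(1) by (auto simp: retract_def)
  obtain j q where jq: "j \<in> mod_hom B Y Z" "q \<in> mod_hom B Z Y" "\<forall>x\<in>carrier Y. q (j x) = x"
    using assms(2) by (auto simp: retract_def)
  show ?thesis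
    by (rule retractI[OF mod_hom_comp[OF ip(1) jq(1)] mod_hom_comp[OF jq(2) ip(2)]])
      (simp add: ip(3) jq(3) mod_hom_closed[OF ip(1)])
qed

lemma iso_imp_retract: "\<lbrakk>left_module B X; mod_iso B X Y\<rbrakk> \<Longrightarrow> retract B X Y"
proof -
  assume X: "left_module B X" and "mod_iso B X Y"
  then obtain f where f: "f \<in> mod_hom B X Y" "bij_betw f (carrier X) (carrier Y)" by (auto simp: mod_iso_def)
  show ?thesis
    by (rule retractI[OF f(1) mod_hom_inverse[OF X f]]) (use f(2) in \<open>simp add: the_inv_into_f_f bij_betw_def\<close>)
qed

lemma internal_dsum_proj:
  assumes "left_module B M" "internal_dsum B M U V"
  obtains p q where "p \<in> mod_hom B M M" "q \<in> mod_hom B M M"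
    "\<And>x. x \<in> carrier M \<Longrightarrow> p x \<in> U" "\<And>x. x \<in> carrier M \<Longrightarrow> q x \<in> V"
    "\<And>x. x \<in> carrier M \<Longrightarrow> p x \<oplus>\<^bsub>M\<^esub> q x = x"
    "\<And>x. x \<in> U \<Longrightarrow> p x = x" "\<And>x. x \<in> V \<Longrightarrow> q x = x"
proof -
  interpret M: left_module B M by fact
  have U: "submodule U B M" and V: "submodule V B M" and sum: "U <+>\<^bsub>M\<^esub> V = carrier M" and int: "U \<inter> V = {\<zero>\<^bsub>M\<^esub>}"
    using assms(2) by (auto simp: internal_dsum_def)
  note Um = submodule_mem[OF U] and Vm = submodule_mem[OF V]
  have uniq: "u = u' \<and> v = v'" if "u \<in> U" "u' \<in> U" "v \<in> V" "v' \<in> V" "u \<oplus>\<^bsub>M\<^esub> v = u' \<oplus>\<^bsub>M\<^esub> v'" for u u' v v'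
  proof -
    note m = Um[OF that(1)] Um[OF that(2)] Vm[OF that(3)] Vm[OF that(4)]
    have sub: "(a \<oplus>\<^bsub>M\<^esub> b) \<ominus>\<^bsub>M\<^esub> (c \<oplus>\<^bsub>M\<^esub> d) = (a \<ominus>\<^bsub>M\<^esub> c) \<oplus>\<^bsub>M\<^esub> (b \<ominus>\<^bsub>M\<^esub> d)"
      if "a \<in> carrier M" "b \<in> carrier M" "c \<in> carrier M" "d \<in> carrier M" for a b c d
      using that by (simp add: a_minus_def M.M.minus_add M.M.a_ac)
    have z: "a \<ominus>\<^bsub>M\<^esub> a = \<zero>\<^bsub>M\<^esub>" if "a \<in> carrier M" for a using that by (simp add: M.M.minus_eq_zero_iff)
    have "u \<ominus>\<^bsub>M\<^esub> u' = (u \<oplus>\<^bsub>M\<^esub> v) \<ominus>\<^bsub>M\<^esub> (u' \<oplus>\<^bsub>M\<^esub> v)" using m by (simp add: sub z)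
    also have "\<dots> = v' \<ominus>\<^bsub>M\<^esub> v" unfolding that(5) using m by (simp add: sub z)
    finally have "u \<ominus>\<^bsub>M\<^esub> u' \<in> U \<inter> V" using submodule_diff[OF U that(1,2)] submodule_diff[OF V that(4,3)] by simp
    hence "u = u'" using m int by (simp add: M.M.minus_eq_zero_iff)
    thus ?thesis using that(5) m by simp
  qed
  have ex: "\<exists>u v. u \<in> U \<and> v \<in> V \<and> u \<oplus>\<^bsub>M\<^esub> v = x" if x: "x \<in> carrier M" for x
  proof -
    have "x \<in> U <+>\<^bsub>M\<^esub> V" using x sum by simp
    thus ?thesis by (elim set_addE) auto
  qed
  then obtain p q where pq: "\<And>x. x \<in> carrier M \<Longrightarrow> p x \<in> U \<and> q x \<in> V \<and> p x \<oplus>\<^bsub>M\<^esub> q x = x" by metis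
  have eq: "p x = u \<and> q x = v" if "u \<in> U" "v \<in> V" "x = u \<oplus>\<^bsub>M\<^esub> v" for x u v
    using pq[of x] uniq[of "p x" u "q x" v] that Um Vm by auto
  have add: "p (x \<oplus>\<^bsub>M\<^esub> y) = p x \<oplus>\<^bsub>M\<^esub> p y \<and> q (x \<oplus>\<^bsub>M\<^esub> y) = q x \<oplus>\<^bsub>M\<^esub> q y"
    if "x \<in> carrier M" "y \<in> carrier M" for x y
  proof (rule eq)
    note x = pq[OF that(1)] and y = pq[OF that(2)]
    show "p x \<oplus>\<^bsub>M\<^esub> p y \<in> U" "q x \<oplus>\<^bsub>M\<^esub> q y \<in> V" using x y submodule_add[OF U] submodule_add[OF V] by auto
    have m: "p x \<in> carrier M" "q x \<in> carrier M" "p y \<in> carrier M" "q y \<in> carrier M"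
      using x y Um Vm by blast+
    have "x \<oplus>\<^bsub>M\<^esub> y = (p x \<oplus>\<^bsub>M\<^esub> q x) \<oplus>\<^bsub>M\<^esub> (p y \<oplus>\<^bsub>M\<^esub> q y)" using x y by simp
    also have "\<dots> = (p x \<oplus>\<^bsub>M\<^esub> p y) \<oplus>\<^bsub>M\<^esub> (q x \<oplus>\<^bsub>M\<^esub> q y)"
      using m by (simp only: M.M.a_ac M.M.add.m_closed)
    finally show "x \<oplus>\<^bsub>M\<^esub> y = (p x \<oplus>\<^bsub>M\<^esub> p y) \<oplus>\<^bsub>M\<^esub> (q x \<oplus>\<^bsub>M\<^esub> q y)" .
  qed
  have smult: "p (b \<odot>\<^bsub>M\<^esub> x) = b \<odot>\<^bsub>M\<^esub> p x \<and> q (b \<odot>\<^bsub>M\<^esub> x) = b \<odot>\<^bsub>M\<^esub> q x"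
    if "b \<in> carrier B" "x \<in> carrier M" for b x
  proof (rule eq)
    note x = pq[OF that(2)]
    show "b \<odot>\<^bsub>M\<^esub> p x \<in> U" "b \<odot>\<^bsub>M\<^esub> q x \<in> V" using x that submodule_smult[OF U] submodule_smult[OF V] by auto
    show "b \<odot>\<^bsub>M\<^esub> x = b \<odot>\<^bsub>M\<^esub> p x \<oplus>\<^bsub>M\<^esub> b \<odot>\<^bsub>M\<^esub> q x"
      using M.smult_r_distr[OF that(1), of "p x" "q x"] x Um Vm by simp
  qed
  show ?thesis
  proof (rule that)
    show "p \<in> mod_hom B M M" "q \<in> mod_hom B M M"
      using pq Um Vm add smult by (auto intro!: mod_homI)
    show "p x = x" if "x \<in> U" for x using eq[OF that submodule_zero[OF V]] Um[OF that] by simp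
    show "q x = x" if "x \<in> V" for x using eq[OF submodule_zero[OF U] that] Vm[OF that] by simp
  qed (use pq in auto)
qed

lemma internal_dsum_of_retraction:
  fixes Y :: "('b, 'm) module"
  assumes X: "left_module B X" and Y: "left_module B Y" and i: "i \<in> mod_hom B X Y" and p: "p \<in> mod_hom B Y X"
    and pi: "\<And>x. x \<in> carrier X \<Longrightarrow> p (i x) = x"
  shows "internal_dsum B Y (i ` carrier X) {y \<in> carrier Y. p y = \<zero>\<^bsub>X\<^esub>}"
proof -
  interpret X: left_module B X by fact
  interpret Y: left_module B Y by fact
  let ?U = "i ` carrier X" and ?V = "{y \<in> carrier Y. p y = \<zero>\<^bsub>X\<^esub>}"
  note U = submodule_image[OF X Y i submodule_carrier[OF X]] and V = submodule_kernel[OF Y X p]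
  have "y \<in> ?U <+>\<^bsub>Y\<^esub> ?V" if y: "y \<in> carrier Y" for y
  proof -
    have m: "p y \<in> carrier X" "i (p y) \<in> carrier Y" using y mod_hom_closed[OF p] mod_hom_closed[OF i] by auto
    have "p (y \<ominus>\<^bsub>Y\<^esub> i (p y)) = \<zero>\<^bsub>X\<^esub>"
      using mod_hom_diff[OF Y X p y m(2)] pi[OF m(1)] m by (simp add: X.M.minus_eq_zero_iff)
    hence "y \<ominus>\<^bsub>Y\<^esub> i (p y) \<in> ?V" using y m by simp
    from set_addI[where M = Y, OF imageI[where f = i, OF m(1)] this] show ?thesis using y m by (simp add: Y.M.add_minus_cancel)
  qed
  moreover have "?U <+>\<^bsub>Y\<^esub> ?V \<subseteq> carrier Y"
    using submodule_subset[OF submodule_set_add[OF Y U V]] .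
  moreover have "?U \<inter> ?V = {\<zero>\<^bsub>Y\<^esub>}"
    using submodule_zero[OF U] submodule_zero[OF V] pi mod_hom_zero[OF X Y i] by auto
  ultimately show ?thesis using U V unfolding internal_dsum_def by blast
qed

abbreviation copies :: "('b, 'm) module \<Rightarrow> nat \<Rightarrow> ('b, nat \<Rightarrow> 'm) module"
  where "copies M k \<equiv> dsum {..<k} (\<lambda>_. M)"

lemma copies_left_module: "left_module B M \<Longrightarrow> left_module B (copies M k)"
  by (rule dsum_left_module[OF left_module_ring])

lemma in_add_iff_retract:
  fixes M :: "('b, 'm) module" and X :: "('b, 'k) module"
  assumes "left_module B M" "left_module B X"
  shows "in_add B M X \<longleftrightarrow> (\<exists>k. retract B X (copies M k))"
proof
  assume "in_add B M X"
  then obtain k U V where UV: "internal_dsum B (copies M k) U V" "mod_iso B X ((copies M k)\<lparr>carrier := U\<rparr>)"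
    unfolding in_add_def by blast
  note P = copies_left_module[OF assms(1), of k]
  have U: "submodule U B (copies M k)" using UV(1) by (simp add: internal_dsum_def)
  obtain p q where p: "p \<in> mod_hom B (copies M k) (copies M k)" "\<And>x. x \<in> carrier (copies M k) \<Longrightarrow> p x \<in> U"
    "\<And>x. x \<in> U \<Longrightarrow> p x = x" using internal_dsum_proj[OF P UV(1)] by metis
  have "retract B ((copies M k)\<lparr>carrier := U\<rparr>) (copies M k)"
  proof (rule retractI[where p = p])
    show "(\<lambda>x. x) \<in> mod_hom B ((copies M k)\<lparr>carrier := U\<rparr>) (copies M k)"
      by (rule mod_hom_restrict_submodule[OF mod_hom_id U])
    show "p \<in> mod_hom B (copies M k) ((copies M k)\<lparr>carrier := U\<rparr>)"
      using p(1) by (subst mod_hom_submodule_iff[OF _ U]) (rule Pi_I, rule p(2))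
  qed (simp add: p(3))
  thus "\<exists>k. retract B X (copies M k)" using retract_trans[OF iso_imp_retract[OF assms(2) UV(2)]] by blast
next
  assume "\<exists>k. retract B X (copies M k)"
  then obtain k i p where ip: "i \<in> mod_hom B X (copies M k)" "p \<in> mod_hom B (copies M k) X"
    "\<And>x. x \<in> carrier X \<Longrightarrow> p (i x) = x" by (auto simp: retract_def)
  note P = copies_left_module[OF assms(1), of k]
  have ds: "internal_dsum B (copies M k) (i ` carrier X) {y \<in> carrier (copies M k). p y = \<zero>\<^bsub>X\<^esub>}"
    by (rule internal_dsum_of_retraction[OF assms(2) P ip(1,2)]) (rule ip(3))
  have U: "submodule (i ` carrier X) B (copies M k)" by (rule submodule_image[OF assms(2) P ip(1) submodule_carrier[OF assms(2)]])
  have "mod_iso B X ((copies M k)\<lparr>carrier := i ` carrier X\<rparr>)"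
    unfolding mod_iso_def
  proof (rule bexI[of _ i])
    show "bij_betw i (carrier X) (carrier ((copies M k)\<lparr>carrier := i ` carrier X\<rparr>))"
      unfolding bij_betw_def using inj_on_inverseI[of "carrier X" p i] ip(3) by simp
    show "i \<in> mod_hom B X ((copies M k)\<lparr>carrier := i ` carrier X\<rparr>)"
      using ip(1) by (subst mod_hom_submodule_iff[OF _ U]) auto
  qed
  thus "in_add B M X"
    unfolding in_add_def using ds by blast
qed

subsection \<open>Decomposition into indecomposables\<close>

lemma internal_dsum_submodule_iff:
  fixes M :: "('b, 'm) module"
  assumes "left_module B M" "submodule W B M"
  shows "internal_dsum B (M\<lparr>carrier := W\<rparr>) U V \<longleftrightarrow> submodule U B M \<and> submodule V B M \<and>
    U <+>\<^bsub>M\<^esub> V = W \<and> U \<inter> V = {\<zero>\<^bsub>M\<^esub>}"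
proof -
  have "U <+>\<^bsub>M\<lparr>carrier := W\<rparr>\<^esub> V = U <+>\<^bsub>M\<^esub> V" by (simp add: set_add_def')
  moreover have "U \<subseteq> W \<and> V \<subseteq> W" if "submodule U B M" "submodule V B M" "U <+>\<^bsub>M\<^esub> V = W"
    using submodule_set_add_upper[OF assms(1) that(1,2)] that(3) by blast
  ultimately show ?thesis
    unfolding internal_dsum_def submodule_submodule_iff[OF assms] by auto
qed

text \<open>The existence of decompositions into indecomposables, packaged as an induction over the
  submodules of one fixed module, so that all carriers stay in one type. Both members of a
  nontrivial decomposition have smaller rank.\<close>

lemma decompose_induct [consumes 3, case_names zero indecomposable sum]:
  fixes M :: "('b, 'm) module"
  assumes "left_module B M" "fin_len B M" "submodule W B M"
    and zero: "P {\<zero>\<^bsub>M\<^esub>}"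
    and ind: "\<And>W. \<lbrakk>submodule W B M; indecomposable B (M\<lparr>carrier := W\<rparr>)\<rbrakk> \<Longrightarrow> P W"
    and sum: "\<And>U V W. \<lbrakk>submodule U B M; submodule V B M; submodule W B M;
      internal_dsum B (M\<lparr>carrier := W\<rparr>) U V; P U; P V\<rbrakk> \<Longrightarrow> P W"
  shows "P W"
proof -
  obtain r where r: "\<And>U V. \<lbrakk>submodule U B M; submodule V B M; U \<subset> V\<rbrakk> \<Longrightarrow> r U < (r V :: nat)"
    using fin_lenE[OF assms(2)] by blast
  show ?thesis using assms(3)
  proof (induction "r W" arbitrary: W rule: less_induct)
    case less
    note W = less.prems
    show ?case
    proof (cases "indecomposable B (M\<lparr>carrier := W\<rparr>) \<or> W = {\<zero>\<^bsub>M\<^esub>}")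
      case True thus ?thesis using ind[OF W] zero by blast
    next
      case False
      then obtain U V where UV: "internal_dsum B (M\<lparr>carrier := W\<rparr>) U V" "U \<noteq> {\<zero>\<^bsub>M\<^esub>}" "V \<noteq> {\<zero>\<^bsub>M\<^esub>}"
        unfolding indecomposable_def by auto
      hence U: "submodule U B M" and V: "submodule V B M" and s: "U <+>\<^bsub>M\<^esub> V = W" "U \<inter> V = {\<zero>\<^bsub>M\<^esub>}"
        using internal_dsum_submodule_iff[OF assms(1) W] by auto
      have "U \<subseteq> W" "V \<subseteq> W" using submodule_set_add_upper[OF assms(1) U V] s by auto
      moreover have "U \<noteq> W" "V \<noteq> W"
        using UV(2,3) s(2) \<open>U \<subseteq> W\<close> \<open>V \<subseteq> W\<close> by blast+
      ultimately have "U \<subset> W" "V \<subset> W" by auto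
      hence "P U" "P V" using less.hyps r[OF U W] r[OF V W] U V by blast+
      thus ?thesis by (rule sum[OF U V W UV(1)])
    qed
  qed
qed

lemma indecomposable_cases:
  "\<lbrakk>indecomposable B M; internal_dsum B M U V\<rbrakk> \<Longrightarrow> U = {\<zero>\<^bsub>M\<^esub>} \<or> V = {\<zero>\<^bsub>M\<^esub>}"
  by (simp add: indecomposable_def)

lemma mod_hom_funpow: "f \<in> mod_hom B M M \<Longrightarrow> (f ^^ n) \<in> mod_hom B M M"
proof (induction n)
  case (Suc n)
  have "f ^^ Suc n = (\<lambda>x. f ((f ^^ n) x))" by (simp add: fun_eq_iff)
  thus ?case using mod_hom_comp[OF Suc.IH[OF Suc.prems] Suc.prems] by simp
qed (simp add: id_def mod_hom_id)

text \<open>Fitting's lemma. Passing from \<open>f^(2^k)\<close> to its square shrinks the image or enlarges the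
  kernel; when neither happens, the module is the direct sum of the two.\<close>

lemma fitting:
  fixes M :: "('b, 'm) module"
  assumes M: "left_module B M" and "fin_len B M" and ind: "indecomposable B M" and f: "f \<in> mod_hom B M M"
  shows "bij_betw f (carrier M) (carrier M) \<or> (\<exists>n. \<forall>x\<in>carrier M. (f ^^ n) x = \<zero>\<^bsub>M\<^esub>)"
proof -
  interpret M: left_module B M by fact
  obtain r where r: "\<And>U V. \<lbrakk>submodule U B M; submodule V B M; U \<subset> V\<rbrakk> \<Longrightarrow> r U < (r V :: nat)"
    using fin_lenE[OF assms(2)] by blast
  define g where "g k = f ^^ (2 ^ k)" for k :: nat
  have g: "g k \<in> mod_hom B M M" for k unfolding g_def by (rule mod_hom_funpow[OF f])
  have gS: "g (Suc k) x = g k (g k x)" for k x by (simp add: g_def funpow_add mult_2)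
  define I where "I k = g k ` carrier M" for k
  define K where "K k = {x \<in> carrier M. g k x = \<zero>\<^bsub>M\<^esub>}" for k
  have I: "submodule (I k) B M" and K: "submodule (K k) B M" for k
    unfolding I_def K_def by (rule submodule_image[OF M M g submodule_carrier[OF M]] submodule_kernel[OF M M g])+
  have ImK: "I (Suc k) \<subseteq> I k" "K k \<subseteq> K (Suc k)" for k
    using mod_hom_closed[OF g] mod_hom_zero[OF M M g] by (auto simp: I_def K_def gS)
  have rK: "r (K k) \<le> r (carrier M)" for k
    using r[OF K submodule_carrier[OF M]] submodule_subset[OF K] by (cases "K k = carrier M") (auto simp: psubset_eq less_imp_le)
  \<comment> \<open>\<open>w\<close> falls whenever the image shrinks or the kernel grows; the
    truncated subtraction is exact because \<open>rK\<close> bounds the rank of the kernel. As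
    naturals cannot decrease forever, image and kernel are both stationary at some common k.\<close>
  define w where "w k = r (I k) + (r (carrier M) - r (K k))" for k
  have "\<exists>k. I (Suc k) = I k \<and> K (Suc k) = K k"
  proof (rule ccontr)
    assume neg: "\<not> ?thesis"
    have "w (Suc k) < w k" for k
    proof -
      have "r (I (Suc k)) \<le> r (I k)" using r[OF I I] ImK(1) by (cases "I (Suc k) = I k") (auto simp: psubset_eq less_imp_le)
      moreover have "r (K k) \<le> r (K (Suc k))" using r[OF K K] ImK(2)
        by (cases "K (Suc k) = K k") (auto simp: psubset_eq less_imp_le)
      moreover have "r (I (Suc k)) < r (I k) \<or> r (K k) < r (K (Suc k))"
        using neg ImK[of k] r[OF I I, of "Suc k" k] r[OF K K, of k "Suc k"] by blast
      ultimately show ?thesis using rK[of "Suc k"] unfolding w_def by linarith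
    qed
    hence "w k + k \<le> w 0" for k
    proof (induction k)
      case (Suc k)
      have "w (Suc k) < w k" "w k + k \<le> w 0" using Suc by blast+
      thus ?case by linarith
    qed simp
    from this[of "Suc (w 0)"] show False by simp
  qed
  then obtain k where k: "I (Suc k) = I k" "K (Suc k) = K k" by blast
  have "I k <+>\<^bsub>M\<^esub> K k = carrier M"
  proof
    show "I k <+>\<^bsub>M\<^esub> K k \<subseteq> carrier M" by (rule submodule_subset[OF submodule_set_add[OF M I K]])
    show "carrier M \<subseteq> I k <+>\<^bsub>M\<^esub> K k"
    proof
      fix x assume x: "x \<in> carrier M"
      have "g k x \<in> I (Suc k)" using k(1) x by (auto simp: I_def)
      then obtain y where y: "y \<in> carrier M" "g k x = g k (g k y)" by (auto simp: I_def gS)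
      have gy: "g k y \<in> carrier M" by (rule mod_hom_closed[OF g y(1)])
      have "g k (x \<ominus>\<^bsub>M\<^esub> g k y) = \<zero>\<^bsub>M\<^esub>"
        using mod_hom_diff[OF M M g x gy] y gy mod_hom_closed[OF g] by (simp add: M.M.minus_eq_zero_iff)
      hence "x \<ominus>\<^bsub>M\<^esub> g k y \<in> K k" using x gy by (simp add: K_def)
      moreover have "g k y \<in> I k" using y by (simp add: I_def)
      ultimately have "g k y \<oplus>\<^bsub>M\<^esub> (x \<ominus>\<^bsub>M\<^esub> g k y) \<in> I k <+>\<^bsub>M\<^esub> K k" by (intro set_addI)
      thus "x \<in> I k <+>\<^bsub>M\<^esub> K k" using x gy by (simp add: M.M.add_minus_cancel)
    qed
  qed
  moreover have "I k \<inter> K k = {\<zero>\<^bsub>M\<^esub>}"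
  proof (intro equalityI subsetI)
    fix x assume "x \<in> I k \<inter> K k"
    then obtain y where y: "y \<in> carrier M" "x = g k y" "g k x = \<zero>\<^bsub>M\<^esub>" by (auto simp: I_def K_def)
    hence "y \<in> K (Suc k)" by (simp add: K_def gS)
    hence "y \<in> K k" using k(2) by simp
    thus "x \<in> {\<zero>\<^bsub>M\<^esub>}" using y(2) by (simp add: K_def)
  qed (use submodule_zero[OF I] submodule_zero[OF K] in auto)
  ultimately have "internal_dsum B M (I k) (K k)" using I K by (simp add: internal_dsum_def)
  then consider "I k = {\<zero>\<^bsub>M\<^esub>}" | "K k = {\<zero>\<^bsub>M\<^esub>}" using indecomposable_cases[OF ind] by blast
  thus ?thesis
  proof cases
    case 1
    hence "\<forall>x\<in>carrier M. (f ^^ (2 ^ k)) x = \<zero>\<^bsub>M\<^esub>" by (auto simp: I_def g_def)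
    thus ?thesis by blast
  next
    case 2
    \<comment> \<open>The exponent is positive, so f can be split off from \<open>g k\<close> on
      either side: injectivity and surjectivity of \<open>g k\<close> pass to f.\<close>
    obtain m where m: "(2::nat) ^ k = Suc m" by (metis Suc_pred zero_less_numeral zero_less_power)
    have gf: "g k x = (f ^^ m) (f x)" "g k x = f ((f ^^ m) x)" for x
      by (simp_all add: g_def m funpow_swap1)
    have "inj_on f (carrier M)"
      unfolding mod_hom_inj_iff[OF M M f]
    proof (intro ballI impI)
      fix x assume "x \<in> carrier M" "f x = \<zero>\<^bsub>M\<^esub>"
      hence "x \<in> K k" using gf(1) mod_hom_zero[OF M M mod_hom_funpow[OF f]] by (simp add: K_def)
      thus "x = \<zero>\<^bsub>M\<^esub>" using 2 by simp
    qed
    moreover have "I k = carrier M"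
    proof
      show "carrier M \<subseteq> I k"
        using \<open>I k <+>\<^bsub>M\<^esub> K k = carrier M\<close> set_add_least[OF I[of k] subset_refl, of "K k"] 2 submodule_zero[OF I[of k]] by simp
    qed (rule submodule_subset[OF I])
    hence "carrier M \<subseteq> f ` carrier M"
      using gf(2) mod_hom_closed[OF mod_hom_funpow[OF f]] unfolding I_def by (metis (no_types, lifting) image_iff subsetI)
    ultimately show ?thesis using mod_hom_closed[OF f] by (auto simp: bij_betw_def)
  qed
qed

lemma retract_of_bij:
  assumes X: "left_module B X" and u: "u \<in> mod_hom B X Y" "u' \<in> mod_hom B Y X"
    and bij: "bij_betw (\<lambda>x. u' (u x)) (carrier X) (carrier X)"
  shows "retract B X Y"
  by (rule retractI[OF u(1) mod_hom_comp[OF u(2) mod_hom_inverse[OF X mod_hom_comp[OF u] bij]]])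
    (use bij in \<open>simp add: bij_betw_def the_inv_into_f_f[where f = "\<lambda>x. u' (u x)"]\<close>)

text \<open>Locality of the endomorphism ring: f = u' u and h = v' v add up to the identity. If f is
  nilpotent, an element killed by h is fixed by f and therefore zero; so h is injective, cannot be
  nilpotent on a nonzero module, and is bijective by Fitting's lemma.\<close>

lemma indecomposable_retract_sum:
  fixes X :: "('b, 'm) module"
  assumes X: "left_module B X" and "fin_len B X" and ind: "indecomposable B X"
    and u: "u \<in> mod_hom B X Y" "u' \<in> mod_hom B Y X" and v: "v \<in> mod_hom B X Z" "v' \<in> mod_hom B Z X"
    and sum: "\<And>x. x \<in> carrier X \<Longrightarrow> u' (u x) \<oplus>\<^bsub>X\<^esub> v' (v x) = x"
  shows "retract B X Y \<or> retract B X Z"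
proof -
  interpret X: left_module B X by fact
  define f where "f = (\<lambda>x. u' (u x))"
  define h where "h = (\<lambda>x. v' (v x))"
  have f: "f \<in> mod_hom B X X" and h: "h \<in> mod_hom B X X"
    unfolding f_def h_def by (rule mod_hom_comp[OF u] mod_hom_comp[OF v])+
  show ?thesis
  proof (cases "bij_betw f (carrier X) (carrier X)")
    case True thus ?thesis using retract_of_bij[OF X u] by (simp add: f_def)
  next
    case False
    then obtain n where n: "\<forall>x\<in>carrier X. (f ^^ n) x = \<zero>\<^bsub>X\<^esub>" using fitting[OF X assms(2) ind f] by blast
    have inj: "x = \<zero>\<^bsub>X\<^esub>" if x: "x \<in> carrier X" "h x = \<zero>\<^bsub>X\<^esub>" for x
    proof -
      have "f x = x" using sum[OF x(1)] x mod_hom_closed[OF f x(1)] by (simp add: f_def h_def)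
      hence "(f ^^ m) x = x" for m by (induction m) auto
      thus ?thesis using n x(1) by metis
    qed
    have "bij_betw h (carrier X) (carrier X)"
    proof (rule ccontr)
      assume "\<not> ?thesis"
      then obtain m where m: "\<forall>x\<in>carrier X. (h ^^ m) x = \<zero>\<^bsub>X\<^esub>" using fitting[OF X assms(2) ind h] by blast
      have "x = \<zero>\<^bsub>X\<^esub>" if "x \<in> carrier X" "(h ^^ m) x = \<zero>\<^bsub>X\<^esub>" for x
        using that
      proof (induction m)
        case (Suc m)
        thus ?case using inj[of "(h ^^ m) x"] mod_hom_closed[OF mod_hom_funpow[OF h]] by auto
      qed simp
      hence "carrier X = {\<zero>\<^bsub>X\<^esub>}" using m X.M.zero_closed by blast
      thus False using ind by (simp add: indecomposable_def)
    qed
    thus ?thesis using retract_of_bij[OF X v] by (simp add: h_def)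
  qed
qed

lemma not_indecomposable_retract_zero:
  assumes "left_module B Y" "left_module B X" "indecomposable B X" "retract B X Y"
  shows "carrier Y \<noteq> {\<zero>\<^bsub>Y\<^esub>}"
proof
  assume Y: "carrier Y = {\<zero>\<^bsub>Y\<^esub>}"
  obtain i p where ip: "i \<in> mod_hom B X Y" "p \<in> mod_hom B Y X" "\<forall>x\<in>carrier X. p (i x) = x"
    using assms(4) by (auto simp: retract_def)
  have "x = \<zero>\<^bsub>X\<^esub>" if "x \<in> carrier X" for x
    using ip(3) that mod_hom_closed[OF ip(1) that] mod_hom_zero[OF assms(1,2) ip(2)] Y by force
  moreover have "\<zero>\<^bsub>X\<^esub> \<in> carrier X"
    using submodule_zero[OF submodule_carrier[OF assms(2)]] .
  ultimately have "carrier X = {\<zero>\<^bsub>X\<^esub>}" by blast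
  thus False using assms(3) by (simp add: indecomposable_def)
qed

text \<open>The retraction splits Y into the image of i and the kernel of p. The image is nonzero,
  so indecomposability of Y removes the kernel.\<close>

lemma indecomposable_retract_iso:
  fixes X :: "('b, 'k) module" and Y :: "('b, 'm) module"
  assumes X: "left_module B X" and Y: "left_module B Y" and "indecomposable B X" and ind: "indecomposable B Y"
    and "retract B X Y"
  shows "mod_iso B X Y"
proof -
  obtain i p where ip: "i \<in> mod_hom B X Y" "p \<in> mod_hom B Y X" "\<And>x. x \<in> carrier X \<Longrightarrow> p (i x) = x"
    using assms(5) by (auto simp: retract_def)
  have ds: "internal_dsum B Y (i ` carrier X) {y \<in> carrier Y. p y = \<zero>\<^bsub>X\<^esub>}"
    by (rule internal_dsum_of_retraction[OF X Y ip(1,2)]) (rule ip(3))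
  interpret Y: left_module B Y by fact
  have 0: "\<zero>\<^bsub>X\<^esub> \<in> carrier X" using submodule_zero[OF submodule_carrier[OF X]] .
  have inj: "inj_on i (carrier X)" using inj_on_inverseI[of "carrier X" p i] ip(3) by blast
  have "i ` carrier X \<noteq> {\<zero>\<^bsub>Y\<^esub>}"
  proof
    assume "i ` carrier X = {\<zero>\<^bsub>Y\<^esub>}"
    hence "i x = \<zero>\<^bsub>Y\<^esub>" if "x \<in> carrier X" for x using that by blast
    hence "x = \<zero>\<^bsub>X\<^esub>" if "x \<in> carrier X" for x using inj_onD[OF inj _ that 0] that 0 by simp
    hence "carrier X = {\<zero>\<^bsub>X\<^esub>}" using 0 by blast
    thus False using assms(3) by (simp add: indecomposable_def)
  qed
  hence K: "{y \<in> carrier Y. p y = \<zero>\<^bsub>X\<^esub>} = {\<zero>\<^bsub>Y\<^esub>}" using indecomposable_cases[OF ind ds] by blast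
  have "i ` carrier X = carrier Y"
  proof
    have sub: "submodule (i ` carrier X) B Y" and e: "i ` carrier X <+>\<^bsub>Y\<^esub> {\<zero>\<^bsub>Y\<^esub>} = carrier Y"
      using ds unfolding internal_dsum_def K by blast+
    show "i ` carrier X \<subseteq> carrier Y" by (rule submodule_subset[OF sub])
    show "carrier Y \<subseteq> i ` carrier X" using set_add_least[OF sub subset_refl, of "{\<zero>\<^bsub>Y\<^esub>}"] e submodule_zero[OF sub] by simp
  qed
  thus ?thesis unfolding mod_iso_def using ip(1) inj by (auto simp: bij_betw_def)
qed

lemma internal_dsum_split:
  fixes Y :: "('b, 'k) module"
  assumes Y: "left_module B Y" and W: "submodule W B Y" and ds: "internal_dsum B (Y\<lparr>carrier := W\<rparr>) U V"
  obtains a b where "a \<in> mod_hom B (Y\<lparr>carrier := W\<rparr>) (Y\<lparr>carrier := U\<rparr>)"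
    "b \<in> mod_hom B (Y\<lparr>carrier := W\<rparr>) (Y\<lparr>carrier := V\<rparr>)"
    "(\<lambda>x. x) \<in> mod_hom B (Y\<lparr>carrier := U\<rparr>) (Y\<lparr>carrier := W\<rparr>)"
    "(\<lambda>x. x) \<in> mod_hom B (Y\<lparr>carrier := V\<rparr>) (Y\<lparr>carrier := W\<rparr>)"
    "\<And>x. x \<in> W \<Longrightarrow> a x \<oplus>\<^bsub>Y\<^esub> b x = x"
proof -
  have U: "submodule U B Y" and V: "submodule V B Y" and UV: "U <+>\<^bsub>Y\<^esub> V = W"
    using ds internal_dsum_submodule_iff[OF Y W] by auto
  have sub: "U \<subseteq> W" "V \<subseteq> W" using submodule_set_add_upper[OF Y U V] UV by auto
  show ?thesis
  proof (rule internal_dsum_proj[OF submodule_left_module[OF Y W] ds], rule that)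
    show "(\<lambda>x. x) \<in> mod_hom B (Y\<lparr>carrier := U\<rparr>) (Y\<lparr>carrier := W\<rparr>)"
      "(\<lambda>x. x) \<in> mod_hom B (Y\<lparr>carrier := V\<rparr>) (Y\<lparr>carrier := W\<rparr>)"
      using sub by (auto simp: mod_hom_def)
  qed (auto simp: mod_hom_def)
qed

lemma indecomposable_retract_dsum:
  fixes X :: "('b, 'k) module" and M :: "('b, 'm) module"
  assumes X: "left_module B X" "fin_len B X" "indecomposable B X"
    and M: "left_module B M" and W: "submodule W B M" and ds: "internal_dsum B (M\<lparr>carrier := W\<rparr>) U V"
    and ret: "retract B X (M\<lparr>carrier := W\<rparr>)"
  shows "retract B X (M\<lparr>carrier := U\<rparr>) \<or> retract B X (M\<lparr>carrier := V\<rparr>)"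
proof (rule internal_dsum_split[OF M W ds])
  let ?W = "M\<lparr>carrier := W\<rparr>"
  obtain i p where ip: "i \<in> mod_hom B X ?W" "p \<in> mod_hom B ?W X" "\<And>x. x \<in> carrier X \<Longrightarrow> p (i x) = x"
    using ret by (auto simp: retract_def)
  fix a b assume a: "a \<in> mod_hom B ?W (M\<lparr>carrier := U\<rparr>)" and b: "b \<in> mod_hom B ?W (M\<lparr>carrier := V\<rparr>)"
    and iU: "(\<lambda>x. x) \<in> mod_hom B (M\<lparr>carrier := U\<rparr>) ?W" and iV: "(\<lambda>x. x) \<in> mod_hom B (M\<lparr>carrier := V\<rparr>) ?W"
    and ab: "\<And>x. x \<in> W \<Longrightarrow> a x \<oplus>\<^bsub>M\<^esub> b x = x"
  show ?thesis
  proof (rule indecomposable_retract_sum[OF X mod_hom_comp[OF ip(1) a] mod_hom_comp[OF iU ip(2)]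
        mod_hom_comp[OF ip(1) b] mod_hom_comp[OF iV ip(2)]])
    fix x assume x: "x \<in> carrier X"
    have ix: "i x \<in> carrier ?W" by (rule mod_hom_closed[OF ip(1) x])
    have "p (a (i x)) \<oplus>\<^bsub>X\<^esub> p (b (i x)) = p (a (i x) \<oplus>\<^bsub>?W\<^esub> b (i x))"
      by (rule mod_hom_add[OF ip(2), symmetric])
        (rule mod_hom_closed[OF mod_hom_comp[OF a iU] ix] mod_hom_closed[OF mod_hom_comp[OF b iV] ix])+
    thus "p (a (i x)) \<oplus>\<^bsub>X\<^esub> p (b (i x)) = x" using ab[of "i x"] ix ip(3)[OF x] by simp
  qed
qed

text \<open>The set \<D> collects the indecomposable pieces of one decomposition of M. By locality,
  an indecomposable retract of a sum is a retract of one of the two terms; so it descends to a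
  piece, to which it is isomorphic. The carrier type of X is unrelated to that of M.\<close>

lemma indecomposable_retracts_finite:
  fixes M :: "('b, 'm) module"
  assumes M: "left_module B M" "fin_len B M"
  shows "\<exists>\<D>. finite \<D> \<and> (\<forall>X :: ('b, 'k) module. left_module B X \<and> fin_len B X \<and> indecomposable B X \<and>
    retract B X M \<longrightarrow> (\<exists>U\<in>\<D>. mod_iso B X (M\<lparr>carrier := U\<rparr>)))"
proof -
  let ?Q = "\<lambda>X :: ('b, 'k) module. left_module B X \<and> fin_len B X \<and> indecomposable B X"
  let ?P = "\<lambda>W. \<exists>\<D>. finite \<D> \<and> (\<forall>X. ?Q X \<and> retract B X (M\<lparr>carrier := W\<rparr>) \<longrightarrow> (\<exists>U\<in>\<D>. mod_iso B X (M\<lparr>carrier := U\<rparr>)))"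
  have "?P (carrier M)"
    using M submodule_carrier[OF M(1)]
  proof (induction rule: decompose_induct)
    case zero
    have "\<not> retract B X (M\<lparr>carrier := {\<zero>\<^bsub>M\<^esub>}\<rparr>)" if "?Q X" for X
      using not_indecomposable_retract_zero[OF submodule_left_module[OF M(1) submodule_zero_set[OF M(1)]], of X] that by auto
    thus ?case by blast
  next
    case (indecomposable W)
    thus ?case
      using indecomposable_retract_iso[OF _ submodule_left_module[OF M(1)]] by (intro exI[of _ "{W}"]) blast
  next
    case (sum U V W)
    then obtain \<D> \<E> where "finite \<D>" "finite \<E>"
      and D: "\<And>X. ?Q X \<and> retract B X (M\<lparr>carrier := U\<rparr>) \<Longrightarrow> \<exists>U\<in>\<D>. mod_iso B X (M\<lparr>carrier := U\<rparr>)"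
      and E: "\<And>X. ?Q X \<and> retract B X (M\<lparr>carrier := V\<rparr>) \<Longrightarrow> \<exists>U\<in>\<E>. mod_iso B X (M\<lparr>carrier := U\<rparr>)" by blast
    have "\<exists>U\<in>\<D> \<union> \<E>. mod_iso B X (M\<lparr>carrier := U\<rparr>)" if "?Q X \<and> retract B X (M\<lparr>carrier := W\<rparr>)" for X
      using indecomposable_retract_dsum[OF _ _ _ M(1) sum.hyps(3,4), of X] that D[of X] E[of X] by blast
    thus ?case using \<open>finite \<D>\<close> \<open>finite \<E>\<close> by (intro exI[of _ "\<D> \<union> \<E>"]) blast
  qed
  thus ?thesis by simp
qed

lemma copies_Suc_split:
  fixes M :: "('b, 'm) module"
  assumes M: "left_module B M"
  obtains a a' b b' where "a \<in> mod_hom B (copies M (Suc k)) (copies M k)" "a' \<in> mod_hom B (copies M k) (copies M (Suc k))"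
    "b \<in> mod_hom B (copies M (Suc k)) M" "b' \<in> mod_hom B M (copies M (Suc k))"
    "\<forall>v\<in>carrier (copies M (Suc k)). a' (a v) \<oplus>\<^bsub>copies M (Suc k)\<^esub> b' (b v) = v"
proof
  interpret M: left_module B M by fact
  let ?C = "copies M (Suc k)" and ?D = "copies M k"
  note lC = copies_left_module[OF M, of "Suc k"] and lD = copies_left_module[OF M, of k]
  let ?a = "\<lambda>v. \<lambda>j\<in>{..<k}. v j" and ?a' = "\<lambda>v. \<lambda>j\<in>{..<Suc k}. if j = k then \<zero>\<^bsub>M\<^esub> else v j"
  show "?a \<in> mod_hom B ?C ?D" by (rule mod_hom_dsumI[OF lC]) (rule dsum_proj, simp)
  show "?a' \<in> mod_hom B ?D ?C"
  proof (rule mod_hom_dsumI[OF lD])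
    fix j assume j: "j \<in> {..<Suc k}"
    show "(\<lambda>v. if j = k then \<zero>\<^bsub>M\<^esub> else v j) \<in> mod_hom B ?D M"
    proof (cases "j = k")
      case True thus ?thesis using mod_hom_const_zero[OF M] by simp
    next
      case False
      thus ?thesis using j dsum_proj[of j "{..<k}" B "\<lambda>_. M"] by simp
    qed
  qed
  show "(\<lambda>v. v k) \<in> mod_hom B ?C M" by (rule dsum_proj) simp
  show "dinj {..<Suc k} (\<lambda>_. M) k \<in> mod_hom B M ?C" by (rule dinj_hom[OF M]) simp
  show "\<forall>v\<in>carrier ?C. ?a' (?a v) \<oplus>\<^bsub>?C\<^esub> dinj {..<Suc k} (\<lambda>_. M) k (v k) = v"
  proof
    fix v assume v: "v \<in> carrier ?C"
    show "?a' (?a v) \<oplus>\<^bsub>?C\<^esub> dinj {..<Suc k} (\<lambda>_. M) k (v k) = v"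
      using v by (intro extensionalityI[of _ "{..<Suc k}"]) (auto simp: dinj_def PiE_iff)
  qed
qed

text \<open>Reduces membership in add(M) to being a retract of M itself: one copy is split off at a
  time, and locality pushes X into that copy or into the remaining power. The zeroth power is
  excluded because X is nonzero.\<close>

lemma indecomposable_retract_copies:
  fixes X :: "('b, 'k) module" and M :: "('b, 'm) module"
  assumes X: "left_module B X" "fin_len B X" "indecomposable B X" and M: "left_module B M"
    and "retract B X (copies M k)"
  shows "retract B X M"
  using assms(5)
proof (induction k)
  case 0
  thus ?case using not_indecomposable_retract_zero[OF copies_left_module[OF M] X(1,3)] by force
next
  case (Suc k)
  let ?C = "copies M (Suc k)"
  obtain i p where ip: "i \<in> mod_hom B X ?C" "p \<in> mod_hom B ?C X" "\<And>x. x \<in> carrier X \<Longrightarrow> p (i x) = x"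
    using Suc.prems by (auto simp: retract_def)
  obtain a a' b b' where a: "a \<in> mod_hom B ?C (copies M k)" "a' \<in> mod_hom B (copies M k) ?C"
    and b: "b \<in> mod_hom B ?C M" "b' \<in> mod_hom B M ?C" and eq: "\<forall>v\<in>carrier ?C. a' (a v) \<oplus>\<^bsub>?C\<^esub> b' (b v) = v"
    by (rule copies_Suc_split[OF M])
  have "retract B X (copies M k) \<or> retract B X M"
  proof (rule indecomposable_retract_sum[OF X mod_hom_comp[OF ip(1) a(1)] mod_hom_comp[OF a(2) ip(2)]
        mod_hom_comp[OF ip(1) b(1)] mod_hom_comp[OF b(2) ip(2)]])
    fix x assume x: "x \<in> carrier X"
    have ix: "i x \<in> carrier ?C" by (rule mod_hom_closed[OF ip(1) x])
    have "p (a' (a (i x)) \<oplus>\<^bsub>?C\<^esub> b' (b (i x))) = p (a' (a (i x))) \<oplus>\<^bsub>X\<^esub> p (b' (b (i x)))"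
      by (rule mod_hom_add[OF ip(2) mod_hom_closed[OF mod_hom_comp[OF a] ix] mod_hom_closed[OF mod_hom_comp[OF b] ix]])
    thus "p (a' (a (i x))) \<oplus>\<^bsub>X\<^esub> p (b' (b (i x))) = x"
      unfolding bspec[OF eq ix] ip(3)[OF x] by (rule sym)
  qed
  thus ?case using Suc.IH by blast
qed

text \<open>Coordinates below k receive u, the others v with the index shifted by k. The hypothesis,
  an identity written as a sum of two composites, fits homotopy formulas as well as internal
  decompositions.\<close>

lemma retract_copies_add:
  fixes M :: "('b, 'm) module"
  assumes X: "left_module B X" and M: "left_module B M"
    and u: "u \<in> mod_hom B X (copies M k)" "u' \<in> mod_hom B (copies M k) X"
    and v: "v \<in> mod_hom B X (copies M l)" "v' \<in> mod_hom B (copies M l) X"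
    and sum: "\<And>x. x \<in> carrier X \<Longrightarrow> u' (u x) \<oplus>\<^bsub>X\<^esub> v' (v x) = x"
  shows "retract B X (copies M (k + l))"
proof -
  let ?C = "copies M (k + l)"
  note lC = copies_left_module[OF M, of "k + l"]
  let ?i = "\<lambda>x. \<lambda>s\<in>{..<k + l}. if s < k then u x s else v x (s - k)"
  let ?r = "\<lambda>v. \<lambda>s\<in>{..<k}. v s" and ?r' = "\<lambda>v. \<lambda>s\<in>{..<l}. v (s + k)"
  have r: "?r \<in> mod_hom B ?C (copies M k)" by (rule mod_hom_dsumI[OF lC]) (rule dsum_proj, simp)
  have r': "?r' \<in> mod_hom B ?C (copies M l)" by (rule mod_hom_dsumI[OF lC]) (rule dsum_proj, simp)
  show ?thesis
  proof (rule retractI)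
    show "?i \<in> mod_hom B X ?C"
    proof (rule mod_hom_dsumI[OF X])
      fix s assume s: "s \<in> {..<k + l}"
      show "(\<lambda>x. if s < k then u x s else v x (s - k)) \<in> mod_hom B X M"
      proof (cases "s < k")
        case True
        have "(\<lambda>x. u x s) \<in> mod_hom B X M" by (rule mod_hom_comp[OF u(1) dsum_proj]) (simp add: True)
        thus ?thesis using True by simp
      next
        case False
        have "(\<lambda>x. v x (s - k)) \<in> mod_hom B X M"
          by (rule mod_hom_comp[OF v(1) dsum_proj]) (use s False in simp)
        thus ?thesis using False by simp
      qed
    qed
    show "(\<lambda>w. u' (?r w) \<oplus>\<^bsub>X\<^esub> v' (?r' w)) \<in> mod_hom B ?C X"
      by (rule mod_hom_sum[OF X mod_hom_comp[OF r u(2)] mod_hom_comp[OF r' v(2)]])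
    fix x assume x: "x \<in> carrier X"
    have "?r (?i x) = u x"
      using mod_hom_closed[OF u(1) x] by (intro extensionalityI[of _ "{..<k}"]) (auto simp: PiE_iff)
    moreover have "?r' (?i x) = v x"
      using mod_hom_closed[OF v(1) x] by (intro extensionalityI[of _ "{..<l}"]) (auto simp: PiE_iff)
    ultimately show "u' (?r (?i x)) \<oplus>\<^bsub>X\<^esub> v' (?r' (?i x)) = x" using sum[OF x] by simp
  qed
qed

lemma retract_copies_sum:
  fixes Y :: "('b, 'k) module" and M :: "('b, 'm) module"
  assumes Y: "left_module B Y" and M: "left_module B M" and W: "submodule W B Y"
    and ds: "internal_dsum B (Y\<lparr>carrier := W\<rparr>) U V"
    and U: "retract B (Y\<lparr>carrier := U\<rparr>) (copies M k)" and V: "retract B (Y\<lparr>carrier := V\<rparr>) (copies M l)"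
  shows "retract B (Y\<lparr>carrier := W\<rparr>) (copies M (k + l))"
proof (rule internal_dsum_split[OF Y W ds])
  let ?W = "Y\<lparr>carrier := W\<rparr>" and ?U = "Y\<lparr>carrier := U\<rparr>" and ?V = "Y\<lparr>carrier := V\<rparr>"
  obtain i p where ip: "i \<in> mod_hom B ?U (copies M k)" "p \<in> mod_hom B (copies M k) ?U" "\<And>x. x \<in> carrier ?U \<Longrightarrow> p (i x) = x"
    using U by (auto simp: retract_def)
  obtain j q where jq: "j \<in> mod_hom B ?V (copies M l)" "q \<in> mod_hom B (copies M l) ?V" "\<And>x. x \<in> carrier ?V \<Longrightarrow> q (j x) = x"
    using V by (auto simp: retract_def)
  fix a b assume a: "a \<in> mod_hom B ?W ?U" and b: "b \<in> mod_hom B ?W ?V"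
    and iU: "(\<lambda>x. x) \<in> mod_hom B ?U ?W" and iV: "(\<lambda>x. x) \<in> mod_hom B ?V ?W"
    and ab: "\<And>x. x \<in> W \<Longrightarrow> a x \<oplus>\<^bsub>Y\<^esub> b x = x"
  show ?thesis
  proof (rule retract_copies_add[OF submodule_left_module[OF Y W] M mod_hom_comp[OF a ip(1)] mod_hom_comp[OF ip(2) iU]
        mod_hom_comp[OF b jq(1)] mod_hom_comp[OF jq(2) iV]])
    fix x assume x: "x \<in> carrier ?W"
    show "p (i (a x)) \<oplus>\<^bsub>?W\<^esub> q (j (b x)) = x"
      using ip(3)[OF mod_hom_closed[OF a x]] jq(3)[OF mod_hom_closed[OF b x]] ab x by simp
  qed
qed

subsection \<open>Finitely generated projectives and resolutions\<close>

text \<open>Projectivity without test modules: \<open>projective\<close> quantifies over modules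
  with one fixed carrier type, whereas retracts of free modules lift along maps between modules of
  any type. The two agree by \<open>projective_iff_fgproj\<close>.\<close>

definition fgproj :: "('b, 'c) ring_scheme \<Rightarrow> ('b, 'm, 'd) module_scheme \<Rightarrow> bool"
  where "fgproj B P \<longleftrightarrow> (\<exists>k. retract B P (free B k))"

lemma fgproj_retract: "\<lbrakk>retract B P Q; fgproj B Q\<rbrakk> \<Longrightarrow> fgproj B P"
  unfolding fgproj_def by (elim exE) (rule exI, rule retract_trans)

lemma free_fgproj: "fgproj B (free B k)"
  unfolding fgproj_def by (rule exI, rule retract_refl)

lemma fgproj_sum:
  assumes H: "left_module B H" and "fgproj B P" "fgproj B Q"
    and u: "u \<in> mod_hom B H P" "u' \<in> mod_hom B P H" and v: "v \<in> mod_hom B H Q" "v' \<in> mod_hom B Q H"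
    and sum: "\<And>x. x \<in> carrier H \<Longrightarrow> u' (u x) \<oplus>\<^bsub>H\<^esub> v' (v x) = x"
  shows "fgproj B H"
proof -
  obtain k i p where ip: "i \<in> mod_hom B P (free B k)" "p \<in> mod_hom B (free B k) P" "\<And>x. x \<in> carrier P \<Longrightarrow> p (i x) = x"
    using assms(2) by (auto simp: fgproj_def retract_def)
  obtain l j q where jq: "j \<in> mod_hom B Q (free B l)" "q \<in> mod_hom B (free B l) Q" "\<And>x. x \<in> carrier Q \<Longrightarrow> q (j x) = x"
    using assms(3) by (auto simp: fgproj_def retract_def)
  have "retract B H (free B (k + l))"
  proof (rule retract_copies_add[OF H reg_left_module[OF left_module_ring[OF H]]
        mod_hom_comp[OF u(1) ip(1)] mod_hom_comp[OF ip(2) u(2)] mod_hom_comp[OF v(1) jq(1)] mod_hom_comp[OF jq(2) v(2)]])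
    fix x assume x: "x \<in> carrier H"
    show "u' (p (i (u x))) \<oplus>\<^bsub>H\<^esub> v' (q (j (v x))) = x"
      using sum[OF x] ip(3)[OF mod_hom_closed[OF u(1) x]] jq(3)[OF mod_hom_closed[OF v(1) x]] by simp
  qed
  thus ?thesis unfolding fgproj_def by (rule exI)
qed

lemma zero_fgproj:
  assumes "left_module B P" "carrier P = {\<zero>\<^bsub>P\<^esub>}" shows "fgproj B P"
  unfolding fgproj_def
proof (intro exI[of _ 0] retractI)
  show "(\<lambda>x. \<zero>\<^bsub>free B 0\<^esub>) \<in> mod_hom B P (free B 0)"
    by (rule mod_hom_const_zero[OF free_left_module[OF left_module_ring[OF assms(1)]]])
  show "(\<lambda>x. \<zero>\<^bsub>P\<^esub>) \<in> mod_hom B (free B 0) P" by (rule mod_hom_const_zero[OF assms(1)])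
qed (use assms(2) in simp)

lemma copies_fgproj:
  assumes "left_module B M" "fgproj B M" shows "fgproj B (copies M k)"
proof (induction k)
  case 0
  show ?case by (rule zero_fgproj[OF copies_left_module[OF assms(1)]]) auto
next
  case (Suc k)
  obtain a a' b b' where "a \<in> mod_hom B (copies M (Suc k)) (copies M k)" "a' \<in> mod_hom B (copies M k) (copies M (Suc k))"
    "b \<in> mod_hom B (copies M (Suc k)) M" "b' \<in> mod_hom B M (copies M (Suc k))"
    "\<forall>v\<in>carrier (copies M (Suc k)). a' (a v) \<oplus>\<^bsub>copies M (Suc k)\<^esub> b' (b v) = v"
    by (rule copies_Suc_split[OF assms(1)])
  thus ?case using fgproj_sum[OF copies_left_module[OF assms(1)] Suc.IH assms(2)] by blast
qed

lemma free_hom_eqI: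
  assumes "left_module B M" "f \<in> mod_hom B (free B k) M" "g \<in> mod_hom B (free B k) M"
    "\<And>i. i < k \<Longrightarrow> f (basis B k i) = g (basis B k i)" "c \<in> carrier (free B k)"
  shows "f c = g c"
proof -
  interpret M: left_module B M by fact
  have "c i \<in> carrier B" if "i < k" for i using assms(5) that by auto
  hence "comb M k (\<lambda>i. f (basis B k i)) c = comb M k (\<lambda>i. g (basis B k i)) c"
    unfolding comb_def using assms(4) mod_hom_closed[OF assms(3) basis_closed[OF M.R.ring_axioms]]
    by (intro M.M.finsum_cong') (auto intro!: M.smult_closed)
  thus ?thesis using mod_hom_free_eq_comb[OF assms(1) _ assms(5)] assms(2,3) by simp
qed

text \<open>Here \<psi> is any map whose image contains that of \<phi>. In this form the lemma lifts
  directly into the next term of an exact sequence, with no passage to a kernel as a module of its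
  own.\<close>

lemma fgproj_lift:
  assumes P: "left_module B P" "fgproj B P" and X: "left_module B X" and Y: "left_module B Y"
    and psi: "\<psi> \<in> mod_hom B X Y" and phi: "\<phi> \<in> mod_hom B P Y" and im: "\<And>x. x \<in> carrier P \<Longrightarrow> \<phi> x \<in> \<psi> ` carrier X"
  shows "\<exists>g\<in>mod_hom B P X. \<forall>x\<in>carrier P. \<psi> (g x) = \<phi> x"
proof -
  obtain k i p where ip: "i \<in> mod_hom B P (free B k)" "p \<in> mod_hom B (free B k) P" "\<And>x. x \<in> carrier P \<Longrightarrow> p (i x) = x"
    using assms(2) by (auto simp: fgproj_def retract_def)
  note B = left_module_ring[OF P(1)]
  have "\<exists>y\<in>carrier X. \<psi> y = \<phi> (p (basis B k j))" if "j < k" for j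
    using im[OF mod_hom_closed[OF ip(2) basis_closed[OF B that]]] by (auto simp: image_iff)
  then obtain y where y: "\<And>j. j < k \<Longrightarrow> y j \<in> carrier X" "\<And>j. j < k \<Longrightarrow> \<psi> (y j) = \<phi> (p (basis B k j))" by metis
  note c = comb_hom[OF X y(1)]
  have "\<psi> (comb X k y c') = \<phi> (p c')" if "c' \<in> carrier (free B k)" for c'
    by (rule free_hom_eqI[OF Y mod_hom_comp[OF c psi] mod_hom_comp[OF ip(2) phi] _ that])
      (simp_all add: comb_basis[OF X y(1)] y(2))
  thus ?thesis
    using ip(3) mod_hom_closed[OF ip(1)] by (intro bexI[of _ "\<lambda>x. comb X k y (i x)"] mod_hom_comp[OF ip(1) c]) simp
qed

text \<open>The counterpart of \<open>fgproj_lift\<close> at the left end of a resolution, where the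
  differential is injective: the lift is given by its inverse on the image, for an arbitrary source
  H.\<close>

lemma mono_lift:
  assumes H: "left_module B H" and X: "left_module B X" and Y: "left_module B Y"
    and psi: "\<psi> \<in> mod_hom B X Y" "inj_on \<psi> (carrier X)" and phi: "\<phi> \<in> mod_hom B H Y"
    and im: "\<And>x. x \<in> carrier H \<Longrightarrow> \<phi> x \<in> \<psi> ` carrier X"
  shows "\<exists>g\<in>mod_hom B H X. \<forall>x\<in>carrier H. \<psi> (g x) = \<phi> x"
proof -
  have S: "submodule (\<psi> ` carrier X) B Y" by (rule submodule_image[OF X Y psi(1) submodule_carrier[OF X]])
  have "\<psi> \<in> mod_hom B X (Y\<lparr>carrier := \<psi> ` carrier X\<rparr>)" using psi(1) by (subst mod_hom_submodule_iff[OF _ S]) auto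
  from mod_hom_inverse[OF X this] have inv: "the_inv_into (carrier X) \<psi> \<in> mod_hom B (Y\<lparr>carrier := \<psi> ` carrier X\<rparr>) X"
    using psi(2) by (simp add: bij_betw_def)
  have "\<phi> \<in> mod_hom B H (Y\<lparr>carrier := \<psi> ` carrier X\<rparr>)" using phi im by (subst mod_hom_submodule_iff[OF _ S]) auto
  from mod_hom_comp[OF this inv] show ?thesis
    using im psi(2) by (intro bexI[of _ "\<lambda>x. the_inv_into (carrier X) \<psi> (\<phi> x)"]) (simp_all add: f_the_inv_into_f)
qed

lemma fgproj_fin_gen: "\<lbrakk>left_module B P; fgproj B P\<rbrakk> \<Longrightarrow> fin_gen B P"
proof -
  assume P: "left_module B P" and "fgproj B P"
  then obtain k i p where ip: "i \<in> mod_hom B P (free B k)" "p \<in> mod_hom B (free B k) P" "\<And>x. x \<in> carrier P \<Longrightarrow> p (i x) = x"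
    by (auto simp: fgproj_def retract_def)
  have "p ` carrier (free B k) = carrier P"
  proof
    show "carrier P \<subseteq> p ` carrier (free B k)"
    proof
      fix x assume "x \<in> carrier P"
      thus "x \<in> p ` carrier (free B k)" using ip(3) mod_hom_closed[OF ip(1)] by (intro image_eqI[of _ _ "i x"]) simp_all
    qed
    show "p ` carrier (free B k) \<subseteq> carrier P" using mod_hom_closed[OF ip(2)] by blast
  qed
  thus ?thesis using fin_gen_image[OF free_left_module P ip(2)] free_fin_gen left_module_ring[OF P] by blast
qed

lemma projective_iff_fgproj:
  fixes P :: "('b, 'm) module"
  assumes P: "left_module B P"
  shows "projective B P \<longleftrightarrow> fgproj B P"
proof
  assume "fgproj B P"
  hence "fg_module B P" using fgproj_fin_gen[OF P] P by (simp add: fg_module_def)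
  moreover have "\<exists>g\<in>mod_hom B P X. \<forall>x\<in>carrier P. p (g x) = f x"
    if "fg_module B X" "fg_module B Y" "p \<in> mod_hom B X Y" "f \<in> mod_hom B P Y" "p ` carrier X = carrier Y"
    for X Y :: "'b fg_mod" and p f
    using that(1,2) by (intro fgproj_lift[OF P \<open>fgproj B P\<close> _ _ that(3,4)])
      (simp_all add: that(5) mod_hom_closed[OF that(4)] fg_module_def)
  ultimately show "projective B P" unfolding projective_def by blast
next
  assume proj: "projective B P"
  hence "fin_gen B P" by (simp add: projective_def fg_module_def)
  then obtain k x where x: "\<forall>i<k. x i \<in> carrier P" "comb P k x ` carrier (free B k) = carrier P"
    using fin_gen_iff_free[OF P] by blast
  let ?q = "comb P k x"
  note B = left_module_ring[OF P] note F = free_left_module[OF B, of k]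
  have q: "?q \<in> mod_hom B (free B k) P" using comb_hom[OF P] x(1) by blast
  \<comment> \<open>The lifting property speaks only about test modules of type
    \<open>'b fg_mod\<close>. So the free cover and P are replaced by isomorphic copies N and
    \<open>N'\<close> of that type, and the splitting is carried back along s and t.\<close>
  obtain N :: "'b fg_mod" where N: "fg_module B N" "mod_iso B (free B k) N"
    using fg_module_realised[of B "free B k"] F free_fin_gen[OF B] by (auto simp: fg_module_def)
  obtain N' :: "'b fg_mod" where N': "fg_module B N'" "mod_iso B P N'"
    using fg_module_realised[of B P] proj by (auto simp: projective_def)
  obtain s where s: "s \<in> mod_hom B (free B k) N" "bij_betw s (carrier (free B k)) (carrier N)"
    using N(2) unfolding mod_iso_def by blast
  obtain t where t: "t \<in> mod_hom B P N'" "bij_betw t (carrier P) (carrier N')"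
    using N'(2) unfolding mod_iso_def by blast
  let ?s = "the_inv_into (carrier (free B k)) s"
  note s' = mod_hom_inverse[OF F s]
  have ss: "bij_betw ?s (carrier N) (carrier (free B k))" by (rule bij_betw_the_inv_into[OF s(2)])
  have "(\<lambda>y. t (?q (?s y))) ` carrier N = t ` (?q ` (?s ` carrier N))" by (simp add: image_comp comp_def)
  also have "\<dots> = carrier N'"
    unfolding bij_betw_imp_surj_on[OF ss] x(2) bij_betw_imp_surj_on[OF t(2)] ..
  finally have "\<exists>g\<in>mod_hom B P N. \<forall>x\<in>carrier P. t (?q (?s (g x))) = t x"
    using proj N(1) N'(1) mod_hom_comp[OF mod_hom_comp[OF s' q] t(1)] t(1) unfolding projective_def by blast
  then obtain g where g: "g \<in> mod_hom B P N" "\<forall>x\<in>carrier P. t (?q (?s (g x))) = t x" by blast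
  have "retract B P (free B k)"
  proof (rule retractI[OF mod_hom_comp[OF g(1) s'] q])
    fix x assume x: "x \<in> carrier P"
    have "?q (?s (g x)) \<in> carrier P" by (rule mod_hom_closed[OF q mod_hom_closed[OF s' mod_hom_closed[OF g(1) x]]])
    thus "?q (?s (g x)) = x" by (intro inj_onD[OF bij_betw_imp_inj_on[OF t(2)] bspec[OF g(2) x] _ x])
  qed
  thus "fgproj B P" unfolding fgproj_def by (rule exI)
qed

text \<open>An exact sequence 0 -> P2 -> P1 -> P0 -> C -> 0. Projectivity is stated separately, so
  that the same predicate describes the sequence whose last term is the syzygy under
  investigation.\<close>

definition short_res where
  "short_res B C P0 P1 P2 d0 d1 d2 \<longleftrightarrow> left_module B C \<and> left_module B P0 \<and> left_module B P1 \<and> left_module B P2 \<and>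
    d0 \<in> mod_hom B P0 C \<and> d1 \<in> mod_hom B P1 P0 \<and> d2 \<in> mod_hom B P2 P1 \<and>
    d0 ` carrier P0 = carrier C \<and> {x \<in> carrier P0. d0 x = \<zero>\<^bsub>C\<^esub>} = d1 ` carrier P1 \<and>
    {x \<in> carrier P1. d1 x = \<zero>\<^bsub>P0\<^esub>} = d2 ` carrier P2 \<and> inj_on d2 (carrier P2)"

text \<open>Two resolutions of the same module are homotopy equivalent. In degree 2 the homotopy exhibits
  the second syzygy \<open>H\<close> as a retract of \<open>P2 \<oplus> Q1\<close>.\<close>

lemma second_syzygy_fgproj:
  assumes P: "short_res B C P0 P1 P2 d0 d1 d2" and Q: "short_res B C Q0 Q1 H e0 e1 e2"
    and proj: "fgproj B P0" "fgproj B P1" "fgproj B P2" "fgproj B Q0" "fgproj B Q1"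
  shows "fgproj B H"
proof -
  have C: "left_module B C" and P0: "left_module B P0" and P1: "left_module B P1" and P2: "left_module B P2"
    and d0: "d0 \<in> mod_hom B P0 C" and d1: "d1 \<in> mod_hom B P1 P0" and d2: "d2 \<in> mod_hom B P2 P1"
    and s0: "d0 ` carrier P0 = carrier C" and s1: "{x \<in> carrier P0. d0 x = \<zero>\<^bsub>C\<^esub>} = d1 ` carrier P1"
    and s2: "{x \<in> carrier P1. d1 x = \<zero>\<^bsub>P0\<^esub>} = d2 ` carrier P2" and i2: "inj_on d2 (carrier P2)"
    using P unfolding short_res_def by blast+
  have Q0: "left_module B Q0" and Q1: "left_module B Q1" and H: "left_module B H"
    and e0: "e0 \<in> mod_hom B Q0 C" and e1: "e1 \<in> mod_hom B Q1 Q0" and e2: "e2 \<in> mod_hom B H Q1"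
    and t0: "e0 ` carrier Q0 = carrier C" and t1: "{x \<in> carrier Q0. e0 x = \<zero>\<^bsub>C\<^esub>} = e1 ` carrier Q1"
    and t2: "{x \<in> carrier Q1. e1 x = \<zero>\<^bsub>Q0\<^esub>} = e2 ` carrier H" and j2: "inj_on e2 (carrier H)"
    using Q unfolding short_res_def by blast+
  interpret Q0: left_module B Q0 by fact
  interpret Q1: left_module B Q1 by fact
  interpret C: left_module B C by fact
  interpret H: left_module B H by fact
  have dd: "d0 (d1 x) = \<zero>\<^bsub>C\<^esub>" if "x \<in> carrier P1" for x using s1 that by blast
  have dd2: "d1 (d2 x) = \<zero>\<^bsub>P0\<^esub>" if "x \<in> carrier P2" for x using s2 that by blast
  have ee: "e0 (e1 x) = \<zero>\<^bsub>C\<^esub>" if "x \<in> carrier Q1" for x using t1 that by blast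
  have ee2: "e1 (e2 x) = \<zero>\<^bsub>Q0\<^esub>" if "x \<in> carrier H" for x using t2 that by blast
  note cl = mod_hom_closed[OF d0] mod_hom_closed[OF d1] mod_hom_closed[OF d2]
    mod_hom_closed[OF e0] mod_hom_closed[OF e1] mod_hom_closed[OF e2]
  \<comment> \<open>Chain maps f from P to Q and g from Q to P over the identity of C, built degree
    by degree.\<close>
  have "d0 x \<in> e0 ` carrier Q0" if "x \<in> carrier P0" for x using t0 cl(1)[OF that] by simp
  from fgproj_lift[OF P0 proj(1) Q0 C e0 d0 this]
  obtain f0 where f0: "f0 \<in> mod_hom B P0 Q0" "\<And>x. x \<in> carrier P0 \<Longrightarrow> e0 (f0 x) = d0 x" by blast
  have "f0 (d1 x) \<in> e1 ` carrier Q1" if "x \<in> carrier P1" for x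
    unfolding t1[symmetric] using f0(2) dd that mod_hom_closed[OF f0(1)] cl by simp
  from fgproj_lift[OF P1 proj(2) Q1 Q0 e1 mod_hom_comp[OF d1 f0(1)] this]
  obtain f1 where f1: "f1 \<in> mod_hom B P1 Q1" "\<And>x. x \<in> carrier P1 \<Longrightarrow> e1 (f1 x) = f0 (d1 x)" by blast
  have "f1 (d2 x) \<in> e2 ` carrier H" if "x \<in> carrier P2" for x
    unfolding t2[symmetric] using f1(2) dd2 that mod_hom_closed[OF f1(1)] cl mod_hom_zero[OF P0 Q0 f0(1)] by simp
  from mono_lift[OF P2 H Q1 e2 j2 mod_hom_comp[OF d2 f1(1)] this]
  obtain f2 where f2: "f2 \<in> mod_hom B P2 H" "\<And>x. x \<in> carrier P2 \<Longrightarrow> e2 (f2 x) = f1 (d2 x)" by blast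
  have "e0 x \<in> d0 ` carrier P0" if "x \<in> carrier Q0" for x using s0 cl(4)[OF that] by simp
  from fgproj_lift[OF Q0 proj(4) P0 C d0 e0 this]
  obtain g0 where g0: "g0 \<in> mod_hom B Q0 P0" "\<And>x. x \<in> carrier Q0 \<Longrightarrow> d0 (g0 x) = e0 x" by blast
  have "g0 (e1 x) \<in> d1 ` carrier P1" if "x \<in> carrier Q1" for x
    unfolding s1[symmetric] using g0(2) ee that mod_hom_closed[OF g0(1)] cl by simp
  from fgproj_lift[OF Q1 proj(5) P1 P0 d1 mod_hom_comp[OF e1 g0(1)] this]
  obtain g1 where g1: "g1 \<in> mod_hom B Q1 P1" "\<And>x. x \<in> carrier Q1 \<Longrightarrow> d1 (g1 x) = g0 (e1 x)" by blast
  have "g1 (e2 x) \<in> d2 ` carrier P2" if "x \<in> carrier H" for x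
    unfolding s2[symmetric] using g1(2) ee2 that mod_hom_closed[OF g1(1)] cl mod_hom_zero[OF Q0 P0 g0(1)] by simp
  from mono_lift[OF H P2 P1 d2 i2 mod_hom_comp[OF e2 g1(1)] this]
  obtain g2 where g2: "g2 \<in> mod_hom B H P2" "\<And>x. x \<in> carrier H \<Longrightarrow> d2 (g2 x) = g1 (e2 x)" by blast
  note cf = mod_hom_closed[OF f0(1)] mod_hom_closed[OF f1(1)] mod_hom_closed[OF f2(1)]
    mod_hom_closed[OF g0(1)] mod_hom_closed[OF g1(1)] mod_hom_closed[OF g2(1)]
  \<comment> \<open>The homotopy: \<open>e1 h0 = f0 g0 - 1\<close> and
    \<open>e2 h1 = f1 g1 - 1 - h0 e1\<close>. Precomposing the second identity with e2 kills its
    last term, and cancelling e2 on the left leaves \<open>f2 g2 - h1 e2 = 1\<close> on H, which is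
    what \<open>fgproj_sum\<close> asks for.\<close>
  have k0: "(\<lambda>x. f0 (g0 x) \<ominus>\<^bsub>Q0\<^esub> x) \<in> mod_hom B Q0 Q0"
    by (rule mod_hom_difference[OF Q0 mod_hom_comp[OF g0(1) f0(1)] mod_hom_id])
  have "f0 (g0 x) \<ominus>\<^bsub>Q0\<^esub> x \<in> e1 ` carrier Q1" if "x \<in> carrier Q0" for x
    unfolding t1[symmetric]
    using mod_hom_diff[OF Q0 C e0 _ that, of "f0 (g0 x)"] that cf cl f0(2) g0(2) by (simp add: C.M.minus_eq_zero_iff)
  from fgproj_lift[OF Q0 proj(4) Q1 Q0 e1 k0 this]
  obtain h0 where h0: "h0 \<in> mod_hom B Q0 Q1" "\<And>x. x \<in> carrier Q0 \<Longrightarrow> e1 (h0 x) = f0 (g0 x) \<ominus>\<^bsub>Q0\<^esub> x" by blast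
  note ch = mod_hom_closed[OF h0(1)]
  have k1: "(\<lambda>x. f1 (g1 x) \<ominus>\<^bsub>Q1\<^esub> x \<ominus>\<^bsub>Q1\<^esub> h0 (e1 x)) \<in> mod_hom B Q1 Q1"
    by (rule mod_hom_difference[OF Q1 mod_hom_difference[OF Q1 mod_hom_comp[OF g1(1) f1(1)] mod_hom_id] mod_hom_comp[OF e1 h0(1)]])
  have "f1 (g1 x) \<ominus>\<^bsub>Q1\<^esub> x \<ominus>\<^bsub>Q1\<^esub> h0 (e1 x) \<in> e2 ` carrier H" if x: "x \<in> carrier Q1" for x
  proof -
    have "e1 (f1 (g1 x) \<ominus>\<^bsub>Q1\<^esub> x) = e1 (h0 (e1 x))"
      using mod_hom_diff[OF Q1 Q0 e1 _ x, of "f1 (g1 x)"] x cf cl f1(2) g1(2) h0(2) by simp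
    hence "e1 (f1 (g1 x) \<ominus>\<^bsub>Q1\<^esub> x \<ominus>\<^bsub>Q1\<^esub> h0 (e1 x)) = \<zero>\<^bsub>Q0\<^esub>"
      using mod_hom_diff[OF Q1 Q0 e1, of "f1 (g1 x) \<ominus>\<^bsub>Q1\<^esub> x" "h0 (e1 x)"] x cf cl ch by (simp add: Q0.M.minus_eq_zero_iff)
    thus ?thesis unfolding t2[symmetric] using x cf cl ch by simp
  qed
  from fgproj_lift[OF Q1 proj(5) H Q1 e2 k1 this]
  obtain h1 where h1: "h1 \<in> mod_hom B Q1 H"
    "\<And>x. x \<in> carrier Q1 \<Longrightarrow> e2 (h1 x) = f1 (g1 x) \<ominus>\<^bsub>Q1\<^esub> x \<ominus>\<^bsub>Q1\<^esub> h0 (e1 x)" by blast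
  have nh: "(\<lambda>x. \<ominus>\<^bsub>H\<^esub> h1 x) \<in> mod_hom B Q1 H"
    using mod_hom_difference[OF H mod_hom_const_zero[OF H] h1(1)] mod_hom_closed[OF h1(1)]
    by (intro mod_hom_cong[OF Q1 mod_hom_difference[OF H mod_hom_const_zero[OF H] h1(1)]]) (simp add: a_minus_def)
  show ?thesis
  proof (rule fgproj_sum[OF H proj(3) proj(5) g2(1) f2(1) e2 nh])
    fix x assume x: "x \<in> carrier H"
    have m: "f2 (g2 x) \<in> carrier H" "h1 (e2 x) \<in> carrier H" "e2 x \<in> carrier Q1" "f1 (g1 (e2 x)) \<in> carrier Q1"
      using x cf cl mod_hom_closed[OF h1(1)] by auto
    have "e2 (h1 (e2 x)) = f1 (g1 (e2 x)) \<ominus>\<^bsub>Q1\<^esub> e2 x"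
      using h1(2)[OF m(3)] ee2[OF x] mod_hom_zero[OF Q0 Q1 h0(1)] m Q1.M.minus_equality[of "\<zero>\<^bsub>Q1\<^esub>" "\<zero>\<^bsub>Q1\<^esub>"]
      by (simp add: a_minus_def)
    moreover have "e2 (f2 (g2 x)) = f1 (g1 (e2 x))" using f2(2) g2(2) x cf by simp
    ultimately have "e2 (f2 (g2 x) \<ominus>\<^bsub>H\<^esub> h1 (e2 x)) = f1 (g1 (e2 x)) \<ominus>\<^bsub>Q1\<^esub> (f1 (g1 (e2 x)) \<ominus>\<^bsub>Q1\<^esub> e2 x)"
      using mod_hom_diff[OF H Q1 e2 m(1,2)] by simp
    also have "\<dots> = e2 x"
      using m by (simp add: a_minus_def Q1.M.minus_add Q1.M.r_neg1 Q1.M.r_neg2 Q1.M.r_neg Q1.M.a_assoc[symmetric])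
    finally have "f2 (g2 x) \<ominus>\<^bsub>H\<^esub> h1 (e2 x) = x" using m x by (intro inj_onD[OF j2]) simp_all
    thus "f2 (g2 x) \<oplus>\<^bsub>H\<^esub> \<ominus>\<^bsub>H\<^esub> h1 (e2 x) = x" by (simp add: a_minus_def)
  qed
qed

lemma bij_betw_Collect_inv:
  assumes "bij_betw t S S'"
  shows "{y \<in> S'. Q (the_inv_into S t y)} = t ` {x \<in> S. Q x}"
proof -
  have t: "inj_on t S" "t ` S = S'" using assms by (auto simp: bij_betw_def)
  show ?thesis
  proof (intro equalityI subsetI)
    fix y assume "y \<in> {y \<in> S'. Q (the_inv_into S t y)}"
    thus "y \<in> t ` {x \<in> S. Q x}"
      using t by (intro image_eqI[of _ _ "the_inv_into S t y"]) (auto simp: f_the_inv_into_f intro: the_inv_into_into[OF t(1)])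
  next
    fix y assume "y \<in> t ` {x \<in> S. Q x}"
    then obtain x where "x \<in> S" "Q x" "y = t x" by blast
    thus "y \<in> {y \<in> S'. Q (the_inv_into S t y)}" using t by (simp add: the_inv_into_f_f[OF t(1)] imageI flip: t(2))
  qed
qed

lemma fgproj_realised:
  assumes P: "left_module B P" "fgproj B P"
  shows "\<exists>(N :: 'b fg_mod) t. left_module B N \<and> fgproj B N \<and> t \<in> mod_hom B P N \<and> bij_betw t (carrier P) (carrier N)"
proof -
  obtain N :: "'b fg_mod" where N: "fg_module B N" "mod_iso B P N"
    using fg_module_realised[of B P] P fgproj_fin_gen[OF P] by (auto simp: fg_module_def)
  have "left_module B N" using N(1) by (simp add: fg_module_def)
  thus ?thesis
    using fgproj_retract[OF iso_imp_retract[OF _ mod_iso_sym[OF P(1) N(2)]] P(2)] N(2) unfolding mod_iso_def by blast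
qed

text \<open>A finite projective resolution may be moved to the carrier type used in \<^const>\<open>proj_dim\<close>.\<close>

lemma proj_dim_le_2:
  fixes C :: "'b fg_mod"
  assumes res: "short_res B C P0 P1 P2 d0 d1 d2" and proj: "fgproj B P0" "fgproj B P1" "fgproj B P2"
  shows "proj_dim B C \<le> 2"
proof -
  have C: "left_module B C" and P0: "left_module B P0" and P1: "left_module B P1" and P2: "left_module B P2"
    and d0: "d0 \<in> mod_hom B P0 C" and d1: "d1 \<in> mod_hom B P1 P0" and d2: "d2 \<in> mod_hom B P2 P1"
    and s0: "d0 ` carrier P0 = carrier C" and s1: "{x \<in> carrier P0. d0 x = \<zero>\<^bsub>C\<^esub>} = d1 ` carrier P1"
    and s2: "{x \<in> carrier P1. d1 x = \<zero>\<^bsub>P0\<^esub>} = d2 ` carrier P2" and i2: "inj_on d2 (carrier P2)"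
    using res unfolding short_res_def by blast+
  obtain N0 t0 N1 t1 N2 t2 where N: "left_module B (N0 :: 'b fg_mod)" "fgproj B N0" "left_module B (N1 :: 'b fg_mod)" "fgproj B N1"
      "left_module B (N2 :: 'b fg_mod)" "fgproj B N2"
    and t0: "t0 \<in> mod_hom B P0 N0" "bij_betw t0 (carrier P0) (carrier N0)"
    and t1: "t1 \<in> mod_hom B P1 N1" "bij_betw t1 (carrier P1) (carrier N1)"
    and t2: "t2 \<in> mod_hom B P2 N2" "bij_betw t2 (carrier P2) (carrier N2)"
    using fgproj_realised[OF P0 proj(1)] fgproj_realised[OF P1 proj(2)] fgproj_realised[OF P2 proj(3)] by metis
  note lN = N(1,3,5)
  let ?u0 = "the_inv_into (carrier P0) t0" and ?u1 = "the_inv_into (carrier P1) t1" and ?u2 = "the_inv_into (carrier P2) t2"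
  note u0 = mod_hom_inverse[OF P0 t0] and u1 = mod_hom_inverse[OF P1 t1] and u2 = mod_hom_inverse[OF P2 t2]
  have b: "?u0 ` carrier N0 = carrier P0" "?u1 ` carrier N1 = carrier P1" "?u2 ` carrier N2 = carrier P2"
    using bij_betw_the_inv_into[OF t0(2)] bij_betw_the_inv_into[OF t1(2)] bij_betw_the_inv_into[OF t2(2)]
    by (simp_all add: bij_betw_def)
  \<comment> \<open>A zero module for the degrees above 2, cut out of N2 so that it has the right
    carrier type.\<close>
  define Z where "Z = N2\<lparr>carrier := {\<zero>\<^bsub>N2\<^esub>}\<rparr>"
  have Z: "left_module B Z" "carrier Z = {\<zero>\<^bsub>Z\<^esub>}"
    unfolding Z_def by (rule submodule_left_module[OF lN(3) submodule_zero_set[OF lN(3)]]) simp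
  define P where "P i = (if i = 0 then N0 else if i = 1 then N1 else if i = 2 then N2 else Z)" for i :: nat
  define d where "d i = (if i = 0 then (\<lambda>x. d0 (?u0 x)) else if i = 1 then (\<lambda>x. t0 (d1 (?u1 x)))
    else if i = 2 then (\<lambda>x. t1 (d2 (?u2 x))) else (\<lambda>x. \<zero>\<^bsub>P (i - 1)\<^esub>))" for i :: nat
  have P [simp]: "P 0 = N0" "P (Suc 0) = N1" "P (Suc (Suc 0)) = N2" "P (Suc (Suc (Suc i))) = Z" for i
    by (simp_all add: P_def)
  have d [simp]: "d 0 = (\<lambda>x. d0 (?u0 x))" "d (Suc 0) = (\<lambda>x. t0 (d1 (?u1 x)))" "d (Suc (Suc 0)) = (\<lambda>x. t1 (d2 (?u2 x)))"
    "d (Suc (Suc (Suc i))) = (\<lambda>x. \<zero>\<^bsub>P (Suc (Suc i))\<^esub>)" for i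
    by (simp_all add: d_def)
  have lP: "left_module B (P i)" for i using lN Z by (simp add: P_def)
  have pr: "fgproj B (P i)" for i
    using N(2,4,6) zero_fgproj[OF Z] by (simp add: P_def)
  have "proj_resolution B C P d"
    unfolding proj_resolution_def
  proof (intro conjI allI)
    show "projective B (P i)" for i using projective_iff_fgproj[OF lP] pr by blast
    show "d 0 \<in> mod_hom B (P 0) C" using mod_hom_comp[OF u0 d0] by simp
    show "d 0 ` carrier (P 0) = carrier C" using s0 image_comp[of d0 ?u0 "carrier N0"] by (simp add: b(1) comp_def)
    show "d (Suc i) \<in> mod_hom B (P (Suc i)) (P i)" for i
    proof -
      consider "i = 0" | "i = Suc 0" | j where "i = Suc (Suc j)" by (metis not0_implies_Suc)
      thus ?thesis
      proof cases
        case 1 thus ?thesis using mod_hom_comp[OF mod_hom_comp[OF u1 d1] t0(1)] by simp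
      next
        case 2 thus ?thesis using mod_hom_comp[OF mod_hom_comp[OF u2 d2] t1(1)] by simp
      next
        case 3 thus ?thesis using mod_hom_const_zero[OF lP[of i]] by simp
      qed
    qed
    have z0: "t0 x = \<zero>\<^bsub>N0\<^esub> \<longleftrightarrow> x = \<zero>\<^bsub>P0\<^esub>" if "x \<in> carrier P0" for x
      using that mod_hom_inj_iff[OF P0 lN(1) t0(1)] t0(2) mod_hom_zero[OF P0 lN(1) t0(1)] by (auto simp: bij_betw_def)
    have z1: "t1 x = \<zero>\<^bsub>N1\<^esub> \<longleftrightarrow> x = \<zero>\<^bsub>P1\<^esub>" if "x \<in> carrier P1" for x
      using that mod_hom_inj_iff[OF P1 lN(2) t1(1)] t1(2) mod_hom_zero[OF P1 lN(2) t1(1)] by (auto simp: bij_betw_def)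
    have "{y \<in> carrier N0. d0 (?u0 y) = \<zero>\<^bsub>C\<^esub>} = t0 ` {x \<in> carrier P0. d0 x = \<zero>\<^bsub>C\<^esub>}"
      by (rule bij_betw_Collect_inv[OF t0(2)])
    also have "\<dots> = t0 ` d1 ` ?u1 ` carrier N1" unfolding s1 b(2) ..
    also have "\<dots> = (\<lambda>x. t0 (d1 (?u1 x))) ` carrier N1" by (simp only: image_image)
    finally show "a_kernel (P 0) C (d 0) = d 1 ` carrier (P 1)" by (simp add: a_kernel_def')
    show "a_kernel (P (Suc i)) (P i) (d (Suc i)) = d (Suc (Suc i)) ` carrier (P (Suc (Suc i)))" for i
    proof -
      consider "i = 0" | "i = Suc 0" | j where "i = Suc (Suc j)" by (metis not0_implies_Suc)
      thus ?thesis
      proof cases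
        case 1
        have "{y \<in> carrier N1. t0 (d1 (?u1 y)) = \<zero>\<^bsub>N0\<^esub>} = {y \<in> carrier N1. d1 (?u1 y) = \<zero>\<^bsub>P0\<^esub>}"
          using z0 mod_hom_closed[OF mod_hom_comp[OF u1 d1]] by auto
        also have "\<dots> = t1 ` {x \<in> carrier P1. d1 x = \<zero>\<^bsub>P0\<^esub>}"
          by (rule bij_betw_Collect_inv[OF t1(2)])
        also have "\<dots> = t1 ` d2 ` ?u2 ` carrier N2" unfolding s2 b(3) ..
        also have "\<dots> = (\<lambda>x. t1 (d2 (?u2 x))) ` carrier N2" by (simp only: image_image)
        finally show ?thesis using 1 by (simp add: a_kernel_def')
      next
        case 2
        have "y = \<zero>\<^bsub>N2\<^esub>" if y: "y \<in> carrier N2" "t1 (d2 (?u2 y)) = \<zero>\<^bsub>N1\<^esub>" for y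
        proof -
          have m: "?u2 y \<in> carrier P2" by (rule mod_hom_closed[OF u2 y(1)])
          have "d2 (?u2 y) = \<zero>\<^bsub>P1\<^esub>" using z1[OF mod_hom_closed[OF d2 m]] y(2) by simp
          hence "?u2 y = \<zero>\<^bsub>P2\<^esub>" using i2 mod_hom_inj_iff[OF P2 P1 d2] m by blast
          hence "t2 (?u2 y) = \<zero>\<^bsub>N2\<^esub>" using mod_hom_zero[OF P2 lN(3) t2(1)] by simp
          thus ?thesis using y(1) t2(2) by (simp add: bij_betw_def f_the_inv_into_f)
        qed
        moreover have "t1 (d2 (?u2 \<zero>\<^bsub>N2\<^esub>)) = \<zero>\<^bsub>N1\<^esub>"
          by (rule mod_hom_zero[OF lN(3,2) mod_hom_comp[OF mod_hom_comp[OF u2 d2] t1(1)]])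
        ultimately have "{y \<in> carrier N2. t1 (d2 (?u2 y)) = \<zero>\<^bsub>N1\<^esub>} = {\<zero>\<^bsub>N2\<^esub>}"
          using submodule_zero[OF submodule_carrier[OF lN(3)]] by blast
        thus ?thesis using 2 Z(2) by (simp add: a_kernel_def')
      next
        case 3 thus ?thesis using Z(2) by (auto simp: a_kernel_def')
      qed
    qed
  qed
  moreover have "\<forall>i>2. carrier (P i) = {\<zero>\<^bsub>P i\<^esub>}" using Z(2) by (simp add: P_def)
  ultimately have "enat 2 \<in> {enat m | m. \<exists>P d. proj_resolution B C P d \<and> (\<forall>i>m. carrier (P i) = {\<zero>\<^bsub>P i\<^esub>})}"
    by blast
  hence "proj_dim B C \<le> enat 2" unfolding proj_dim_def by (rule Inf_lower)
  thus ?thesis by (simp add: numeral_eq_enat)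
qed

text \<open>In \<open>enat\<close> the infimum of a nonempty set is its least element, so a finite
  bound on \<open>proj_dim\<close> is attained by an actual resolution.\<close>

lemma gl_dim_le_2_resolution:
  fixes B :: "('b, 'c) ring_scheme" and C :: "('b, 'm) module"
  assumes "gl_dim B \<le> 2" "fg_module B C"
  shows "\<exists>(P0 :: 'b fg_mod) (P1 :: 'b fg_mod) (P2 :: 'b fg_mod) d0 d1 d2.
    short_res B C P0 P1 P2 d0 d1 d2 \<and> fgproj B P0 \<and> fgproj B P1 \<and> fgproj B P2"
proof -
  obtain N :: "'b fg_mod" where N: "fg_module B N" "mod_iso B C N" using fg_module_realised[OF assms(2)] by blast
  have C: "left_module B C" and lN: "left_module B N" using assms(2) N(1) by (auto simp: fg_module_def)
  obtain t where t: "t \<in> mod_hom B N C" "bij_betw t (carrier N) (carrier C)"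
    using mod_iso_sym[OF C N(2)] unfolding mod_iso_def by blast
  have "proj_dim B N \<le> gl_dim B" unfolding gl_dim_def using N(1) by (intro SUP_upper) simp
  hence le: "proj_dim B N \<le> 2" using assms(1) by (rule order_trans)
  let ?S = "{enat m | m. \<exists>P d. proj_resolution B N P d \<and> (\<forall>i>m. carrier (P i) = {\<zero>\<^bsub>P i\<^esub>})}"
  have "?S \<noteq> {}"
  proof
    assume "?S = {}"
    hence "proj_dim B N = \<infinity>" by (simp add: proj_dim_def Inf_enat_def)
    thus False using le by simp
  qed
  then obtain s where "s \<in> ?S" by (elim ex_in_conv[THEN iffD2, elim_format] exE)
  hence "(LEAST x. x \<in> ?S) \<in> ?S" by (rule LeastI)
  hence "proj_dim B N \<in> ?S" unfolding proj_dim_def Inf_enat_def using \<open>?S \<noteq> {}\<close> by (simp only: if_False)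
  then obtain m P d where m: "proj_dim B N = enat m" and res: "proj_resolution B N P d"
    and z: "\<forall>i>m. carrier (P i) = {\<zero>\<^bsub>P i\<^esub>}" by blast
  have "m \<le> 2" using le m by (simp add: numeral_eq_enat)
  \<comment> \<open>A resolution of length at most 2 has zero third term, which makes its second
    differential injective.\<close>
  hence z3: "carrier (P (Suc (Suc (Suc 0)))) = {\<zero>\<^bsub>P (Suc (Suc (Suc 0)))\<^esub>}" using z by simp
  have pr: "projective B (P i)" for i using res by (simp add: proj_resolution_def)
  hence lP: "left_module B (P i)" for i by (simp add: projective_def fg_module_def)
  have d0: "d 0 \<in> mod_hom B (P 0) N" "d 0 ` carrier (P 0) = carrier N"
    "{x \<in> carrier (P 0). d 0 x = \<zero>\<^bsub>N\<^esub>} = d (Suc 0) ` carrier (P (Suc 0))"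
    using res by (simp_all add: proj_resolution_def a_kernel_def')
  have dS: "d (Suc i) \<in> mod_hom B (P (Suc i)) (P i)"
    "{x \<in> carrier (P (Suc i)). d (Suc i) x = \<zero>\<^bsub>P i\<^esub>} = d (Suc (Suc i)) ` carrier (P (Suc (Suc i)))" for i
    using res by (simp_all add: proj_resolution_def a_kernel_def')
  have "inj_on (d (Suc (Suc 0))) (carrier (P (Suc (Suc 0))))"
    unfolding mod_hom_inj_iff[OF lP lP dS(1)]
    using dS(2)[of "Suc 0"] z3 mod_hom_zero[OF lP lP dS(1)] by auto
  moreover have "t (d 0 x) = \<zero>\<^bsub>C\<^esub> \<longleftrightarrow> d 0 x = \<zero>\<^bsub>N\<^esub>" if "x \<in> carrier (P 0)" for x
    using mod_hom_closed[OF d0(1) that] mod_hom_inj_iff[OF lN C t(1)] t(2) mod_hom_zero[OF lN C t(1)]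
    by (auto simp: bij_betw_def)
  hence "{x \<in> carrier (P 0). t (d 0 x) = \<zero>\<^bsub>C\<^esub>} = d (Suc 0) ` carrier (P (Suc 0))"
    unfolding d0(3)[symmetric] by blast
  moreover have "(\<lambda>x. t (d 0 x)) ` carrier (P 0) = carrier C"
    using d0(2) t(2) image_comp[of t "d 0" "carrier (P 0)"] by (simp add: bij_betw_def comp_def)
  ultimately have "short_res B C (P 0) (P (Suc 0)) (P (Suc (Suc 0))) (\<lambda>x. t (d 0 x)) (d (Suc 0)) (d (Suc (Suc 0)))"
    unfolding short_res_def using C lP mod_hom_comp[OF d0(1) t(1)] dS by simp
  thus ?thesis using pr projective_iff_fgproj[OF lP] by blast
qed

subsection \<open>Endomorphism rings\<close>

text \<open>M over its endomorphism ring, acting by evaluation. This is Hom(B, M) with a map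
  identified with its value at one.\<close>

definition End_mod :: "('b, 'm) module \<Rightarrow> ('m \<Rightarrow> 'm, 'm) module"
  where "End_mod M = \<lparr>carrier = carrier M, mult = undefined, one = undefined,
    zero = \<zero>\<^bsub>M\<^esub>, add = add M, smult = (\<lambda>f x. f x)\<rparr>"

text \<open>The endomorphism ring acts by postcomposition, so X enters contravariantly.\<close>

definition Hom_mod :: "('b, 'c) ring_scheme \<Rightarrow> ('b, 'k) module \<Rightarrow> ('b, 'm) module \<Rightarrow> ('m \<Rightarrow> 'm, 'k \<Rightarrow> 'm) module"
  where "Hom_mod B X M = \<lparr>carrier = mod_hom B X M \<inter> extensional (carrier X), mult = undefined, one = undefined,
    zero = (\<lambda>x\<in>carrier X. \<zero>\<^bsub>M\<^esub>), add = (\<lambda>f g. \<lambda>x\<in>carrier X. f x \<oplus>\<^bsub>M\<^esub> g x),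
    smult = (\<lambda>a f. \<lambda>x\<in>carrier X. a (f x))\<rparr>"

lemma End_mod_simps [simp]: "carrier (End_mod M) = carrier M" "\<zero>\<^bsub>End_mod M\<^esub> = \<zero>\<^bsub>M\<^esub>"
  "x \<oplus>\<^bsub>End_mod M\<^esub> y = x \<oplus>\<^bsub>M\<^esub> y" "f \<odot>\<^bsub>End_mod M\<^esub> x = f x"
  by (simp_all add: End_mod_def)

lemma Hom_mod_simps [simp]: "carrier (Hom_mod B X M) = mod_hom B X M \<inter> extensional (carrier X)"
  "\<zero>\<^bsub>Hom_mod B X M\<^esub> = (\<lambda>x\<in>carrier X. \<zero>\<^bsub>M\<^esub>)" "f \<oplus>\<^bsub>Hom_mod B X M\<^esub> g = (\<lambda>x\<in>carrier X. f x \<oplus>\<^bsub>M\<^esub> g x)"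
  "a \<odot>\<^bsub>Hom_mod B X M\<^esub> f = (\<lambda>x\<in>carrier X. a (f x))"
  by (simp_all add: Hom_mod_def)

lemma End_ring_simps [simp]: "carrier (End_ring B M) = mod_hom B M M \<inter> extensional (carrier M)"
  "\<zero>\<^bsub>End_ring B M\<^esub> = (\<lambda>x\<in>carrier M. \<zero>\<^bsub>M\<^esub>)" "f \<oplus>\<^bsub>End_ring B M\<^esub> g = (\<lambda>x\<in>carrier M. f x \<oplus>\<^bsub>M\<^esub> g x)"
  "\<one>\<^bsub>End_ring B M\<^esub> = (\<lambda>x\<in>carrier M. x)" "f \<otimes>\<^bsub>End_ring B M\<^esub> g = (\<lambda>x\<in>carrier M. f (g x))"
  by (simp_all add: End_ring_def compose_def)

lemma restrict_mod_hom_iff: "left_module B X \<Longrightarrow> restrict f (carrier X) \<in> mod_hom B X N \<longleftrightarrow> f \<in> mod_hom B X N"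
  using mod_hom_cong[of B X f N "restrict f (carrier X)"] mod_hom_cong[of B X "restrict f (carrier X)" N f] by auto

text \<open>Stated for any record G with these three fields, because the same group underlies
  \<open>End_ring\<close>, \<open>Hom_mod\<close>, \<open>Hom_cmod\<close> and the dual of
  A.\<close>

lemma Hom_group:
  assumes X: "left_module B X" and M: "left_module B M"
    and G: "carrier G = mod_hom B X M \<inter> extensional (carrier X)" "\<zero>\<^bsub>G\<^esub> = (\<lambda>x\<in>carrier X. \<zero>\<^bsub>M\<^esub>)"
      "\<And>f g. f \<oplus>\<^bsub>G\<^esub> g = (\<lambda>x\<in>carrier X. f x \<oplus>\<^bsub>M\<^esub> g x)"
  shows "abelian_group G"
proof -
  interpret M: left_module B M by fact
  have c: "f x \<in> carrier M" if "f \<in> carrier G" "x \<in> carrier X" for f x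
    using that mod_hom_closed[of f B X M x] by (simp add: G)
  show ?thesis
  proof (rule abelian_groupI)
    fix f g assume "f \<in> carrier G" "g \<in> carrier G"
    thus "f \<oplus>\<^bsub>G\<^esub> g \<in> carrier G" by (simp add: G restrict_mod_hom_iff[OF X] mod_hom_sum[OF M])
  next
    show "\<zero>\<^bsub>G\<^esub> \<in> carrier G" using mod_hom_const_zero[OF M] by (simp add: G restrict_mod_hom_iff[OF X])
  next
    fix f g h assume fgh: "f \<in> carrier G" "g \<in> carrier G" "h \<in> carrier G"
    show "f \<oplus>\<^bsub>G\<^esub> g \<oplus>\<^bsub>G\<^esub> h = f \<oplus>\<^bsub>G\<^esub> (g \<oplus>\<^bsub>G\<^esub> h)"
      unfolding G by (rule restrict_ext) (simp add: M.M.a_assoc c fgh)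
  next
    fix f g assume fg: "f \<in> carrier G" "g \<in> carrier G"
    show "f \<oplus>\<^bsub>G\<^esub> g = g \<oplus>\<^bsub>G\<^esub> f" unfolding G by (rule restrict_ext) (simp add: M.M.a_comm c fg)
  next
    fix f assume f: "f \<in> carrier G"
    show "\<zero>\<^bsub>G\<^esub> \<oplus>\<^bsub>G\<^esub> f = f"
      using f c[OF f] unfolding G by (intro extensionalityI[of _ "carrier X"]) simp_all
    have "(\<lambda>x. \<zero>\<^bsub>M\<^esub> \<ominus>\<^bsub>M\<^esub> f x) \<in> mod_hom B X M"
      using f by (intro mod_hom_difference[OF M mod_hom_const_zero[OF M]]) (simp add: G)
    hence "(\<lambda>x\<in>carrier X. \<zero>\<^bsub>M\<^esub> \<ominus>\<^bsub>M\<^esub> f x) \<in> carrier G" by (simp add: G restrict_mod_hom_iff[OF X])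
    moreover have "(\<lambda>x\<in>carrier X. \<zero>\<^bsub>M\<^esub> \<ominus>\<^bsub>M\<^esub> f x) \<oplus>\<^bsub>G\<^esub> f = \<zero>\<^bsub>G\<^esub>"
      unfolding G by (rule restrict_ext) (simp add: M.M.add_minus_cancel c f)
    ultimately show "\<exists>g\<in>carrier G. g \<oplus>\<^bsub>G\<^esub> f = \<zero>\<^bsub>G\<^esub>" by blast
  qed
qed

lemma End_ring_ring:
  assumes M: "left_module B M" shows "ring (End_ring B M)"
proof -
  let ?G = "End_ring B M"
  have ag: "abelian_group ?G" by (rule Hom_group[OF M M]) simp_all
  have c: "f x \<in> carrier M" if "f \<in> carrier ?G" "x \<in> carrier M" for f x
    using that mod_hom_closed[of f B M M x] by simp
  have a: "f (x \<oplus>\<^bsub>M\<^esub> y) = f x \<oplus>\<^bsub>M\<^esub> f y" if "f \<in> carrier ?G" "x \<in> carrier M" "y \<in> carrier M" for f x y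
    using that mod_hom_add[of f B M M x y] by simp
  show ?thesis
  proof (rule ringI[OF ag])
    show "monoid ?G"
    proof (rule monoidI)
      fix f g assume "f \<in> carrier ?G" "g \<in> carrier ?G"
      thus "f \<otimes>\<^bsub>?G\<^esub> g \<in> carrier ?G"
        using mod_hom_comp[of g B M M f M] by (simp add: restrict_mod_hom_iff[OF M])
    next
      show "\<one>\<^bsub>?G\<^esub> \<in> carrier ?G" by (simp add: restrict_mod_hom_iff[OF M] mod_hom_id)
    next
      fix f g h assume "f \<in> carrier ?G" "g \<in> carrier ?G" "h \<in> carrier ?G"
      thus "f \<otimes>\<^bsub>?G\<^esub> g \<otimes>\<^bsub>?G\<^esub> h = f \<otimes>\<^bsub>?G\<^esub> (g \<otimes>\<^bsub>?G\<^esub> h)"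
        unfolding End_ring_simps(5) by (intro restrict_ext) (simp add: c)
    next
      fix f assume f: "f \<in> carrier ?G"
      show "\<one>\<^bsub>?G\<^esub> \<otimes>\<^bsub>?G\<^esub> f = f"
        using f c[OF f] by (intro extensionalityI[of _ "carrier M"]) simp_all
      show "f \<otimes>\<^bsub>?G\<^esub> \<one>\<^bsub>?G\<^esub> = f"
        using f by (intro extensionalityI[of _ "carrier M"]) simp_all
    qed
  next
    fix f g h assume "f \<in> carrier ?G" "g \<in> carrier ?G" "h \<in> carrier ?G"
    thus "(f \<oplus>\<^bsub>?G\<^esub> g) \<otimes>\<^bsub>?G\<^esub> h = f \<otimes>\<^bsub>?G\<^esub> h \<oplus>\<^bsub>?G\<^esub> g \<otimes>\<^bsub>?G\<^esub> h"
      "h \<otimes>\<^bsub>?G\<^esub> (f \<oplus>\<^bsub>?G\<^esub> g) = h \<otimes>\<^bsub>?G\<^esub> f \<oplus>\<^bsub>?G\<^esub> h \<otimes>\<^bsub>?G\<^esub> g"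
      unfolding End_ring_simps(3,5) by (intro restrict_ext, simp add: c a)+
  qed
qed

lemma Hom_mod_left_module:
  assumes X: "left_module B X" and M: "left_module B M"
  shows "left_module (End_ring B M) (Hom_mod B X M)"
proof (rule left_moduleI[OF End_ring_ring[OF M]])
  let ?H = "Hom_mod B X M"
  show "abelian_group ?H" by (rule Hom_group[OF X M]) simp_all
  have c: "f x \<in> carrier M" if "f \<in> carrier ?H" "x \<in> carrier X" for f x
    using that mod_hom_closed[of f B X M x] by simp
  have a: "f (x \<oplus>\<^bsub>M\<^esub> y) = f x \<oplus>\<^bsub>M\<^esub> f y" if "f \<in> carrier (End_ring B M)" "x \<in> carrier M" "y \<in> carrier M" for f x y
    using that mod_hom_add[of f B M M x y] by simp
  fix f assume f: "f \<in> carrier ?H"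
  show "\<one>\<^bsub>End_ring B M\<^esub> \<odot>\<^bsub>?H\<^esub> f = f"
    using f c[OF f] by (intro extensionalityI[of _ "carrier X"]) simp_all
  fix s assume s: "s \<in> carrier (End_ring B M)"
  show "s \<odot>\<^bsub>?H\<^esub> f \<in> carrier ?H"
    using f s mod_hom_comp[of f B X M s M] by (simp add: restrict_mod_hom_iff[OF X])
  show "s \<odot>\<^bsub>?H\<^esub> (f \<oplus>\<^bsub>?H\<^esub> g) = s \<odot>\<^bsub>?H\<^esub> f \<oplus>\<^bsub>?H\<^esub> s \<odot>\<^bsub>?H\<^esub> g"
    if "g \<in> carrier ?H" for g
    unfolding Hom_mod_simps(3,4) by (rule restrict_ext) (simp add: a[OF s] c[OF f] c[OF that])
  fix t assume t: "t \<in> carrier (End_ring B M)"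
  show "(s \<oplus>\<^bsub>End_ring B M\<^esub> t) \<odot>\<^bsub>?H\<^esub> f = s \<odot>\<^bsub>?H\<^esub> f \<oplus>\<^bsub>?H\<^esub> t \<odot>\<^bsub>?H\<^esub> f"
    unfolding Hom_mod_simps(3,4) by (rule restrict_ext) (simp add: c[OF f])
  show "(s \<otimes>\<^bsub>End_ring B M\<^esub> t) \<odot>\<^bsub>?H\<^esub> f = s \<odot>\<^bsub>?H\<^esub> (t \<odot>\<^bsub>?H\<^esub> f)"
    unfolding Hom_mod_simps(3,4) by (rule restrict_ext) (simp add: c[OF f])
qed

lemma End_mod_left_module:
  assumes M: "left_module B M" shows "left_module (End_ring B M) (End_mod M)"
proof -
  interpret M: left_module B M by fact
  have ab: "abelian_group (End_mod M)"
  proof (rule abelian_groupI)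
    fix x assume "x \<in> carrier (End_mod M)"
    thus "\<exists>y\<in>carrier (End_mod M). y \<oplus>\<^bsub>End_mod M\<^esub> x = \<zero>\<^bsub>End_mod M\<^esub>"
      by (intro bexI[of _ "\<ominus>\<^bsub>M\<^esub> x"]) (auto simp: M.M.l_neg)
  qed (auto simp: M.M.a_ac)
  show ?thesis
    by (rule left_moduleI[OF End_ring_ring[OF M] ab])
      (simp_all add: mod_hom_closed[of _ B M M] mod_hom_add[of _ B M M])
qed

lemma comb_End_mod:
  assumes M: "left_module B M" and c: "c \<in> carrier (free (End_ring B M) k)" and v: "v \<in> carrier (copies M k)"
  shows "comb (End_mod M) k v c = (\<Oplus>\<^bsub>M\<^esub>i\<in>{..<k}. c i (v i))"
proof -
  have "c i (v i) \<in> carrier M" if "i < k" for i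
    using c v that mod_hom_closed[of "c i" B M M "v i"] by (simp add: PiE_iff)
  hence "(\<Oplus>\<^bsub>M\<^esub>i\<in>{..<k}. c i (v i)) = (\<Oplus>\<^bsub>End_mod M\<^esub>i\<in>{..<k}. c i (v i))"
    using additive_finsum[of M "End_mod M" "\<lambda>x. x" "\<lambda>i. c i (v i)" "{..<k}"]
      left_module_abelian[OF M] left_module_abelian[OF End_mod_left_module[OF M]] by auto
  thus ?thesis by (simp add: comb_def)
qed

lemma comb_End_mod_hom:
  assumes M: "left_module B M" and c: "c \<in> carrier (free (End_ring B M) k)"
  shows "(\<lambda>v. comb (End_mod M) k v c) \<in> mod_hom B (copies M k) M"
proof -
  have "c i \<in> mod_hom B M M" if "i \<in> {..<k}" for i using c that by auto
  hence "(\<lambda>v. \<Oplus>\<^bsub>M\<^esub>i\<in>{..<k}. c i (v i)) \<in> mod_hom B (copies M k) M" by (rule mod_hom_copair[OF M])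
  thus ?thesis by (rule mod_hom_cong[OF copies_left_module[OF M]]) (rule comb_End_mod[OF M c])
qed

text \<open>The row of components of a map M^k -> M. With \<open>comb (End_mod M) k v\<close> as
  evaluation at v, this identifies Hom(M^k, M) with the free module \<Gamma>^k; see
  \<open>comb_comps\<close> and \<open>comps_eqI\<close>.\<close>

definition comps :: "('b, 'm) module \<Rightarrow> nat \<Rightarrow> ((nat \<Rightarrow> 'm) \<Rightarrow> 'm) \<Rightarrow> nat \<Rightarrow> 'm \<Rightarrow> 'm"
  where "comps M k f = (\<lambda>j\<in>{..<k}. \<lambda>x\<in>carrier M. f (dinj {..<k} (\<lambda>_. M) j x))"

lemma copies_inj_hom: "\<lbrakk>left_module B M; j < k\<rbrakk> \<Longrightarrow> dinj {..<k} (\<lambda>_. M) j \<in> mod_hom B M (copies M k)"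
  by (rule dinj_hom[where X = "\<lambda>_. M"]) simp_all

lemma comps_closed:
  assumes M: "left_module B M" and f: "f \<in> mod_hom B (copies M k) M"
  shows "comps M k f \<in> carrier (free (End_ring B M) k)"
proof -
  have "(\<lambda>x. f (dinj {..<k} (\<lambda>_. M) j x)) \<in> mod_hom B M M" if "j < k" for j
    by (rule mod_hom_comp[OF copies_inj_hom[OF M that] f])
  thus ?thesis by (simp add: comps_def PiE_iff restrict_mod_hom_iff[OF M])
qed

lemma comb_comps:
  assumes M: "left_module B M" and f: "f \<in> mod_hom B (copies M k) M" and v: "v \<in> carrier (copies M k)"
  shows "comb (End_mod M) k v (comps M k f) = f v"
proof -
  interpret M: left_module B M by fact
  have vi: "v i \<in> carrier M" if "i < k" for i using v that by auto
  have d: "dinj {..<k} (\<lambda>_. M) j x \<in> carrier (copies M k)" if "j < k" "x \<in> carrier M" for j x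
    by (rule mod_hom_closed[OF copies_inj_hom[OF M that(1)] that(2)])
  have "f v = (\<Oplus>\<^bsub>M\<^esub>i\<in>{..<k}. f (dinj {..<k} (\<lambda>_. M) i (v i)))"
    by (rule mod_hom_dsum_decompose[OF M _ M f v]) simp
  also have "\<dots> = (\<Oplus>\<^bsub>M\<^esub>i\<in>{..<k}. comps M k f i (v i))"
    using vi d mod_hom_closed[OF f] by (intro M.M.finsum_cong') (simp_all add: comps_def)
  finally show ?thesis by (simp add: comb_End_mod[OF M comps_closed[OF M f] v])
qed

lemma comps_eqI:
  assumes M: "left_module B M" and e: "e \<in> carrier (free (End_ring B M) k)"
    and f: "\<And>v. v \<in> carrier (copies M k) \<Longrightarrow> f v = comb (End_mod M) k v e"
  shows "comps M k f = e"
proof (rule extensionalityI[of _ "{..<k}"])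
  fix j assume j: "j \<in> {..<k}"
  have ej: "e t \<in> mod_hom B M M" if "t \<in> {..<k}" for t using e that by auto
  show "comps M k f j = e j"
  proof (rule extensionalityI[of _ "carrier M"])
    fix x assume x: "x \<in> carrier M"
    have d: "dinj {..<k} (\<lambda>_. M) j x \<in> carrier (copies M k)"
      using mod_hom_closed[OF copies_inj_hom[OF M] x] j by simp
    have "comps M k f j x = (\<Oplus>\<^bsub>M\<^esub>t\<in>{..<k}. e t (dinj {..<k} (\<lambda>_. M) j x t))"
      using f[OF d] comb_End_mod[OF M e d] j x by (simp add: comps_def)
    also have "\<dots> = e j x" by (rule copair_dinj[OF M M ej]) (use j x in simp_all)
    finally show "comps M k f j x = e j x" .
  qed (use j e in \<open>auto simp: comps_def PiE_iff\<close>)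
qed (use e in \<open>auto simp: comps_def PiE_iff\<close>)

text \<open>The ring \<Gamma> acts on values: if the maps \<open>\<phi> d\<close> depend
  \<Gamma>-linearly on d at every argument v, then so do their rows.\<close>

lemma comps_hom:
  assumes M: "left_module B M" and F: "left_module (End_ring B M) F"
    and 1: "\<And>d. d \<in> carrier F \<Longrightarrow> \<phi> d \<in> mod_hom B (copies M k) M"
    and 2: "\<And>v. v \<in> carrier (copies M k) \<Longrightarrow> (\<lambda>d. \<phi> d v) \<in> mod_hom (End_ring B M) F (End_mod M)"
  shows "(\<lambda>d. comps M k (\<phi> d)) \<in> mod_hom (End_ring B M) F (free (End_ring B M) k)"
  unfolding comps_def
proof (rule mod_hom_dsumI[OF F], rule mod_homI)
  let ?G = "End_ring B M"
  fix j d assume j: "j \<in> {..<k}" and d: "d \<in> carrier F"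
  let ?h = "\<lambda>d x. \<phi> d (dinj {..<k} (\<lambda>_. M) j x)"
  note \<iota> = copies_inj_hom[OF M, of j k]
  show "(\<lambda>x\<in>carrier M. ?h d x) \<in> carrier (reg ?G)"
    using mod_hom_comp[OF \<iota> 1[OF d]] j by (simp add: restrict_mod_hom_iff[OF M])
  have h: "(\<lambda>d. ?h d x) \<in> mod_hom ?G F (End_mod M)" if "x \<in> carrier M" for x
    using 2[OF mod_hom_closed[OF \<iota> that]] j by simp
  show "(\<lambda>x\<in>carrier M. ?h (d \<oplus>\<^bsub>F\<^esub> d') x) = (\<lambda>x\<in>carrier M. ?h d x) \<oplus>\<^bsub>reg ?G\<^esub> (\<lambda>x\<in>carrier M. ?h d' x)"
    if "d' \<in> carrier F" for d'
    unfolding reg_simps End_ring_simps by (rule restrict_ext) (simp add: mod_hom_add[OF h d that])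
  show "(\<lambda>x\<in>carrier M. ?h (s \<odot>\<^bsub>F\<^esub> d) x) = s \<odot>\<^bsub>reg ?G\<^esub> (\<lambda>x\<in>carrier M. ?h d x)" if "s \<in> carrier ?G" for s
    unfolding reg_simps End_ring_simps by (rule restrict_ext) (simp add: mod_hom_smult[OF h that d])
qed

text \<open>Apply Hom(-, M) to the retract B of M^k: then M = Hom(B, M) becomes a retract of
  Hom(M^k, M) = \<Gamma>^k. Explicitly, m is the image of one in M^k, and an element x of M
  corresponds to the row of the map v -> p(v) x.\<close>

lemma End_mod_fgproj:
  assumes M: "left_module B M" and ret: "retract B (reg B) (copies M k)"
  shows "fgproj (End_ring B M) (End_mod M)"
proof -
  interpret M: left_module B M by fact
  let ?G = "End_ring B M" and ?N = "End_mod M"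
  note lN = End_mod_left_module[OF M]
  obtain i p where ip: "i \<in> mod_hom B (reg B) (copies M k)" "p \<in> mod_hom B (copies M k) (reg B)"
    "\<And>x. x \<in> carrier (reg B) \<Longrightarrow> p (i x) = x" using ret by (auto simp: retract_def)
  define m where "m = i \<one>\<^bsub>B\<^esub>"
  have m: "m \<in> carrier (copies M k)" unfolding m_def by (rule mod_hom_closed[OF ip(1)]) simp
  have px: "(\<lambda>v. p v \<odot>\<^bsub>M\<^esub> x) \<in> mod_hom B (copies M k) M" if "x \<in> carrier M" for x
    by (rule mod_hom_comp[OF ip(2) mod_hom_reg[OF M that]])
  have pv: "(\<lambda>x. p v \<odot>\<^bsub>M\<^esub> x) \<in> mod_hom ?G ?N ?N" if "v \<in> carrier (copies M k)" for v
    using mod_hom_closed[OF ip(2) that]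
    by (intro mod_homI) (simp_all add: M.smult_closed M.smult_r_distr mod_hom_smult[of _ B M M])
  have s: "(\<lambda>x. comps M k (\<lambda>v. p v \<odot>\<^bsub>M\<^esub> x)) \<in> mod_hom ?G ?N (free ?G k)"
    by (rule comps_hom[OF M lN px pv]) simp
  have q: "comb ?N k m \<in> mod_hom ?G (free ?G k) ?N" by (rule comb_hom[OF lN]) (use m in auto)
  have "retract ?G ?N (free ?G k)"
  proof (rule retractI[OF s q])
    fix x assume "x \<in> carrier ?N"
    hence x: "x \<in> carrier M" by simp
    show "comb ?N k m (comps M k (\<lambda>v. p v \<odot>\<^bsub>M\<^esub> x)) = x"
      unfolding comb_comps[OF M px[OF x] m] using ip(3)[of "\<one>\<^bsub>B\<^esub>"] x by (simp add: m_def M.smult_one)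
  qed
  thus ?thesis unfolding fgproj_def by (rule exI)
qed

lemma factor_through_surjection:
  assumes "left_module B X" "left_module B Y" "left_module B Z"
    and p: "p \<in> mod_hom B X Y" "p ` carrier X = carrier Y" and f: "f \<in> mod_hom B X Z"
    and ker: "\<And>x. \<lbrakk>x \<in> carrier X; p x = \<zero>\<^bsub>Y\<^esub>\<rbrakk> \<Longrightarrow> f x = \<zero>\<^bsub>Z\<^esub>"
  shows "\<exists>g\<in>mod_hom B Y Z. \<forall>x\<in>carrier X. g (p x) = f x"
proof -
  interpret X: left_module B X by fact
  interpret Y: left_module B Y by fact
  interpret Z: left_module B Z by fact
  have wd: "f x = f y" if "x \<in> carrier X" "y \<in> carrier X" "p x = p y" for x y
  proof -
    have "p (x \<ominus>\<^bsub>X\<^esub> y) = \<zero>\<^bsub>Y\<^esub>"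
      using mod_hom_diff[OF assms(1,2) p(1) that(1,2)] that mod_hom_closed[OF p(1)] by (simp add: Y.M.minus_eq_zero_iff)
    hence "f (x \<ominus>\<^bsub>X\<^esub> y) = \<zero>\<^bsub>Z\<^esub>" using ker that by simp
    thus ?thesis using mod_hom_diff[OF assms(1,3) f that(1,2)] that mod_hom_closed[OF f] by (simp add: Z.M.minus_eq_zero_iff)
  qed
  define \<sigma> where "\<sigma> y = (SOME x. x \<in> carrier X \<and> p x = y)" for y
  have "\<exists>x. x \<in> carrier X \<and> p x = y" if "y \<in> carrier Y" for y
    using that unfolding p(2)[symmetric] by blast
  hence \<sigma>: "\<sigma> y \<in> carrier X" "p (\<sigma> y) = y" if "y \<in> carrier Y" for y
    using that someI_ex[of "\<lambda>x. x \<in> carrier X \<and> p x = y"] by (auto simp: \<sigma>_def)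
  show ?thesis
  proof (intro bexI[of _ "\<lambda>y. f (\<sigma> y)"] ballI)
    fix x assume x: "x \<in> carrier X"
    show "f (\<sigma> (p x)) = f x" using \<sigma>[OF mod_hom_closed[OF p(1) x]] x by (intro wd)
  next
    show "(\<lambda>y. f (\<sigma> y)) \<in> mod_hom B Y Z"
    proof (rule mod_homI)
      fix y assume y: "y \<in> carrier Y"
      show "f (\<sigma> y) \<in> carrier Z" by (rule mod_hom_closed[OF f \<sigma>(1)[OF y]])
      fix y' assume y': "y' \<in> carrier Y"
      have "f (\<sigma> (y \<oplus>\<^bsub>Y\<^esub> y')) = f (\<sigma> y \<oplus>\<^bsub>X\<^esub> \<sigma> y')"
        using y y' \<sigma> mod_hom_add[OF p(1)] by (intro wd) simp_all
      thus "f (\<sigma> (y \<oplus>\<^bsub>Y\<^esub> y')) = f (\<sigma> y) \<oplus>\<^bsub>Z\<^esub> f (\<sigma> y')"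
        using mod_hom_add[OF f \<sigma>(1)[OF y] \<sigma>(1)[OF y']] by simp
    next
      fix b y assume b: "b \<in> carrier B" and y: "y \<in> carrier Y"
      have "f (\<sigma> (b \<odot>\<^bsub>Y\<^esub> y)) = f (b \<odot>\<^bsub>X\<^esub> \<sigma> y)"
        using b y \<sigma> mod_hom_smult[OF p(1)] by (intro wd) (simp_all add: Y.smult_closed X.smult_closed)
      thus "f (\<sigma> (b \<odot>\<^bsub>Y\<^esub> y)) = b \<odot>\<^bsub>Z\<^esub> f (\<sigma> y)" using mod_hom_smult[OF f b \<sigma>(1)[OF y]] by simp
    qed
  qed
qed

text \<open>A presentation \<open>B^b \<rightarrow> B^a \<rightarrow> X \<rightarrow> 0\<close> gives an exact sequence
  \<open>0 \<rightarrow> Hom(X, M) \<rightarrow> M^a \<rightarrow> M^b\<close> of modules over the endomorphism ring, so \<open>Hom(X, M)\<close> is a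
  second syzygy.\<close>

lemma Hom_mod_fgproj:
  fixes M :: "('b, 'm) module" and X :: "('b, 'k) module"
  assumes M: "left_module B M" and ret: "retract B (reg B) (copies M k)" and gd: "gl_dim (End_ring B M) \<le> 2"
    and X: "left_module B X" "fin_gen B X" and noeth: "fin_len B (reg B)"
  shows "fgproj (End_ring B M) (Hom_mod B X M)"
proof -
  let ?H = "Hom_mod B X M"
  interpret M: left_module B M by fact
  note B = M.R.ring_axioms
  let ?G = "End_ring B M" and ?N = "End_mod M"
  note lN = End_mod_left_module[OF M] and lH = Hom_mod_left_module[OF X(1) M]
  interpret N: left_module ?G ?N by (rule lN)
  obtain a x where x: "\<And>i. i < a \<Longrightarrow> x i \<in> carrier X" "comb X a x ` carrier (free B a) = carrier X"
    using X(2) fin_gen_iff_free[OF X(1)] by blast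
  note F = free_left_module[OF B, of a]
  have q: "comb X a x \<in> mod_hom B (free B a) X" by (rule comb_hom[OF X(1) x(1)])
  let ?K = "{c \<in> carrier (free B a). comb X a x c = \<zero>\<^bsub>X\<^esub>}"
  have K: "submodule ?K B (free B a)" by (rule submodule_kernel[OF F X(1) q])
  obtain b :: nat and u where uK: "\<And>j. j < b \<Longrightarrow> u j \<in> ?K" and sp: "span B (free B a) (u ` {..<b}) = ?K"
    by (rule submodule_generators[OF F fin_len_free[OF B noeth] K that])
  hence uF: "u j \<in> carrier (free B a)" if "j < b" for j using that by blast
  \<comment> \<open>\<open>\<delta>\<close> is Hom(-, M) applied to the map B^b -> B^a given by the
    relations u: a tuple m, read as a map B^a -> M, goes to its values on the relations.\<close>
  define \<delta> where "\<delta> m = (\<lambda>j\<in>{..<b}. \<Oplus>\<^bsub>?N\<^esub>i\<in>{..<a}. u j i \<odot>\<^bsub>M\<^esub> m i)" for m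
  have \<delta>0: "(\<lambda>m. u j i \<odot>\<^bsub>M\<^esub> m i) \<in> mod_hom ?G (copies ?N a) ?N" if ji: "j < b" "i < a" for j i
  proof -
    have ub: "u j i \<in> carrier B" using uF[OF ji(1)] ji(2) by auto
    have "(\<lambda>z. u j i \<odot>\<^bsub>M\<^esub> z) \<in> mod_hom ?G ?N ?N"
      by (rule mod_homI) (simp_all add: ub M.smult_closed M.smult_r_distr mod_hom_smult[of _ B M M])
    from mod_hom_comp[OF dsum_proj[of i "{..<a}"] this] show ?thesis using ji by simp
  qed
  have \<delta>: "\<delta> \<in> mod_hom ?G (copies ?N a) (copies ?N b)"
    unfolding \<delta>_def by (intro mod_hom_dsumI[OF copies_left_module[OF lN]] mod_hom_finsum_pointwise[OF lN] \<delta>0) simp_all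
  have \<delta>c: "\<delta> m j = comb M a m (u j)" if "j < b" "m \<in> carrier (copies ?N a)" for j m
  proof -
    have "u j i \<odot>\<^bsub>M\<^esub> m i \<in> carrier M" if "i < a" for i
      using mod_hom_closed[OF \<delta>0[OF \<open>j < b\<close> that] \<open>m \<in> _\<close>] by simp
    hence "(\<Oplus>\<^bsub>M\<^esub>i\<in>{..<a}. u j i \<odot>\<^bsub>M\<^esub> m i) = (\<Oplus>\<^bsub>?N\<^esub>i\<in>{..<a}. u j i \<odot>\<^bsub>M\<^esub> m i)"
      using additive_finsum[of M ?N "\<lambda>z. z" "\<lambda>i. u j i \<odot>\<^bsub>M\<^esub> m i" "{..<a}"]
        M.M.abelian_group_axioms N.M.abelian_group_axioms by auto
    thus ?thesis using that by (simp add: \<delta>_def comb_def)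
  qed
  define e2 where "e2 f = (\<lambda>i\<in>{..<a}. f (x i))" for f :: "'k \<Rightarrow> 'm"
  have e2: "e2 \<in> mod_hom ?G ?H (copies ?N a)"
    unfolding e2_def
  proof (rule mod_hom_dsumI[OF lH], rule mod_homI)
    fix i f assume i: "i \<in> {..<a}" and f: "f \<in> carrier ?H"
    show "f (x i) \<in> carrier ?N" using f i x(1) mod_hom_closed[of f B X M "x i"] by simp
    show "(f \<oplus>\<^bsub>?H\<^esub> g) (x i) = f (x i) \<oplus>\<^bsub>?N\<^esub> g (x i)" for g using i x(1) by simp
    show "(s \<odot>\<^bsub>?H\<^esub> f) (x i) = s \<odot>\<^bsub>?N\<^esub> f (x i)" for s using i x(1) by simp
  qed
  have q_basis: "comb X a x (basis B a i) = x i" if "i < a" for i by (rule comb_basis[OF X(1) x(1) that])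
  have inj: "inj_on e2 (carrier ?H)"
  proof (rule inj_onI)
    fix f g assume f: "f \<in> carrier ?H" and g: "g \<in> carrier ?H" and eq: "e2 f = e2 g"
    have fx: "f (x i) = g (x i)" if "i < a" for i using fun_cong[OF eq, of i] that by (simp add: e2_def)
    have "f (comb X a x c) = g (comb X a x c)" if "c \<in> carrier (free B a)" for c
      by (rule free_hom_eqI[OF M mod_hom_comp[OF q] mod_hom_comp[OF q] _ that]) (use f g fx q_basis in simp_all)
    hence "f y = g y" if "y \<in> carrier X" for y
      using that unfolding x(2)[symmetric] by (elim imageE) simp
    thus "f = g" using f g by (intro extensionalityI[of _ "carrier X"]) simp_all
  qed
  \<comment> \<open>A tuple killed by \<open>\<delta>\<close> is a map B^a -> M vanishing on all
    relations, that is, a map X -> M recorded by its values on the generators.\<close>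
  have ker: "{m \<in> carrier (copies ?N a). \<delta> m = \<zero>\<^bsub>copies ?N b\<^esub>} = e2 ` carrier ?H"
  proof (intro equalityI subsetI)
    fix m assume "m \<in> {m \<in> carrier (copies ?N a). \<delta> m = \<zero>\<^bsub>copies ?N b\<^esub>}"
    hence m: "m \<in> carrier (copies ?N a)" and dm: "\<delta> m = \<zero>\<^bsub>copies ?N b\<^esub>" by auto
    have mi: "m i \<in> carrier M" if "i < a" for i using m that by auto
    have cm: "comb M a m \<in> mod_hom B (free B a) M" by (rule comb_hom[OF M mi])
    have "comb M a m (u j) = \<zero>\<^bsub>M\<^esub>" if "j < b" for j using \<delta>c[OF that m] dm that by simp
    hence "u ` {..<b} \<subseteq> {c \<in> carrier (free B a). comb M a m c = \<zero>\<^bsub>M\<^esub>}" using uF by blast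
    from span_least[OF submodule_kernel[OF F M cm] this, unfolded sp]
    have z: "comb M a m c = \<zero>\<^bsub>M\<^esub>" if "c \<in> carrier (free B a)" "comb X a x c = \<zero>\<^bsub>X\<^esub>" for c using that by blast
    obtain g where g: "g \<in> mod_hom B X M" "\<forall>c\<in>carrier (free B a). g (comb X a x c) = comb M a m c"
      using factor_through_surjection[OF F X(1) M q x(2) cm z] by blast
    have "g (x i) = m i" if "i < a" for i
      using bspec[OF g(2) basis_closed[OF B that]] comb_basis[OF M mi that] q_basis[OF that] by simp
    hence "m = e2 (restrict g (carrier X))"
      using m x(1) by (intro extensionalityI[of _ "{..<a}"]) (simp_all add: e2_def PiE_iff)
    moreover have "restrict g (carrier X) \<in> carrier ?H" using g(1) by (simp add: restrict_mod_hom_iff[OF X(1)])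
    ultimately show "m \<in> e2 ` carrier ?H" by blast
  next
    fix m assume "m \<in> e2 ` carrier ?H"
    then obtain f where f: "f \<in> carrier ?H" "m = e2 f" by blast
    have m: "m \<in> carrier (copies ?N a)" unfolding f(2) by (rule mod_hom_closed[OF e2 f(1)])
    have mi: "m i = f (x i)" if "i < a" for i using that f(2) by (simp add: e2_def)
    have mc: "m i \<in> carrier M" if "i < a" for i using m that by auto
    have fh: "f \<in> mod_hom B X M" using f(1) by simp
    have fc: "f (comb X a x c) = comb M a m c" if "c \<in> carrier (free B a)" for c
      by (rule free_hom_eqI[OF M mod_hom_comp[OF q fh] comb_hom[OF M mc] _ that])
        (simp_all add: q_basis comb_basis[OF M mc] mi)
    have "comb M a m (u j) = \<zero>\<^bsub>M\<^esub>" if "j < b" for j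
    proof -
      have "comb M a m (u j) = f (comb X a x (u j))" using fc[OF uF[OF that]] by (rule sym)
      also have "\<dots> = \<zero>\<^bsub>M\<^esub>" using uK[OF that] mod_hom_zero[OF X(1) M fh] by simp
      finally show ?thesis .
    qed
    hence "\<delta> m = \<zero>\<^bsub>copies ?N b\<^esub>"
      using \<delta>c[OF _ m] mod_hom_closed[OF \<delta> m] by (intro extensionalityI[of _ "{..<b}"]) (simp_all add: PiE_iff)
    thus "m \<in> {m \<in> carrier (copies ?N a). \<delta> m = \<zero>\<^bsub>copies ?N b\<^esub>}" using m by blast
  qed
  note lCa = copies_left_module[OF lN, of a] and lCb = copies_left_module[OF lN, of b]
  \<comment> \<open>The bound on the global dimension is applied to the cokernel Q of
    \<open>\<delta>\<close>. In its sequence with terms M^b, M^a and Hom(X, M) the first two are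
    projective over \<Gamma>, so the sequence can be compared with a projective resolution of length
    two.\<close>
  obtain Q :: "('m \<Rightarrow> 'm, (nat \<Rightarrow> 'm) set) module" and p where Q: "left_module ?G Q" "p \<in> mod_hom ?G (copies ?N b) Q"
    "p ` carrier (copies ?N b) = carrier Q"
    "\<forall>y\<in>carrier (copies ?N b). p y = \<zero>\<^bsub>Q\<^esub> \<longleftrightarrow> y \<in> \<delta> ` carrier (copies ?N a)"
    using quotient_exists[OF lCb submodule_image[OF lCa lCb \<delta> submodule_carrier[OF lCa]]] by blast
  have im: "\<delta> ` carrier (copies ?N a) \<subseteq> carrier (copies ?N b)" using mod_hom_closed[OF \<delta>] by (rule image_subsetI)
  have kerp: "{y \<in> carrier (copies ?N b). p y = \<zero>\<^bsub>Q\<^esub>} = \<delta> ` carrier (copies ?N a)" using Q(4) im by blast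
  have res: "short_res ?G Q (copies ?N b) (copies ?N a) ?H p \<delta> e2"
    unfolding short_res_def using Q(1-3) lCa lCb lH \<delta> e2 inj ker kerp by (intro conjI)
  have pN: "fgproj ?G (copies ?N c)" for c by (rule copies_fgproj[OF lN End_mod_fgproj[OF M ret]])
  have "fg_module ?G Q"
    unfolding fg_module_def using Q(1) fin_gen_image[OF lCb Q(1-3) fgproj_fin_gen[OF lCb pN]] by blast
  from gl_dim_le_2_resolution[OF gd this] obtain P0 P1 P2 :: "('m \<Rightarrow> 'm) fg_mod" and d0 d1 d2
    where "short_res ?G Q P0 P1 P2 d0 d1 d2" "fgproj ?G P0" "fgproj ?G P1" "fgproj ?G P2" by blast
  from second_syzygy_fgproj[OF this(1) res this(2-4) pN pN] show ?thesis .
qed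

text \<open>Projectivity of \<open>Hom(X, M)\<close> yields a dual basis \<open>f j\<close>, \<open>s j\<close>. The matrix \<open>(s j (f i))\<close> is an
  idempotent endomorphism of \<open>M^k\<close> whose image is that of \<open>f : X \<rightarrow> M^k\<close>, by the detection hypothesis.\<close>

lemma retract_copies_of_Hom_fgproj:
  fixes M :: "('b, 'm) module" and X :: "('b, 'k) module"
  assumes M: "left_module B M" and X: "left_module B X" and proj: "fgproj (End_ring B M) (Hom_mod B X M)"
    and detect: "\<And>k f. \<lbrakk>f \<in> mod_hom B X (copies M k);
        \<And>\<phi>. \<phi> \<in> mod_hom B X M \<Longrightarrow> \<exists>g\<in>mod_hom B (copies M k) M. \<forall>x\<in>carrier X. g (f x) = \<phi> x\<rbrakk> \<Longrightarrow>
      inj_on f (carrier X) \<and> (\<forall>v\<in>carrier (copies M k). v \<notin> f ` carrier X \<longrightarrow>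
        (\<exists>h\<in>mod_hom B (copies M k) M. (\<forall>x\<in>carrier X. h (f x) = \<zero>\<^bsub>M\<^esub>) \<and> h v \<noteq> \<zero>\<^bsub>M\<^esub>))"
  shows "\<exists>k. retract B X (copies M k)"
proof -
  interpret M: left_module B M by fact
  let ?G = "End_ring B M" and ?N = "End_mod M" and ?H = "Hom_mod B X M"
  note lN = End_mod_left_module[OF M] and lH = Hom_mod_left_module[OF X M] and G = End_ring_ring[OF M]
  obtain k s q where s: "s \<in> mod_hom ?G ?H (free ?G k)" and q: "q \<in> mod_hom ?G (free ?G k) ?H"
    and qs: "\<And>\<phi>. \<phi> \<in> carrier ?H \<Longrightarrow> q (s \<phi>) = \<phi>"
    using proj unfolding fgproj_def retract_def by blast
  let ?C = "copies M k"
  note lC = copies_left_module[OF M, of k] and F = free_left_module[OF G, of k]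
  \<comment> \<open>The dual basis: the images under q of the standard basis vectors become the
    components of f.\<close>
  define f' where "f' j = q (basis ?G k j)" for j
  have f'H: "f' j \<in> carrier ?H" if "j < k" for j
    unfolding f'_def by (rule mod_hom_closed[OF q basis_closed[OF G that]])
  hence f'h: "f' j \<in> mod_hom B X M" if "j < k" for j using that by simp
  define f where "f x = (\<lambda>j\<in>{..<k}. f' j x)" for x
  have f: "f \<in> mod_hom B X ?C" unfolding f_def by (rule mod_hom_dsumI[OF X f'h]) simp
  have q_eval: "q c x = comb ?N k (f x) c" if c: "c \<in> carrier (free ?G k)" and x: "x \<in> carrier X" for c x
  proof -
    have ev: "(\<lambda>\<phi>. \<phi> x) \<in> mod_hom ?G ?H ?N"
      using x by (intro mod_homI) (simp_all add: mod_hom_closed[of _ B X M])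
    have fx: "f x j \<in> carrier ?N" if "j < k" for j using mod_hom_closed[OF f x] that by auto
    show ?thesis
    proof (rule free_hom_eqI[OF lN mod_hom_comp[OF q ev] comb_hom[OF lN fx] _ c])
      fix j assume j: "j < k"
      show "q (basis ?G k j) x = comb ?N k (f x) (basis ?G k j)"
        using comb_basis[where x = "f x", OF lN fx j] j by (simp add: f_def f'_def)
    qed
  qed
  \<comment> \<open>\<open>S \<phi>\<close> extends \<phi> along f: it is the map M^k -> M with row
    \<open>s \<phi>\<close>.\<close>
  define S where "S \<phi> v = comb ?N k v (s \<phi>)" for \<phi> v
  have Sh: "S \<phi> \<in> mod_hom B ?C M" if "\<phi> \<in> carrier ?H" for \<phi>
    unfolding S_def by (rule comb_End_mod_hom[OF M mod_hom_closed[OF s that]])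
  have Sf: "S \<phi> (f x) = \<phi> x" if "\<phi> \<in> carrier ?H" "x \<in> carrier X" for \<phi> x
    using q_eval[OF mod_hom_closed[OF s that(1)] that(2)] qs[OF that(1)] by (simp add: S_def)
  have approx: "\<exists>g\<in>mod_hom B ?C M. \<forall>x\<in>carrier X. g (f x) = \<phi> x" if "\<phi> \<in> mod_hom B X M" for \<phi>
  proof -
    have r: "restrict \<phi> (carrier X) \<in> carrier ?H" using that by (simp add: restrict_mod_hom_iff[OF X])
    show ?thesis using Sh[OF r] Sf[OF r] by (intro bexI[of _ "S (restrict \<phi> (carrier X))"]) simp_all
  qed
  define e where "e v = (\<lambda>i\<in>{..<k}. S (f' i) v)" for v
  have e: "e \<in> mod_hom B ?C ?C" unfolding e_def by (rule mod_hom_dsumI[OF lC Sh[OF f'H]]) simp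
  have ef: "e (f x) = f x" if "x \<in> carrier X" for x
    using Sf[OF f'H that] by (simp add: e_def f_def cong: restrict_cong)
  \<comment> \<open>A map that kills f(X) also kills the image of e. Its row c satisfies q c = 0,
    and evaluating s (q c) at v equals evaluating c at e v, an identity of \<Gamma>-linear maps that
    is checked on the basis.\<close>
  have he: "h (e v) = \<zero>\<^bsub>M\<^esub>"
    if h: "h \<in> mod_hom B ?C M" "\<forall>x\<in>carrier X. h (f x) = \<zero>\<^bsub>M\<^esub>" and v: "v \<in> carrier ?C" for h v
  proof -
    let ?c = "comps M k h"
    have c: "?c \<in> carrier (free ?G k)" by (rule comps_closed[OF M h(1)])
    have vN: "v i \<in> carrier ?N" if "i < k" for i using v that by auto
    have eN: "e v i \<in> carrier ?N" if "i < k" for i using mod_hom_closed[OF e v] that by auto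
    have "q ?c x = \<zero>\<^bsub>?H\<^esub> x" if "x \<in> carrier X" for x
      using q_eval[OF c that] comb_comps[OF M h(1) mod_hom_closed[OF f that]] h(2) that by simp
    hence q0: "q ?c = \<zero>\<^bsub>?H\<^esub>"
      using mod_hom_closed[OF q c] by (intro extensionalityI[of _ "carrier X"]) simp_all
    have psi: "comb ?N k v \<in> mod_hom ?G (free ?G k) ?N" by (rule comb_hom[OF lN vN])
    have "comb ?N k v (s (q ?c)) = comb ?N k (e v) ?c"
    proof (rule free_hom_eqI[OF lN mod_hom_comp[OF mod_hom_comp[OF q s] psi] comb_hom[OF lN eN] _ c])
      fix j assume "j < k"
      thus "comb ?N k v (s (q (basis ?G k j))) = comb ?N k (e v) (basis ?G k j)"
        using comb_basis[where x = "e v", OF lN eN] by (simp add: e_def S_def f'_def)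
    qed
    moreover have "comb ?N k v (s (q ?c)) = \<zero>\<^bsub>M\<^esub>"
      unfolding q0 mod_hom_zero[OF lH F s] using mod_hom_zero[OF F lN psi] by simp
    ultimately show ?thesis using comb_comps[OF M h(1) mod_hom_closed[OF e v]] by simp
  qed
  have det: "inj_on f (carrier X)" "\<And>v. \<lbrakk>v \<in> carrier ?C; v \<notin> f ` carrier X\<rbrakk> \<Longrightarrow>
      \<exists>h\<in>mod_hom B ?C M. (\<forall>x\<in>carrier X. h (f x) = \<zero>\<^bsub>M\<^esub>) \<and> h v \<noteq> \<zero>\<^bsub>M\<^esub>"
    using detect[OF f approx] by blast+
  \<comment> \<open>If e v were outside f(X), detection would produce a map that kills f(X) but not
    e v, which \<open>he\<close> forbids.\<close>
  have im: "e v \<in> f ` carrier X" if v: "v \<in> carrier ?C" for v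
    using det(2)[OF mod_hom_closed[OF e v]] he[OF _ _ v] by blast
  obtain g where g: "g \<in> mod_hom B ?C X" "\<forall>v\<in>carrier ?C. f (g v) = e v"
    using mono_lift[OF lC X lC f det(1) e im] by blast
  have "retract B X ?C"
  proof (rule retractI[OF f g(1)])
    fix x assume x: "x \<in> carrier X"
    note fx = mod_hom_closed[OF f x]
    show "g (f x) = x"
      using bspec[OF g(2) fx] ef[OF x] x mod_hom_closed[OF g(1) fx] by (intro inj_onD[OF det(1)]) simp_all
  qed
  thus ?thesis by (rule exI)
qed

text \<open>The second syzygy \<open>L\<close> of a \<open>\<Gamma>\<close>-module consists of the maps \<open>M^b \<rightarrow> M\<close> killing finitely many maps
  \<open>M \<rightarrow> M^b\<close>, hence \<open>L = Hom(Y, M)\<close> where \<open>Y\<close> is the image of \<open>M^b\<close> under generators of \<open>L\<close>.\<close>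

lemma gl_dim_End_le_2:
  fixes M :: "('b, 'm) module"
  assumes M: "left_module B M" and noeth: "fin_len (End_ring B M) (reg (End_ring B M))"
    and sub: "\<And>l Y. submodule Y B (copies M l) \<Longrightarrow> \<exists>k. retract B ((copies M l)\<lparr>carrier := Y\<rparr>) (copies M k)"
  shows "gl_dim (End_ring B M) \<le> 2"
  unfolding gl_dim_def
proof (rule SUP_least)
  interpret M: left_module B M by fact
  let ?G = "End_ring B M" and ?N = "End_mod M"
  note lN = End_mod_left_module[OF M] and G = End_ring_ring[OF M]
  fix C :: "('m \<Rightarrow> 'm) fg_mod" assume "C \<in> {X. fg_module ?G X}"
  hence C: "left_module ?G C" "fin_gen ?G C" by (simp_all add: fg_module_def)
  obtain a x where x: "\<And>i. i < a \<Longrightarrow> x i \<in> carrier C" "comb C a x ` carrier (free ?G a) = carrier C"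
    using C(2) fin_gen_iff_free[OF C(1)] by blast
  have d0: "comb C a x \<in> mod_hom ?G (free ?G a) C" by (rule comb_hom[OF C(1) x(1)])
  note Fa = free_left_module[OF G, of a]
  obtain b :: nat and g where g: "\<And>j. j < b \<Longrightarrow> g j \<in> {c \<in> carrier (free ?G a). comb C a x c = \<zero>\<^bsub>C\<^esub>}"
    "span ?G (free ?G a) (g ` {..<b}) = {c \<in> carrier (free ?G a). comb C a x c = \<zero>\<^bsub>C\<^esub>}"
    by (rule submodule_generators[OF Fa fin_len_free[OF G noeth] submodule_kernel[OF Fa C(1) d0] that])
  hence gF: "g j \<in> carrier (free ?G a)" if "j < b" for j using that by blast
  note Fb = free_left_module[OF G, of b]
  let ?d1 = "comb (free ?G a) b g"
  have d1: "?d1 \<in> mod_hom ?G (free ?G b) (free ?G a)" by (rule comb_hom[OF Fa gF])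
  define L where "L = {c \<in> carrier (free ?G b). ?d1 c = \<zero>\<^bsub>free ?G a\<^esub>}"
  have L: "submodule L ?G (free ?G b)" unfolding L_def by (rule submodule_kernel[OF Fb Fa d1])
  let ?L = "(free ?G b)\<lparr>carrier := L\<rparr>"
  note lL = submodule_left_module[OF Fb L]
  obtain l :: nat and c where c: "\<And>t. t < l \<Longrightarrow> c t \<in> L" "span ?G (free ?G b) (c ` {..<l}) = L"
    by (rule submodule_generators[OF Fb fin_len_free[OF G noeth] L that])
  note cF = submodule_mem[OF L c(1)]
  let ?Mb = "copies M b" and ?Ml = "copies M l"
  note lMb = copies_left_module[OF M, of b] and lMl = copies_left_module[OF M, of l]
  \<comment> \<open>\<open>h\<close> stacks finitely many generators of L into one map M^b -> M^l.
    All maps in L vanish on its kernel (fact \<open>kill\<close>) and therefore descend to its image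
    Y.\<close>
  define h where "h v = (\<lambda>t\<in>{..<l}. comb ?N b v (c t))" for v
  have h: "h \<in> mod_hom B ?Mb ?Ml"
    unfolding h_def by (rule mod_hom_dsumI[OF lMb comb_End_mod_hom[OF M cF]]) simp
  define Y where "Y = h ` carrier ?Mb"
  have Y: "submodule Y B ?Ml" unfolding Y_def by (rule submodule_image[OF lMb lMl h submodule_carrier[OF lMb]])
  let ?Y = "?Ml\<lparr>carrier := Y\<rparr>"
  note lY = submodule_left_module[OF lMl Y]
  have hY: "h \<in> mod_hom B ?Mb ?Y" using h by (subst mod_hom_submodule_iff[OF _ Y]) (auto simp: Y_def simp del: dsum_simps)
  have hYs: "h ` carrier ?Mb = carrier ?Y" by (simp add: Y_def)
  obtain k i p where ip: "i \<in> mod_hom B ?Y (copies M k)" "p \<in> mod_hom B (copies M k) ?Y" "\<And>y. y \<in> carrier ?Y \<Longrightarrow> p (i y) = y"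
    using sub[OF Y] unfolding retract_def by blast
  let ?Mk = "copies M k"
  note lMk = copies_left_module[OF M, of k]
  have vN: "v j \<in> carrier ?N" if "v \<in> carrier (copies M n)" "j < n" for v j n using that by auto
  have kill: "comb ?N b v d = \<zero>\<^bsub>M\<^esub>" if v: "v \<in> carrier ?Mb" and hv: "h v = \<zero>\<^bsub>?Y\<^esub>" and d: "d \<in> L" for v d
  proof -
    have psi: "comb ?N b v \<in> mod_hom ?G (free ?G b) ?N" by (rule comb_hom[OF lN vN[OF v]])
    have "comb ?N b v (c t) = \<zero>\<^bsub>M\<^esub>" if "t < l" for t using fun_cong[OF hv, of t] that by (simp add: h_def)
    hence "c ` {..<l} \<subseteq> {d \<in> carrier (free ?G b). comb ?N b v d = \<zero>\<^bsub>?N\<^esub>}" using cF by (simp add: image_subset_iff)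
    from span_least[OF submodule_kernel[OF Fb lN psi] this] show ?thesis using d c(2) by auto
  qed
  have "\<exists>\<gamma>\<in>mod_hom B ?Y M. \<forall>v\<in>carrier ?Mb. \<gamma> (h v) = comb ?N b v d" if d: "d \<in> L" for d
    by (rule factor_through_surjection[OF lMb lY M hY hYs comb_End_mod_hom[OF M submodule_mem[OF L d]] kill[OF _ _ d]])
  then obtain \<gamma> where \<gamma>: "\<And>d. d \<in> L \<Longrightarrow> \<gamma> d \<in> mod_hom B ?Y M"
    and \<gamma>h: "\<And>d v. \<lbrakk>d \<in> L; v \<in> carrier ?Mb\<rbrakk> \<Longrightarrow> \<gamma> d (h v) = comb ?N b v d" by metis
  have \<gamma>2: "(\<lambda>d. \<gamma> d y) \<in> mod_hom ?G ?L ?N" if y: "y \<in> carrier ?Y" for y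
  proof -
    obtain v where v: "v \<in> carrier ?Mb" "y = h v" using y unfolding hYs[symmetric] by blast
    have "comb ?N b v \<in> mod_hom ?G ?L ?N"
      by (rule mod_hom_restrict_submodule[OF comb_hom[OF lN vN[OF v(1)]] L])
    thus ?thesis by (rule mod_hom_cong[OF lL]) (simp add: v(2) \<gamma>h[OF _ v(1)])
  qed
  \<comment> \<open>\<open>\<alpha>\<close> and \<open>\<beta>\<close> exhibit L = Hom(Y, M) as a
    retract of Hom(M^k, M) = \<Gamma>^k: the first precomposes with p, the second with i and
    h.\<close>
  define \<alpha> where "\<alpha> d = comps M k (\<lambda>w. \<gamma> d (p w))" for d
  have \<alpha>: "\<alpha> \<in> mod_hom ?G ?L (free ?G k)"
    unfolding \<alpha>_def by (rule comps_hom[OF M lL mod_hom_comp[OF ip(2) \<gamma>] \<gamma>2[OF mod_hom_closed[OF ip(2)]]]) simp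
  define \<beta> where "\<beta> d = comps M b (\<lambda>v. comb ?N k (i (h v)) d)" for d
  have ih: "(\<lambda>v. i (h v)) \<in> mod_hom B ?Mb ?Mk" by (rule mod_hom_comp[OF hY ip(1)])
  have \<beta>h: "(\<lambda>v. comb ?N k (i (h v)) d) \<in> mod_hom B ?Mb M" if "d \<in> carrier (free ?G k)" for d
    by (rule mod_hom_comp[OF ih comb_End_mod_hom[OF M that]])
  have \<beta>F: "\<beta> \<in> mod_hom ?G (free ?G k) (free ?G b)"
    unfolding \<beta>_def
    by (rule comps_hom[OF M free_left_module[OF G] \<beta>h comb_hom[OF lN vN[OF mod_hom_closed[OF ih]]]])
  have \<beta>c: "comb ?N b v (\<beta> d) = comb ?N k (i (h v)) d" if "d \<in> carrier (free ?G k)" "v \<in> carrier ?Mb" for d v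
    unfolding \<beta>_def by (rule comb_comps[OF M \<beta>h[OF that(1)] that(2)])
  \<comment> \<open>\<open>w s x\<close> lists the values at x of the s-th components of the
    generators g. A row d is killed by \<open>?d1\<close> exactly if its map M^b -> M kills all
    these vectors.\<close>
  define w where "w s x = (\<lambda>j\<in>{..<b}. g j s x)" for s x
  have w: "w s x \<in> carrier ?Mb" if "s < a" "x \<in> carrier M" for s x
  proof -
    have "g j s \<in> mod_hom B M M" if "j < b" for j using gF[OF that] \<open>s < a\<close> by auto
    thus ?thesis using mod_hom_closed[of _ B M M x] that by (simp add: w_def PiE_iff)
  qed
  have d1w: "?d1 d s x = comb ?N b (w s x) d" if d: "d \<in> carrier (free ?G b)" and sx: "s < a" "x \<in> carrier M" for d s x
  proof -
    have ev: "(\<lambda>e. e s x) \<in> mod_hom ?G (free ?G a) ?N"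
    proof (rule mod_hom_comp[OF dsum_proj[of s "{..<a}" ?G "\<lambda>_. reg ?G"]])
      show "(\<lambda>e. e x) \<in> mod_hom ?G (reg ?G) ?N"
        using sx by (intro mod_homI) (simp_all add: mod_hom_closed[of _ B M M])
    qed (simp add: sx)
    show ?thesis
    proof (rule free_hom_eqI[OF lN mod_hom_comp[OF d1 ev] comb_hom[OF lN vN[OF w[OF sx]]] _ d])
      fix j assume j: "j < b"
      show "?d1 (basis ?G b j) s x = comb ?N b (w s x) (basis ?G b j)"
      proof -
        have "comb ?N b (w s x) (basis ?G b j) = w s x j"
          by (rule comb_basis[OF lN _ j]) (rule vN[OF w[OF sx]])
        moreover have "?d1 (basis ?G b j) = g j" by (rule comb_basis[OF Fa _ j]) (rule gF)
        ultimately show ?thesis using j by (simp add: w_def)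
      qed
    qed
  qed
  have L_iff: "d \<in> L \<longleftrightarrow> (\<forall>s<a. \<forall>x\<in>carrier M. comb ?N b (w s x) d = \<zero>\<^bsub>M\<^esub>)" if d: "d \<in> carrier (free ?G b)" for d
  proof
    assume "d \<in> L"
    hence z: "?d1 d = \<zero>\<^bsub>free ?G a\<^esub>" by (simp add: L_def)
    show "\<forall>s<a. \<forall>x\<in>carrier M. comb ?N b (w s x) d = \<zero>\<^bsub>M\<^esub>"
      using d1w[OF d] unfolding z by simp
  next
    assume *: "\<forall>s<a. \<forall>x\<in>carrier M. comb ?N b (w s x) d = \<zero>\<^bsub>M\<^esub>"
    have c1: "?d1 d \<in> carrier (free ?G a)" by (rule mod_hom_closed[OF d1 d])
    have "?d1 d = \<zero>\<^bsub>free ?G a\<^esub>"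
    proof (rule extensionalityI[of _ "{..<a}"])
      fix s assume s: "s \<in> {..<a}"
      have "?d1 d s = (\<lambda>x\<in>carrier M. \<zero>\<^bsub>M\<^esub>)"
      proof (rule extensionalityI[of _ "carrier M"])
        show "?d1 d s \<in> extensional (carrier M)" using c1 s by (simp add: PiE_iff)
        fix x assume "x \<in> carrier M"
        thus "?d1 d s x = (\<lambda>x\<in>carrier M. \<zero>\<^bsub>M\<^esub>) x" using d1w[OF d] * s by simp
      qed simp
      thus "?d1 d s = \<zero>\<^bsub>free ?G a\<^esub> s" using s by simp
    qed (use c1 in \<open>simp_all add: PiE_iff\<close>)
    thus "d \<in> L" using d by (simp add: L_def)
  qed
  \<comment> \<open>The generators c of L kill \<open>w s x\<close>, hence so does h, and with it
    every map that factors through h.\<close>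
  have \<beta>L: "\<beta> d \<in> L" if d: "d \<in> carrier (free ?G k)" for d
    unfolding L_iff[OF mod_hom_closed[OF \<beta>F d]]
  proof (intro allI impI ballI)
    fix s x assume sx: "s < a" "x \<in> carrier M"
    have "comb ?N b (w s x) (c t) = \<zero>\<^bsub>M\<^esub>" if "t < l" for t
      using L_iff[OF cF[OF that]] c(1)[OF that] sx by blast
    hence "h (w s x) = \<zero>\<^bsub>?Y\<^esub>" by (simp add: h_def cong: restrict_cong)
    hence "i (h (w s x)) = \<zero>\<^bsub>?Mk\<^esub>" using mod_hom_zero[OF lY lMk ip(1)] by simp
    hence "comb ?N b (w s x) (\<beta> d) = comb ?N k \<zero>\<^bsub>?Mk\<^esub> d" using \<beta>c[OF d w[OF sx]] by simp
    also have "\<dots> = \<zero>\<^bsub>M\<^esub>" by (rule mod_hom_zero[OF lMk M comb_End_mod_hom[OF M d]])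
    finally show "comb ?N b (w s x) (\<beta> d) = \<zero>\<^bsub>M\<^esub>" .
  qed
  have \<beta>: "\<beta> \<in> mod_hom ?G (free ?G k) ?L"
    using \<beta>F \<beta>L by (subst mod_hom_submodule_iff[OF _ L]) (rule Pi_I)
  have "retract ?G ?L (free ?G k)"
  proof (rule retractI[OF \<alpha> \<beta>])
    fix d assume "d \<in> carrier ?L"
    hence d: "d \<in> L" by simp
    have \<alpha>d: "\<alpha> d \<in> carrier (free ?G k)" using mod_hom_closed[OF \<alpha>] d by simp
    show "\<beta> (\<alpha> d) = d"
      unfolding \<beta>_def
    proof (rule comps_eqI[OF M submodule_mem[OF L d]])
      fix v assume v: "v \<in> carrier ?Mb"
      have hv: "h v \<in> carrier ?Y" by (rule mod_hom_closed[OF hY v])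
      have "comb ?N k (i (h v)) (\<alpha> d) = \<gamma> d (p (i (h v)))"
        unfolding \<alpha>_def by (rule comb_comps[OF M mod_hom_comp[OF ip(2) \<gamma>[OF d]] mod_hom_closed[OF ip(1) hv]])
      thus "comb ?N k (i (h v)) (\<alpha> d) = comb ?N b v d" unfolding ip(3)[OF hv] \<gamma>h[OF d v] .
    qed
  qed
  hence pL: "fgproj ?G ?L" unfolding fgproj_def by (rule exI)
  have im1: "{e \<in> carrier (free ?G a). comb C a x e = \<zero>\<^bsub>C\<^esub>} = ?d1 ` carrier (free ?G b)"
    using comb_image[OF Fa gF] g(2) by simp
  have "short_res ?G C (free ?G a) (free ?G b) ?L (comb C a x) ?d1 (\<lambda>d. d)"
    unfolding short_res_def
  proof (intro conjI)
    show "(\<lambda>d. d) \<in> mod_hom ?G ?L (free ?G b)" by (rule mod_hom_restrict_submodule[OF mod_hom_id L])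
    show "{d \<in> carrier (free ?G b). ?d1 d = \<zero>\<^bsub>free ?G a\<^esub>} = (\<lambda>d. d) ` carrier ?L" by (simp add: L_def)
  qed (use C(1) Fa Fb lL d0 d1 x(2) im1 in simp_all)
  from proj_dim_le_2[OF this free_fgproj free_fgproj pL] show "proj_dim ?G C \<le> 2" .
qed

subsection \<open>Finite length of intervals of submodules\<close>

text \<open>Finite length of an interval, without the quotient module, whose carrier would have
  another type. Finite length is assembled by gluing intervals; the full interval gives
  \<open>fin_len\<close> back.\<close>

definition fin_int :: "('b, 'c) ring_scheme \<Rightarrow> ('b, 'm, 'd) module_scheme \<Rightarrow> 'm set \<Rightarrow> 'm set \<Rightarrow> bool"
  where "fin_int B M L H \<longleftrightarrow> (\<exists>r :: 'm set \<Rightarrow> nat. \<forall>U V. submodule U B M \<longrightarrow> submodule V B M \<longrightarrow>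
    L \<subseteq> U \<longrightarrow> U \<subset> V \<longrightarrow> V \<subseteq> H \<longrightarrow> r U < r V)"

lemma fin_intE:
  assumes "fin_int B M L H"
  obtains r :: "'m set \<Rightarrow> nat" where
    "\<And>U V. \<lbrakk>submodule U B M; submodule V B M; L \<subseteq> U; U \<subset> V; V \<subseteq> H\<rbrakk> \<Longrightarrow> r U < r V"
proof -
  obtain r :: "'m set \<Rightarrow> nat" where r: "\<forall>U V. submodule U B M \<longrightarrow> submodule V B M \<longrightarrow>
    L \<subseteq> U \<longrightarrow> U \<subset> V \<longrightarrow> V \<subseteq> H \<longrightarrow> r U < r V"
    using assms unfolding fin_int_def by blast
  show ?thesis by (rule that[of r]) (simp add: r)
qed

text \<open>Rank 0 at the bottom and 1 elsewhere. The condition covers simple quotients and the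
  degenerate interval L = H alike.\<close>

lemma fin_int_simple:
  assumes "\<And>U. \<lbrakk>submodule U B M; L \<subset> U; U \<subseteq> H\<rbrakk> \<Longrightarrow> U = H"
  shows "fin_int B M L H"
  unfolding fin_int_def
proof (intro exI[of _ "\<lambda>U. if U = L then 0 else 1"] allI impI)
  fix U V assume UV: "submodule U B M" "submodule V B M" "L \<subseteq> U" "U \<subset> V" "V \<subseteq> H"
  have "U = L"
  proof (rule ccontr)
    assume "U \<noteq> L"
    hence "U = H" using assms[of U] UV by blast
    thus False using UV by blast
  qed
  thus "(if U = L then 0 else 1) < (if V = L then 0 else 1 :: nat)" using UV by auto
qed

text \<open>The rank of U is that of U \<inter> K in the lower interval plus that of U + K in the
  upper one. By the modular law a strict inclusion changes at least one of the two.\<close>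

lemma fin_int_trans:
  assumes M: "left_module B M" and K: "submodule K B M" and LK: "L \<subseteq> K" "K \<subseteq> H" and H: "submodule H B M"
    and "fin_int B M L K" "fin_int B M K H"
  shows "fin_int B M L H"
proof -
  interpret M: left_module B M by fact
  obtain r where r: "\<And>U V. \<lbrakk>submodule U B M; submodule V B M; L \<subseteq> U; U \<subset> V; V \<subseteq> K\<rbrakk> \<Longrightarrow> r U < (r V :: nat)"
    using fin_intE[OF assms(6)] by blast
  obtain s where s: "\<And>U V. \<lbrakk>submodule U B M; submodule V B M; K \<subseteq> U; U \<subset> V; V \<subseteq> H\<rbrakk> \<Longrightarrow> s U < (s V :: nat)"
    using fin_intE[OF assms(7)] by blast
  have "r (U \<inter> K) + s (U <+>\<^bsub>M\<^esub> K) < r (V \<inter> K) + s (V <+>\<^bsub>M\<^esub> K)"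
    if U: "submodule U B M" and V: "submodule V B M" and UV: "L \<subseteq> U" "U \<subset> V" "V \<subseteq> H" for U V
  proof -
    note up = submodule_set_add_upper[OF M U K] submodule_set_add_upper[OF M V K]
    have 1: "U \<inter> K \<subseteq> V \<inter> K" using UV by blast
    have 2: "U <+>\<^bsub>M\<^esub> K \<subseteq> V <+>\<^bsub>M\<^esub> K"
      by (rule set_add_least[OF submodule_set_add[OF M V K]]) (use UV up in auto)
    have 3: "V <+>\<^bsub>M\<^esub> K \<subseteq> H" by (rule set_add_least[OF H UV(3) LK(2)])
    have "U \<inter> K \<subset> V \<inter> K \<or> U <+>\<^bsub>M\<^esub> K \<subset> V <+>\<^bsub>M\<^esub> K"
    proof (rule ccontr)
      assume "\<not> ?thesis"
      hence eq: "U \<inter> K = V \<inter> K" "U <+>\<^bsub>M\<^esub> K = V <+>\<^bsub>M\<^esub> K" using 1 2 by auto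
      have "V \<subseteq> U"
      proof
        fix v assume v: "v \<in> V"
        hence "v \<in> U <+>\<^bsub>M\<^esub> K" using up eq by blast
        then obtain u k where uk: "u \<in> U" "k \<in> K" "v = u \<oplus>\<^bsub>M\<^esub> k" by (elim set_addE)
        have m: "u \<in> carrier M" "k \<in> carrier M" using uk submodule_mem[OF U] submodule_mem[OF K] by auto
        have "v \<ominus>\<^bsub>M\<^esub> u = k"
          using m uk(3) by (simp add: a_minus_def M.M.a_ac M.M.r_neg M.M.r_neg1 M.M.r_neg2)
        moreover have "v \<ominus>\<^bsub>M\<^esub> u \<in> V" using submodule_diff[OF V v] uk UV by blast
        ultimately have "k \<in> U" using uk eq(1) by blast
        thus "v \<in> U" using uk submodule_add[OF U] by simp
      qed
      thus False using UV by blast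
    qed
    moreover have "r (U \<inter> K) \<le> r (V \<inter> K)"
      using r[OF submodule_Int[OF M U K] submodule_Int[OF M V K]] 1 UV LK
      by (cases "U \<inter> K = V \<inter> K") (auto simp: psubset_eq intro: less_imp_le)
    moreover have "s (U <+>\<^bsub>M\<^esub> K) \<le> s (V <+>\<^bsub>M\<^esub> K)"
      using s[OF submodule_set_add[OF M U K] submodule_set_add[OF M V K]] 2 3 up
      by (cases "U <+>\<^bsub>M\<^esub> K = V <+>\<^bsub>M\<^esub> K") (auto simp: psubset_eq intro: less_imp_le)
    moreover have "U \<inter> K \<subset> V \<inter> K \<Longrightarrow> r (U \<inter> K) < r (V \<inter> K)"
      using r[OF submodule_Int[OF M U K] submodule_Int[OF M V K]] UV LK by blast
    moreover have "U <+>\<^bsub>M\<^esub> K \<subset> V <+>\<^bsub>M\<^esub> K \<Longrightarrow> s (U <+>\<^bsub>M\<^esub> K) < s (V <+>\<^bsub>M\<^esub> K)"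
      using s[OF submodule_set_add[OF M U K] submodule_set_add[OF M V K] up(2)] 3 by blast
    ultimately show ?thesis by linarith
  qed
  thus ?thesis unfolding fin_int_def by (intro exI[of _ "\<lambda>U. r (U \<inter> K) + s (U <+>\<^bsub>M\<^esub> K)"]) blast
qed

lemma fin_int_imp_fin_len:
  assumes "fin_int B M {\<zero>\<^bsub>M\<^esub>} (carrier M)" shows "fin_len B M"
proof -
  obtain r where "\<And>U V. \<lbrakk>submodule U B M; submodule V B M; {\<zero>\<^bsub>M\<^esub>} \<subseteq> U; U \<subset> V; V \<subseteq> carrier M\<rbrakk> \<Longrightarrow> r U < (r V :: nat)"
    using fin_intE[OF assms] by blast
  hence "r U < r V" if "submodule U B M" "submodule V B M" "U \<subset> V" for U V
    using that submodule_zero[OF that(1)] submodule_subset[OF that(2)] by blast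
  thus ?thesis unfolding fin_len_def by blast
qed

text \<open>Zorn's lemma. With x = 1 in a ring it yields maximal ideals; with x outside m I it
  yields the hyperplanes that replace linear algebra in I / m I.\<close>

lemma maximal_submodule_avoiding:
  assumes M: "left_module B M" and U: "submodule U B M" and x: "x \<notin> U"
  obtains W where "submodule W B M" "U \<subseteq> W" "x \<notin> W" "\<And>V. \<lbrakk>submodule V B M; W \<subset> V\<rbrakk> \<Longrightarrow> x \<in> V"
proof -
  interpret M: left_module B M by fact
  let ?A = "{W. submodule W B M \<and> U \<subseteq> W \<and> x \<notin> W}"
  have "\<exists>W\<in>?A. \<forall>V\<in>?A. W \<subseteq> V \<longrightarrow> V = W"
  proof (rule subset_Zorn_nonempty)
    show "?A \<noteq> {}" using U x by blast
    fix C assume ne: "C \<noteq> {}" and ch: "subset.chain ?A C"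
    have C: "W \<in> C \<Longrightarrow> submodule W B M" "W \<in> C \<Longrightarrow> U \<subseteq> W" "W \<in> C \<Longrightarrow> x \<notin> W" for W
      using ch by (auto simp: subset.chain_def)
    have "submodule (\<Union>C) B M"
    proof (rule M.submoduleI)
      show "\<Union>C \<subseteq> carrier M" using submodule_mem[OF C(1)] by blast
      show "\<zero>\<^bsub>M\<^esub> \<in> \<Union>C" using submodule_zero[OF C(1)] ne by blast
      show "a \<odot>\<^bsub>M\<^esub> y \<in> \<Union>C" if "a \<in> carrier B" "y \<in> \<Union>C" for a y
        using that submodule_smult[OF C(1)] by blast
      fix y z assume "y \<in> \<Union>C" "z \<in> \<Union>C"
      then obtain V W where VW: "V \<in> C" "W \<in> C" "y \<in> V" "z \<in> W" by blast
      hence "V \<subseteq> W \<or> W \<subseteq> V" using ch by (auto simp: subset.chain_def)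
      thus "y \<oplus>\<^bsub>M\<^esub> z \<in> \<Union>C" using VW submodule_add[OF C(1)] by blast
    qed
    thus "\<Union>C \<in> ?A" using ne C(2,3) by blast
  qed
  then obtain W where W0: "W \<in> ?A" and W1: "\<forall>V\<in>?A. W \<subseteq> V \<longrightarrow> V = W" by (elim bexE)
  have W: "submodule W B M" "U \<subseteq> W" "x \<notin> W" using W0 by simp_all
  have "x \<in> V" if V: "submodule V B M" "W \<subset> V" for V
  proof (rule ccontr)
    assume "x \<notin> V"
    hence "V \<in> ?A" using V W(2) by auto
    hence "V = W" using W1 V(2) by auto
    thus False using V(2) by simp
  qed
  thus ?thesis using that[OF W] by simp
qed

lemma submodule_cyclic:
  assumes M: "left_module B M" and y: "y \<in> carrier M"
  shows "submodule {c \<odot>\<^bsub>M\<^esub> y | c. c \<in> carrier B} B M"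
proof -
  have "submodule ((\<lambda>c. c \<odot>\<^bsub>M\<^esub> y) ` carrier (reg B)) B M"
    using submodule_image[OF reg_left_module M mod_hom_reg[OF M y] submodule_carrier[OF reg_left_module]]
      left_module_ring[OF M] by blast
  moreover have "(\<lambda>c. c \<odot>\<^bsub>M\<^esub> y) ` carrier (reg B) = {c \<odot>\<^bsub>M\<^esub> y | c. c \<in> carrier B}" by auto
  ultimately show ?thesis by simp
qed

subsection \<open>Commutative artinian rings\<close>

text \<open>Maximality in the form in which it is used: every r outside m has an explicit inverse s
  modulo m. The order-theoretic form is recovered in \<open>max_id_iff_maximalideal\<close>.\<close>

definition max_id :: "('r, 'c) ring_scheme \<Rightarrow> 'r set \<Rightarrow> bool"
  where "max_id R m \<longleftrightarrow> submodule m R (reg R) \<and> \<one>\<^bsub>R\<^esub> \<notin> m \<and>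
    (\<forall>r\<in>carrier R - m. \<exists>s\<in>carrier R. \<exists>a\<in>m. s \<otimes>\<^bsub>R\<^esub> r \<oplus>\<^bsub>R\<^esub> a = \<one>\<^bsub>R\<^esub>)"

context cring
begin

lemma reg_module: "left_module R (reg R)"
  by (rule reg_left_module) (rule ring_axioms)

lemma ideal_mem: "submodule I R (reg R) \<Longrightarrow> a \<in> I \<Longrightarrow> a \<in> carrier R"
  using submodule_mem[of I R "reg R" a] by simp

lemma ideal_add: "submodule I R (reg R) \<Longrightarrow> a \<in> I \<Longrightarrow> b \<in> I \<Longrightarrow> a \<oplus> b \<in> I"
  using submodule_add[of I R "reg R" a b] by simp

lemma ideal_mult: "submodule I R (reg R) \<Longrightarrow> a \<in> carrier R \<Longrightarrow> b \<in> I \<Longrightarrow> a \<otimes> b \<in> I"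
  using submodule_smult[of I R "reg R" a b] by simp

lemma ideal_mult_right: "submodule I R (reg R) \<Longrightarrow> a \<in> carrier R \<Longrightarrow> b \<in> I \<Longrightarrow> b \<otimes> a \<in> I"
  using ideal_mult[of I a b] ideal_mem[of I b] by (simp add: m_comm)

lemma ideal_one: "submodule I R (reg R) \<Longrightarrow> \<one> \<in> I \<Longrightarrow> I = carrier R"
  using ideal_mult_right[of I _ \<one>] ideal_mem[of I] by auto

lemma submodule_reg_iff_ideal: "submodule I R (reg R) \<longleftrightarrow> ideal I R"
proof
  assume I: "submodule I R (reg R)"
  have "subgroup I (add_monoid R)"
  proof (rule subgroup.intro)
    show "I \<subseteq> carrier (add_monoid R)" using ideal_mem[OF I] by auto
    show "\<one>\<^bsub>add_monoid R\<^esub> \<in> I" using submodule_zero[OF I] by simp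
    show "a \<otimes>\<^bsub>add_monoid R\<^esub> b \<in> I" if "a \<in> I" "b \<in> I" for a b using ideal_add[OF I that] by simp
    show "inv\<^bsub>add_monoid R\<^esub> a \<in> I" if "a \<in> I" for a
      using ideal_mult[OF I _ that, of "\<ominus> \<one>"] ideal_mem[OF I that] by (simp add: l_minus flip: a_inv_def)
  qed
  thus "ideal I R"
    by (rule idealI[OF ring_axioms]) (simp_all add: ideal_mult[OF I] ideal_mult_right[OF I])
next
  interpret M: left_module R "reg R" by (rule reg_module)
  assume "ideal I R"
  then interpret I: ideal I R .
  show "submodule I R (reg R)"
    by (rule M.submoduleI) (use I.a_subset I.I_l_closed in auto)
qed

lemma max_id_I:
  assumes m: "submodule m R (reg R)" and 1: "\<one> \<notin> m"
    and max: "\<And>V. \<lbrakk>submodule V R (reg R); m \<subset> V\<rbrakk> \<Longrightarrow> \<one> \<in> V"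
  shows "max_id R m"
  unfolding max_id_def
proof (intro conjI ballI m 1)
  fix r assume r: "r \<in> carrier R - m"
  let ?C = "{c \<odot>\<^bsub>reg R\<^esub> r | c. c \<in> carrier R}"
  have C: "submodule ?C R (reg R)" using submodule_cyclic[OF reg_module, of r] r by simp
  have "r \<in> ?C" using r by (intro CollectI exI[of _ \<one>]) simp
  hence "m \<subset> ?C <+>\<^bsub>reg R\<^esub> m" using submodule_set_add_upper[OF reg_module C m] r by blast
  hence "\<one> \<in> ?C <+>\<^bsub>reg R\<^esub> m" by (intro max submodule_set_add[OF reg_module C m])
  then obtain s a where "s \<in> carrier R" "a \<in> m" "\<one> = s \<otimes> r \<oplus> a" by (auto elim!: set_addE)
  thus "\<exists>s\<in>carrier R. \<exists>a\<in>m. s \<otimes> r \<oplus> a = \<one>" by (intro bexI[of _ s] bexI[of _ a]) auto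
qed

lemma exists_max_id:
  assumes "submodule I R (reg R)" "\<one> \<notin> I"
  shows "\<exists>m. max_id R m \<and> I \<subseteq> m"
proof -
  obtain W where W: "submodule W R (reg R)" "I \<subseteq> W" "\<one> \<notin> W" "\<And>V. \<lbrakk>submodule V R (reg R); W \<subset> V\<rbrakk> \<Longrightarrow> \<one> \<in> V"
    using maximal_submodule_avoiding[OF reg_module assms] by blast
  thus ?thesis using max_id_I[OF W(1,3,4)] by blast
qed

lemma max_idD:
  assumes "max_id R m"
  shows "submodule m R (reg R)" "\<one> \<notin> m"
    "\<And>r. \<lbrakk>r \<in> carrier R; r \<notin> m\<rbrakk> \<Longrightarrow> \<exists>s\<in>carrier R. \<exists>a\<in>m. s \<otimes> r \<oplus> a = \<one>"
  using assms by (auto simp: max_id_def)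

lemma max_id_maximal:
  assumes m: "max_id R m" and V: "submodule V R (reg R)" "m \<subset> V"
  shows "V = carrier R"
proof -
  obtain r where r: "r \<in> V" "r \<notin> m" using V(2) by blast
  obtain s a where "s \<in> carrier R" "a \<in> m" "s \<otimes> r \<oplus> a = \<one>"
    using max_idD(3)[OF m ideal_mem[OF V(1) r(1)] r(2)] by blast
  hence "\<one> \<in> V" using ideal_add[OF V(1) ideal_mult[OF V(1) _ r(1)], of s a] V(2) by auto
  thus ?thesis by (rule ideal_one[OF V(1)])
qed

lemma max_id_prime:
  assumes m: "max_id R m" and "a \<in> carrier R" "b \<in> carrier R" "a \<otimes> b \<in> m" "a \<notin> m"
  shows "b \<in> m"
proof -
  obtain s p where sp: "s \<in> carrier R" "p \<in> m" "s \<otimes> a \<oplus> p = \<one>" using max_idD(3)[OF m assms(2,5)] by blast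
  note I = max_idD(1)[OF m]
  have "b = (s \<otimes> a \<oplus> p) \<otimes> b" using sp assms by simp
  also have "\<dots> = s \<otimes> (a \<otimes> b) \<oplus> p \<otimes> b" using sp(1) ideal_mem[OF I sp(2)] assms by (simp add: l_distr m_assoc)
  also have "\<dots> \<in> m"
    by (rule ideal_add[OF I ideal_mult[OF I sp(1) assms(4)] ideal_mult_right[OF I assms(3) sp(2)]])
  finally show ?thesis .
qed

lemma max_id_iff_maximalideal: "max_id R m \<longleftrightarrow> maximalideal m R"
proof
  assume m: "max_id R m"
  show "maximalideal m R"
  proof (rule maximalidealI)
    show "ideal m R" using max_idD(1)[OF m] submodule_reg_iff_ideal by blast
    show "carrier R \<noteq> m" using max_idD(2)[OF m] by auto
    show "J = m \<or> J = carrier R" if "ideal J R" "m \<subseteq> J" "J \<subseteq> carrier R" for J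
      using max_id_maximal[OF m, of J] that submodule_reg_iff_ideal by blast
  qed
next
  assume "maximalideal m R"
  then interpret m: maximalideal m R .
  have s: "submodule m R (reg R)" using submodule_reg_iff_ideal m.is_ideal by blast
  show "max_id R m"
  proof (rule max_id_I[OF s])
    show "\<one> \<notin> m" using ideal_one[OF s] m.I_notcarr by blast
    show "\<one> \<in> V" if "submodule V R (reg R)" "m \<subset> V" for V
      using m.I_maximal[of V] that submodule_reg_iff_ideal ideal_mem[OF that(1)] by blast
  qed
qed

lemma rad_iff: "a \<in> rad R \<longleftrightarrow> a \<in> carrier R \<and> (\<forall>m. max_id R m \<longrightarrow> a \<in> m)"
  by (auto simp: rad_def max_id_iff_maximalideal)

lemma rad_ideal: "ideal (rad R) R"
proof -
  interpret M: left_module R "reg R" by (rule reg_module)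
  have "submodule (rad R) R (reg R)"
    by (rule M.submoduleI)
      (auto simp: rad_iff max_idD(1) ideal_add ideal_mult submodule_zero[of _ R "reg R", simplified] dest: max_idD(1))
  thus ?thesis using submodule_reg_iff_ideal by blast
qed

end

text \<open>The minimum condition: without a minimal ideal, iterating a choice of smaller ideals
  gives a chain that never becomes stationary.\<close>

lemma (in cring) artinian_minimal:
  assumes art: "artinian_cring R" and "submodule I R (reg R)" "P I"
  shows "\<exists>I. submodule I R (reg R) \<and> P I \<and> (\<forall>J. submodule J R (reg R) \<and> J \<subset> I \<longrightarrow> \<not> P J)"
proof (rule ccontr)
  assume neg: "\<not> ?thesis"
  let ?Q = "\<lambda>I. submodule I R (reg R) \<and> P I"
  have "\<forall>I. \<exists>J. ?Q I \<longrightarrow> ?Q J \<and> J \<subset> I" using neg by blast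
  then obtain f where f: "\<And>I. ?Q I \<Longrightarrow> ?Q (f I) \<and> f I \<subset> I" by metis
  define c where "c k = (f ^^ k) I" for k
  have Q: "?Q (c k)" for k by (induction k) (use assms f in \<open>auto simp: c_def\<close>)
  have dec: "c (Suc k) \<subset> c k" for k using f[OF Q[of k]] by (simp add: c_def)
  have "\<forall>k. ideal (c k) R \<and> c (Suc k) \<subseteq> c k" using Q dec submodule_reg_iff_ideal by blast
  then obtain m where "\<forall>k\<ge>m. c k = c m" using art unfolding artinian_cring_def by blast
  thus False using dec[of m] by (metis le_SucI order_refl psubset_eq)
qed

section \<open>Products of ideals and Hopkins' theorem\<close>

definition id_prod :: "('r, 'c) ring_scheme \<Rightarrow> 'r set \<Rightarrow> 'r set \<Rightarrow> 'r set"
  where "id_prod R I J = span R (reg R) {a \<otimes>\<^bsub>R\<^esub> b | a b. a \<in> I \<and> b \<in> J}"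

context cring
begin

lemma id_prod_submodule:
  "\<lbrakk>submodule I R (reg R); submodule J R (reg R)\<rbrakk> \<Longrightarrow> submodule (id_prod R I J) R (reg R)"
  unfolding id_prod_def by (rule span_submodule[OF reg_module]) (auto simp: ideal_mem)

lemma id_prod_mem: "\<lbrakk>a \<in> I; b \<in> J\<rbrakk> \<Longrightarrow> a \<otimes> b \<in> id_prod R I J"
  unfolding id_prod_def using span_upper[of "{a \<otimes> b | a b. a \<in> I \<and> b \<in> J}" R "reg R"] by blast

lemma id_prod_least:
  "\<lbrakk>submodule W R (reg R); \<And>a b. \<lbrakk>a \<in> I; b \<in> J\<rbrakk> \<Longrightarrow> a \<otimes> b \<in> W\<rbrakk> \<Longrightarrow> id_prod R I J \<subseteq> W"
  unfolding id_prod_def by (rule span_least) auto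

lemma id_prod_le: "\<lbrakk>submodule I R (reg R); submodule J R (reg R)\<rbrakk> \<Longrightarrow> id_prod R I J \<subseteq> I"
  "\<lbrakk>submodule I R (reg R); submodule J R (reg R)\<rbrakk> \<Longrightarrow> id_prod R I J \<subseteq> J"
  by (rule id_prod_least; auto intro: ideal_mult ideal_mult_right ideal_mem)+

end

text \<open>Passing to a quotient \<open>I / m I\<close>, a vector space over \<open>R / m\<close>, hyperplanes are maximal submodules
  avoiding a vector.\<close>

lemma (in cring) fin_int_id_prod_max:
  assumes art: "artinian_cring R" and m: "max_id R m" and I: "submodule I R (reg R)"
  shows "fin_int R (reg R) (id_prod R m I) I"
proof -
  note M = reg_module
  interpret M: left_module R "reg R" by (rule M)
  note ms = max_idD(1)[OF m]
  let ?J = "id_prod R m I"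
  have J: "submodule ?J R (reg R)" by (rule id_prod_submodule[OF ms I])
  have JI: "?J \<subseteq> I" by (rule id_prod_le(2)[OF ms I])
  have "fin_int R (reg R) I I" by (rule fin_int_simple) blast
  \<comment> \<open>W is minimal among the ideals between \<open>?J\<close> and I above which I has
    finite length; the aim is W = \<open>?J\<close>.\<close>
  hence "\<exists>W. submodule W R (reg R) \<and> (?J \<subseteq> W \<and> W \<subseteq> I \<and> fin_int R (reg R) W I) \<and>
    (\<forall>V. submodule V R (reg R) \<and> V \<subset> W \<longrightarrow> \<not> (?J \<subseteq> V \<and> V \<subseteq> I \<and> fin_int R (reg R) V I))"
    by (intro artinian_minimal[OF art I]) (use JI in blast)
  then obtain W where W: "submodule W R (reg R)" "?J \<subseteq> W" "W \<subseteq> I" "fin_int R (reg R) W I"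
    and min: "\<And>V. \<lbrakk>submodule V R (reg R); V \<subset> W; ?J \<subseteq> V; V \<subseteq> I\<rbrakk> \<Longrightarrow> \<not> fin_int R (reg R) V I" by blast
  have "W = ?J"
  proof (rule ccontr)
    assume "W \<noteq> ?J"
    then obtain x where x: "x \<in> W" "x \<notin> ?J" using W(2) by blast
    obtain H where H: "submodule H R (reg R)" "?J \<subseteq> H" "x \<notin> H" "\<And>V. \<lbrakk>submodule V R (reg R); H \<subset> V\<rbrakk> \<Longrightarrow> x \<in> V"
      using maximal_submodule_avoiding[OF M J x(2)] by blast
    \<comment> \<open>Modulo H, an element y of W outside H and the vector x are multiples of each
      other: a coefficient r in m would send y into m I, so r is invertible modulo m. Thus H
      \<inter> W has codimension one in W, which contradicts the minimality of W.\<close>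
    have hyper: "\<exists>w\<in>H. \<exists>r\<in>carrier R. \<exists>s\<in>carrier R. \<exists>w'\<in>H. x = w \<oplus> r \<otimes> y \<and> y = s \<otimes> x \<oplus> w'"
      if y: "y \<in> W" "y \<notin> H" for y
    proof -
      have yc: "y \<in> carrier R" and xc: "x \<in> carrier R" using ideal_mem[OF W(1)] x y by auto
      let ?C = "{c \<odot>\<^bsub>reg R\<^esub> y | c. c \<in> carrier R}"
      have C: "submodule ?C R (reg R)" using submodule_cyclic[OF M, of y] yc by simp
      have "y \<in> ?C" using yc by (intro CollectI exI[of _ \<one>]) simp
      hence "H \<subset> H <+>\<^bsub>reg R\<^esub> ?C" using submodule_set_add_upper[OF M H(1) C] y by blast
      hence "x \<in> H <+>\<^bsub>reg R\<^esub> ?C" by (intro H(4) submodule_set_add[OF M H(1) C])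
      then obtain w r where wr: "w \<in> H" "r \<in> carrier R" "x = w \<oplus> r \<otimes> y" by (auto elim!: set_addE)
      have wc: "w \<in> carrier R" by (rule ideal_mem[OF H(1) wr(1)])
      have "r \<notin> m"
      proof
        assume "r \<in> m"
        hence "r \<otimes> y \<in> H" using id_prod_mem[of r m y I] y W(3) H(2) by blast
        thus False using wr H(3) ideal_add[OF H(1)] by blast
      qed
      then obtain s a where sa: "s \<in> carrier R" "a \<in> m" "s \<otimes> r \<oplus> a = \<one>" using max_idD(3)[OF m wr(2)] by blast
      have ac: "a \<in> carrier R" by (rule ideal_mem[OF ms sa(2)])
      have aH: "a \<otimes> y \<in> H" using id_prod_mem[OF sa(2), of y I] y W(3) H(2) by blast
      have "s \<otimes> x = s \<otimes> w \<oplus> s \<otimes> r \<otimes> y" using wr sa(1) wc yc by (simp add: r_distr m_assoc)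
      hence "s \<otimes> x \<oplus> (a \<otimes> y \<ominus> s \<otimes> w) = (s \<otimes> r \<oplus> a) \<otimes> y"
        using wr sa(1) wc yc ac by (simp add: l_distr a_minus_def a_ac r_neg r_neg1 r_neg2)
      hence "y = s \<otimes> x \<oplus> (a \<otimes> y \<ominus> s \<otimes> w)" using sa(3) yc by simp
      moreover have "a \<otimes> y \<ominus> s \<otimes> w \<in> H"
      proof -
        have "\<ominus> (s \<otimes> w) = (\<ominus> s) \<otimes> w" using sa(1) wc by (simp add: l_minus)
        thus ?thesis unfolding a_minus_def using aH ideal_mult[OF H(1) _ wr(1), of "\<ominus> s"] sa(1) by (simp add: ideal_add[OF H(1)])
      qed
      ultimately show ?thesis using wr sa(1) by blast
    qed
    let ?V = "H \<inter> W"
    have V: "submodule ?V R (reg R)" by (rule submodule_Int[OF M H(1) W(1)])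
    have "fin_int R (reg R) ?V W"
    proof (rule fin_int_simple)
      fix U assume U: "submodule U R (reg R)" "?V \<subset> U" "U \<subseteq> W"
      obtain y where y: "y \<in> U" "y \<notin> H" using U by blast
      have yW: "y \<in> W" using y U by blast
      obtain w r where wr: "w \<in> H" "r \<in> carrier R" "x = w \<oplus> r \<otimes> y" using hyper[OF yW y(2)] by blast
      have c: "w \<in> carrier R" "y \<in> carrier R" "x \<in> carrier R" using ideal_mem[OF H(1)] ideal_mem[OF W(1)] wr yW x by auto
      have "w = x \<oplus> (\<ominus> r) \<otimes> y" using wr c by (simp add: l_minus a_assoc r_neg)
      hence "w \<in> W" using x yW wr(2) ideal_add[OF W(1)] ideal_mult[OF W(1), of "\<ominus> r" y] by simp
      hence "w \<in> U" using wr(1) U by blast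
      hence xU: "x \<in> U" unfolding wr(3) by (intro ideal_add[OF U(1)] ideal_mult[OF U(1) wr(2) y(1)])
      have "z \<in> U" if z: "z \<in> W" for z
      proof (cases "z \<in> H")
        case True thus ?thesis using z U by blast
      next
        case False
        obtain s w' where sw: "s \<in> carrier R" "w' \<in> H" "z = s \<otimes> x \<oplus> w'" using hyper[OF z False] by blast
        have c': "w' \<in> carrier R" "z \<in> carrier R" using ideal_mem[OF H(1)] ideal_mem[OF W(1)] sw z by auto
        have "w' = z \<oplus> (\<ominus> s) \<otimes> x" using sw(1,3) c' c by (simp add: l_minus a_ac r_neg r_neg1 r_neg2)
        hence "w' \<in> W" using z x sw(1) ideal_add[OF W(1)] ideal_mult[OF W(1), of "\<ominus> s" x] by simp
        hence "w' \<in> U" using sw(2) U by blast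
        thus "z \<in> U" unfolding sw(3) by (intro ideal_add[OF U(1)] ideal_mult[OF U(1) sw(1) xU])
      qed
      thus "U = W" using U(3) by blast
    qed
    from fin_int_trans[OF M W(1) _ W(3) I this W(4)] have "fin_int R (reg R) ?V I" by blast
    moreover have "?V \<subset> W" using x H(3) by blast
    ultimately show False using min[OF V] H(2) W(2,3) by blast
  qed
  thus ?thesis using W(4) by simp
qed

text \<open>Hopkins' theorem: take the least ideal \<open>I\<close> with \<open>R / I\<close> of finite length. Then \<open>m I = I\<close> for all
  maximal \<open>m\<close>, and an ideal \<open>J\<close> minimal with \<open>J I \<noteq> 0\<close> contradicts Nakayama's lemma.\<close>

lemma (in cring) artinian_fin_len:
  assumes art: "artinian_cring R" shows "fin_len R (reg R)"
proof -
  note M = reg_module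
  interpret M: left_module R "reg R" by (rule M)
  have C: "submodule (carrier R) R (reg R)" using submodule_carrier[OF M] by simp
  have "fin_int R (reg R) (carrier R) (carrier R)" by (rule fin_int_simple) blast
  from artinian_minimal[OF art C, of "\<lambda>I. fin_int R (reg R) I (carrier R)", OF this]
  obtain I where I: "submodule I R (reg R)" "fin_int R (reg R) I (carrier R)"
    and min: "\<And>J. \<lbrakk>submodule J R (reg R); J \<subset> I\<rbrakk> \<Longrightarrow> \<not> fin_int R (reg R) J (carrier R)" by blast
  have Isub: "I \<subseteq> carrier R" using ideal_mem[OF I(1)] by blast
  \<comment> \<open>If m I were smaller than I, the finite length of I / m I would extend the finite
    interval above I downwards, against minimality.\<close>
  have mI: "id_prod R m I = I" if m: "max_id R m" for m
  proof (rule ccontr)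
    note ms = max_idD(1)[OF m]
    note J = id_prod_submodule[OF ms I(1)] and JI = id_prod_le(2)[OF ms I(1)]
    assume "id_prod R m I \<noteq> I"
    hence "id_prod R m I \<subset> I" using JI by blast
    from min[OF J this] fin_int_trans[OF M I(1) JI Isub C fin_int_id_prod_max[OF art m I(1)] I(2)] show False ..
  qed
  have "I = {\<zero>}"
  proof (rule ccontr)
    assume "I \<noteq> {\<zero>}"
    moreover have "\<zero> \<in> I" using submodule_zero[OF I(1)] by simp
    ultimately obtain b0 where b0: "b0 \<in> I" "b0 \<noteq> \<zero>" by blast
    let ?P = "\<lambda>J. \<exists>x\<in>J. \<exists>b\<in>I. x \<otimes> b \<noteq> \<zero>"
    have "?P (carrier R)" using b0 ideal_mem[OF I(1)] by (intro bexI[of _ \<one>] bexI[of _ b0]) auto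
    from artinian_minimal[OF art C, of ?P, OF this] obtain J where J: "submodule J R (reg R)" "?P J"
      and Jmin: "\<forall>K. submodule K R (reg R) \<and> K \<subset> J \<longrightarrow> \<not> ?P K" by (elim exE conjE)
    obtain x b where xb: "x \<in> J" "b \<in> I" "x \<otimes> b \<noteq> \<zero>" using J(2) by blast
    have xc: "x \<in> carrier R" by (rule ideal_mem[OF J(1) xb(1)])
    have h: "(\<lambda>z. z \<otimes> x) \<in> mod_hom R (reg R) (reg R)" using mod_hom_reg[OF M, of x] xc by simp
    \<comment> \<open>The annihilator of x is proper, so it lies in a maximal ideal m. The next goal
      is m x = J, which puts x into m x.\<close>
    let ?A = "{z \<in> carrier R. z \<otimes> x = \<zero>}"
    have A: "submodule ?A R (reg R)" using submodule_kernel[OF M M h] by simp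
    have "\<one> \<notin> ?A" using xc xb ideal_mem[OF I(1)] by auto
    then obtain m where m: "max_id R m" "?A \<subseteq> m" using exists_max_id[OF A] by blast
    note ms = max_idD(1)[OF m(1)]
    let ?K = "(\<lambda>z. z \<otimes> x) ` m"
    have K: "submodule ?K R (reg R)" by (rule submodule_image[OF M M h ms])
    have KJ: "?K \<subseteq> J" using ideal_mult[OF J(1) ideal_mem[OF ms] xb(1)] by blast
    \<comment> \<open>If m x I were zero, then m I, which equals I, would annihilate x, against x b
      \<noteq> 0. So m x is among the ideals for which J is minimal.\<close>
    have "?P ?K"
    proof (rule ccontr)
      assume neg: "\<not> ?P ?K"
      have "a \<otimes> b' \<in> ?A" if "a \<in> m" "b' \<in> I" for a b'
      proof -
        have c: "a \<in> carrier R" "b' \<in> carrier R" using that ideal_mem[OF ms] ideal_mem[OF I(1)] by auto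
        have "(a \<otimes> b') \<otimes> x = (a \<otimes> x) \<otimes> b'" using c xc by (simp add: m_ac)
        also have "\<dots> = \<zero>" using neg that by blast
        finally show ?thesis using c by simp
      qed
      hence "id_prod R m I \<subseteq> ?A" by (rule id_prod_least[OF A])
      hence "I \<subseteq> ?A" unfolding mI[OF m(1)] .
      hence "b \<otimes> x = \<zero>" using xb by blast
      thus False using xb xc ideal_mem[OF I(1) xb(2)] by (simp add: m_comm)
    qed
    hence "\<not> ?K \<subset> J" using spec[OF Jmin, of ?K] K by simp
    hence "?K = J" using KJ by blast
    then obtain a where a: "a \<in> m" "x = a \<otimes> x" using xb(1) by blast
    have ac: "a \<in> carrier R" by (rule ideal_mem[OF ms a(1)])
    \<comment> \<open>Nakayama's argument: x = a x with a in m puts 1 - a into the annihilator of x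
      and hence into m.\<close>
    have "(\<one> \<ominus> a) \<otimes> x = x \<ominus> a \<otimes> x" using ac xc by (simp add: a_minus_def l_distr l_minus)
    also have "\<dots> = \<zero>" using a(2) xc minus_eq_zero_iff[of x "a \<otimes> x"] ac by simp
    finally have "\<one> \<ominus> a \<in> m" using m(2) ac by blast
    from ideal_add[OF ms a(1) this] have "\<one> \<in> m" using ac by (simp add: add_minus_cancel)
    thus False using max_idD(2)[OF m(1)] by blast
  qed
  thus ?thesis using I(2) by (intro fin_int_imp_fin_len) simp
qed

subsection \<open>The injective envelope of the semisimple quotient\<close>

text \<open>\<open>injective\<close> tests modules of one carrier type; the data are carried to
  isomorphic copies of that type and the extension is carried back.\<close>

lemma injective_extend:
  fixes X :: "('r, 'x) module" and Y :: "('r, 'y) module" and E :: "('r, 'e) module"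
  assumes inj: "injective R E" and X: "fg_module R X" and Y: "fg_module R Y"
    and i: "i \<in> mod_hom R X Y" "inj_on i (carrier X)" and f: "f \<in> mod_hom R X E"
  shows "\<exists>g\<in>mod_hom R Y E. \<forall>x\<in>carrier X. g (i x) = f x"
proof -
  have lX: "left_module R X" and lY: "left_module R Y" using X Y by (auto simp: fg_module_def)
  obtain X' :: "'r fg_mod" where X': "fg_module R X'" "mod_iso R X X'" using fg_module_realised[OF X] by blast
  obtain Y' :: "'r fg_mod" where Y': "fg_module R Y'" "mod_iso R Y Y'" using fg_module_realised[OF Y] by blast
  obtain s where s: "s \<in> mod_hom R X X'" "bij_betw s (carrier X) (carrier X')" using X'(2) unfolding mod_iso_def by blast
  obtain t where t: "t \<in> mod_hom R Y Y'" "bij_betw t (carrier Y) (carrier Y')" using Y'(2) unfolding mod_iso_def by blast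
  let ?s = "the_inv_into (carrier X) s"
  note s' = mod_hom_inverse[OF lX s] and bs = bij_betw_the_inv_into[OF s(2)]
  have m: "?s x \<in> carrier X" if "x \<in> carrier X'" for x by (rule mod_hom_closed[OF s' that])
  have "inj_on (\<lambda>x. t (i (?s x))) (carrier X')"
  proof (rule inj_onI)
    fix x y assume x: "x \<in> carrier X'" and y: "y \<in> carrier X'" and e: "t (i (?s x)) = t (i (?s y))"
    have "i (?s x) = i (?s y)"
      by (rule inj_onD[OF bij_betw_imp_inj_on[OF t(2)] e mod_hom_closed[OF i(1) m[OF x]] mod_hom_closed[OF i(1) m[OF y]]])
    hence "?s x = ?s y" by (rule inj_onD[OF i(2) _ m[OF x] m[OF y]])
    thus "x = y" by (rule inj_onD[OF bij_betw_imp_inj_on[OF bs] _ x y])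
  qed
  moreover have "\<forall>i\<in>mod_hom R X' Y'. \<forall>f\<in>mod_hom R X' E. inj_on i (carrier X') \<longrightarrow>
      (\<exists>g\<in>mod_hom R Y' E. \<forall>x\<in>carrier X'. g (i x) = f x)"
    using inj X'(1) Y'(1) by (simp add: injective_def)
  from bspec[OF bspec[OF this mod_hom_comp[OF mod_hom_comp[OF s' i(1)] t(1)]] mod_hom_comp[OF s' f]]
  have "inj_on (\<lambda>x. t (i (?s x))) (carrier X') \<longrightarrow>
      (\<exists>g\<in>mod_hom R Y' E. \<forall>x\<in>carrier X'. g (t (i (?s x))) = f (?s x))" .
  ultimately have "\<exists>g\<in>mod_hom R Y' E. \<forall>x\<in>carrier X'. g (t (i (?s x))) = f (?s x)" by (rule rev_mp)
  then obtain g where g: "g \<in> mod_hom R Y' E" "\<forall>x\<in>carrier X'. g (t (i (?s x))) = f (?s x)" by (elim bexE)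
  show ?thesis
  proof (intro bexI[of _ "\<lambda>y. g (t y)"] ballI)
    fix x assume x: "x \<in> carrier X"
    have "?s (s x) = x" by (rule the_inv_into_f_f[OF bij_betw_imp_inj_on[OF s(2)] x])
    thus "g (t (i x)) = f x" using bspec[OF g(2) mod_hom_closed[OF s(1) x]] by simp
  qed (rule mod_hom_comp[OF t(1) g(1)])
qed

lemma quot_module_simps [simp]:
  "carrier (quot_module R I) = carrier (R Quot I)" "\<zero>\<^bsub>quot_module R I\<^esub> = I"
  "x \<oplus>\<^bsub>quot_module R I\<^esub> y = x \<oplus>\<^bsub>R Quot I\<^esub> y" "r \<odot>\<^bsub>quot_module R I\<^esub> x = (I +>\<^bsub>R\<^esub> r) \<otimes>\<^bsub>R Quot I\<^esub> x"
  by (simp_all add: quot_module_def ring.defs module.defs FactRing_def)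

text \<open>The embedding of cosets is replaced by its pullback \<epsilon> : R -> E with kernel rad
  R, so that arguments about E become calculations with ring elements. Essentiality turns into the
  last clause.\<close>

lemma injective_envelope_reg:
  fixes R :: "'r ring" and E :: "('r, 'e) module"
  assumes "cring R" and env: "injective_envelope R (quot_module R (rad R)) E"
  obtains \<epsilon> where "\<epsilon> \<in> mod_hom R (reg R) E" "\<And>a. a \<in> carrier R \<Longrightarrow> \<epsilon> a = \<zero>\<^bsub>E\<^esub> \<longleftrightarrow> a \<in> rad R"
    "\<And>U. \<lbrakk>submodule U R E; U \<noteq> {\<zero>\<^bsub>E\<^esub>}\<rbrakk> \<Longrightarrow> \<exists>a\<in>carrier R. \<epsilon> a \<in> U \<and> \<epsilon> a \<noteq> \<zero>\<^bsub>E\<^esub>"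
proof -
  interpret cring R by fact
  interpret I: ideal "rad R" R by (rule rad_ideal)
  let ?I = "rad R" and ?S = "quot_module R (rad R)"
  obtain \<iota> where \<iota>: "\<iota> \<in> mod_hom R ?S E" "inj_on \<iota> (carrier ?S)"
    and ess: "\<forall>U. submodule U R E \<and> U \<noteq> {\<zero>\<^bsub>E\<^esub>} \<longrightarrow> U \<inter> \<iota> ` carrier ?S \<noteq> {\<zero>\<^bsub>E\<^esub>}"
    using env unfolding injective_envelope_def by blast
  have E: "left_module R E" using env by (simp add: injective_envelope_def)
  interpret E: left_module R E by fact
  have h: "(+>\<^bsub>R\<^esub>) ?I \<in> ring_hom R (R Quot ?I)" by (rule I.rcos_ring_hom)
  have q: "(\<lambda>a. ?I +>\<^bsub>R\<^esub> a) \<in> mod_hom R (reg R) ?S"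
    by (rule mod_homI) (simp_all add: ring_hom_closed[OF h] ring_hom_add[OF h] ring_hom_mult[OF h])
  have \<epsilon>: "(\<lambda>a. \<iota> (?I +>\<^bsub>R\<^esub> a)) \<in> mod_hom R (reg R) E" by (rule mod_hom_comp[OF q \<iota>(1)])
  have zero: "?I +>\<^bsub>R\<^esub> \<zero>\<^bsub>R\<^esub> = ?I" using I.a_subset by (simp add: a_coset_add_zero)
  have \<iota>0: "\<iota> ?I = \<zero>\<^bsub>E\<^esub>"
    using mod_hom_zero[OF reg_module E \<epsilon>] by (simp add: zero)
  have I_in: "?I \<in> carrier ?S" using mod_hom_closed[OF q, of "\<zero>\<^bsub>R\<^esub>"] zero by simp
  have surj: "x \<in> carrier ?S \<Longrightarrow> \<exists>a\<in>carrier R. x = ?I +>\<^bsub>R\<^esub> a" for x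
    by (auto simp: FactRing_def A_RCOSETS_def')
  have ker: "\<iota> (?I +>\<^bsub>R\<^esub> a) = \<zero>\<^bsub>E\<^esub> \<longleftrightarrow> a \<in> ?I" if a: "a \<in> carrier R" for a
  proof
    assume "\<iota> (?I +>\<^bsub>R\<^esub> a) = \<zero>\<^bsub>E\<^esub>"
    hence "?I +>\<^bsub>R\<^esub> a = ?I" using inj_onD[OF \<iota>(2)] mod_hom_closed[OF q, of a] a I_in \<iota>0 by simp
    thus "a \<in> ?I" using a_coset_join1[OF _ a I.a_subgroup] by simp
  next
    assume "a \<in> ?I"
    hence "?I +>\<^bsub>R\<^esub> a = ?I" using I.a_rcos_const by simp
    thus "\<iota> (?I +>\<^bsub>R\<^esub> a) = \<zero>\<^bsub>E\<^esub>" using \<iota>0 by simp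
  qed
  show ?thesis
  proof (rule that[OF \<epsilon> ker])
    fix U assume U: "submodule U R E" "U \<noteq> {\<zero>\<^bsub>E\<^esub>}"
    have "\<zero>\<^bsub>E\<^esub> \<in> U \<inter> \<iota> ` carrier ?S" using submodule_zero[OF U(1)] I_in \<iota>0 by force
    moreover have "U \<inter> \<iota> ` carrier ?S \<noteq> {\<zero>\<^bsub>E\<^esub>}" using ess U by blast
    ultimately obtain y where y: "y \<in> U" "y \<in> \<iota> ` carrier ?S" "y \<noteq> \<zero>\<^bsub>E\<^esub>" by blast
    then obtain x where x: "x \<in> carrier ?S" "y = \<iota> x" by blast
    obtain a where "a \<in> carrier R" "x = ?I +>\<^bsub>R\<^esub> a" using surj[OF x(1)] by blast
    thus "\<exists>a\<in>carrier R. \<iota> (?I +>\<^bsub>R\<^esub> a) \<in> U \<and> \<iota> (?I +>\<^bsub>R\<^esub> a) \<noteq> \<zero>\<^bsub>E\<^esub>" using x y by blast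
  qed
qed

section \<open>The socle of the injective envelope and separation of points\<close>

locale artinian_envelope = cring R for R (structure) +
  fixes E :: "('r, 'e) module" and \<epsilon>
  assumes art: "artinian_cring R" and E: "left_module R E" and inj: "injective R E"
    and \<epsilon>: "\<epsilon> \<in> mod_hom R (reg R) E" and \<epsilon>_ker: "\<And>a. a \<in> carrier R \<Longrightarrow> \<epsilon> a = \<zero>\<^bsub>E\<^esub> \<longleftrightarrow> a \<in> rad R"
    and \<epsilon>_ess: "\<And>U. \<lbrakk>submodule U R E; U \<noteq> {\<zero>\<^bsub>E\<^esub>}\<rbrakk> \<Longrightarrow> \<exists>a\<in>carrier R. \<epsilon> a \<in> U \<and> \<epsilon> a \<noteq> \<zero>\<^bsub>E\<^esub>"
begin

lemma \<epsilon>_closed: "a \<in> carrier R \<Longrightarrow> \<epsilon> a \<in> carrier E"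
  using mod_hom_closed[OF \<epsilon>, of a] by simp

lemma \<epsilon>_smult: "\<lbrakk>b \<in> carrier R; a \<in> carrier R\<rbrakk> \<Longrightarrow> \<epsilon> (b \<otimes> a) = b \<odot>\<^bsub>E\<^esub> \<epsilon> a"
  using mod_hom_smult[OF \<epsilon>, of b a] by simp

lemma \<epsilon>_add: "\<lbrakk>b \<in> carrier R; a \<in> carrier R\<rbrakk> \<Longrightarrow> \<epsilon> (b \<oplus> a) = \<epsilon> b \<oplus>\<^bsub>E\<^esub> \<epsilon> a"
  using mod_hom_add[OF \<epsilon>, of b a] by simp

lemma max_id_eq:
  assumes "max_id R m" "max_id R m'" "m \<subseteq> m'" shows "m = m'"
  using max_id_maximal[OF assms(1) max_idD(1)[OF assms(2)]] assms(3) max_idD(2)[OF assms(2)] one_closed by blast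

text \<open>By minimality, an ideal \<open>J\<close> minimal among those not contained in \<open>m\<close> lies in every other maximal
  ideal.\<close>

lemma annihilated_nonzero:
  assumes m: "max_id R m"
  shows "\<exists>v\<in>carrier E. v \<noteq> \<zero>\<^bsub>E\<^esub> \<and> (\<forall>a\<in>m. a \<odot>\<^bsub>E\<^esub> v = \<zero>\<^bsub>E\<^esub>)"
proof -
  have C: "submodule (carrier R) R (reg R)" using submodule_carrier[OF reg_module] by simp
  have "\<not> carrier R \<subseteq> m" using max_idD(2)[OF m] one_closed by blast
  from artinian_minimal[OF art C, of "\<lambda>J. \<not> J \<subseteq> m", OF this]
  obtain J where J: "submodule J R (reg R)" "\<not> J \<subseteq> m" "\<forall>K. submodule K R (reg R) \<and> K \<subset> J \<longrightarrow> \<not> \<not> K \<subseteq> m"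
    by (elim exE conjE)
  obtain e where e: "e \<in> J" "e \<notin> m" using J(2) by blast
  have ec: "e \<in> carrier R" by (rule ideal_mem[OF J(1) e(1)])
  have other: "e \<in> m'" if m': "max_id R m'" "m' \<noteq> m" for m'
  proof -
    note s' = max_idD(1)[OF m'(1)]
    have "\<not> m' \<subseteq> m" using max_id_eq[OF m'(1) m] m'(2) by blast
    then obtain b where b: "b \<in> m'" "b \<notin> m" by blast
    have "e \<otimes> b \<notin> m" using max_id_prime[OF m ec ideal_mem[OF s' b(1)]] e(2) b(2) by blast
    hence "\<not> id_prod R J m' \<subseteq> m" using id_prod_mem[OF e(1) b(1)] by blast
    hence "\<not> id_prod R J m' \<subset> J" using J(3) id_prod_submodule[OF J(1) s'] by blast
    hence "J \<subseteq> id_prod R J m'" using id_prod_le(1)[OF J(1) s'] by blast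
    thus ?thesis using id_prod_le(2)[OF J(1) s'] e(1) by blast
  qed
  show ?thesis
  \<comment> \<open>The element e is outside m, hence nonzero modulo the radical, whereas m e lies
    in m and in every other maximal ideal.\<close>
  proof (intro bexI[of _ "\<epsilon> e"] conjI ballI)
    show "\<epsilon> e \<noteq> \<zero>\<^bsub>E\<^esub>" using \<epsilon>_ker[OF ec] e(2) m by (auto simp: rad_iff)
    fix a assume a: "a \<in> m"
    note ms = max_idD(1)[OF m]
    have ac: "a \<in> carrier R" by (rule ideal_mem[OF ms a])
    have "a \<otimes> e \<in> m'" if "max_id R m'" for m'
    proof (cases "m' = m")
      case True thus ?thesis using ideal_mult_right[OF ms ec a] by simp
    next
      case False thus ?thesis using ideal_mult[OF max_idD(1)[OF that] ac other[OF that False]] by simp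
    qed
    hence "a \<otimes> e \<in> rad R" using ac ec by (simp add: rad_iff)
    thus "a \<odot>\<^bsub>E\<^esub> \<epsilon> e = \<zero>\<^bsub>E\<^esub>" using \<epsilon>_ker[of "a \<otimes> e"] \<epsilon>_smult[OF ac ec] ac ec by simp
  qed (rule \<epsilon>_closed[OF ec])
qed

text \<open>The elements of \<open>E\<close> killed by a maximal ideal lie in the image of \<open>R / rad R\<close>.\<close>

lemma annihilated_line:
  assumes m: "max_id R m" and v: "v \<in> carrier E" "v \<noteq> \<zero>\<^bsub>E\<^esub>" "\<And>a. a \<in> m \<Longrightarrow> a \<odot>\<^bsub>E\<^esub> v = \<zero>\<^bsub>E\<^esub>"
    and w: "w \<in> carrier E" "\<And>a. a \<in> m \<Longrightarrow> a \<odot>\<^bsub>E\<^esub> w = \<zero>\<^bsub>E\<^esub>"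
  shows "\<exists>c\<in>carrier R. w = c \<odot>\<^bsub>E\<^esub> v"
proof -
  interpret E: left_module R E by (rule E)
  note ms = max_idD(1)[OF m]
  \<comment> \<open>Essentiality puts some nonzero multiple c u into the image of \<epsilon>. As m
    kills u, the scalar c is outside m, and its inverse modulo m brings u itself into the image,
    with a representative that m multiplies into the radical.\<close>
  have lift: "\<exists>a\<in>carrier R. u = \<epsilon> a \<and> (\<forall>p\<in>m. p \<otimes> a \<in> rad R)"
    if u: "u \<in> carrier E" "u \<noteq> \<zero>\<^bsub>E\<^esub>" "\<And>a. a \<in> m \<Longrightarrow> a \<odot>\<^bsub>E\<^esub> u = \<zero>\<^bsub>E\<^esub>" for u
  proof -
    let ?C = "{c \<odot>\<^bsub>E\<^esub> u | c. c \<in> carrier R}"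
    have C: "submodule ?C R E" by (rule submodule_cyclic[OF E u(1)])
    have "u \<in> ?C" using u(1) E.smult_one by (intro CollectI exI[of _ \<one>]) simp
    hence "?C \<noteq> {\<zero>\<^bsub>E\<^esub>}" using u(2) by blast
    then obtain a where a: "a \<in> carrier R" "\<epsilon> a \<in> ?C" "\<epsilon> a \<noteq> \<zero>\<^bsub>E\<^esub>" using \<epsilon>_ess[OF C] by blast
    then obtain c where c: "c \<in> carrier R" "\<epsilon> a = c \<odot>\<^bsub>E\<^esub> u" by blast
    have "c \<notin> m" using a(3) c(2) u(3) by auto
    then obtain s p where sp: "s \<in> carrier R" "p \<in> m" "s \<otimes> c \<oplus> p = \<one>" using max_idD(3)[OF m c(1)] by blast
    have pc: "p \<in> carrier R" by (rule ideal_mem[OF ms sp(2)])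
    have "u = (s \<otimes> c \<oplus> p) \<odot>\<^bsub>E\<^esub> u" using sp(3) u(1) by (simp add: E.smult_one)
    also have "\<dots> = s \<odot>\<^bsub>E\<^esub> \<epsilon> a"
      using sp(1) c pc u(1) u(3)[OF sp(2)] by (simp add: E.smult_l_distr E.smult_assoc E.smult_closed)
    finally have u_eq: "u = \<epsilon> (s \<otimes> a)" using \<epsilon>_smult[OF sp(1) a(1)] by simp
    have "q \<otimes> (s \<otimes> a) \<in> rad R" if q: "q \<in> m" for q
    proof -
      have qc: "q \<in> carrier R" by (rule ideal_mem[OF ms q])
      have "\<epsilon> (q \<otimes> (s \<otimes> a)) = \<zero>\<^bsub>E\<^esub>" using \<epsilon>_smult[OF qc, of "s \<otimes> a"] u(3)[OF q] sp(1) a(1) u_eq by simp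
      thus ?thesis using \<epsilon>_ker[of "q \<otimes> (s \<otimes> a)"] qc sp(1) a(1) by simp
    qed
    thus ?thesis using u_eq sp(1) a(1) by (intro bexI[of _ "s \<otimes> a"]) simp_all
  qed
  show ?thesis
  proof (cases "w = \<zero>\<^bsub>E\<^esub>")
    case True thus ?thesis using v(1) by (intro bexI[of _ \<zero>]) simp_all
  next
    case False
    obtain a where a: "a \<in> carrier R" "v = \<epsilon> a" "\<forall>p\<in>m. p \<otimes> a \<in> rad R" using lift[OF v] by blast
    obtain b where b: "b \<in> carrier R" "w = \<epsilon> b" "\<forall>p\<in>m. p \<otimes> b \<in> rad R" using lift[OF w(1) False w(2)] by blast
    have "a \<notin> rad R" using \<epsilon>_ker[OF a(1)] v(2) a(2) by simp
    \<comment> \<open>As m multiplies a into the radical, a lies in every maximal ideal other than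
      m. It is not in the radical, so it is outside m and invertible modulo m; then b equals s b a
      modulo the radical.\<close>
    have "a \<notin> m"
    proof
      assume am: "a \<in> m"
      have "a \<in> m'" if m': "max_id R m'" for m'
      proof (cases "m' = m")
        case False
        hence "\<not> m \<subseteq> m'" using max_id_eq[OF m m'] by blast
        then obtain p where p: "p \<in> m" "p \<notin> m'" by blast
        have "p \<otimes> a \<in> m'" using a(3) p(1) m' by (auto simp: rad_iff)
        thus ?thesis using max_id_prime[OF m' ideal_mem[OF ms p(1)] a(1) _ p(2)] by blast
      qed (simp add: am)
      thus False using \<open>a \<notin> rad R\<close> a(1) by (simp add: rad_iff)
    qed
    then obtain s p where sp: "s \<in> carrier R" "p \<in> m" "s \<otimes> a \<oplus> p = \<one>" using max_idD(3)[OF m a(1)] by blast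
    have pc: "p \<in> carrier R" by (rule ideal_mem[OF ms sp(2)])
    have "b = (s \<otimes> a \<oplus> p) \<otimes> b" using sp(3) b(1) by simp
    also have "\<dots> = (s \<otimes> b) \<otimes> a \<oplus> p \<otimes> b" using sp(1) pc a(1) b(1) by (simp add: l_distr r_distr m_ac)
    finally have "\<epsilon> b = \<epsilon> ((s \<otimes> b) \<otimes> a \<oplus> p \<otimes> b)" by simp
    also have "\<dots> = (s \<otimes> b) \<odot>\<^bsub>E\<^esub> v \<oplus>\<^bsub>E\<^esub> \<epsilon> (p \<otimes> b)"
      using sp(1) pc a b(1) by (simp add: \<epsilon>_add \<epsilon>_smult[of "s \<otimes> b"])
    also have "\<epsilon> (p \<otimes> b) = \<zero>\<^bsub>E\<^esub>" using \<epsilon>_ker[of "p \<otimes> b"] b sp(2) pc by simp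
    finally show ?thesis using b(1,2) sp(1) v(1) by (intro bexI[of _ "s \<otimes> b"]) (simp_all add: E.smult_closed)
  qed
qed

text \<open>In X / U the annihilator of the class y of x lies in a maximal ideal m. Sending y to a
  nonzero v killed by m is well defined on the cyclic module of y, and injectivity of E extends it
  to X / U.\<close>

lemma separate:
  fixes X :: "('r, 'x) module"
  assumes X: "fg_module R X" and U: "submodule U R X" and x: "x \<in> carrier X" "x \<notin> U"
  shows "\<exists>f\<in>mod_hom R X E. (\<forall>u\<in>U. f u = \<zero>\<^bsub>E\<^esub>) \<and> f x \<noteq> \<zero>\<^bsub>E\<^esub>"
proof -
  interpret E: left_module R E by (rule E)
  have lX: "left_module R X" and fX: "fin_gen R X" using X by (auto simp: fg_module_def)
  obtain Q :: "('r, 'x set) module" and p where Q: "left_module R Q" "p \<in> mod_hom R X Q" "p ` carrier X = carrier Q"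
    "\<forall>x\<in>carrier X. p x = \<zero>\<^bsub>Q\<^esub> \<longleftrightarrow> x \<in> U" using quotient_exists[OF lX U] by blast
  interpret Q: left_module R Q by (rule Q(1))
  define y where "y = p x"
  have y: "y \<in> carrier Q" "y \<noteq> \<zero>\<^bsub>Q\<^esub>" using Q(4) x mod_hom_closed[OF Q(2) x(1)] by (auto simp: y_def)
  have h: "(\<lambda>c. c \<odot>\<^bsub>Q\<^esub> y) \<in> mod_hom R (reg R) Q" by (rule mod_hom_reg[OF Q(1) y(1)])
  let ?A = "{c \<in> carrier R. c \<odot>\<^bsub>Q\<^esub> y = \<zero>\<^bsub>Q\<^esub>}"
  have "submodule ?A R (reg R)" using submodule_kernel[OF reg_module Q(1) h] by simp
  moreover have "\<one> \<notin> ?A" using y by (simp add: Q.smult_one)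
  ultimately obtain m where m: "max_id R m" "?A \<subseteq> m" using exists_max_id by blast
  obtain v where v: "v \<in> carrier E" "v \<noteq> \<zero>\<^bsub>E\<^esub>" "\<forall>a\<in>m. a \<odot>\<^bsub>E\<^esub> v = \<zero>\<^bsub>E\<^esub>" using annihilated_nonzero[OF m(1)] by blast
  let ?Y = "(\<lambda>c. c \<odot>\<^bsub>Q\<^esub> y) ` carrier (reg R)"
  let ?Q = "Q\<lparr>carrier := ?Y\<rparr>"
  have Y: "submodule ?Y R Q" by (rule submodule_image[OF reg_module Q(1) h submodule_carrier[OF reg_module]])
  note lY = submodule_left_module[OF Q(1) Y]
  have hY: "(\<lambda>c. c \<odot>\<^bsub>Q\<^esub> y) \<in> mod_hom R (reg R) ?Q" using h by (subst mod_hom_submodule_iff[OF _ Y]) auto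
  have "\<exists>f\<in>mod_hom R ?Q E. \<forall>c\<in>carrier (reg R). f (c \<odot>\<^bsub>Q\<^esub> y) = c \<odot>\<^bsub>E\<^esub> v"
  proof (rule factor_through_surjection[OF reg_module lY E hY _ mod_hom_reg[OF E v(1)]])
    fix c assume "c \<in> carrier (reg R)" "c \<odot>\<^bsub>Q\<^esub> y = \<zero>\<^bsub>?Q\<^esub>"
    hence "c \<in> m" using m(2) by auto
    thus "c \<odot>\<^bsub>E\<^esub> v = \<zero>\<^bsub>E\<^esub>" using v(3) by blast
  qed simp
  then obtain f where f: "f \<in> mod_hom R ?Q E" "\<forall>c\<in>carrier (reg R). f (c \<odot>\<^bsub>Q\<^esub> y) = c \<odot>\<^bsub>E\<^esub> v" by (elim bexE)
  have "fin_gen R (reg R)" by (rule fin_len_fin_gen[OF reg_module artinian_fin_len[OF art]])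
  hence "fin_gen R ?Q" by (intro fin_gen_image[OF reg_module lY hY]) simp
  hence fg: "fg_module R ?Q" "fg_module R Q"
    using lY Q(1) fin_gen_image[OF lX Q(1-3) fX] by (simp_all add: fg_module_def)
  have i: "(\<lambda>z. z) \<in> mod_hom R ?Q Q" by (rule mod_hom_restrict_submodule[OF mod_hom_id Y])
  obtain g where g: "g \<in> mod_hom R Q E" "\<forall>z\<in>carrier ?Q. g z = f z"
    using injective_extend[OF inj fg i _ f(1)] by (auto simp: inj_on_def)
  have yY: "y \<in> carrier ?Q" using y Q.smult_one by (auto intro!: image_eqI[of _ _ \<one>])
  have "g y = v"
    using bspec[OF g(2) yY] bspec[OF f(2), of \<one>] y(1) v(1) by (simp add: Q.smult_one E.smult_one)
  show ?thesis
  proof (intro bexI[of _ "\<lambda>z. g (p z)"] conjI ballI)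
    show "g (p x) \<noteq> \<zero>\<^bsub>E\<^esub>" using \<open>g y = v\<close> v(2) by (simp add: y_def)
    fix u assume u: "u \<in> U"
    hence "p u = \<zero>\<^bsub>Q\<^esub>" using Q(4) submodule_mem[OF U] by blast
    thus "g (p u) = \<zero>\<^bsub>E\<^esub>" using mod_hom_zero[OF Q(1) E g(1)] by simp
  qed (rule mod_hom_comp[OF Q(2) g(1)])
qed

end

section \<open>Duals of modules of finite length over R\<close>

definition Hom_cmod :: "('r, 'c) ring_scheme \<Rightarrow> ('r, 'x, 'd) module_scheme \<Rightarrow> ('r, 'e) module \<Rightarrow> ('r, 'x \<Rightarrow> 'e) module"
  where "Hom_cmod R X E = \<lparr>carrier = mod_hom R X E \<inter> extensional (carrier X), mult = undefined, one = undefined,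
    zero = (\<lambda>x\<in>carrier X. \<zero>\<^bsub>E\<^esub>), add = (\<lambda>f g. \<lambda>x\<in>carrier X. f x \<oplus>\<^bsub>E\<^esub> g x),
    smult = (\<lambda>r f. \<lambda>x\<in>carrier X. r \<odot>\<^bsub>E\<^esub> f x)\<rparr>"

lemma Hom_cmod_simps [simp]: "carrier (Hom_cmod R X E) = mod_hom R X E \<inter> extensional (carrier X)"
  "\<zero>\<^bsub>Hom_cmod R X E\<^esub> = (\<lambda>x\<in>carrier X. \<zero>\<^bsub>E\<^esub>)" "f \<oplus>\<^bsub>Hom_cmod R X E\<^esub> g = (\<lambda>x\<in>carrier X. f x \<oplus>\<^bsub>E\<^esub> g x)"
  "r \<odot>\<^bsub>Hom_cmod R X E\<^esub> f = (\<lambda>x\<in>carrier X. r \<odot>\<^bsub>E\<^esub> f x)"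
  by (simp_all add: Hom_cmod_def)

lemma (in cring) Hom_cmod_left_module:
  assumes X: "left_module R X" and E: "left_module R E"
  shows "left_module R (Hom_cmod R X E)"
proof (rule left_moduleI[OF ring_axioms])
  let ?H = "Hom_cmod R X E"
  interpret E: left_module R E by fact
  show "abelian_group ?H" by (rule Hom_group[OF X E]) simp_all
  have c: "f x \<in> carrier E" if "f \<in> carrier ?H" "x \<in> carrier X" for f x
    using that mod_hom_closed[of f R X E x] by simp
  fix f assume f: "f \<in> carrier ?H"
  show "\<one> \<odot>\<^bsub>?H\<^esub> f = f"
    using f c[OF f] by (intro extensionalityI[of _ "carrier X"]) (simp_all add: E.smult_one)
  fix s assume s: "s \<in> carrier R"
  have "(\<lambda>x. s \<odot>\<^bsub>E\<^esub> f x) \<in> mod_hom R X E"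
  proof (rule mod_homI)
    fix x y assume "x \<in> carrier X" "y \<in> carrier X"
    thus "s \<odot>\<^bsub>E\<^esub> f (x \<oplus>\<^bsub>X\<^esub> y) = s \<odot>\<^bsub>E\<^esub> f x \<oplus>\<^bsub>E\<^esub> s \<odot>\<^bsub>E\<^esub> f y"
      using f s c[OF f] by (simp add: mod_hom_add[of f R X E] E.smult_r_distr)
  next
    fix b x assume b: "b \<in> carrier R" and x: "x \<in> carrier X"
    have "s \<odot>\<^bsub>E\<^esub> (b \<odot>\<^bsub>E\<^esub> f x) = b \<odot>\<^bsub>E\<^esub> (s \<odot>\<^bsub>E\<^esub> f x)"
      using b s c[OF f x] by (simp add: m_comm flip: E.smult_assoc)
    thus "s \<odot>\<^bsub>E\<^esub> f (b \<odot>\<^bsub>X\<^esub> x) = b \<odot>\<^bsub>E\<^esub> (s \<odot>\<^bsub>E\<^esub> f x)" using f b x by (simp add: mod_hom_smult[of f R X E])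
  qed (simp add: E.smult_closed s c[OF f])
  thus "s \<odot>\<^bsub>?H\<^esub> f \<in> carrier ?H" by (simp add: restrict_mod_hom_iff[OF X])
  show "s \<odot>\<^bsub>?H\<^esub> (f \<oplus>\<^bsub>?H\<^esub> g) = s \<odot>\<^bsub>?H\<^esub> f \<oplus>\<^bsub>?H\<^esub> s \<odot>\<^bsub>?H\<^esub> g"
    if g: "g \<in> carrier ?H" for g
    unfolding Hom_cmod_simps(3,4) by (rule restrict_ext) (simp add: E.smult_r_distr s c[OF f] c[OF g])
  fix t assume t: "t \<in> carrier R"
  show "(s \<oplus> t) \<odot>\<^bsub>?H\<^esub> f = s \<odot>\<^bsub>?H\<^esub> f \<oplus>\<^bsub>?H\<^esub> t \<odot>\<^bsub>?H\<^esub> f"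
    unfolding Hom_cmod_simps(3,4) by (rule restrict_ext) (simp add: E.smult_l_distr s t c[OF f])
  show "(s \<otimes> t) \<odot>\<^bsub>?H\<^esub> f = s \<odot>\<^bsub>?H\<^esub> (t \<odot>\<^bsub>?H\<^esub> f)"
    unfolding Hom_cmod_simps(3,4) by (rule restrict_ext) (simp add: E.smult_assoc s t c[OF f])
qed

text \<open>For \<open>V \<subset> U\<close> with simple quotient, the maps killing \<open>V\<close> modulo those killing \<open>U\<close> embed into
  the elements of \<open>E\<close> killed by a maximal ideal, a line.\<close>

lemma (in artinian_envelope) Hom_cmod_fin_len:
  assumes X: "left_module R X" "fin_len R X"
  shows "fin_len R (Hom_cmod R X E)"
proof -
  interpret E: left_module R E by (rule E)
  interpret X: left_module R X by (rule X)
  let ?H = "Hom_cmod R X E"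
  note H = Hom_cmod_left_module[OF X(1) E]
  interpret H: left_module R ?H by (rule H)
  obtain r where r: "\<And>U V. \<lbrakk>submodule U R X; submodule V R X; U \<subset> V\<rbrakk> \<Longrightarrow> r U < (r V :: nat)"
    using fin_lenE[OF X(2)] by blast
  define K where "K U = {f \<in> carrier ?H. \<forall>u\<in>U. f u = \<zero>\<^bsub>E\<^esub>}" for U
  have hom: "f \<in> mod_hom R X E" if "f \<in> carrier ?H" for f using that by simp
  have fc: "f x \<in> carrier E" if "f \<in> carrier ?H" "x \<in> carrier X" for f x by (rule mod_hom_closed[OF hom[OF that(1)] that(2)])
  have K: "submodule (K U) R ?H" if U: "submodule U R X" for U
  proof (rule H.submoduleI)
    note mem = submodule_mem[OF U]
    show "K U \<subseteq> carrier ?H" by (auto simp: K_def)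
    show "\<zero>\<^bsub>?H\<^esub> \<in> K U" unfolding K_def using H.M.zero_closed mem by (simp del: Hom_cmod_simps(1))
    show "f \<oplus>\<^bsub>?H\<^esub> g \<in> K U" if "f \<in> K U" "g \<in> K U" for f g
      using that H.M.a_closed[of f g] mem by (simp add: K_def del: Hom_cmod_simps(1))
    show "a \<odot>\<^bsub>?H\<^esub> f \<in> K U" if "a \<in> carrier R" "f \<in> K U" for a f
      using that H.smult_closed[of a f] mem by (simp add: K_def del: Hom_cmod_simps(1))
  qed
  have step: "fin_int R ?H (K U) (K V)"
    if U: "submodule U R X" and V: "submodule V R X" and VU: "V \<subset> U"
      and simple: "\<And>W. \<lbrakk>submodule W R X; V \<subset> W; W \<subseteq> U\<rbrakk> \<Longrightarrow> W = U" for U V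
  proof (rule fin_int_simple)
    fix W assume W: "submodule W R ?H" "K U \<subset> W" "W \<subseteq> K V"
    obtain f where f: "f \<in> W" "f \<notin> K U" using W(2) by blast
    have fV: "f \<in> K V" using f W by blast
    hence fH: "f \<in> carrier ?H" by (simp add: K_def)
    obtain y where y: "y \<in> U" "f y \<noteq> \<zero>\<^bsub>E\<^esub>" using f(2) fH by (auto simp: K_def)
    have yc: "y \<in> carrier X" by (rule submodule_mem[OF U y(1)])
    have yV: "y \<notin> V" using fV y(2) by (auto simp: K_def)
    have gen: "\<exists>v\<in>V. \<exists>s\<in>carrier R. z = v \<oplus>\<^bsub>X\<^esub> s \<odot>\<^bsub>X\<^esub> y'" if y': "y' \<in> U" "y' \<notin> V" and z: "z \<in> U" for y' z
    proof -
      have yc': "y' \<in> carrier X" by (rule submodule_mem[OF U y'(1)])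
      let ?C = "{c \<odot>\<^bsub>X\<^esub> y' | c. c \<in> carrier R}"
      have C: "submodule ?C R X" by (rule submodule_cyclic[OF X(1) yc'])
      have "y' \<in> ?C" using yc' X.smult_one by (intro CollectI exI[of _ \<one>]) simp
      hence "V \<subset> V <+>\<^bsub>X\<^esub> ?C" using submodule_set_add_upper[OF X(1) V C] y'(2) by blast
      moreover have "?C \<subseteq> U" using submodule_smult[OF U _ y'(1)] by blast
      hence "V <+>\<^bsub>X\<^esub> ?C \<subseteq> U" using VU by (intro set_add_least[OF U]) auto
      ultimately have "V <+>\<^bsub>X\<^esub> ?C = U" by (rule simple[OF submodule_set_add[OF X(1) V C]])
      hence "z \<in> V <+>\<^bsub>X\<^esub> ?C" using z by simp
      thus ?thesis by (auto elim!: set_addE)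
    qed
    \<comment> \<open>Since U / V is simple, the scalars carrying y into V form a maximal ideal;
      evaluation at y sends \<open>K V\<close> into the elements of E killed by it.\<close>
    define m where "m = {a \<in> carrier R. a \<odot>\<^bsub>X\<^esub> y \<in> V}"
    have ms: "submodule m R (reg R)"
      using submodule_preimage[OF reg_module X(1) mod_hom_reg[OF X(1) yc] V] by (simp add: m_def)
    have m: "max_id R m"
      unfolding max_id_def
    proof (intro conjI ms ballI)
      show "\<one> \<notin> m" using yV yc by (simp add: m_def X.smult_one)
      fix b assume b: "b \<in> carrier R - m"
      hence bc: "b \<in> carrier R" and "b \<odot>\<^bsub>X\<^esub> y \<notin> V" by (auto simp: m_def)
      then obtain v s where vs: "v \<in> V" "s \<in> carrier R" "y = v \<oplus>\<^bsub>X\<^esub> s \<odot>\<^bsub>X\<^esub> (b \<odot>\<^bsub>X\<^esub> y)"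
        using gen[OF submodule_smult[OF U bc y(1)] _ y(1)] by blast
      have vc: "v \<in> carrier X" by (rule submodule_mem[OF V vs(1)])
      have "(\<one> \<ominus> s \<otimes> b) \<odot>\<^bsub>X\<^esub> y = y \<ominus>\<^bsub>X\<^esub> s \<odot>\<^bsub>X\<^esub> (b \<odot>\<^bsub>X\<^esub> y)"
        using vs(2) bc yc by (simp add: a_minus_def X.smult_l_distr X.smult_minus_left X.smult_assoc X.smult_one)
      also have "\<dots> = v"
      proof -
        have m: "s \<odot>\<^bsub>X\<^esub> (b \<odot>\<^bsub>X\<^esub> y) \<in> carrier X" using vs(2) bc yc by (simp add: X.smult_closed)
        have "y \<ominus>\<^bsub>X\<^esub> s \<odot>\<^bsub>X\<^esub> (b \<odot>\<^bsub>X\<^esub> y) = (v \<oplus>\<^bsub>X\<^esub> s \<odot>\<^bsub>X\<^esub> (b \<odot>\<^bsub>X\<^esub> y)) \<ominus>\<^bsub>X\<^esub> s \<odot>\<^bsub>X\<^esub> (b \<odot>\<^bsub>X\<^esub> y)"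
          by (subst (1) vs(3)) (rule refl)
        also have "\<dots> = v" using m vc by (simp add: a_minus_def X.M.a_assoc X.M.r_neg)
        finally show ?thesis .
      qed
      finally have "\<one> \<ominus> s \<otimes> b \<in> m" using vs(1,2) bc by (simp add: m_def)
      thus "\<exists>s\<in>carrier R. \<exists>a\<in>m. s \<otimes> b \<oplus> a = \<one>"
        using vs(2) bc by (intro bexI[of _ s] bexI[of _ "\<one> \<ominus> s \<otimes> b"]) (simp_all add: add_minus_cancel)
    qed
    have ann: "a \<odot>\<^bsub>E\<^esub> g y = \<zero>\<^bsub>E\<^esub>" if "g \<in> K V" "a \<in> m" for g a
      using that mod_hom_smult[OF hom, of g a y] yc by (auto simp: K_def m_def)
    show "W = K V"
    proof
      show "K V \<subseteq> W"
      proof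
        fix g assume g: "g \<in> K V"
        hence gH: "g \<in> carrier ?H" by (simp add: K_def)
        obtain c where c: "c \<in> carrier R" "g y = c \<odot>\<^bsub>E\<^esub> f y"
          using annihilated_line[OF m fc[OF fH yc] y(2) ann[OF fV] fc[OF gH yc] ann[OF g]] by blast
        \<comment> \<open>g - c f vanishes at y and on V, hence on U = V + R y. So g differs from a
          multiple of f by an element of \<open>K U\<close>.\<close>
        define h where "h = g \<ominus>\<^bsub>?H\<^esub> (c \<odot>\<^bsub>?H\<^esub> f)"
        have cf: "c \<odot>\<^bsub>?H\<^esub> f \<in> carrier ?H" by (rule H.smult_closed[OF c(1) fH])
        have hH: "h \<in> carrier ?H" unfolding h_def using gH cf by (rule H.M.minus_closed)
        have gh: "g = h \<oplus>\<^bsub>?H\<^esub> c \<odot>\<^bsub>?H\<^esub> f" unfolding h_def using H.M.add_minus_cancel(2)[OF gH cf] by simp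
        have hV: "h \<in> K V" unfolding h_def by (rule submodule_diff[OF K[OF V] g submodule_smult[OF K[OF V] c(1) fV]])
        have "g y = h y \<oplus>\<^bsub>E\<^esub> c \<odot>\<^bsub>E\<^esub> f y" using fun_cong[OF gh, of y] yc by simp
        hence "h y \<oplus>\<^bsub>E\<^esub> g y = \<zero>\<^bsub>E\<^esub> \<oplus>\<^bsub>E\<^esub> g y" using c(2) fc[OF gH yc] by simp
        hence hy: "h y = \<zero>\<^bsub>E\<^esub>" using fc[OF hH yc] fc[OF gH yc] by (simp del: E.M.l_zero)
        have "h z = \<zero>\<^bsub>E\<^esub>" if z: "z \<in> U" for z
        proof -
          obtain v s where vs: "v \<in> V" "s \<in> carrier R" "z = v \<oplus>\<^bsub>X\<^esub> s \<odot>\<^bsub>X\<^esub> y" using gen[OF y(1) yV z] by blast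
          have "h z = h v \<oplus>\<^bsub>E\<^esub> s \<odot>\<^bsub>E\<^esub> h y"
            unfolding vs(3) using mod_hom_add[OF hom[OF hH] submodule_mem[OF V vs(1)] X.smult_closed[OF vs(2) yc]]
              mod_hom_smult[OF hom[OF hH] vs(2) yc] by simp
          thus ?thesis using hV vs(1,2) hy by (simp add: K_def)
        qed
        hence "h \<in> W" using hH W(2) by (auto simp: K_def simp del: Hom_cmod_simps)
        thus "g \<in> W" unfolding gh by (intro submodule_add[OF W(1)] submodule_smult[OF W(1) c(1) f(1)])
      qed
    qed (rule W(3))
  qed
  have main: "fin_int R ?H (K U) (carrier ?H)" if "submodule U R X" for U
    using that
  proof (induction "r U" arbitrary: U rule: less_induct)
    case less
    note U = less.prems
    show ?case
    proof (cases "U = {\<zero>\<^bsub>X\<^esub>}")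
      case True
      have "K U = carrier ?H"
        using True mod_hom_zero[OF X(1) E hom] by (auto simp: K_def simp del: Hom_cmod_simps)
      thus ?thesis by (intro fin_int_simple) auto
    next
      case False
      \<comment> \<open>A proper submodule of U of largest rank has simple quotient, and the
        induction hypothesis applies to it.\<close>
      let ?P = "\<lambda>V. submodule V R X \<and> V \<subset> U"
      have "?P {\<zero>\<^bsub>X\<^esub>}" using False submodule_zero[OF U] submodule_zero_set[OF X(1)] by auto
      moreover have "r V < Suc (r U)" if "?P V" for V using r[of V U] that U by auto
      ultimately have "\<exists>V. ?P V \<and> (\<forall>W. ?P W \<longrightarrow> r W \<le> r V)"
        using ex_has_greatest_nat[of ?P "{\<zero>\<^bsub>X\<^esub>}" r "Suc (r U)"] by blast
      then obtain V where V: "submodule V R X" "V \<subset> U" "\<forall>W. ?P W \<longrightarrow> r W \<le> r V" by (elim exE conjE)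
      have "W = U" if W: "submodule W R X" "V \<subset> W" "W \<subseteq> U" for W
      proof (rule ccontr)
        assume "W \<noteq> U"
        hence "r W \<le> r V" using V(3) W by blast
        thus False using r[OF V(1) W(1,2)] by simp
      qed
      from step[OF U V(1,2) this] have 1: "fin_int R ?H (K U) (K V)" by simp
      have 2: "fin_int R ?H (K V) (carrier ?H)" by (rule less.hyps[OF r[OF V(1) U V(2)] V(1)])
      have "K U \<subseteq> K V" using V(2) unfolding K_def by blast
      from fin_int_trans[OF H K[OF V(1)] this submodule_subset[OF K[OF V(1)]] submodule_carrier[OF H] 1 2]
      show ?thesis .
    qed
  qed
  have "K (carrier X) = {\<zero>\<^bsub>?H\<^esub>}"
  proof
    show "K (carrier X) \<subseteq> {\<zero>\<^bsub>?H\<^esub>}"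
    proof
      fix f assume "f \<in> K (carrier X)"
      thus "f \<in> {\<zero>\<^bsub>?H\<^esub>}" by (auto simp: K_def intro!: extensionalityI[of _ "carrier X"])
    qed
  qed (use submodule_zero[OF K[OF submodule_carrier[OF X(1)]]] in blast)
  with main[OF submodule_carrier[OF X(1)]] show ?thesis by (intro fin_int_imp_fin_len) simp
qed

subsection \<open>Artin algebras\<close>

locale artin_alg = fixes R :: "'r ring" and A :: "('r, 'a) module"
  assumes artin: "artin_algebra R A"
begin

lemma art: "artinian_cring R" and A_ring: "ring A" and A_mod: "Module.module R A" and A_fg: "fin_gen R A"
  and smult_mult: "\<And>r a b. \<lbrakk>r \<in> carrier R; a \<in> carrier A; b \<in> carrier A\<rbrakk> \<Longrightarrow>
    (r \<odot>\<^bsub>A\<^esub> a) \<otimes>\<^bsub>A\<^esub> b = r \<odot>\<^bsub>A\<^esub> (a \<otimes>\<^bsub>A\<^esub> b)"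
  and mult_smult: "\<And>r a b. \<lbrakk>r \<in> carrier R; a \<in> carrier A; b \<in> carrier A\<rbrakk> \<Longrightarrow>
    a \<otimes>\<^bsub>A\<^esub> (r \<odot>\<^bsub>A\<^esub> b) = r \<odot>\<^bsub>A\<^esub> (a \<otimes>\<^bsub>A\<^esub> b)"
  using artin by (auto simp: artin_algebra_def)

lemma R_cring: "cring R"
  using art by (simp add: artinian_cring_def)

sublocale R: cring R by (rule R_cring)
sublocale A: ring A by (rule A_ring)

lemma A_left_module: "left_module R A"
proof -
  interpret Mod: Module.module R A by (rule A_mod)
  show ?thesis
    by (rule left_moduleI[OF R.ring_axioms A.abelian_group_axioms])
      (simp_all add: Mod.smult_l_distr Mod.smult_r_distr Mod.smult_assoc1)
qed

sublocale AM: left_module R A by (rule A_left_module)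

abbreviation \<rho> :: "'r \<Rightarrow> 'a" where "\<rho> r \<equiv> r \<odot>\<^bsub>A\<^esub> \<one>\<^bsub>A\<^esub>"

lemma rho_closed: "r \<in> carrier R \<Longrightarrow> \<rho> r \<in> carrier A"
  by (simp add: AM.smult_closed)

lemma rho_mult: "\<lbrakk>r \<in> carrier R; a \<in> carrier A\<rbrakk> \<Longrightarrow> \<rho> r \<otimes>\<^bsub>A\<^esub> a = r \<odot>\<^bsub>A\<^esub> a"
  by (simp add: smult_mult)

lemma mult_rho: "\<lbrakk>r \<in> carrier R; a \<in> carrier A\<rbrakk> \<Longrightarrow> a \<otimes>\<^bsub>A\<^esub> \<rho> r = r \<odot>\<^bsub>A\<^esub> a"
  by (simp add: mult_smult)

lemma restrict_simps [simp]: "carrier (restrict_scalars A X) = carrier X" "\<zero>\<^bsub>restrict_scalars A X\<^esub> = \<zero>\<^bsub>X\<^esub>"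
  "x \<oplus>\<^bsub>restrict_scalars A X\<^esub> y = x \<oplus>\<^bsub>X\<^esub> y" "r \<odot>\<^bsub>restrict_scalars A X\<^esub> x = \<rho> r \<odot>\<^bsub>X\<^esub> x"
  by (simp_all add: restrict_scalars_def)

lemma restrict_left_module:
  assumes X: "left_module A X" shows "left_module R (restrict_scalars A X)"
proof -
  let ?S = "restrict_scalars A X"
  interpret X: left_module A X by fact
  have ab: "abelian_group ?S"
  proof (rule abelian_groupI)
    fix x assume "x \<in> carrier ?S"
    thus "\<exists>y\<in>carrier ?S. y \<oplus>\<^bsub>?S\<^esub> x = \<zero>\<^bsub>?S\<^esub>"
      by (intro bexI[of _ "\<ominus>\<^bsub>X\<^esub> x"]) (auto simp: X.M.l_neg)
  qed (auto simp: X.M.a_ac)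
  show ?thesis
  proof (rule left_moduleI[OF R.ring_axioms ab])
    fix a b x assume ab: "a \<in> carrier R" "b \<in> carrier R" and x: "x \<in> carrier ?S"
    show "(a \<oplus>\<^bsub>R\<^esub> b) \<odot>\<^bsub>?S\<^esub> x =
        a \<odot>\<^bsub>?S\<^esub> x \<oplus>\<^bsub>?S\<^esub> b \<odot>\<^bsub>?S\<^esub> x"
      using ab x by (simp add: AM.smult_l_distr rho_closed X.smult_l_distr)
    have "\<rho> (a \<otimes>\<^bsub>R\<^esub> b) = \<rho> a \<otimes>\<^bsub>A\<^esub> \<rho> b" using ab by (simp add: rho_mult rho_closed AM.smult_assoc)
    thus "(a \<otimes>\<^bsub>R\<^esub> b) \<odot>\<^bsub>?S\<^esub> x = a \<odot>\<^bsub>?S\<^esub> (b \<odot>\<^bsub>?S\<^esub> x)"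
      using ab x by (simp add: X.smult_assoc rho_closed)
  qed (simp_all add: X.smult_closed rho_closed X.smult_r_distr AM.smult_one X.smult_one)
qed

lemma restrict_hom: "f \<in> mod_hom A X Y \<Longrightarrow> f \<in> mod_hom R (restrict_scalars A X) (restrict_scalars A Y)"
  by (rule mod_homI) (simp_all add: mod_hom_closed mod_hom_add mod_hom_smult[of f A X Y] rho_closed)

lemma restrict_submodule:
  assumes X: "left_module A X" and U: "submodule U A X"
  shows "submodule U R (restrict_scalars A X)"
proof -
  interpret X: left_module R "restrict_scalars A X" by (rule restrict_left_module[OF X])
  show ?thesis
    by (rule X.submoduleI)
      (simp_all add: submodule_subset[OF U] submodule_zero[OF U] submodule_add[OF U] submodule_smult[OF U] rho_closed)
qed

lemma R_fin_len: "fin_len R (reg R)"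
  by (rule R.artinian_fin_len[OF art])

lemma A_fin_len: "fin_len R A"
  by (rule fg_fin_len[OF R_fin_len A_left_module A_fg])

lemma restrict_copies: "restrict_scalars A (copies X k) = copies (restrict_scalars A X) k"
  by (simp add: restrict_scalars_def dsum_def)

lemma restrict_reg_fin_len: "fin_len R (restrict_scalars A (reg A))"
proof (rule fin_len_mono[OF A_fin_len])
  fix U assume U: "submodule U R (restrict_scalars A (reg A))"
  show "submodule U R A"
  proof (rule AM.submoduleI)
    show "U \<subseteq> carrier A" using submodule_subset[OF U] by simp
    show "\<zero>\<^bsub>A\<^esub> \<in> U" using submodule_zero[OF U] by simp
    show "x \<oplus>\<^bsub>A\<^esub> y \<in> U" if "x \<in> U" "y \<in> U" for x y using submodule_add[OF U that] by simp
    show "r \<odot>\<^bsub>A\<^esub> x \<in> U" if "r \<in> carrier R" "x \<in> U" for r x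
      using submodule_smult[OF U that] submodule_mem[OF U that(2)] that(1) by (simp add: rho_mult)
  qed
qed

text \<open>Length is measured over R throughout: a power of A has finite length over R and maps
  onto X.\<close>

lemma restrict_fin_len:
  assumes X: "left_module A X" "fin_gen A X"
  shows "fin_len R (restrict_scalars A X)"
proof -
  note rA = restrict_left_module[OF reg_left_module[OF A_ring]]
  have F: "fin_len R (copies (restrict_scalars A (reg A)) k)" for k
    by (rule fin_len_dsum[OF R.ring_axioms _ rA restrict_reg_fin_len]) simp
  obtain k x where x: "\<And>i. i < k \<Longrightarrow> x i \<in> carrier X" "comb X k x ` carrier (free A k) = carrier X"
    using X(2) fin_gen_iff_free[OF X(1)] by blast
  have "comb X k x \<in> mod_hom R (restrict_scalars A (free A k)) (restrict_scalars A X)"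
    by (rule restrict_hom[OF comb_hom[OF X(1) x(1)]])
  hence "comb X k x \<in> mod_hom R (copies (restrict_scalars A (reg A)) k) (restrict_scalars A X)"
    unfolding restrict_copies .
  moreover have "comb X k x ` carrier (copies (restrict_scalars A (reg A)) k) = carrier (restrict_scalars A X)"
    using x(2) by simp
  ultimately show ?thesis
    by (rule fin_len_image[OF copies_left_module[OF rA] restrict_left_module[OF X(1)] _ _ F])
qed

lemma restrict_fg:
  assumes X: "left_module A X" "fin_gen A X"
  shows "fg_module R (restrict_scalars A X)"
  unfolding fg_module_def
  using restrict_left_module[OF X(1)] fin_len_fin_gen[OF _ restrict_fin_len[OF X]] by blast

end

section \<open>The dual D(A_A): finite generation and cogeneration\<close>

locale artin_alg_dual = artin_alg R A for R :: "'r ring" and A :: "('r, 'a) module" +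
  fixes E :: "('r, 'e) module"
  assumes env: "injective_envelope R (quot_module R (rad R)) E"
begin

abbreviation D :: "('a, 'a \<Rightarrow> 'e) module" where "D \<equiv> duality R A E (regular_right A)"

lemma E_left_module: "left_module R E" and E_injective: "injective R E"
  using env by (simp_all add: injective_envelope_def)

sublocale E: left_module R E by (rule E_left_module)

lemma envelope_obtain: obtains \<epsilon> where "artinian_envelope R E \<epsilon>"
proof -
  obtain \<epsilon> where \<epsilon>: "\<epsilon> \<in> mod_hom R (reg R) E" "\<And>a. a \<in> carrier R \<Longrightarrow> \<epsilon> a = \<zero>\<^bsub>E\<^esub> \<longleftrightarrow> a \<in> rad R"
    "\<And>U. \<lbrakk>submodule U R E; U \<noteq> {\<zero>\<^bsub>E\<^esub>}\<rbrakk> \<Longrightarrow> \<exists>a\<in>carrier R. \<epsilon> a \<in> U \<and> \<epsilon> a \<noteq> \<zero>\<^bsub>E\<^esub>"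
    by (rule injective_envelope_reg[OF R_cring env]) blast
  have "artinian_envelope R E \<epsilon>"
    by (intro artinian_envelope.intro artinian_envelope_axioms.intro R_cring art E_left_module E_injective \<epsilon>)
  thus ?thesis by (rule that)
qed

text \<open>R acts on the restricted right module through right multiplication by
  \<open>\<rho> r\<close>, which agrees with its action on A; so D consists of the R-linear maps A
  -> E.\<close>

lemma D_simps [simp]: "carrier D = mod_hom R A E \<inter> extensional (carrier A)" "\<zero>\<^bsub>D\<^esub> = (\<lambda>x\<in>carrier A. \<zero>\<^bsub>E\<^esub>)"
  "f \<oplus>\<^bsub>D\<^esub> g = (\<lambda>x\<in>carrier A. f x \<oplus>\<^bsub>E\<^esub> g x)" "a \<odot>\<^bsub>D\<^esub> f = (\<lambda>x\<in>carrier A. f (x \<otimes>\<^bsub>A\<^esub> a))"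
proof -
  have "mod_hom R (restrict_scalars A (regular_right A)) E = mod_hom R A E"
    by (auto simp: mod_hom_def restrict_scalars_def regular_right_def mult_rho)
  thus "carrier D = mod_hom R A E \<inter> extensional (carrier A)" by (simp add: duality_def regular_right_def)
qed (simp_all add: duality_def regular_right_def)

lemma D_left_module: "left_module A D"
proof (rule left_moduleI[OF A_ring])
  show "abelian_group D" by (rule Hom_group[OF A_left_module E_left_module]) simp_all
  have c: "f x \<in> carrier E" if "f \<in> carrier D" "x \<in> carrier A" for f x
    using that mod_hom_closed[of f R A E x] by simp
  have add: "f (x \<oplus>\<^bsub>A\<^esub> y) = f x \<oplus>\<^bsub>E\<^esub> f y" if "f \<in> carrier D" "x \<in> carrier A" "y \<in> carrier A" for f x y
    using that mod_hom_add[of f R A E x y] by simp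
  fix f assume f: "f \<in> carrier D"
  show "\<one>\<^bsub>A\<^esub> \<odot>\<^bsub>D\<^esub> f = f" using f by (intro extensionalityI[of _ "carrier A"]) simp_all
  fix a assume a: "a \<in> carrier A"
  have "(\<lambda>x. f (x \<otimes>\<^bsub>A\<^esub> a)) \<in> mod_hom R A E"
  proof (rule mod_homI)
    fix x y assume "x \<in> carrier A" "y \<in> carrier A"
    thus "f ((x \<oplus>\<^bsub>A\<^esub> y) \<otimes>\<^bsub>A\<^esub> a) = f (x \<otimes>\<^bsub>A\<^esub> a) \<oplus>\<^bsub>E\<^esub> f (y \<otimes>\<^bsub>A\<^esub> a)" using a by (simp add: A.l_distr add[OF f])
  next
    fix r x assume "r \<in> carrier R" "x \<in> carrier A"
    thus "f ((r \<odot>\<^bsub>A\<^esub> x) \<otimes>\<^bsub>A\<^esub> a) = r \<odot>\<^bsub>E\<^esub> f (x \<otimes>\<^bsub>A\<^esub> a)"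
      using a f mod_hom_smult[of f R A E r "x \<otimes>\<^bsub>A\<^esub> a"] by (simp add: smult_mult)
  qed (simp add: a c[OF f])
  thus "a \<odot>\<^bsub>D\<^esub> f \<in> carrier D" by (simp add: restrict_mod_hom_iff[OF A_left_module])
  show "a \<odot>\<^bsub>D\<^esub> (f \<oplus>\<^bsub>D\<^esub> g) = a \<odot>\<^bsub>D\<^esub> f \<oplus>\<^bsub>D\<^esub> a \<odot>\<^bsub>D\<^esub> g" for g
    unfolding D_simps(3,4) by (rule restrict_ext) (simp add: a)
  fix b assume b: "b \<in> carrier A"
  show "(a \<oplus>\<^bsub>A\<^esub> b) \<odot>\<^bsub>D\<^esub> f = a \<odot>\<^bsub>D\<^esub> f \<oplus>\<^bsub>D\<^esub> b \<odot>\<^bsub>D\<^esub> f"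
    unfolding D_simps(3,4) by (rule restrict_ext) (simp add: a b A.r_distr add[OF f])
  show "(a \<otimes>\<^bsub>A\<^esub> b) \<odot>\<^bsub>D\<^esub> f = a \<odot>\<^bsub>D\<^esub> (b \<odot>\<^bsub>D\<^esub> f)"
    unfolding D_simps(3,4) by (rule restrict_ext) (simp add: a b A.m_assoc)
qed

text \<open>Multiplying values by r is the action of \<open>\<rho> r\<close>, so A-submodules of D
  are R-submodules of the dual of A, which has finite length.\<close>

lemma D_fin_len: "fin_len A D"
proof -
  obtain \<epsilon> where "artinian_envelope R E \<epsilon>" by (rule envelope_obtain)
  then interpret artinian_envelope R E \<epsilon> .
  interpret H: left_module R "Hom_cmod R A E" by (rule R.Hom_cmod_left_module[OF A_left_module E_left_module])
  show ?thesis
  proof (rule fin_len_mono[OF Hom_cmod_fin_len[OF A_left_module A_fin_len]])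
    fix U assume U: "submodule U A D"
    show "submodule U R (Hom_cmod R A E)"
    proof (rule H.submoduleI)
      show "U \<subseteq> carrier (Hom_cmod R A E)" using submodule_subset[OF U] by simp
      show "\<zero>\<^bsub>Hom_cmod R A E\<^esub> \<in> U" using submodule_zero[OF U] by simp
      show "f \<oplus>\<^bsub>Hom_cmod R A E\<^esub> g \<in> U" if "f \<in> U" "g \<in> U" for f g using submodule_add[OF U that] by simp
      fix r f assume r: "r \<in> carrier R" and f: "f \<in> U"
      have fh: "f \<in> mod_hom R A E" using submodule_mem[OF U f] by simp
      have "(\<lambda>x\<in>carrier A. r \<odot>\<^bsub>E\<^esub> f x) = (\<lambda>x\<in>carrier A. f (x \<otimes>\<^bsub>A\<^esub> \<rho> r))"
        by (rule restrict_ext) (simp add: mult_rho r mod_hom_smult[OF fh])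
      thus "r \<odot>\<^bsub>Hom_cmod R A E\<^esub> f \<in> U" using submodule_smult[OF U rho_closed[OF r] f] by simp
    qed
  qed
qed

lemma D_fg: "fg_module A D"
  unfolding fg_module_def using D_left_module fin_len_fin_gen[OF D_left_module D_fin_len] by simp

text \<open>The adjunction between restriction of scalars and D: an R-linear f : X -> E corresponds
  to h y = (a -> f (a y)). As U is an A-submodule killed by f, it is killed by h; evaluation at one
  recovers f.\<close>

lemma D_cogenerator:
  fixes X :: "('a, 'x) module"
  assumes X: "left_module A X" "fin_gen A X" and U: "submodule U A X" and x: "x \<in> carrier X" "x \<notin> U"
  shows "\<exists>h\<in>mod_hom A X D. (\<forall>u\<in>U. h u = \<zero>\<^bsub>D\<^esub>) \<and> h x \<noteq> \<zero>\<^bsub>D\<^esub>"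
proof -
  obtain \<epsilon> where "artinian_envelope R E \<epsilon>" by (rule envelope_obtain)
  then interpret artinian_envelope R E \<epsilon> .
  interpret X: left_module A X by (rule X(1))
  obtain f where f: "f \<in> mod_hom R (restrict_scalars A X) E" "\<forall>u\<in>U. f u = \<zero>\<^bsub>E\<^esub>" "f x \<noteq> \<zero>\<^bsub>E\<^esub>"
    using separate[OF restrict_fg[OF X] restrict_submodule[OF X(1) U], of x] x by auto
  have fc: "f y \<in> carrier E" if "y \<in> carrier X" for y using mod_hom_closed[OF f(1)] that by simp
  have fadd: "f (y \<oplus>\<^bsub>X\<^esub> z) = f y \<oplus>\<^bsub>E\<^esub> f z" if "y \<in> carrier X" "z \<in> carrier X" for y z
    using mod_hom_add[OF f(1)] that by simp
  define h where "h y = (\<lambda>a\<in>carrier A. f (a \<odot>\<^bsub>X\<^esub> y))" for y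
  have "h \<in> mod_hom A X D"
  proof (rule mod_homI)
    fix y assume y: "y \<in> carrier X"
    have "(\<lambda>a. f (a \<odot>\<^bsub>X\<^esub> y)) \<in> mod_hom R A E"
    proof (rule mod_homI)
      fix r a assume r: "r \<in> carrier R" and a: "a \<in> carrier A"
      have "f ((r \<odot>\<^bsub>A\<^esub> a) \<odot>\<^bsub>X\<^esub> y) = f (\<rho> r \<odot>\<^bsub>X\<^esub> (a \<odot>\<^bsub>X\<^esub> y))"
        using X.smult_assoc[OF rho_closed[OF r] a y] by (simp add: rho_mult[OF r a])
      also have "\<dots> = r \<odot>\<^bsub>E\<^esub> f (a \<odot>\<^bsub>X\<^esub> y)"
        using mod_hom_smult[OF f(1) r, of "a \<odot>\<^bsub>X\<^esub> y"] a y by (simp add: X.smult_closed)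
      finally show "f ((r \<odot>\<^bsub>A\<^esub> a) \<odot>\<^bsub>X\<^esub> y) = r \<odot>\<^bsub>E\<^esub> f (a \<odot>\<^bsub>X\<^esub> y)" .
    qed (simp_all add: y fc fadd X.smult_closed X.smult_l_distr)
    thus "h y \<in> carrier D" by (simp add: h_def restrict_mod_hom_iff[OF A_left_module])
    show "h (y \<oplus>\<^bsub>X\<^esub> z) = h y \<oplus>\<^bsub>D\<^esub> h z" if "z \<in> carrier X" for z
      unfolding D_simps h_def by (rule restrict_ext) (simp add: y that X.smult_r_distr X.smult_closed fadd)
    show "h (b \<odot>\<^bsub>X\<^esub> y) = b \<odot>\<^bsub>D\<^esub> h y" if "b \<in> carrier A" for b
      unfolding D_simps h_def by (rule restrict_ext) (simp add: y that X.smult_assoc)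
  qed
  moreover have "h u = \<zero>\<^bsub>D\<^esub>" if "u \<in> U" for u
    unfolding D_simps h_def by (rule restrict_ext) (simp add: f(2) submodule_smult[OF U _ that])
  moreover have "h x \<noteq> \<zero>\<^bsub>D\<^esub>"
  proof
    assume "h x = \<zero>\<^bsub>D\<^esub>"
    from fun_cong[OF this, of "\<one>\<^bsub>A\<^esub>"] show False using f(3) x(1) by (simp add: h_def X.smult_one)
  qed
  ultimately show ?thesis by blast
qed

end

section \<open>Finite length of endomorphism rings\<close>

context artin_alg
begin

lemma reg_fin_len: "fin_len A (reg A)"
  by (rule fin_len_mono[OF restrict_reg_fin_len restrict_submodule[OF reg_left_module[OF A_ring]]])

text \<open>R acts on X through endomorphisms, so \<Gamma>-submodules of X are R-submodules and X
  has finite length over \<Gamma>. Evaluation at k generators embeds \<Gamma> into X^k.\<close>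

lemma End_fin_len:
  assumes X: "left_module A X" "fin_gen A X"
  shows "fin_len (End_ring A X) (reg (End_ring A X))"
proof -
  let ?S = "restrict_scalars A X"
  interpret X: left_module A X by (rule X(1))
  let ?G = "End_ring A X" and ?N = "End_mod X"
  note G = End_ring_ring[OF X(1)] and lN = End_mod_left_module[OF X(1)]
  interpret RX: left_module R "?S" by (rule restrict_left_module[OF X(1)])
  have "fin_len ?G ?N"
  proof (rule fin_len_mono[OF restrict_fin_len[OF X]])
    fix U assume U: "submodule U ?G ?N"
    show "submodule U R ?S"
    proof (rule RX.submoduleI)
      show "U \<subseteq> carrier ?S" using submodule_subset[OF U] by simp
      show "\<zero>\<^bsub>?S\<^esub> \<in> U" using submodule_zero[OF U] by simp
      show "x \<oplus>\<^bsub>?S\<^esub> y \<in> U" if "x \<in> U" "y \<in> U" for x y using submodule_add[OF U that] by simp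
      fix r x assume r: "r \<in> carrier R" and x: "x \<in> U"
      have xc: "x \<in> carrier X" using submodule_mem[OF U x] by simp
      have "(\<lambda>y. \<rho> r \<odot>\<^bsub>X\<^esub> y) \<in> mod_hom A X X"
      proof (rule mod_homI)
        fix b y assume b: "b \<in> carrier A" and y: "y \<in> carrier X"
        have "\<rho> r \<otimes>\<^bsub>A\<^esub> b = b \<otimes>\<^bsub>A\<^esub> \<rho> r" by (simp add: rho_mult mult_rho r b)
        thus "\<rho> r \<odot>\<^bsub>X\<^esub> (b \<odot>\<^bsub>X\<^esub> y) = b \<odot>\<^bsub>X\<^esub> (\<rho> r \<odot>\<^bsub>X\<^esub> y)"
          using X.smult_assoc[OF rho_closed[OF r] b y] X.smult_assoc[OF b rho_closed[OF r] y] by simp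
      qed (simp_all add: X.smult_closed X.smult_r_distr rho_closed[OF r])
      hence "(\<lambda>y\<in>carrier X. \<rho> r \<odot>\<^bsub>X\<^esub> y) \<in> carrier ?G" by (simp add: restrict_mod_hom_iff[OF X(1)])
      from submodule_smult[OF U this x] show "r \<odot>\<^bsub>?S\<^esub> x \<in> U" using xc by simp
    qed
  qed
  hence F: "fin_len ?G (copies ?N k)" for k by (intro fin_len_dsum[OF G]) (simp_all add: lN)
  obtain k x where x: "\<And>i. i < k \<Longrightarrow> x i \<in> carrier X" "comb X k x ` carrier (free A k) = carrier X"
    using X(2) fin_gen_iff_free[OF X(1)] by blast
  let ?e = "\<lambda>f. \<lambda>i\<in>{..<k}. f (x i)"
  have e: "?e \<in> mod_hom ?G (reg ?G) (copies ?N k)"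
  proof (rule mod_hom_dsumI[OF reg_left_module[OF G]])
    fix i assume i: "i \<in> {..<k}"
    show "(\<lambda>f. f (x i)) \<in> mod_hom ?G (reg ?G) ?N"
      using x(1)[of i] i by (intro mod_homI) (simp_all add: mod_hom_closed[of _ A X X])
  qed
  have "inj_on ?e (carrier (reg ?G))"
  proof (rule inj_onI)
    fix f g assume f: "f \<in> carrier (reg ?G)" and g: "g \<in> carrier (reg ?G)" and eq: "?e f = ?e g"
    have fx: "f (x i) = g (x i)" if "i < k" for i using fun_cong[OF eq, of i] that by simp
    have fg: "f \<in> mod_hom A X X" "g \<in> mod_hom A X X" using f g by auto
    have c: "comb X k x \<in> mod_hom A (free A k) X" by (rule comb_hom[OF X(1) x(1)])
    have "f (comb X k x c) = g (comb X k x c)" if "c \<in> carrier (free A k)" for c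
      by (rule free_hom_eqI[OF X(1) mod_hom_comp[OF c fg(1)] mod_hom_comp[OF c fg(2)] _ that])
        (simp add: comb_basis[OF X(1) x(1)] fx)
    hence "f y = g y" if "y \<in> carrier X" for y
      using that unfolding x(2)[symmetric] by (elim imageE) simp
    thus "f = g" using f g by (intro extensionalityI[of _ "carrier X"]) simp_all
  qed
  thus ?thesis by (rule fin_len_inj[OF reg_left_module[OF G] copies_left_module[OF lN] e _ F])
qed

end

subsection \<open>Triangular matrices\<close>

lemma (in abelian_monoid) finsum_swap:
  assumes "finite I" "finite J" "\<And>i j. \<lbrakk>i \<in> I; j \<in> J\<rbrakk> \<Longrightarrow> f i j \<in> carrier G"
  shows "(\<Oplus>i\<in>I. \<Oplus>j\<in>J. f i j) = (\<Oplus>j\<in>J. \<Oplus>i\<in>I. f i j)"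
  using assms(1,3)
proof (induction I rule: finite_induct)
  case empty
  thus ?case by (simp add: finsum_zero)
next
  case (insert i I)
  have c: "f i' j \<in> carrier G" if "i' \<in> insert i I" "j \<in> J" for i' j using insert.prems that by blast
  have "(\<Oplus>i\<in>insert i I. \<Oplus>j\<in>J. f i j) = (\<Oplus>j\<in>J. f i j) \<oplus> (\<Oplus>i\<in>I. \<Oplus>j\<in>J. f i j)"
    using insert.hyps c by (intro finsum_insert) (auto intro!: finsum_closed)
  also have "(\<Oplus>i\<in>I. \<Oplus>j\<in>J. f i j) = (\<Oplus>j\<in>J. \<Oplus>i\<in>I. f i j)" using insert.IH c by blast
  also have "(\<Oplus>j\<in>J. f i j) \<oplus> (\<Oplus>j\<in>J. \<Oplus>i\<in>I. f i j) = (\<Oplus>j\<in>J. f i j \<oplus> (\<Oplus>i\<in>I. f i j))"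
    using c by (intro finsum_addf[symmetric]) (auto intro!: finsum_closed)
  also have "\<dots> = (\<Oplus>j\<in>J. \<Oplus>i\<in>insert i I. f i j)"
    using insert.hyps c by (intro finsum_cong' refl finsum_insert[symmetric]) (auto intro!: finsum_closed)
  finally show ?case .
qed

lemma tri_ring_simps [simp]:
  "carrier (tri_ring n A) = {a. \<forall>i j. if 1 \<le> i \<and> i \<le> j \<and> j \<le> n then a i j \<in> carrier A else a i j = \<zero>\<^bsub>A\<^esub>}"
  "\<zero>\<^bsub>tri_ring n A\<^esub> = (\<lambda>i j. \<zero>\<^bsub>A\<^esub>)" "a \<oplus>\<^bsub>tri_ring n A\<^esub> b = (\<lambda>i j. a i j \<oplus>\<^bsub>A\<^esub> b i j)"
  "\<one>\<^bsub>tri_ring n A\<^esub> = (\<lambda>i j. if i = j \<and> i \<in> {1..n} then \<one>\<^bsub>A\<^esub> else \<zero>\<^bsub>A\<^esub>)"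
  "a \<otimes>\<^bsub>tri_ring n A\<^esub> b = (\<lambda>i j. \<Oplus>\<^bsub>A\<^esub>k\<in>{1..n}. a i k \<otimes>\<^bsub>A\<^esub> b k j)"
  by (simp_all add: tri_ring_def)

lemma tri_carrierI:
  assumes "\<And>i j. \<lbrakk>1 \<le> i; i \<le> j; j \<le> n\<rbrakk> \<Longrightarrow> a i j \<in> carrier A" "\<And>i j. \<not> (1 \<le> i \<and> i \<le> j \<and> j \<le> n) \<Longrightarrow> a i j = \<zero>\<^bsub>A\<^esub>"
  shows "a \<in> carrier (tri_ring n A)"
  using assms by simp

lemma tri_zero: "\<lbrakk>a \<in> carrier (tri_ring n A); \<not> (1 \<le> i \<and> i \<le> j \<and> j \<le> n)\<rbrakk> \<Longrightarrow> a i j = \<zero>\<^bsub>A\<^esub>"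
  by (simp only: tri_ring_simps mem_Collect_eq) (metis (full_types))

context ring
begin

lemma tri_closed:
  assumes a: "a \<in> carrier (tri_ring n R)" shows "a i j \<in> carrier R"
proof (cases "1 \<le> i \<and> i \<le> j \<and> j \<le> n")
  case True
  have "if 1 \<le> i \<and> i \<le> j \<and> j \<le> n then a i j \<in> carrier R else a i j = \<zero>" using a by simp
  thus ?thesis using True by simp
next
  case False
  thus ?thesis using tri_zero[OF a False] by simp
qed

lemma tri_mult_closed:
  assumes a: "a \<in> carrier (tri_ring n R)" and b: "b \<in> carrier (tri_ring n R)"
  shows "a \<otimes>\<^bsub>tri_ring n R\<^esub> b \<in> carrier (tri_ring n R)"
proof (rule tri_carrierI)
  fix i j
  show "(a \<otimes>\<^bsub>tri_ring n R\<^esub> b) i j \<in> carrier R"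
    unfolding tri_ring_simps(5) by (intro finsum_closed) (simp add: tri_closed[OF a] tri_closed[OF b] del: tri_ring_simps)
  assume ij: "\<not> (1 \<le> i \<and> i \<le> j \<and> j \<le> n)"
  have "a i k \<otimes> b k j = \<zero>" if "k \<in> {1..n}" for k
  proof (cases "1 \<le> i \<and> i \<le> k \<and> k \<le> n")
    case True
    hence "\<not> (1 \<le> k \<and> k \<le> j \<and> j \<le> n)" using ij by auto
    thus ?thesis using tri_zero[OF b] tri_closed[OF a] by simp
  next
    case False
    thus ?thesis using tri_zero[OF a] tri_closed[OF b] by simp
  qed
  hence "(\<Oplus>k\<in>{1..n}. a i k \<otimes> b k j) = (\<Oplus>k\<in>{1..n}. \<zero>)" by (intro finsum_cong') auto
  thus "(a \<otimes>\<^bsub>tri_ring n R\<^esub> b) i j = \<zero>" by (simp add: finsum_zero)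
qed

lemma tri_ring_ring: "ring (tri_ring n R)"
proof (rule ringI)
  let ?T = "tri_ring n R"
  note c = tri_closed[of _ n]
  show "abelian_group ?T"
  proof (rule abelian_groupI)
    fix a b assume a: "a \<in> carrier ?T" and b: "b \<in> carrier ?T"
    show "a \<oplus>\<^bsub>?T\<^esub> b \<in> carrier ?T"
      by (rule tri_carrierI) (simp_all add: c[OF a] c[OF b] tri_zero[OF a] tri_zero[OF b] del: tri_ring_simps(1))
    show "a \<oplus>\<^bsub>?T\<^esub> b = b \<oplus>\<^bsub>?T\<^esub> a" by (simp add: a_comm c[OF a] c[OF b] del: tri_ring_simps(1))
    show "\<zero>\<^bsub>?T\<^esub> \<oplus>\<^bsub>?T\<^esub> a = a" by (simp add: c[OF a] del: tri_ring_simps(1))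
    show "a \<oplus>\<^bsub>?T\<^esub> b \<oplus>\<^bsub>?T\<^esub> d = a \<oplus>\<^bsub>?T\<^esub> (b \<oplus>\<^bsub>?T\<^esub> d)" if d: "d \<in> carrier ?T" for d
      by (simp add: a_assoc c[OF a] c[OF b] c[OF d] del: tri_ring_simps(1))
    have "(\<lambda>i j. \<ominus> a i j) \<in> carrier ?T"
      by (rule tri_carrierI) (simp_all add: c[OF a] tri_zero[OF a] minus_zero del: tri_ring_simps(1))
    moreover have "(\<lambda>i j. \<ominus> a i j) \<oplus>\<^bsub>?T\<^esub> a = \<zero>\<^bsub>?T\<^esub>" by (simp add: l_neg c[OF a] del: tri_ring_simps(1))
    ultimately show "\<exists>y\<in>carrier ?T. y \<oplus>\<^bsub>?T\<^esub> a = \<zero>\<^bsub>?T\<^esub>" by blast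
  qed (rule tri_carrierI; simp)
  show "monoid ?T"
  proof (rule monoidI)
    show "\<one>\<^bsub>?T\<^esub> \<in> carrier ?T" by (rule tri_carrierI) auto
    fix a assume a: "a \<in> carrier ?T"
    show "\<one>\<^bsub>?T\<^esub> \<otimes>\<^bsub>?T\<^esub> a = a"
    proof (intro ext)
      fix i j
      show "(\<one>\<^bsub>?T\<^esub> \<otimes>\<^bsub>?T\<^esub> a) i j = a i j"
      proof (cases "i \<in> {1..n}")
        case True
        have "(\<Oplus>k\<in>{1..n}. \<one>\<^bsub>?T\<^esub> i k \<otimes> a k j) = (\<Oplus>k\<in>{1..n}. if k = i then a i j else \<zero>)"
          using True by (intro finsum_cong') (auto simp: c[OF a] simp del: tri_ring_simps(1))
        thus ?thesis using finsum_delta[OF _ True c[OF a]] by (simp del: tri_ring_simps(1,4))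
      next
        case False
        have "(\<Oplus>k\<in>{1..n}. \<one>\<^bsub>?T\<^esub> i k \<otimes> a k j) = (\<Oplus>k\<in>{1..n}. \<zero>)"
          using False by (intro finsum_cong') (auto simp: c[OF a] simp del: tri_ring_simps(1))
        moreover have "a i j = \<zero>" by (rule tri_zero[OF a]) (use False in auto)
        ultimately show ?thesis by (simp add: finsum_zero del: tri_ring_simps(1,4))
      qed
    qed
    show "a \<otimes>\<^bsub>?T\<^esub> \<one>\<^bsub>?T\<^esub> = a"
    proof (intro ext)
      fix i j
      show "(a \<otimes>\<^bsub>?T\<^esub> \<one>\<^bsub>?T\<^esub>) i j = a i j"
      proof (cases "j \<in> {1..n}")
        case True
        have "(\<Oplus>k\<in>{1..n}. a i k \<otimes> \<one>\<^bsub>?T\<^esub> k j) = (\<Oplus>k\<in>{1..n}. if k = j then a i j else \<zero>)"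
          using True by (intro finsum_cong') (auto simp: c[OF a] simp del: tri_ring_simps(1))
        thus ?thesis using finsum_delta[OF _ True c[OF a]] by (simp del: tri_ring_simps(1,4))
      next
        case False
        have "(\<Oplus>k\<in>{1..n}. a i k \<otimes> \<one>\<^bsub>?T\<^esub> k j) = (\<Oplus>k\<in>{1..n}. \<zero>)"
          using False by (intro finsum_cong') (auto simp: c[OF a] simp del: tri_ring_simps(1))
        moreover have "a i j = \<zero>" by (rule tri_zero[OF a]) (use False in auto)
        ultimately show ?thesis by (simp add: finsum_zero del: tri_ring_simps(1,4))
      qed
    qed
    fix b d assume b: "b \<in> carrier ?T" and d: "d \<in> carrier ?T"
    show "a \<otimes>\<^bsub>?T\<^esub> b \<in> carrier ?T" by (rule tri_mult_closed[OF a b])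
    show "a \<otimes>\<^bsub>?T\<^esub> b \<otimes>\<^bsub>?T\<^esub> d = a \<otimes>\<^bsub>?T\<^esub> (b \<otimes>\<^bsub>?T\<^esub> d)"
    proof (intro ext)
      fix i j
      have "(\<Oplus>k\<in>{1..n}. (\<Oplus>l\<in>{1..n}. a i l \<otimes> b l k) \<otimes> d k j) = (\<Oplus>k\<in>{1..n}. \<Oplus>l\<in>{1..n}. a i l \<otimes> b l k \<otimes> d k j)"
        by (intro finsum_cong' refl finsum_ldistr) (auto simp: c[OF a] c[OF b] c[OF d] simp del: tri_ring_simps(1) intro!: finsum_closed)
      also have "\<dots> = (\<Oplus>l\<in>{1..n}. \<Oplus>k\<in>{1..n}. a i l \<otimes> b l k \<otimes> d k j)"
        by (rule finsum_swap) (auto simp: c[OF a] c[OF b] c[OF d] simp del: tri_ring_simps(1))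
      also have "\<dots> = (\<Oplus>l\<in>{1..n}. \<Oplus>k\<in>{1..n}. a i l \<otimes> (b l k \<otimes> d k j))"
        by (intro finsum_cong' refl) (auto simp: m_assoc c[OF a] c[OF b] c[OF d] simp del: tri_ring_simps(1) intro!: finsum_closed)
      also have "\<dots> = (\<Oplus>l\<in>{1..n}. a i l \<otimes> (\<Oplus>k\<in>{1..n}. b l k \<otimes> d k j))"
        by (intro finsum_cong' refl finsum_rdistr[symmetric]) (auto simp: c[OF a] c[OF b] c[OF d] simp del: tri_ring_simps(1) intro!: finsum_closed)
      finally show "(a \<otimes>\<^bsub>?T\<^esub> b \<otimes>\<^bsub>?T\<^esub> d) i j = (a \<otimes>\<^bsub>?T\<^esub> (b \<otimes>\<^bsub>?T\<^esub> d)) i j" by (simp del: tri_ring_simps(1))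
    qed
  qed
  fix a b d assume a: "a \<in> carrier ?T" and b: "b \<in> carrier ?T" and d: "d \<in> carrier ?T"
  show "(a \<oplus>\<^bsub>?T\<^esub> b) \<otimes>\<^bsub>?T\<^esub> d = a \<otimes>\<^bsub>?T\<^esub> d \<oplus>\<^bsub>?T\<^esub> b \<otimes>\<^bsub>?T\<^esub> d"
  proof (intro ext)
    fix i j
    have "(\<Oplus>k\<in>{1..n}. (a i k \<oplus> b i k) \<otimes> d k j) = (\<Oplus>k\<in>{1..n}. a i k \<otimes> d k j \<oplus> b i k \<otimes> d k j)"
      by (intro finsum_cong' refl) (auto simp: l_distr c[OF a] c[OF b] c[OF d] simp del: tri_ring_simps(1))
    also have "\<dots> = (\<Oplus>k\<in>{1..n}. a i k \<otimes> d k j) \<oplus> (\<Oplus>k\<in>{1..n}. b i k \<otimes> d k j)"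
      by (rule finsum_addf) (auto simp: c[OF a] c[OF b] c[OF d] simp del: tri_ring_simps(1))
    finally show "((a \<oplus>\<^bsub>?T\<^esub> b) \<otimes>\<^bsub>?T\<^esub> d) i j = (a \<otimes>\<^bsub>?T\<^esub> d \<oplus>\<^bsub>?T\<^esub> b \<otimes>\<^bsub>?T\<^esub> d) i j" by (simp del: tri_ring_simps(1))
  qed
  show "d \<otimes>\<^bsub>?T\<^esub> (a \<oplus>\<^bsub>?T\<^esub> b) = d \<otimes>\<^bsub>?T\<^esub> a \<oplus>\<^bsub>?T\<^esub> d \<otimes>\<^bsub>?T\<^esub> b"
  proof (intro ext)
    fix i j
    have "(\<Oplus>k\<in>{1..n}. d i k \<otimes> (a k j \<oplus> b k j)) = (\<Oplus>k\<in>{1..n}. d i k \<otimes> a k j \<oplus> d i k \<otimes> b k j)"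
      by (intro finsum_cong' refl) (auto simp: r_distr c[OF a] c[OF b] c[OF d] simp del: tri_ring_simps(1))
    also have "\<dots> = (\<Oplus>k\<in>{1..n}. d i k \<otimes> a k j) \<oplus> (\<Oplus>k\<in>{1..n}. d i k \<otimes> b k j)"
      by (rule finsum_addf) (auto simp: c[OF a] c[OF b] c[OF d] simp del: tri_ring_simps(1))
    finally show "(d \<otimes>\<^bsub>?T\<^esub> (a \<oplus>\<^bsub>?T\<^esub> b)) i j = (d \<otimes>\<^bsub>?T\<^esub> a \<oplus>\<^bsub>?T\<^esub> d \<otimes>\<^bsub>?T\<^esub> b) i j" by (simp del: tri_ring_simps(1))
  qed
qed

definition el :: "nat \<Rightarrow> nat \<Rightarrow> 'a \<Rightarrow> nat \<Rightarrow> nat \<Rightarrow> 'a"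
  where "el i j a = (\<lambda>i' j'. if i' = i \<and> j' = j then a else \<zero>)"

lemma el_closed: "\<lbrakk>1 \<le> i; i \<le> j; j \<le> n; a \<in> carrier R\<rbrakk> \<Longrightarrow> el i j a \<in> carrier (tri_ring n R)"
  by (rule tri_carrierI) (auto simp: el_def)

lemma el_mult:
  assumes "j \<in> {1..n}" "a \<in> carrier R" "t \<in> carrier (tri_ring n R)"
  shows "el i j a \<otimes>\<^bsub>tri_ring n R\<^esub> t = (\<lambda>i' k. if i' = i then a \<otimes> t j k else \<zero>)"
proof (intro ext)
  fix i' k
  note c = tri_closed[OF assms(3)]
  show "(el i j a \<otimes>\<^bsub>tri_ring n R\<^esub> t) i' k = (if i' = i then a \<otimes> t j k else \<zero>)"
  proof (cases "i' = i")
    case True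
    have "(\<Oplus>l\<in>{1..n}. el i j a i' l \<otimes> t l k) = (\<Oplus>l\<in>{1..n}. if l = j then a \<otimes> t j k else \<zero>)"
      using True assms(2) by (intro finsum_cong') (auto simp: el_def c simp del: tri_ring_simps(1))
    also have "\<dots> = a \<otimes> t j k" by (rule finsum_delta) (use assms c in \<open>auto simp del: tri_ring_simps(1)\<close>)
    finally show ?thesis using True by (simp del: tri_ring_simps(1))
  next
    case False
    have "(\<Oplus>l\<in>{1..n}. el i j a i' l \<otimes> t l k) = (\<Oplus>l\<in>{1..n}. \<zero>)"
      using False by (intro finsum_cong') (auto simp: el_def c simp del: tri_ring_simps(1))
    thus ?thesis using False by (simp add: finsum_zero del: tri_ring_simps(1))
  qed
qed

lemma el_el:
  assumes "1 \<le> j" "j \<le> k" "k \<le> n" "a \<in> carrier R" "b \<in> carrier R"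
  shows "el i j a \<otimes>\<^bsub>tri_ring n R\<^esub> el j k b = el i k (a \<otimes> b)"
  using el_mult[of j n a "el j k b" i] el_closed[of j k n b] assms by (auto simp: el_def fun_eq_iff simp del: tri_ring_simps)

lemma el_add: "\<lbrakk>a \<in> carrier R; b \<in> carrier R\<rbrakk> \<Longrightarrow> el i j (a \<oplus> b) = el i j a \<oplus>\<^bsub>tri_ring n R\<^esub> el i j b"
  by (auto simp: el_def fun_eq_iff)

lemma finsum_tri_apply:
  assumes "g \<in> J \<rightarrow> carrier (tri_ring n R)"
  shows "finsum (tri_ring n R) g J i k = (\<Oplus>j\<in>J. g j i k)"
proof -
  interpret T: ring "tri_ring n R" by (rule tri_ring_ring)
  show ?thesis
    using additive_finsum[OF T.abelian_group_axioms abelian_group_axioms, of "\<lambda>t. t i k" g J] assms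
    by (simp add: tri_closed Pi_iff del: tri_ring_simps(1))
qed

text \<open>The sum begins at the diagonal because the entries below it vanish. It splits an
  arbitrary scalar into matrix units in \<open>tri_homI\<close>.\<close>

lemma el_row:
  assumes i: "i \<in> {1..n}" and t: "t \<in> carrier (tri_ring n R)"
  shows "el i i \<one> \<otimes>\<^bsub>tri_ring n R\<^esub> t = (\<Oplus>\<^bsub>tri_ring n R\<^esub>j\<in>{i..n}. el i j (t i j))"
proof (intro ext)
  fix i' k
  note c = tri_closed[OF t]
  have cl: "(\<lambda>j. el i j (t i j)) \<in> {i..n} \<rightarrow> carrier (tri_ring n R)"
    using i c by (intro Pi_I el_closed) auto
  have l: "(el i i \<one> \<otimes>\<^bsub>tri_ring n R\<^esub> t) i' k = (if i' = i then t i k else \<zero>)"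
    using el_mult[OF i one_closed t, of i] c by (simp del: tri_ring_simps)
  show "(el i i \<one> \<otimes>\<^bsub>tri_ring n R\<^esub> t) i' k = (\<Oplus>\<^bsub>tri_ring n R\<^esub>j\<in>{i..n}. el i j (t i j)) i' k"
    unfolding l finsum_tri_apply[OF cl]
  proof (cases "i' = i \<and> k \<in> {i..n}")
    case True
    have "(\<Oplus>j\<in>{i..n}. el i j (t i j) i' k) = (\<Oplus>j\<in>{i..n}. if j = k then t i k else \<zero>)"
      using True c by (intro finsum_cong') (auto simp: el_def simp del: tri_ring_simps)
    also have "\<dots> = t i k" by (rule finsum_delta) (use True c in \<open>auto simp del: tri_ring_simps\<close>)
    finally show "(if i' = i then t i k else \<zero>) = (\<Oplus>j\<in>{i..n}. el i j (t i j) i' k)" using True by simp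
  next
    case False
    have "(\<Oplus>j\<in>{i..n}. el i j (t i j) i' k) = (\<Oplus>j\<in>{i..n}. \<zero>)"
      using False by (intro finsum_cong') (auto simp: el_def)
    thus "(if i' = i then t i k else \<zero>) = (\<Oplus>j\<in>{i..n}. el i j (t i j) i' k)"
      using False tri_zero[OF t, of i k] by (auto simp: finsum_zero)
  qed
qed

lemma one_eq_sum_el: "\<one>\<^bsub>tri_ring n R\<^esub> = (\<Oplus>\<^bsub>tri_ring n R\<^esub>i\<in>{1..n}. el i i \<one>)"
proof (intro ext)
  fix i k
  have cl: "(\<lambda>i. el i i \<one>) \<in> {1..n} \<rightarrow> carrier (tri_ring n R)" by (intro Pi_I el_closed) auto
  show "\<one>\<^bsub>tri_ring n R\<^esub> i k = (\<Oplus>\<^bsub>tri_ring n R\<^esub>i\<in>{1..n}. el i i \<one>) i k"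
    unfolding finsum_tri_apply[OF cl]
  proof (cases "i = k \<and> i \<in> {1..n}")
    case True
    have "(\<Oplus>j\<in>{1..n}. el j j \<one> i k) = (\<Oplus>j\<in>{1..n}. if j = i then \<one> else \<zero>)"
      using True by (intro finsum_cong') (auto simp: el_def)
    also have "\<dots> = \<one>" by (rule finsum_delta) (use True in auto)
    finally show "\<one>\<^bsub>tri_ring n R\<^esub> i k = (\<Oplus>j\<in>{1..n}. el j j \<one> i k)" using True by simp
  next
    case False
    have "(\<Oplus>j\<in>{1..n}. el j j \<one> i k) = (\<Oplus>j\<in>{1..n}. \<zero>)"
      using False by (intro finsum_cong') (auto simp: el_def)
    thus "\<one>\<^bsub>tri_ring n R\<^esub> i k = (\<Oplus>j\<in>{1..n}. el j j \<one> i k)" using False by (auto simp: finsum_zero)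
  qed
qed

end

text \<open>\<open>tri_ring\<close> carries no action of R. Adding one entry by entry makes T_n(A)
  an instance of \<open>artin_alg\<close>, so that the finite length results for A apply to
  it.\<close>

definition tri_alg :: "nat \<Rightarrow> ('r, 'a) module \<Rightarrow> ('r, nat \<Rightarrow> nat \<Rightarrow> 'a) module"
  where "tri_alg n A = ring.extend (tri_ring n A) (module.fields (\<lambda>r t i j. r \<odot>\<^bsub>A\<^esub> t i j))"

lemma tri_alg_simps: "carrier (tri_alg n A) = carrier (tri_ring n A)" "mult (tri_alg n A) = mult (tri_ring n A)"
  "one (tri_alg n A) = one (tri_ring n A)" "zero (tri_alg n A) = zero (tri_ring n A)"
  "add (tri_alg n A) = add (tri_ring n A)" "smult (tri_alg n A) r t = (\<lambda>i j. r \<odot>\<^bsub>A\<^esub> t i j)"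
  by (simp_all add: tri_alg_def ring.defs module.defs)

lemma ring_cong:
  assumes "ring B" and eq: "carrier B' = carrier B" "mult B' = mult B" "one B' = one B" "zero B' = zero B" "add B' = add B"
  shows "ring B'"
proof -
  interpret ring B by fact
  show ?thesis
  proof (rule ringI)
    show "abelian_group B'"
    proof (rule abelian_groupI)
      fix x assume "x \<in> carrier B'"
      thus "\<exists>y\<in>carrier B'. y \<oplus>\<^bsub>B'\<^esub> x = \<zero>\<^bsub>B'\<^esub>" unfolding eq by (intro bexI[of _ "\<ominus>\<^bsub>B\<^esub> x"]) (auto simp: l_neg)
    qed (simp_all add: eq a_ac)
    show "monoid B'" by (rule monoidI) (simp_all add: eq m_assoc)
  qed (simp_all add: eq l_distr r_distr)
qed

text \<open>The two records share all ring fields, and this notion and the next ones depend on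
  nothing else.\<close>

lemma mod_hom_tri_alg: "mod_hom (tri_alg n A) X Y = mod_hom (tri_ring n A) X Y"
  by (simp add: mod_hom_def tri_alg_simps(1))

lemma submodule_tri_alg: "submodule U (tri_alg n A) X \<longleftrightarrow> submodule U (tri_ring n A) X"
  by (simp add: submodule_def submodule_axioms_def tri_alg_simps(1))

lemma fin_len_tri_alg: "fin_len (tri_alg n A) X \<longleftrightarrow> fin_len (tri_ring n A) X"
  by (simp add: fin_len_def submodule_tri_alg)

lemma reg_tri_alg: "reg (tri_alg n A) = reg (tri_ring n A)"
  by (simp add: reg_def tri_alg_simps)

lemma End_ring_tri_alg: "End_ring (tri_alg n A) X = End_ring (tri_ring n A) X"
  by (simp add: End_ring_def mod_hom_tri_alg)

lemma span_tri_alg: "span (tri_alg n A) X S = span (tri_ring n A) X S"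
  by (simp add: span_def submodule_tri_alg)

context artin_alg
begin

lemma tri_ring_ring: "ring (tri_ring n A)"
  by (rule A.tri_ring_ring)

lemma left_module_tri_alg: "left_module (tri_ring n A) X \<Longrightarrow> left_module (tri_alg n A) X"
proof -
  assume "left_module (tri_ring n A) X"
  then interpret X: left_module "tri_ring n A" X .
  show ?thesis
    by (rule left_moduleI[OF ring_cong[OF tri_ring_ring[of n] tri_alg_simps(1-5)] X.M.abelian_group_axioms])
      (simp_all only: tri_alg_simps X.smult_closed X.smult_l_distr X.smult_r_distr X.smult_assoc X.smult_one)
qed

lemma smult_A_zero: "r \<in> carrier R \<Longrightarrow> r \<odot>\<^bsub>A\<^esub> \<zero>\<^bsub>A\<^esub> = \<zero>\<^bsub>A\<^esub>"
  by (rule AM.smult_zero_right)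

lemma tri_alg_left_module: "left_module R (tri_alg n A)"
proof (rule left_moduleI[OF R.ring_axioms])
  interpret T: ring "tri_alg n A" by (rule ring_cong[OF tri_ring_ring tri_alg_simps(1-5)])
  show "abelian_group (tri_alg n A)" by (rule T.abelian_group_axioms)
  note c = A.tri_closed[of _ n] and z = tri_zero[of _ n A]
  fix r t assume r: "r \<in> carrier R" and t: "t \<in> carrier (tri_alg n A)"
  hence t: "t \<in> carrier (tri_ring n A)" by (simp only: tri_alg_simps)
  have "(\<lambda>i j. r \<odot>\<^bsub>A\<^esub> t i j) \<in> carrier (tri_ring n A)"
    by (rule tri_carrierI) (simp_all add: AM.smult_closed r c[OF t] z[OF t] smult_A_zero del: tri_ring_simps)
  thus "r \<odot>\<^bsub>tri_alg n A\<^esub> t \<in> carrier (tri_alg n A)" by (simp only: tri_alg_simps)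
  show "r \<odot>\<^bsub>tri_alg n A\<^esub> (t \<oplus>\<^bsub>tri_alg n A\<^esub> u) = r \<odot>\<^bsub>tri_alg n A\<^esub> t \<oplus>\<^bsub>tri_alg n A\<^esub> r \<odot>\<^bsub>tri_alg n A\<^esub> u"
    if "u \<in> carrier (tri_alg n A)" for u
  proof -
    have u: "u \<in> carrier (tri_ring n A)" using that by (simp only: tri_alg_simps)
    show ?thesis unfolding tri_alg_simps tri_ring_simps(3) by (simp add: AM.smult_r_distr r c[OF t] c[OF u] del: tri_ring_simps)
  qed
  fix s assume s: "s \<in> carrier R"
  show "(r \<oplus>\<^bsub>R\<^esub> s) \<odot>\<^bsub>tri_alg n A\<^esub> t = r \<odot>\<^bsub>tri_alg n A\<^esub> t \<oplus>\<^bsub>tri_alg n A\<^esub> s \<odot>\<^bsub>tri_alg n A\<^esub> t"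
    unfolding tri_alg_simps tri_ring_simps(3) by (simp add: AM.smult_l_distr r s c[OF t] del: tri_ring_simps)
  show "(r \<otimes>\<^bsub>R\<^esub> s) \<odot>\<^bsub>tri_alg n A\<^esub> t = r \<odot>\<^bsub>tri_alg n A\<^esub> (s \<odot>\<^bsub>tri_alg n A\<^esub> t)"
    unfolding tri_alg_simps by (simp add: AM.smult_assoc r s c[OF t] del: tri_ring_simps)
next
  fix t assume "t \<in> carrier (tri_alg n A)"
  hence t: "t \<in> carrier (tri_ring n A)" by (simp only: tri_alg_simps)
  show "\<one>\<^bsub>R\<^esub> \<odot>\<^bsub>tri_alg n A\<^esub> t = t" unfolding tri_alg_simps by (simp add: AM.smult_one A.tri_closed[OF t] del: tri_ring_simps)
qed

text \<open>Reading off entries embeds T_n(A) over R into n^2 copies of A, so it has finite length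
  over R.\<close>

lemma tri_alg_fin_gen: "fin_gen R (tri_alg n A)"
proof (rule fin_len_fin_gen[OF tri_alg_left_module])
  let ?B = "tri_alg n A"
  define A' where "A' = restrict_scalars A (reg A)"
  have A': "left_module R A'" "fin_len R A'"
    unfolding A'_def by (rule restrict_left_module[OF reg_left_module[OF A_ring]]) (rule restrict_reg_fin_len)
  let ?N = "dsum {1..n} (\<lambda>_. dsum {1..n} (\<lambda>_. A'))"
  have N1: "left_module R (dsum {1..n} (\<lambda>_. A'))" by (rule dsum_left_module[OF R.ring_axioms A'(1)])
  have N: "left_module R ?N" by (rule dsum_left_module[OF R.ring_axioms N1])
  have F1: "fin_len R (dsum {1..n} (\<lambda>_. A'))" by (rule fin_len_dsum[OF R.ring_axioms finite_atLeastAtMost A'])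
  have F: "fin_len R ?N" by (rule fin_len_dsum[OF R.ring_axioms finite_atLeastAtMost N1 F1])
  let ?f = "\<lambda>t. \<lambda>i\<in>{1..n}. \<lambda>j\<in>{1..n}. t i j"
  have f: "?f \<in> mod_hom R ?B ?N"
  proof (intro mod_hom_dsumI[OF tri_alg_left_module])
    fix i j
    show "(\<lambda>t. t i j) \<in> mod_hom R ?B A'"
    proof (rule mod_homI)
      fix t assume "t \<in> carrier ?B"
      hence t: "t \<in> carrier (tri_ring n A)" by (simp only: tri_alg_simps)
      show "t i j \<in> carrier A'" using A.tri_closed[OF t] by (simp add: A'_def del: tri_ring_simps)
      show "(t \<oplus>\<^bsub>?B\<^esub> u) i j = t i j \<oplus>\<^bsub>A'\<^esub> u i j" for u by (simp add: A'_def tri_alg_simps)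
      show "(r \<odot>\<^bsub>?B\<^esub> t) i j = r \<odot>\<^bsub>A'\<^esub> t i j" if "r \<in> carrier R" for r
        using rho_mult[OF that A.tri_closed[OF t]] by (simp add: A'_def tri_alg_simps)
    qed
  qed
  have inj: "inj_on ?f (carrier ?B)"
  proof (rule inj_onI, intro ext)
    fix t u i j assume "t \<in> carrier ?B" "u \<in> carrier ?B" and eq: "?f t = ?f u"
    hence t: "t \<in> carrier (tri_ring n A)" and u: "u \<in> carrier (tri_ring n A)" by (simp_all only: tri_alg_simps)
    show "t i j = u i j"
    proof (cases "i \<in> {1..n} \<and> j \<in> {1..n}")
      case True
      thus ?thesis using fun_cong[OF fun_cong[OF eq, of i], of j] by simp
    next
      case False
      have "t i j = \<zero>\<^bsub>A\<^esub>" by (rule tri_zero[OF t]) (use False in auto)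
      moreover have "u i j = \<zero>\<^bsub>A\<^esub>" by (rule tri_zero[OF u]) (use False in auto)
      ultimately show ?thesis by simp
    qed
  qed
  show "fin_len R ?B" by (rule fin_len_inj[OF tri_alg_left_module N f inj F])
qed

lemma tri_artin_alg: "artin_alg R (tri_alg n A)"
proof
  let ?B = "tri_alg n A"
  have ring: "ring ?B" by (rule ring_cong[OF tri_ring_ring tri_alg_simps(1-5)])
  interpret T: left_module R "?B" by (rule tri_alg_left_module)
  have mod: "Module.module R ?B"
    by (rule moduleI) (simp_all add: R.cring_axioms T.M.abelian_group_axioms T.smult_closed T.smult_l_distr
        T.smult_r_distr T.smult_assoc T.smult_one)
  have "(r \<odot>\<^bsub>?B\<^esub> a) \<otimes>\<^bsub>?B\<^esub> b = r \<odot>\<^bsub>?B\<^esub> (a \<otimes>\<^bsub>?B\<^esub> b) \<and>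
      a \<otimes>\<^bsub>?B\<^esub> (r \<odot>\<^bsub>?B\<^esub> b) = r \<odot>\<^bsub>?B\<^esub> (a \<otimes>\<^bsub>?B\<^esub> b)"
    if r: "r \<in> carrier R" and "a \<in> carrier ?B" "b \<in> carrier ?B" for r a b
  proof -
    have a: "a \<in> carrier (tri_ring n A)" and b: "b \<in> carrier (tri_ring n A)" using that by (simp_all only: tri_alg_simps)
    note c = A.tri_closed[OF a] A.tri_closed[OF b]
    have "(\<Oplus>\<^bsub>A\<^esub>k\<in>{1..n}. (r \<odot>\<^bsub>A\<^esub> a i k) \<otimes>\<^bsub>A\<^esub> b k j) = r \<odot>\<^bsub>A\<^esub> (\<Oplus>\<^bsub>A\<^esub>k\<in>{1..n}. a i k \<otimes>\<^bsub>A\<^esub> b k j)"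
      "(\<Oplus>\<^bsub>A\<^esub>k\<in>{1..n}. a i k \<otimes>\<^bsub>A\<^esub> (r \<odot>\<^bsub>A\<^esub> b k j)) = r \<odot>\<^bsub>A\<^esub> (\<Oplus>\<^bsub>A\<^esub>k\<in>{1..n}. a i k \<otimes>\<^bsub>A\<^esub> b k j)" for i j
      using AM.smult_finsum[OF r, of "\<lambda>k. a i k \<otimes>\<^bsub>A\<^esub> b k j" "{1..n}"] c
      by (auto simp: smult_mult mult_smult r simp del: tri_ring_simps)
    thus ?thesis unfolding tri_alg_simps tri_ring_simps(5) by simp
  qed
  thus "artin_algebra R ?B"
    unfolding artin_algebra_def using art ring mod tri_alg_fin_gen by blast
qed

lemma tri_reg_fin_len: "fin_len (tri_ring n A) (reg (tri_ring n A))"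
proof -
  interpret T: artin_alg R "tri_alg n A" by (rule tri_artin_alg)
  show ?thesis using T.reg_fin_len by (simp only: fin_len_tri_alg reg_tri_alg)
qed

lemma tri_End_fin_len:
  assumes X: "left_module (tri_ring n A) X" "fin_gen (tri_ring n A) X"
  shows "fin_len (End_ring (tri_ring n A) X) (reg (End_ring (tri_ring n A) X))"
proof -
  interpret T: artin_alg R "tri_alg n A" by (rule tri_artin_alg)
  note X' = left_module_tri_alg[OF X(1)]
  have "fin_gen (tri_alg n A) X"
    using X(2) unfolding fin_gen_iff_span[OF X(1)] fin_gen_iff_span[OF X'] span_tri_alg .
  from T.End_fin_len[OF X' this] show ?thesis by (simp only: End_ring_tri_alg)
qed

end

subsection \<open>Objects of the morphism category as modules over the triangular matrix ring\<close>

lemma tri_module_simps [simp]: "carrier (tri_module n X) = (\<Pi>\<^sub>E i\<in>{1..n}. carrier (branch X i))"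
  "\<zero>\<^bsub>tri_module n X\<^esub> = (\<lambda>i\<in>{1..n}. \<zero>\<^bsub>branch X i\<^esub>)"
  "x \<oplus>\<^bsub>tri_module n X\<^esub> y = (\<lambda>i\<in>{1..n}. x i \<oplus>\<^bsub>branch X i\<^esub> y i)"
  by (simp_all add: tri_module_def)

locale tri_mod = ring A for A (structure) +
  fixes n :: nat and X :: "('a, 'm) mor"
  assumes branch: "\<And>i. i \<in> {1..n} \<Longrightarrow> left_module A (branch X i)"
    and smap: "\<And>i. i \<in> {1..<n} \<Longrightarrow> smap X i \<in> mod_hom A (branch X (Suc i)) (branch X i)"
begin

definition phi :: "nat \<Rightarrow> nat \<Rightarrow> 'm \<Rightarrow> 'm" where "phi i j = foldr (smap X) [i..<j]"

lemma phi_self [simp]: "phi i i x = x"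
  by (simp add: phi_def)

lemma phi_Suc: "i \<le> j \<Longrightarrow> phi i (Suc j) x = phi i j (smap X j x)"
  by (simp add: phi_def)

lemma phi_phi: "\<lbrakk>i \<le> j; j \<le> k\<rbrakk> \<Longrightarrow> phi i j (phi j k x) = phi i k x"
  using upt_add_eq_append[of i j "k - j"] by (simp add: phi_def)

lemma phi_hom: "\<lbrakk>1 \<le> i; i \<le> j; j \<le> n\<rbrakk> \<Longrightarrow> phi i j \<in> mod_hom A (branch X j) (branch X i)"
proof (induction "j - i" arbitrary: j)
  case 0
  hence "j = i" by simp
  thus ?case using mod_hom_id by (simp add: phi_def id_def)
next
  case (Suc k)
  then obtain j' where j: "j = Suc j'" by (cases j) auto
  have "phi i j = (\<lambda>x. phi i j' (smap X j' x))" using Suc j by (simp add: fun_eq_iff phi_Suc)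
  moreover have h: "phi i j' \<in> mod_hom A (branch X j') (branch X i)" using Suc j by simp
  have "j' \<in> {1..<n}" using Suc.prems Suc.hyps(2) j by auto
  from mod_hom_comp[OF smap[OF this] h]
  have "(\<lambda>x. phi i j' (smap X j' x)) \<in> mod_hom A (branch X j) (branch X i)" using j by simp
  ultimately show ?case by simp
qed

text \<open>Extended by zero below the diagonal, so that the action of a matrix becomes a sum over
  the full range, as in \<open>tri_smult\<close>, and double sums can be interchanged.\<close>

definition psi :: "nat \<Rightarrow> nat \<Rightarrow> 'm \<Rightarrow> 'm" where "psi i j x = (if i \<le> j then phi i j x else \<zero>\<^bsub>branch X i\<^esub>)"

lemma psi_hom: "\<lbrakk>i \<in> {1..n}; j \<in> {1..n}\<rbrakk> \<Longrightarrow> psi i j \<in> mod_hom A (branch X j) (branch X i)"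
  using phi_hom[of i j] mod_hom_const_zero[OF branch[of i], of "branch X j"] by (cases "i \<le> j") (simp_all add: psi_def[abs_def])

lemma tri_smult_closed_term:
  assumes "a \<in> carrier (tri_ring n A)" "i \<in> {1..n}" "j \<in> {1..n}" "y \<in> carrier (branch X j)"
  shows "a i j \<odot>\<^bsub>branch X i\<^esub> psi i j y \<in> carrier (branch X i)"
  using left_module.smult_closed[OF branch[OF assms(2)] tri_closed[OF assms(1)] mod_hom_closed[OF psi_hom[OF assms(2,3)] assms(4)]] .

lemma tri_smult:
  assumes a: "a \<in> carrier (tri_ring n A)" and x: "x \<in> carrier (tri_module n X)" and i: "i \<in> {1..n}"
  shows "(a \<odot>\<^bsub>tri_module n X\<^esub> x) i = (\<Oplus>\<^bsub>branch X i\<^esub>j\<in>{1..n}. a i j \<odot>\<^bsub>branch X i\<^esub> psi i j (x j))"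
proof -
  interpret B: left_module A "branch X i" by (rule branch[OF i])
  have xj: "x j \<in> carrier (branch X j)" if "j \<in> {1..n}" for j using x that by auto
  let ?t = "\<lambda>j. a i j \<odot>\<^bsub>branch X i\<^esub> psi i j (x j)"
  have t: "?t j \<in> carrier (branch X i)" if "j \<in> {1..n}" for j by (rule tri_smult_closed_term[OF a i that xj[OF that]])
  have z: "?t j = \<zero>\<^bsub>branch X i\<^esub>" if "j \<in> {1..<i}" for j
  proof -
    have "a i j = \<zero>" by (rule tri_zero[OF a]) (use that in auto)
    thus ?thesis using that by (simp add: psi_def)
  qed
  have f: "foldr (smap X) [i..<j] y = psi i j y" if "i < j" for j y using that by (simp add: psi_def phi_def)
  have U: "{1..n} = {1..<i} \<union> insert i {i<..n}" using i by auto
  have "(\<Oplus>\<^bsub>branch X i\<^esub>j\<in>{1..n}. ?t j) = (\<Oplus>\<^bsub>branch X i\<^esub>j\<in>{1..<i}. ?t j) \<oplus>\<^bsub>branch X i\<^esub> (\<Oplus>\<^bsub>branch X i\<^esub>j\<in>insert i {i<..n}. ?t j)"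
    unfolding U by (rule B.M.finsum_Un_disjoint) (use t i in auto)
  also have "(\<Oplus>\<^bsub>branch X i\<^esub>j\<in>{1..<i}. ?t j) = (\<Oplus>\<^bsub>branch X i\<^esub>j\<in>{1..<i}. \<zero>\<^bsub>branch X i\<^esub>)"
    using z by (intro B.M.finsum_cong') auto
  also have "(\<Oplus>\<^bsub>branch X i\<^esub>j\<in>insert i {i<..n}. ?t j) = ?t i \<oplus>\<^bsub>branch X i\<^esub> (\<Oplus>\<^bsub>branch X i\<^esub>j\<in>{i<..n}. ?t j)"
    by (rule B.M.finsum_insert) (use t i in auto)
  also have "(\<Oplus>\<^bsub>branch X i\<^esub>j\<in>{i<..n}. ?t j) = (\<Oplus>\<^bsub>branch X i\<^esub>j\<in>{i<..n}. a i j \<odot>\<^bsub>branch X i\<^esub> foldr (smap X) [i..<j] (x j))"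
    using t i by (intro B.M.finsum_cong' refl Pi_I) (simp_all add: f)
  finally have "(\<Oplus>\<^bsub>branch X i\<^esub>j\<in>{1..n}. ?t j) = \<zero>\<^bsub>branch X i\<^esub> \<oplus>\<^bsub>branch X i\<^esub> (a i i \<odot>\<^bsub>branch X i\<^esub> x i \<oplus>\<^bsub>branch X i\<^esub>
      (\<Oplus>\<^bsub>branch X i\<^esub>j\<in>{i<..n}. a i j \<odot>\<^bsub>branch X i\<^esub> foldr (smap X) [i..<j] (x j)))"
    by (simp add: B.M.finsum_zero psi_def)
  moreover have "a i i \<odot>\<^bsub>branch X i\<^esub> x i \<oplus>\<^bsub>branch X i\<^esub>
      (\<Oplus>\<^bsub>branch X i\<^esub>j\<in>{i<..n}. a i j \<odot>\<^bsub>branch X i\<^esub> foldr (smap X) [i..<j] (x j)) \<in> carrier (branch X i)"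
  proof (intro B.M.a_closed B.M.finsum_closed Pi_I)
    show "a i i \<odot>\<^bsub>branch X i\<^esub> x i \<in> carrier (branch X i)" using t[OF i] by (simp add: psi_def)
    fix j assume "j \<in> {i<..n}"
    thus "a i j \<odot>\<^bsub>branch X i\<^esub> foldr (smap X) [i..<j] (x j) \<in> carrier (branch X i)"
      using t[of j] i by (simp add: f)
  qed
  ultimately show ?thesis using i by (simp add: tri_module_def)
qed

lemma tri_smult_ext: "a \<odot>\<^bsub>tri_module n X\<^esub> x \<in> extensional {1..n}"
  by (simp add: tri_module_def)

lemma tri_module_left_module: "left_module (tri_ring n A) (tri_module n X)"
proof -
  let ?D = "dsum {1..n} (branch X)"
  have D: "left_module A ?D" by (rule dsum_left_module[OF ring_axioms branch])
  interpret D: left_module A "?D" by (rule D)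
  let ?V = "tri_module n X" and ?T = "tri_ring n A"
  have eq: "carrier ?V = carrier ?D" "\<zero>\<^bsub>?V\<^esub> = \<zero>\<^bsub>?D\<^esub>"
    "x \<oplus>\<^bsub>?V\<^esub> y = x \<oplus>\<^bsub>?D\<^esub> y" for x y by simp_all
  have ab: "abelian_group ?V"
  proof (rule abelian_groupI)
    fix x assume "x \<in> carrier ?V"
    thus "\<exists>y\<in>carrier ?V. y \<oplus>\<^bsub>?V\<^esub> x = \<zero>\<^bsub>?V\<^esub>"
      unfolding eq by (intro bexI[of _ "\<ominus>\<^bsub>?D\<^esub> x"] D.M.l_neg D.M.a_inv_closed)
  qed (simp_all only: eq D.M.a_closed D.M.zero_closed D.M.a_ac D.M.l_zero D.M.r_zero)
  have cl: "x i \<in> carrier (branch X i)" if "x \<in> carrier ?V" "i \<in> {1..n}" for x i using that by auto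
  have smc: "a \<odot>\<^bsub>?V\<^esub> x \<in> carrier ?V" if a: "a \<in> carrier ?T" and x: "x \<in> carrier ?V" for a x
  proof -
    have "(a \<odot>\<^bsub>?V\<^esub> x) i \<in> carrier (branch X i)" if i: "i \<in> {1..n}" for i
    proof -
      interpret B: left_module A "branch X i" by (rule branch[OF i])
      show ?thesis unfolding tri_smult[OF a x i] using tri_smult_closed_term[OF a i _ cl[OF x]] by (intro B.M.finsum_closed) blast
    qed
    thus ?thesis using tri_smult_ext[of a x] by (simp add: PiE_iff)
  qed
  have ext: "u = v" if "u \<in> carrier ?V" "v \<in> carrier ?V" "\<And>i. i \<in> {1..n} \<Longrightarrow> u i = v i" for u v
    using that by (intro extensionalityI[of _ "{1..n}"]) (auto simp: PiE_iff)
  interpret V: abelian_group ?V by (rule ab)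
  interpret T: ring ?T by (rule tri_ring_ring)
  show ?thesis
  proof (rule left_moduleI[OF tri_ring_ring ab smc])
    fix a b x assume a: "a \<in> carrier ?T" and b: "b \<in> carrier ?T" and x: "x \<in> carrier ?V"
    show "(a \<oplus>\<^bsub>?T\<^esub> b) \<odot>\<^bsub>?V\<^esub> x = a \<odot>\<^bsub>?V\<^esub> x \<oplus>\<^bsub>?V\<^esub> b \<odot>\<^bsub>?V\<^esub> x"
    proof (rule ext)
      fix i assume i: "i \<in> {1..n}"
      interpret B: left_module A "branch X i" by (rule branch[OF i])
      have p: "psi i j (x j) \<in> carrier (branch X i)" if "j \<in> {1..n}" for j by (rule mod_hom_closed[OF psi_hom[OF i that] cl[OF x that]])
      have "((a \<oplus>\<^bsub>?T\<^esub> b) \<odot>\<^bsub>?V\<^esub> x) i = (\<Oplus>\<^bsub>branch X i\<^esub>j\<in>{1..n}. (a i j \<oplus> b i j) \<odot>\<^bsub>branch X i\<^esub> psi i j (x j))"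
        using tri_smult[OF T.a_closed[OF a b] x i] by (simp del: tri_ring_simps(1))
      also have "\<dots> = (\<Oplus>\<^bsub>branch X i\<^esub>j\<in>{1..n}. a i j \<odot>\<^bsub>branch X i\<^esub> psi i j (x j) \<oplus>\<^bsub>branch X i\<^esub> b i j \<odot>\<^bsub>branch X i\<^esub> psi i j (x j))"
        by (intro B.M.finsum_cong' refl Pi_I)
          (simp_all add: B.smult_l_distr B.smult_closed p tri_closed[OF a] tri_closed[OF b] del: tri_ring_simps)
      also have "\<dots> = (a \<odot>\<^bsub>?V\<^esub> x) i \<oplus>\<^bsub>branch X i\<^esub> (b \<odot>\<^bsub>?V\<^esub> x) i"
        unfolding tri_smult[OF a x i] tri_smult[OF b x i]
        by (rule B.M.finsum_addf) (simp_all add: B.smult_closed p tri_closed[OF a] tri_closed[OF b] del: tri_ring_simps)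
      finally show "((a \<oplus>\<^bsub>?T\<^esub> b) \<odot>\<^bsub>?V\<^esub> x) i = (a \<odot>\<^bsub>?V\<^esub> x \<oplus>\<^bsub>?V\<^esub> b \<odot>\<^bsub>?V\<^esub> x) i" using i by simp
    qed (intro smc V.a_closed T.a_closed a b x)+
    show "(a \<otimes>\<^bsub>?T\<^esub> b) \<odot>\<^bsub>?V\<^esub> x = a \<odot>\<^bsub>?V\<^esub> (b \<odot>\<^bsub>?V\<^esub> x)"
    proof (rule ext)
      fix i assume i: "i \<in> {1..n}"
      interpret B: left_module A "branch X i" by (rule branch[OF i])
      have p: "psi i j (x j) \<in> carrier (branch X i)" if "j \<in> {1..n}" for j by (rule mod_hom_closed[OF psi_hom[OF i that] cl[OF x that]])
      have pp: "psi i k (psi k j (x j)) \<in> carrier (branch X i)" if "k \<in> {1..n}" "j \<in> {1..n}" for k j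
        by (rule mod_hom_closed[OF psi_hom[OF i that(1)] mod_hom_closed[OF psi_hom[OF that] cl[OF x that(2)]]])
      note c = tri_closed[OF a] tri_closed[OF b]
      have "((a \<otimes>\<^bsub>?T\<^esub> b) \<odot>\<^bsub>?V\<^esub> x) i = (\<Oplus>\<^bsub>branch X i\<^esub>j\<in>{1..n}. (\<Oplus>k\<in>{1..n}. a i k \<otimes> b k j) \<odot>\<^bsub>branch X i\<^esub> psi i j (x j))"
        using tri_smult[OF tri_mult_closed[OF a b] x i] by (simp del: tri_ring_simps(1))
      also have "\<dots> = (\<Oplus>\<^bsub>branch X i\<^esub>j\<in>{1..n}. \<Oplus>\<^bsub>branch X i\<^esub>k\<in>{1..n}. (a i k \<otimes> b k j) \<odot>\<^bsub>branch X i\<^esub> psi i j (x j))"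
        by (intro B.M.finsum_cong' refl B.finsum_smult Pi_I B.M.finsum_closed) (simp_all add: B.smult_closed p c del: tri_ring_simps)
      also have "\<dots> = (\<Oplus>\<^bsub>branch X i\<^esub>k\<in>{1..n}. \<Oplus>\<^bsub>branch X i\<^esub>j\<in>{1..n}. (a i k \<otimes> b k j) \<odot>\<^bsub>branch X i\<^esub> psi i j (x j))"
        by (rule B.M.finsum_swap) (simp_all add: B.smult_closed p c del: tri_ring_simps)
      also have "\<dots> = (\<Oplus>\<^bsub>branch X i\<^esub>k\<in>{1..n}. \<Oplus>\<^bsub>branch X i\<^esub>j\<in>{1..n}. a i k \<odot>\<^bsub>branch X i\<^esub> psi i k (b k j \<odot>\<^bsub>branch X k\<^esub> psi k j (x j)))"
      proof -
        have tc: "a i k \<odot>\<^bsub>branch X i\<^esub> psi i k (b k j \<odot>\<^bsub>branch X k\<^esub> psi k j (x j)) \<in> carrier (branch X i) \<and>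
          (a i k \<otimes> b k j) \<odot>\<^bsub>branch X i\<^esub> psi i j (x j) = a i k \<odot>\<^bsub>branch X i\<^esub> psi i k (b k j \<odot>\<^bsub>branch X k\<^esub> psi k j (x j))"
          if k: "k \<in> {1..n}" and j: "j \<in> {1..n}" for k j
        proof
        have pk: "psi k j (x j) \<in> carrier (branch X k)" by (rule mod_hom_closed[OF psi_hom[OF k j] cl[OF x j]])
        have *: "psi i k (b k j \<odot>\<^bsub>branch X k\<^esub> psi k j (x j)) = b k j \<odot>\<^bsub>branch X i\<^esub> psi i k (psi k j (x j))"
          by (rule mod_hom_smult[OF psi_hom[OF i k] c(2) pk])
        show "a i k \<odot>\<^bsub>branch X i\<^esub> psi i k (b k j \<odot>\<^bsub>branch X k\<^esub> psi k j (x j)) \<in> carrier (branch X i)"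
          unfolding * by (intro B.smult_closed pp k j c)
        show "(a i k \<otimes> b k j) \<odot>\<^bsub>branch X i\<^esub> psi i j (x j) = a i k \<odot>\<^bsub>branch X i\<^esub> psi i k (b k j \<odot>\<^bsub>branch X k\<^esub> psi k j (x j))"
        \<comment> \<open>For i \<le> k \<le> j the composites of structure maps match; otherwise
          one of the two matrix entries is zero.\<close>
        proof (cases "i \<le> k \<and> k \<le> j")
          case True
          hence "psi i k (psi k j (x j)) = psi i j (x j)" by (simp add: psi_def phi_phi)
          thus ?thesis unfolding * using p[OF j] c by (simp add: B.smult_assoc del: tri_ring_simps)
        next
          case False
          hence "a i k = \<zero> \<or> b k j = \<zero>" using tri_zero[OF a, of i k] tri_zero[OF b, of k j] by auto
          thus ?thesis unfolding * using p[OF j] pp[OF k j] c by (auto simp: B.smult_closed simp del: tri_ring_simps)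
        qed
        qed
        show ?thesis by (intro B.M.finsum_cong' refl Pi_I B.M.finsum_closed tc[THEN conjunct1] tc[THEN conjunct2])
      qed
      also have "\<dots> = (\<Oplus>\<^bsub>branch X i\<^esub>k\<in>{1..n}. a i k \<odot>\<^bsub>branch X i\<^esub> psi i k ((b \<odot>\<^bsub>?V\<^esub> x) k))"
      proof (intro B.M.finsum_cong' refl Pi_I)
        fix k assume k: "k \<in> {1..n}"
        have t: "(\<lambda>j. b k j \<odot>\<^bsub>branch X k\<^esub> psi k j (x j)) \<in> {1..n} \<rightarrow> carrier (branch X k)"
          by (rule Pi_I) (rule tri_smult_closed_term[OF b k _ cl[OF x]])
        have t': "(\<lambda>j. psi i k (b k j \<odot>\<^bsub>branch X k\<^esub> psi k j (x j))) \<in> {1..n} \<rightarrow> carrier (branch X i)"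
          using t mod_hom_closed[OF psi_hom[OF i k]] by (simp add: Pi_iff)
        show "a i k \<odot>\<^bsub>branch X i\<^esub> psi i k ((b \<odot>\<^bsub>?V\<^esub> x) k) \<in> carrier (branch X i)"
          by (rule tri_smult_closed_term[OF a i k cl[OF smc[OF b x] k]])
        show "(\<Oplus>\<^bsub>branch X i\<^esub>j\<in>{1..n}. a i k \<odot>\<^bsub>branch X i\<^esub> psi i k (b k j \<odot>\<^bsub>branch X k\<^esub> psi k j (x j))) =
          a i k \<odot>\<^bsub>branch X i\<^esub> psi i k ((b \<odot>\<^bsub>?V\<^esub> x) k)"
          unfolding tri_smult[OF b x k] mod_hom_finsum[OF branch[OF k] branch[OF i] psi_hom[OF i k] t]
          by (rule B.smult_finsum[symmetric, OF c(1) t'])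
      qed
      also have "\<dots> = (a \<odot>\<^bsub>?V\<^esub> (b \<odot>\<^bsub>?V\<^esub> x)) i" by (rule tri_smult[OF a smc[OF b x] i, symmetric])
      finally show "((a \<otimes>\<^bsub>?T\<^esub> b) \<odot>\<^bsub>?V\<^esub> x) i = (a \<odot>\<^bsub>?V\<^esub> (b \<odot>\<^bsub>?V\<^esub> x)) i" .
    qed (intro smc tri_mult_closed a b x)+
  next
    fix a x y assume a: "a \<in> carrier ?T" and x: "x \<in> carrier ?V" and y: "y \<in> carrier ?V"
    show "a \<odot>\<^bsub>?V\<^esub> (x \<oplus>\<^bsub>?V\<^esub> y) = a \<odot>\<^bsub>?V\<^esub> x \<oplus>\<^bsub>?V\<^esub> a \<odot>\<^bsub>?V\<^esub> y"
    proof (rule ext)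
      fix i assume i: "i \<in> {1..n}"
      interpret B: left_module A "branch X i" by (rule branch[OF i])
      have p: "psi i j (x j) \<in> carrier (branch X i)" "psi i j (y j) \<in> carrier (branch X i)" if "j \<in> {1..n}" for j
        by (rule mod_hom_closed[OF psi_hom[OF i that] cl[OF x that]] mod_hom_closed[OF psi_hom[OF i that] cl[OF y that]])+
      have "(a \<odot>\<^bsub>?V\<^esub> (x \<oplus>\<^bsub>?V\<^esub> y)) i = (\<Oplus>\<^bsub>branch X i\<^esub>j\<in>{1..n}. a i j \<odot>\<^bsub>branch X i\<^esub> psi i j ((x \<oplus>\<^bsub>?V\<^esub> y) j))"
        by (rule tri_smult[OF a V.a_closed[OF x y] i])
      also have "\<dots> = (\<Oplus>\<^bsub>branch X i\<^esub>j\<in>{1..n}. a i j \<odot>\<^bsub>branch X i\<^esub> psi i j (x j) \<oplus>\<^bsub>branch X i\<^esub> a i j \<odot>\<^bsub>branch X i\<^esub> psi i j (y j))"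
        by (intro B.M.finsum_cong' refl Pi_I)
          (simp_all add: B.smult_r_distr B.smult_closed p tri_closed[OF a] mod_hom_add[OF psi_hom[OF i]] cl[OF x, simplified] cl[OF y, simplified] del: tri_ring_simps)
      also have "\<dots> = (a \<odot>\<^bsub>?V\<^esub> x) i \<oplus>\<^bsub>branch X i\<^esub> (a \<odot>\<^bsub>?V\<^esub> y) i"
        unfolding tri_smult[OF a x i] tri_smult[OF a y i]
        by (rule B.M.finsum_addf) (simp_all add: B.smult_closed p tri_closed[OF a] del: tri_ring_simps)
      finally show "(a \<odot>\<^bsub>?V\<^esub> (x \<oplus>\<^bsub>?V\<^esub> y)) i = (a \<odot>\<^bsub>?V\<^esub> x \<oplus>\<^bsub>?V\<^esub> a \<odot>\<^bsub>?V\<^esub> y) i" using i by simp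
    qed (intro smc V.a_closed a x y)+
  next
    fix x assume x: "x \<in> carrier ?V"
    show "\<one>\<^bsub>?T\<^esub> \<odot>\<^bsub>?V\<^esub> x = x"
    proof (rule ext)
      fix i assume i: "i \<in> {1..n}"
      interpret B: left_module A "branch X i" by (rule branch[OF i])
      have p: "psi i j (x j) \<in> carrier (branch X i)" if "j \<in> {1..n}" for j by (rule mod_hom_closed[OF psi_hom[OF i that] cl[OF x that]])
      have "(\<one>\<^bsub>?T\<^esub> \<odot>\<^bsub>?V\<^esub> x) i = (\<Oplus>\<^bsub>branch X i\<^esub>j\<in>{1..n}. \<one>\<^bsub>?T\<^esub> i j \<odot>\<^bsub>branch X i\<^esub> psi i j (x j))"
        by (rule tri_smult[OF T.one_closed x i])
      also have "\<dots> = (\<Oplus>\<^bsub>branch X i\<^esub>j\<in>{1..n}. if j = i then x i else \<zero>\<^bsub>branch X i\<^esub>)"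
        using i cl[OF x i] by (intro B.M.finsum_cong' refl Pi_I) (auto simp: B.smult_one psi_def p[simplified psi_def])
      also have "\<dots> = x i" by (rule B.M.finsum_delta[OF _ i cl[OF x i]]) simp
      finally show "(\<one>\<^bsub>?T\<^esub> \<odot>\<^bsub>?V\<^esub> x) i = x i" .
    qed (intro smc T.one_closed x)+
  qed
qed

lemma el_smult:
  assumes i: "1 \<le> i" "i \<le> j" "j \<le> n" and a: "a \<in> carrier A" and x: "x \<in> carrier (tri_module n X)" and k: "k \<in> {1..n}"
  shows "(el i j a \<odot>\<^bsub>tri_module n X\<^esub> x) k = (if k = i then a \<odot>\<^bsub>branch X i\<^esub> phi i j (x j) else \<zero>\<^bsub>branch X k\<^esub>)"
proof -
  interpret B: left_module A "branch X k" by (rule branch[OF k])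
  have j: "j \<in> {1..n}" "i \<in> {1..n}" using i by auto
  have cl: "x l \<in> carrier (branch X l)" if "l \<in> {1..n}" for l using x that by auto
  have p: "psi k l (x l) \<in> carrier (branch X k)" if "l \<in> {1..n}" for l by (rule mod_hom_closed[OF psi_hom[OF k that] cl[OF that]])
  have *: "(el i j a \<odot>\<^bsub>tri_module n X\<^esub> x) k = (\<Oplus>\<^bsub>branch X k\<^esub>l\<in>{1..n}. el i j a k l \<odot>\<^bsub>branch X k\<^esub> psi k l (x l))"
    by (rule tri_smult[OF el_closed[OF i a] x k])
  show ?thesis
  proof (cases "k = i")
    case True
    note * also have "(\<Oplus>\<^bsub>branch X k\<^esub>l\<in>{1..n}. el i j a k l \<odot>\<^bsub>branch X k\<^esub> psi k l (x l)) = (\<Oplus>\<^bsub>branch X k\<^esub>l\<in>{1..n}. if l = j then a \<odot>\<^bsub>branch X k\<^esub> psi k j (x j) else \<zero>\<^bsub>branch X k\<^esub>)"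
      using p a j unfolding True[symmetric] by (intro B.M.finsum_cong' refl Pi_I) (auto simp: el_def B.smult_closed)
    also have "\<dots> = a \<odot>\<^bsub>branch X k\<^esub> psi k j (x j)" by (rule B.M.finsum_delta[OF _ j(1)]) (use p[OF j(1)] a in \<open>simp_all add: B.smult_closed\<close>)
    finally show ?thesis using True i by (simp add: psi_def)
  next
    case False
    have "(\<Oplus>\<^bsub>branch X k\<^esub>l\<in>{1..n}. el i j a k l \<odot>\<^bsub>branch X k\<^esub> psi k l (x l)) = (\<Oplus>\<^bsub>branch X k\<^esub>l\<in>{1..n}. \<zero>\<^bsub>branch X k\<^esub>)"
      using False p by (intro B.M.finsum_cong' refl Pi_I) (auto simp: el_def)
    thus ?thesis using * False by (simp add: B.M.finsum_zero)
  qed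
qed

text \<open>T_n(A) is generated by the matrices with one diagonal entry together with the units just
  above the diagonal, so linearity is checked on these. Units further up are products of them, and
  \<open>el_row\<close> with additivity covers general scalars.\<close>

lemma tri_homI:
  assumes V: "left_module (tri_ring n A) V"
    and closed: "\<And>i v. \<lbrakk>i \<in> {1..n}; v \<in> carrier V\<rbrakk> \<Longrightarrow> g i v \<in> carrier (branch X i)"
    and add: "\<And>i v w. \<lbrakk>i \<in> {1..n}; v \<in> carrier V; w \<in> carrier V\<rbrakk> \<Longrightarrow> g i (v \<oplus>\<^bsub>V\<^esub> w) = g i v \<oplus>\<^bsub>branch X i\<^esub> g i w"
    and diag: "\<And>i a v. \<lbrakk>i \<in> {1..n}; a \<in> carrier A; v \<in> carrier V\<rbrakk> \<Longrightarrow> g i (el i i a \<odot>\<^bsub>V\<^esub> v) = a \<odot>\<^bsub>branch X i\<^esub> g i v"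
    and step: "\<And>i v. \<lbrakk>i \<in> {1..<n}; v \<in> carrier V\<rbrakk> \<Longrightarrow> g i (el i (Suc i) \<one> \<odot>\<^bsub>V\<^esub> v) = smap X i (g (Suc i) v)"
  shows "(\<lambda>v. \<lambda>i\<in>{1..n}. g i v) \<in> mod_hom (tri_ring n A) V (tri_module n X)"
proof -
  let ?T = "tri_ring n A"
  let ?X = "tri_module n X"
  interpret V: left_module "?T" V by (rule V)
  interpret W: left_module "?T" "?X" by (rule tri_module_left_module)
  have unit: "g i (el i j \<one> \<odot>\<^bsub>V\<^esub> v) = phi i j (g j v)" if "1 \<le> i" "i \<le> j" "j \<le> n" "v \<in> carrier V" for i j v
    using that(2,1,3,4)
  proof (induction j arbitrary: v rule: dec_induct)
    case base
    interpret B: left_module A "branch X i" by (rule branch) (use base in auto)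
    show ?case using diag[of i \<one> v] closed[of i v] base by (simp add: B.smult_one)
  next
    case (step j)
    have e: "el j (Suc j) \<one> \<odot>\<^bsub>V\<^esub> v \<in> carrier V" using step by (intro V.smult_closed el_closed) auto
    have "el i (Suc j) \<one> = el i j \<one> \<otimes>\<^bsub>?T\<^esub> el j (Suc j) \<one>" using el_el[of j "Suc j" n \<one> \<one> i] step by simp
    moreover have "(el i j \<one> \<otimes>\<^bsub>?T\<^esub> el j (Suc j) \<one>) \<odot>\<^bsub>V\<^esub> v = el i j \<one> \<odot>\<^bsub>V\<^esub> (el j (Suc j) \<one> \<odot>\<^bsub>V\<^esub> v)"
      using step by (intro V.smult_assoc el_closed) auto
    ultimately have "el i (Suc j) \<one> \<odot>\<^bsub>V\<^esub> v = el i j \<one> \<odot>\<^bsub>V\<^esub> (el j (Suc j) \<one> \<odot>\<^bsub>V\<^esub> v)" by (simp only:)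
    hence "g i (el i (Suc j) \<one> \<odot>\<^bsub>V\<^esub> v) = phi i j (g j (el j (Suc j) \<one> \<odot>\<^bsub>V\<^esub> v))" using step.IH[of "el j (Suc j) \<one> \<odot>\<^bsub>V\<^esub> v"] e step by simp
    also have "\<dots> = phi i (Suc j) (g (Suc j) v)" using assms(5)[of j v] step by (simp add: phi_Suc)
    finally show ?case .
  qed
  have unit': "g i (el i j a \<odot>\<^bsub>V\<^esub> v) = a \<odot>\<^bsub>branch X i\<^esub> phi i j (g j v)"
    if "1 \<le> i" "i \<le> j" "j \<le> n" "v \<in> carrier V" "a \<in> carrier A" for i j v a
  proof -
    have "el i j a = el i i a \<otimes>\<^bsub>?T\<^esub> el i j \<one>" using el_el[of i j n a \<one> i] that by simp
    moreover have "(el i i a \<otimes>\<^bsub>?T\<^esub> el i j \<one>) \<odot>\<^bsub>V\<^esub> v = el i i a \<odot>\<^bsub>V\<^esub> (el i j \<one> \<odot>\<^bsub>V\<^esub> v)"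
      using that by (intro V.smult_assoc el_closed) auto
    ultimately have "el i j a \<odot>\<^bsub>V\<^esub> v = el i i a \<odot>\<^bsub>V\<^esub> (el i j \<one> \<odot>\<^bsub>V\<^esub> v)" by (simp only:)
    moreover have "el i j \<one> \<odot>\<^bsub>V\<^esub> v \<in> carrier V" using that by (intro V.smult_closed el_closed) auto
    ultimately show ?thesis using diag[of i a "el i j \<one> \<odot>\<^bsub>V\<^esub> v"] unit[of i j v] that by simp
  qed
  show ?thesis
  proof (rule mod_homI)
    fix v assume v: "v \<in> carrier V"
    show "(\<lambda>i\<in>{1..n}. g i v) \<in> carrier ?X" using closed v by simp
    show "(\<lambda>i\<in>{1..n}. g i (v \<oplus>\<^bsub>V\<^esub> w)) = (\<lambda>i\<in>{1..n}. g i v) \<oplus>\<^bsub>?X\<^esub> (\<lambda>i\<in>{1..n}. g i w)"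
      if "w \<in> carrier V" for w
      unfolding tri_module_simps by (rule restrict_ext) (simp add: add v that)
    fix t assume t: "t \<in> carrier ?T"
    have gc: "(\<lambda>i\<in>{1..n}. g i v) \<in> carrier ?X" using closed v by simp
    show "(\<lambda>i\<in>{1..n}. g i (t \<odot>\<^bsub>V\<^esub> v)) = t \<odot>\<^bsub>?X\<^esub> (\<lambda>i\<in>{1..n}. g i v)"
    proof (rule extensionalityI[of _ "{1..n}"])
      show "t \<odot>\<^bsub>?X\<^esub> (\<lambda>i\<in>{1..n}. g i v) \<in> extensional {1..n}" by (rule tri_smult_ext)
      fix i assume i: "i \<in> {1..n}"
      interpret B: left_module A "branch X i" by (rule branch[OF i])
      have tv: "t \<odot>\<^bsub>V\<^esub> v \<in> carrier V" by (rule V.smult_closed[OF t v])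
      have ei: "el i i \<one> \<in> carrier ?T" using i by (intro el_closed) auto
      have cl: "(\<lambda>j. el i j (t i j)) \<in> {i..n} \<rightarrow> carrier ?T"
        using i tri_closed[OF t] by (intro Pi_I el_closed) auto
      have "g i (t \<odot>\<^bsub>V\<^esub> v) = g i (el i i \<one> \<odot>\<^bsub>V\<^esub> (t \<odot>\<^bsub>V\<^esub> v))"
        using diag[OF i one_closed tv] closed[OF i tv] by (simp add: B.smult_one)
      also have "el i i \<one> \<odot>\<^bsub>V\<^esub> (t \<odot>\<^bsub>V\<^esub> v) = (\<Oplus>\<^bsub>?T\<^esub>j\<in>{i..n}. el i j (t i j)) \<odot>\<^bsub>V\<^esub> v"
        unfolding V.smult_assoc[OF ei t v, symmetric] el_row[OF i t] ..
      also have "\<dots> = (\<Oplus>\<^bsub>V\<^esub>j\<in>{i..n}. el i j (t i j) \<odot>\<^bsub>V\<^esub> v)" by (rule V.finsum_smult[OF v cl])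
      also have "g i \<dots> = (\<Oplus>\<^bsub>branch X i\<^esub>j\<in>{i..n}. g i (el i j (t i j) \<odot>\<^bsub>V\<^esub> v))"
        by (rule additive_finsum[OF V.M.abelian_group_axioms B.M.abelian_group_axioms])
          (use closed[OF i] add[OF i] cl v in \<open>auto intro!: V.smult_closed simp del: tri_ring_simps\<close>)
      also have "\<dots> = (\<Oplus>\<^bsub>branch X i\<^esub>j\<in>{i..n}. t i j \<odot>\<^bsub>branch X i\<^esub> psi i j (g j v))"
      proof (intro B.M.finsum_cong' refl Pi_I)
        fix j assume j: "j \<in> {i..n}"
        show "t i j \<odot>\<^bsub>branch X i\<^esub> psi i j (g j v) \<in> carrier (branch X i)"
          using i j v by (intro tri_smult_closed_term[OF t] closed) auto
        show "g i (el i j (t i j) \<odot>\<^bsub>V\<^esub> v) = t i j \<odot>\<^bsub>branch X i\<^esub> psi i j (g j v)"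
          using i j v unit'[of i j v "t i j"] tri_closed[OF t] by (simp add: psi_def del: tri_ring_simps)
      qed
      also have "\<dots> = (\<Oplus>\<^bsub>branch X i\<^esub>j\<in>{1..<i}. t i j \<odot>\<^bsub>branch X i\<^esub> psi i j (g j v)) \<oplus>\<^bsub>branch X i\<^esub>
          (\<Oplus>\<^bsub>branch X i\<^esub>j\<in>{i..n}. t i j \<odot>\<^bsub>branch X i\<^esub> psi i j (g j v))"
      proof -
        have "t i j \<odot>\<^bsub>branch X i\<^esub> psi i j (g j v) = \<zero>\<^bsub>branch X i\<^esub>" if "j \<in> {1..<i}" for j
          using that i closed[of j v] v tri_zero[OF t, of i j] by (simp add: psi_def)
        hence "(\<Oplus>\<^bsub>branch X i\<^esub>j\<in>{1..<i}. t i j \<odot>\<^bsub>branch X i\<^esub> psi i j (g j v)) = (\<Oplus>\<^bsub>branch X i\<^esub>j\<in>{1..<i}. \<zero>\<^bsub>branch X i\<^esub>)"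
          by (intro B.M.finsum_cong') auto
        moreover have "(\<Oplus>\<^bsub>branch X i\<^esub>j\<in>{i..n}. t i j \<odot>\<^bsub>branch X i\<^esub> psi i j (g j v)) \<in> carrier (branch X i)"
          using i v by (intro B.M.finsum_closed Pi_I tri_smult_closed_term[OF t] closed) auto
        ultimately show ?thesis by (simp add: B.M.finsum_zero)
      qed
      also have "\<dots> = (\<Oplus>\<^bsub>branch X i\<^esub>j\<in>{1..<i} \<union> {i..n}. t i j \<odot>\<^bsub>branch X i\<^esub> psi i j (g j v))"
        using i v by (intro B.M.finsum_Un_disjoint[symmetric] Pi_I tri_smult_closed_term[OF t] closed) auto
      also have "{1..<i} \<union> {i..n} = {1..n}" using i by auto
      also have "(\<Oplus>\<^bsub>branch X i\<^esub>j\<in>{1..n}. t i j \<odot>\<^bsub>branch X i\<^esub> psi i j (g j v)) =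
          (t \<odot>\<^bsub>?X\<^esub> (\<lambda>i\<in>{1..n}. g i v)) i"
        unfolding tri_smult[OF t gc i]
        using i v by (intro B.M.finsum_cong' refl Pi_I tri_smult_closed_term[OF t]) (auto intro: closed)
      finally show "(\<lambda>i\<in>{1..n}. g i (t \<odot>\<^bsub>V\<^esub> v)) i = (t \<odot>\<^bsub>?X\<^esub> (\<lambda>i\<in>{1..n}. g i v)) i" using i by simp
    qed simp
  qed
qed

end

section \<open>Components of a module over the triangular matrix ring\<close>

locale tri_V = ring A for A (structure) +
  fixes n :: nat and V :: "(nat \<Rightarrow> nat \<Rightarrow> 'a, 'v) module"
  assumes V: "left_module (tri_ring n A) V"
begin

sublocale V: left_module "tri_ring n A" V by (rule V)

definition e :: "nat \<Rightarrow> nat \<Rightarrow> 'v \<Rightarrow> 'v" where "e i j v = el i j \<one> \<odot>\<^bsub>V\<^esub> v"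

lemma el_smult_closed: "\<lbrakk>1 \<le> i; i \<le> j; j \<le> n; a \<in> carrier A; v \<in> carrier V\<rbrakk> \<Longrightarrow> el i j a \<odot>\<^bsub>V\<^esub> v \<in> carrier V"
  by (intro V.smult_closed el_closed)

lemma e_closed: "\<lbrakk>1 \<le> i; i \<le> j; j \<le> n; v \<in> carrier V\<rbrakk> \<Longrightarrow> e i j v \<in> carrier V"
  unfolding e_def by (rule el_smult_closed) simp_all

lemma el_el_smult:
  "\<lbrakk>1 \<le> i; i \<le> j; j \<le> k; k \<le> n; a \<in> carrier A; b \<in> carrier A; v \<in> carrier V\<rbrakk> \<Longrightarrow>
    el i j a \<odot>\<^bsub>V\<^esub> (el j k b \<odot>\<^bsub>V\<^esub> v) = el i k (a \<otimes> b) \<odot>\<^bsub>V\<^esub> v"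
  by (subst V.smult_assoc[symmetric]) (simp_all add: el_closed el_el del: tri_ring_simps)

lemma e_e: "\<lbrakk>1 \<le> i; i \<le> j; j \<le> k; k \<le> n; v \<in> carrier V\<rbrakk> \<Longrightarrow> e i j (e j k v) = e i k v"
  by (simp add: e_def el_el_smult)

lemma e_add: "\<lbrakk>1 \<le> i; i \<le> j; j \<le> n; v \<in> carrier V; w \<in> carrier V\<rbrakk> \<Longrightarrow> e i j (v \<oplus>\<^bsub>V\<^esub> w) = e i j v \<oplus>\<^bsub>V\<^esub> e i j w"
  unfolding e_def by (rule V.smult_r_distr) (simp_all add: el_closed del: tri_ring_simps)

lemma e_zero: "\<lbrakk>1 \<le> i; i \<le> j; j \<le> n\<rbrakk> \<Longrightarrow> e i j \<zero>\<^bsub>V\<^esub> = \<zero>\<^bsub>V\<^esub>"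
  unfolding e_def by (rule V.smult_zero_right) (simp add: el_closed del: tri_ring_simps)

lemma sum_e:
  assumes v: "v \<in> carrier V" shows "v = (\<Oplus>\<^bsub>V\<^esub>i\<in>{1..n}. e i i v)"
proof -
  have "(\<lambda>i. el i i \<one>) \<in> {1..n} \<rightarrow> carrier (tri_ring n A)" by (intro Pi_I el_closed) auto
  from V.finsum_smult[OF v this] show ?thesis unfolding e_def one_eq_sum_el[symmetric] V.smult_one[OF v] .
qed

lemma eq_zero_of_e:
  assumes "v \<in> carrier V" "\<And>i. i \<in> {1..n} \<Longrightarrow> e i i v = \<zero>\<^bsub>V\<^esub>" shows "v = \<zero>\<^bsub>V\<^esub>"
proof -
  have "(\<Oplus>\<^bsub>V\<^esub>i\<in>{1..n}. e i i v) = (\<Oplus>\<^bsub>V\<^esub>i\<in>{1..n}. \<zero>\<^bsub>V\<^esub>)" using assms(2) by (intro V.M.finsum_cong') auto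
  thus ?thesis using sum_e[OF assms(1)] by (simp add: V.M.finsum_zero)
qed

text \<open>The i-th branch of the object behind V, as the fixed points of the i-th diagonal
  idempotent. The composite structure map from component j to component i is
  \<open>e i j\<close>.\<close>

definition comp :: "nat \<Rightarrow> ('a, 'v) module"
  where "comp i = \<lparr>carrier = {v \<in> carrier V. e i i v = v}, mult = undefined, one = undefined,
    zero = \<zero>\<^bsub>V\<^esub>, add = add V, smult = (\<lambda>a v. el i i a \<odot>\<^bsub>V\<^esub> v)\<rparr>"

lemma comp_simps [simp]: "carrier (comp i) = {v \<in> carrier V. e i i v = v}" "\<zero>\<^bsub>comp i\<^esub> = \<zero>\<^bsub>V\<^esub>"
  "v \<oplus>\<^bsub>comp i\<^esub> w = v \<oplus>\<^bsub>V\<^esub> w" "a \<odot>\<^bsub>comp i\<^esub> v = el i i a \<odot>\<^bsub>V\<^esub> v"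
  by (simp_all add: comp_def)

lemma e_in_comp: "\<lbrakk>1 \<le> i; i \<le> j; j \<le> n; v \<in> carrier V\<rbrakk> \<Longrightarrow> e i j v \<in> carrier (comp i)"
  by (simp add: e_closed e_e)

lemma el_in_comp: "\<lbrakk>1 \<le> i; i \<le> j; j \<le> n; a \<in> carrier A; v \<in> carrier V\<rbrakk> \<Longrightarrow> el i j a \<odot>\<^bsub>V\<^esub> v \<in> carrier (comp i)"
  by (simp add: el_smult_closed e_def el_el_smult)

lemma comp_left_module:
  assumes i: "i \<in> {1..n}" shows "left_module A (comp i)"
proof -
  have i': "1 \<le> i" "i \<le> n" using i by auto
  have ab: "abelian_group (comp i)"
  proof (rule abelian_groupI)
    fix v assume v: "v \<in> carrier (comp i)"
    have "e i i (\<ominus>\<^bsub>V\<^esub> v) = \<ominus>\<^bsub>V\<^esub> e i i v"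
      unfolding e_def using v i' by (intro V.smult_minus_right el_closed) auto
    thus "\<exists>w\<in>carrier (comp i). w \<oplus>\<^bsub>comp i\<^esub> v = \<zero>\<^bsub>comp i\<^esub>"
      using v by (intro bexI[of _ "\<ominus>\<^bsub>V\<^esub> v"]) (auto simp: V.M.l_neg)
  qed (use i' in \<open>auto simp: V.M.a_ac e_add e_zero\<close>)
  show ?thesis
  proof (rule left_moduleI[OF ring_axioms ab])
    fix a b v assume a: "a \<in> carrier A" and b: "b \<in> carrier A" and v: "v \<in> carrier (comp i)"
    have "el i i (a \<oplus> b) = el i i a \<oplus>\<^bsub>tri_ring n A\<^esub> el i i b" by (rule el_add[OF a b])
    thus "(a \<oplus> b) \<odot>\<^bsub>comp i\<^esub> v = a \<odot>\<^bsub>comp i\<^esub> v \<oplus>\<^bsub>comp i\<^esub> b \<odot>\<^bsub>comp i\<^esub> v"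
      using a b v i' V.smult_l_distr[OF el_closed el_closed] by (simp del: tri_ring_simps)
    show "(a \<otimes> b) \<odot>\<^bsub>comp i\<^esub> v = a \<odot>\<^bsub>comp i\<^esub> (b \<odot>\<^bsub>comp i\<^esub> v)"
      using a b v i' by (simp add: el_el_smult)
  next
    fix a v w assume a: "a \<in> carrier A" and v: "v \<in> carrier (comp i)" and w: "w \<in> carrier (comp i)"
    show "a \<odot>\<^bsub>comp i\<^esub> (v \<oplus>\<^bsub>comp i\<^esub> w) = a \<odot>\<^bsub>comp i\<^esub> v \<oplus>\<^bsub>comp i\<^esub> a \<odot>\<^bsub>comp i\<^esub> w"
      using V.smult_r_distr[OF el_closed[of i i n a]] a v w i' by (simp del: tri_ring_simps)
  next
    fix a v assume a: "a \<in> carrier A" and v: "v \<in> carrier (comp i)"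
    show "a \<odot>\<^bsub>comp i\<^esub> v \<in> carrier (comp i)" using el_in_comp[of i i a v] a v i' by simp
  next
    fix v assume "v \<in> carrier (comp i)"
    thus "\<one> \<odot>\<^bsub>comp i\<^esub> v = v" by (simp add: e_def)
  qed
qed

lemma e_el: "\<lbrakk>1 \<le> i; i \<le> j; j \<le> n; a \<in> carrier A; v \<in> carrier V\<rbrakk> \<Longrightarrow> e i j (el j j a \<odot>\<^bsub>V\<^esub> v) = el i i a \<odot>\<^bsub>V\<^esub> e i j v"
  by (simp add: e_def el_el_smult)

lemma e_comp_hom:
  assumes "1 \<le> i" "i \<le> j" "j \<le> n" shows "e i j \<in> mod_hom A (comp j) (comp i)"
  by (rule mod_homI) (use assms in \<open>auto simp: e_add e_el e_e e_closed\<close>)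

text \<open>A rank function on submodules of \<open>V\<close> induces one on \<open>A\<close>-submodules \<open>W\<close> of the \<open>i\<close>-th component:
  take the largest submodule of \<open>V\<close> with \<open>i\<close>-th component \<open>W\<close>.\<close>

lemma comp_fin_len:
  assumes i: "i \<in> {1..n}" and fl: "fin_len (tri_ring n A) V"
  shows "fin_len A (comp i)"
proof -
  have i': "1 \<le> i" "i \<le> n" using i by auto
  let ?T = "tri_ring n A"
  define F where "F W = {v \<in> carrier V. \<forall>t\<in>carrier ?T. e i i (t \<odot>\<^bsub>V\<^esub> v) \<in> W}" for W
  \<comment> \<open>The product of t with the i-th idempotent on both sides is the entry t_ii. On
    the i-th component the condition defining \<open>F W\<close> therefore concerns only
    A-multiples, which is how W is recovered from \<open>F W\<close>.\<close>
  have ec: "e i i (t \<odot>\<^bsub>V\<^esub> v) = t i i \<odot>\<^bsub>comp i\<^esub> v" if t: "t \<in> carrier ?T" and v: "v \<in> carrier (comp i)" for t v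
  proof -
    have vV: "v \<in> carrier V" "v = e i i v" using v by auto
    have tii: "t i i \<in> carrier A" by (rule tri_closed[OF t])
    have "el i i \<one> \<otimes>\<^bsub>?T\<^esub> t \<otimes>\<^bsub>?T\<^esub> el i i \<one> = el i i (t i i)"
    proof (intro HOL.ext)
      fix k l
      have e1: "el i i \<one> \<in> carrier ?T" using i' by (intro el_closed) auto
      have "el i i \<one> \<otimes>\<^bsub>?T\<^esub> t \<otimes>\<^bsub>?T\<^esub> el i i \<one> = el i i \<one> \<otimes>\<^bsub>?T\<^esub> (t \<otimes>\<^bsub>?T\<^esub> el i i \<one>)"
        by (rule V.R.m_assoc[OF e1 t e1])
      also have "\<dots> = (\<lambda>i' k. if i' = i then \<one> \<otimes> (t \<otimes>\<^bsub>?T\<^esub> el i i \<one>) i k else \<zero>)"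
        by (rule el_mult[OF i one_closed V.R.m_closed[OF t e1]])
      finally have eq: "(el i i \<one> \<otimes>\<^bsub>?T\<^esub> t \<otimes>\<^bsub>?T\<^esub> el i i \<one>) k l = (if k = i then \<one> \<otimes> (t \<otimes>\<^bsub>?T\<^esub> el i i \<one>) i l else \<zero>)" by simp
      have "(\<Oplus>m\<in>{1..n}. t i m \<otimes> el i i \<one> m l) = (\<Oplus>m\<in>{1..n}. if m = i then (if l = i then t i i else \<zero>) else \<zero>)"
        by (intro finsum_cong' refl Pi_I) (auto simp: el_def tri_closed[OF t] simp del: tri_ring_simps)
      also have "\<dots> = (if l = i then t i i else \<zero>)" by (rule finsum_delta[OF _ i]) (simp_all add: tii)
      finally have m: "(t \<otimes>\<^bsub>?T\<^esub> el i i \<one>) i l = (if l = i then t i i else \<zero>)" by (simp del: tri_ring_simps(1))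
      show "(el i i \<one> \<otimes>\<^bsub>?T\<^esub> t \<otimes>\<^bsub>?T\<^esub> el i i \<one>) k l = el i i (t i i) k l"
        unfolding eq m by (simp add: el_def tii)
    qed
    moreover have "(el i i \<one> \<otimes>\<^bsub>?T\<^esub> t \<otimes>\<^bsub>?T\<^esub> el i i \<one>) \<odot>\<^bsub>V\<^esub> v = e i i (t \<odot>\<^bsub>V\<^esub> e i i v)"
      unfolding e_def using i' t vV(1) by (simp add: V.smult_assoc el_closed V.R.m_closed V.smult_closed del: tri_ring_simps)
    ultimately show ?thesis using vV by (simp del: tri_ring_simps)
  qed
  show ?thesis
  proof (rule fin_len_transfer[where F = F, OF fl])
    fix W assume W: "submodule W A (comp i)"
    note mem = submodule_mem[OF W, simplified]
    show "submodule (F W) ?T V"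
    proof (rule V.submoduleI)
      show "F W \<subseteq> carrier V" by (auto simp: F_def)
      show "\<zero>\<^bsub>V\<^esub> \<in> F W" using submodule_zero[OF W] i' by (simp add: F_def e_zero del: tri_ring_simps)
      show "v \<oplus>\<^bsub>V\<^esub> w \<in> F W" if "v \<in> F W" "w \<in> F W" for v w
        using that i' submodule_add[OF W] by (simp add: F_def V.smult_r_distr e_add V.smult_closed del: tri_ring_simps)
      show "t \<odot>\<^bsub>V\<^esub> v \<in> F W" if "t \<in> carrier ?T" "v \<in> F W" for t v
        using that by (simp add: F_def V.smult_closed V.smult_assoc[symmetric] V.R.m_closed del: tri_ring_simps)
    qed
  next
    fix U W assume U: "submodule U A (comp i)" and W: "submodule W A (comp i)" and eq: "F U = F W"
    show "W \<subseteq> U"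
    proof
      fix w assume w: "w \<in> W"
      have wc: "w \<in> carrier (comp i)" by (rule submodule_mem[OF W w])
      have "w \<in> F W"
        unfolding F_def using wc ec[OF _ wc] submodule_smult[OF W tri_closed w] by (simp del: tri_ring_simps comp_simps(4))
      hence "e i i (\<one>\<^bsub>?T\<^esub> \<odot>\<^bsub>V\<^esub> w) \<in> U" unfolding eq[symmetric] unfolding F_def by (auto simp del: tri_ring_simps)
      thus "w \<in> U" using wc V.smult_one by simp
    qed
  qed (auto simp: F_def)
qed

end

text \<open>Multiplication by the matrix unit at \<open>(i, i + 1)\<close> is the structure map from the component
  \<open>i + 1\<close> to the component \<open>i\<close>, so this says that the structure maps are injective.\<close>

definition monic :: "nat \<Rightarrow> ('a, 'c) ring_scheme \<Rightarrow> (nat \<Rightarrow> nat \<Rightarrow> 'a, 'v, 'd) module_scheme \<Rightarrow> bool"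
  where "monic n A V \<longleftrightarrow> (\<forall>i\<in>{1..<n}. \<forall>v\<in>carrier V. ring.el A i (Suc i) \<one>\<^bsub>A\<^esub> \<odot>\<^bsub>V\<^esub> v = \<zero>\<^bsub>V\<^esub> \<longrightarrow>
    ring.el A (Suc i) (Suc i) \<one>\<^bsub>A\<^esub> \<odot>\<^bsub>V\<^esub> v = \<zero>\<^bsub>V\<^esub>)"

lemma (in ring) monic_inj:
  assumes V: "left_module (tri_ring n R) V" and W: "left_module (tri_ring n R) W" and f: "f \<in> mod_hom (tri_ring n R) V W"
    and inj: "inj_on f (carrier V)" and mon: "monic n R W"
  shows "monic n R V"
  unfolding monic_def
proof (intro ballI impI)
  fix i v assume i: "i \<in> {1..<n}" and v: "v \<in> carrier V" and z: "el i (Suc i) \<one> \<odot>\<^bsub>V\<^esub> v = \<zero>\<^bsub>V\<^esub>"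
  interpret V: left_module "tri_ring n R" V by (rule V)
  have e: "el i (Suc i) \<one> \<in> carrier (tri_ring n R)" "el (Suc i) (Suc i) \<one> \<in> carrier (tri_ring n R)"
    using i by (auto intro!: el_closed simp del: tri_ring_simps)
  have "el i (Suc i) \<one> \<odot>\<^bsub>W\<^esub> f v = f (el i (Suc i) \<one> \<odot>\<^bsub>V\<^esub> v)" by (rule mod_hom_smult[OF f e(1) v, symmetric])
  also have "\<dots> = \<zero>\<^bsub>W\<^esub>" unfolding z by (rule mod_hom_zero[OF V W f])
  finally have "el (Suc i) (Suc i) \<one> \<odot>\<^bsub>W\<^esub> f v = \<zero>\<^bsub>W\<^esub>" using mon i mod_hom_closed[OF f v] unfolding monic_def by blast
  hence "f (el (Suc i) (Suc i) \<one> \<odot>\<^bsub>V\<^esub> v) = \<zero>\<^bsub>W\<^esub>" using mod_hom_smult[OF f e(2) v] by simp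
  thus "el (Suc i) (Suc i) \<one> \<odot>\<^bsub>V\<^esub> v = \<zero>\<^bsub>V\<^esub>"
    using inj V.smult_closed[OF e(2) v] unfolding mod_hom_inj_iff[OF V W f] by blast
qed

lemma (in ring) monic_submodule:
  assumes V: "left_module (tri_ring n R) V" and U: "submodule U (tri_ring n R) V" and mon: "monic n R V"
  shows "monic n R (V\<lparr>carrier := U\<rparr>)"
  by (rule monic_inj[OF submodule_left_module[OF V U] V mod_hom_restrict_submodule[OF mod_hom_id U] _ mon]) (simp add: inj_on_def)

lemma monic_dsum:
  assumes "\<And>k. k \<in> K \<Longrightarrow> monic n A (V k)"
  shows "monic n A (dsum K V)"
  unfolding monic_def
proof (intro ballI impI)
  fix i v assume i: "i \<in> {1..<n}" and v: "v \<in> carrier (dsum K V)"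
    and z: "ring.el A i (Suc i) \<one>\<^bsub>A\<^esub> \<odot>\<^bsub>dsum K V\<^esub> v = \<zero>\<^bsub>dsum K V\<^esub>"
  have "ring.el A (Suc i) (Suc i) \<one>\<^bsub>A\<^esub> \<odot>\<^bsub>V k\<^esub> v k = \<zero>\<^bsub>V k\<^esub>" if k: "k \<in> K" for k
  proof -
    have "ring.el A i (Suc i) \<one>\<^bsub>A\<^esub> \<odot>\<^bsub>V k\<^esub> v k = \<zero>\<^bsub>V k\<^esub>" using fun_cong[OF z, of k] k by simp
    moreover have "v k \<in> carrier (V k)" using v k by auto
    ultimately show ?thesis using assms[OF k] i unfolding monic_def by blast
  qed
  thus "ring.el A (Suc i) (Suc i) \<one>\<^bsub>A\<^esub> \<odot>\<^bsub>dsum K V\<^esub> v = \<zero>\<^bsub>dsum K V\<^esub>" unfolding dsum_simps by (rule restrict_ext)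
qed

text \<open>Left multiplication by the unit at (i, i + 1) moves row i + 1 into row i, so nothing of
  that row is lost. Hence free modules lie in S_n(A), which is what the generator condition
  requires.\<close>

lemma (in ring) monic_reg: "monic n R (reg (tri_ring n R))"
  unfolding monic_def
proof (intro ballI impI)
  fix i t assume i: "i \<in> {1..<n}" and "t \<in> carrier (reg (tri_ring n R))"
    and "el i (Suc i) \<one> \<odot>\<^bsub>reg (tri_ring n R)\<^esub> t = \<zero>\<^bsub>reg (tri_ring n R)\<^esub>"
  hence t: "t \<in> carrier (tri_ring n R)" and z: "el i (Suc i) \<one> \<otimes>\<^bsub>tri_ring n R\<^esub> t = \<zero>\<^bsub>tri_ring n R\<^esub>" by simp_all
  have S: "Suc i \<in> {1..n}" using i by auto
  have "t (Suc i) k = \<zero>" for k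
    using fun_cong[OF fun_cong[OF z, of i], of k] tri_closed[OF t] unfolding el_mult[OF S one_closed t]
    by (simp del: tri_ring_simps(1))
  hence "el (Suc i) (Suc i) \<one> \<otimes>\<^bsub>tri_ring n R\<^esub> t = \<zero>\<^bsub>tri_ring n R\<^esub>"
    unfolding el_mult[OF S one_closed t] by (simp add: fun_eq_iff)
  thus "el (Suc i) (Suc i) \<one> \<odot>\<^bsub>reg (tri_ring n R)\<^esub> t = \<zero>\<^bsub>reg (tri_ring n R)\<^esub>" by simp
qed

lemma (in tri_mod) monic_tri_module:
  assumes "\<And>i. i \<in> {1..<n} \<Longrightarrow> inj_on (smap X i) (carrier (branch X (Suc i)))"
  shows "monic n A (tri_module n X)"
  unfolding monic_def
proof (intro ballI impI)
  fix i x assume i: "i \<in> {1..<n}" and x: "x \<in> carrier (tri_module n X)"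
    and z: "el i (Suc i) \<one> \<odot>\<^bsub>tri_module n X\<^esub> x = \<zero>\<^bsub>tri_module n X\<^esub>"
  have i': "i \<in> {1..n}" "Suc i \<in> {1..n}" "1 \<le> i" "Suc i \<le> n" using i by auto
  interpret B: left_module A "branch X i" by (rule branch[OF i'(1)])
  interpret C: left_module A "branch X (Suc i)" by (rule branch[OF i'(2)])
  have xc: "x (Suc i) \<in> carrier (branch X (Suc i))" using x i' by auto
  have "smap X i (x (Suc i)) \<in> carrier (branch X i)" by (rule mod_hom_closed[OF smap[OF i] xc])
  hence "smap X i (x (Suc i)) = \<zero>\<^bsub>branch X i\<^esub>"
    using fun_cong[OF z, of i] el_smult[OF i'(3) le_SucI[OF le_refl] i'(4) one_closed x i'(1)] i'
    by (simp add: phi_Suc B.smult_one)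
  hence x0: "x (Suc i) = \<zero>\<^bsub>branch X (Suc i)\<^esub>"
    using assms[OF i] xc unfolding mod_hom_inj_iff[OF branch[OF i'(2)] branch[OF i'(1)] smap[OF i]] by blast
  show "el (Suc i) (Suc i) \<one> \<odot>\<^bsub>tri_module n X\<^esub> x = \<zero>\<^bsub>tri_module n X\<^esub>"
  proof (rule extensionalityI[of _ "{1..n}"])
    show "el (Suc i) (Suc i) \<one> \<odot>\<^bsub>tri_module n X\<^esub> x \<in> extensional {1..n}" by (rule tri_smult_ext)
    fix k assume k: "k \<in> {1..n}"
    show "(el (Suc i) (Suc i) \<one> \<odot>\<^bsub>tri_module n X\<^esub> x) k = \<zero>\<^bsub>tri_module n X\<^esub> k"
      using el_smult[of "Suc i" "Suc i" \<one> x k] i' x k x0 C.M.zero_closed C.smult_one by (auto simp del: tri_module_simps(1)) 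
  qed simp
qed

lemma Mor_tri_mod:
  assumes "ring A" "X \<in> Mor n A" shows "tri_mod A n X"
  using assms by (auto simp: tri_mod_def tri_mod_axioms_def Mor_def fg_module_def)

text \<open>The branches are the components of \<open>V\<close> cut out by the diagonal idempotents.\<close>

lemma realise_monic:
  fixes V :: "(nat \<Rightarrow> nat \<Rightarrow> 'a, 'v) module"
  assumes A: "ring A" and V: "left_module (tri_ring n A) V" and fl: "fin_len (tri_ring n A) V" and mon: "monic n A V"
  shows "\<exists>X\<in>(Smon n A :: ('a, (nat \<Rightarrow> 'a) set) mor set). mod_iso (tri_ring n A) V (tri_module n X)"
proof -
  interpret ring A by (rule A)
  interpret tri_V A n V by (intro tri_V.intro tri_V_axioms.intro A V)
  have fg: "fg_module A (comp i)" if "i \<in> {1..n}" for i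
    unfolding fg_module_def using comp_left_module[OF that] fin_len_fin_gen[OF _ comp_fin_len[OF that fl]] by blast
  \<comment> \<open>The components are copied into the type \<open>'a fg_mod\<close>, with s and
    \<open>s'\<close> as transport in both directions.\<close>
  have "\<forall>i. \<exists>N :: 'a fg_mod. \<exists>s. i \<in> {1..n} \<longrightarrow> fg_module A N \<and> s \<in> mod_hom A (comp i) N \<and> bij_betw s (carrier (comp i)) (carrier N)"
    using fg_module_realised[OF fg] unfolding mod_iso_def by blast
  then obtain N :: "nat \<Rightarrow> 'a fg_mod" and s where N: "\<And>i. i \<in> {1..n} \<Longrightarrow> fg_module A (N i)"
    and s: "\<And>i. i \<in> {1..n} \<Longrightarrow> s i \<in> mod_hom A (comp i) (N i)"
    and bs: "\<And>i. i \<in> {1..n} \<Longrightarrow> bij_betw (s i) (carrier (comp i)) (carrier (N i))" by metis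
  define s' where "s' i = the_inv_into (carrier (comp i)) (s i)" for i
  have s': "s' i \<in> mod_hom A (N i) (comp i)" if "i \<in> {1..n}" for i
    unfolding s'_def by (rule mod_hom_inverse[OF comp_left_module[OF that] s[OF that] bs[OF that]])
  have s's: "s' i (s i v) = v" if "i \<in> {1..n}" "v \<in> carrier (comp i)" for i v
    unfolding s'_def by (rule the_inv_into_f_f[OF bij_betw_imp_inj_on[OF bs[OF that(1)]] that(2)])
  have ss': "s i (s' i x) = x" if "i \<in> {1..n}" "x \<in> carrier (N i)" for i x
    unfolding s'_def by (rule f_the_inv_into_f_bij_betw[OF bs[OF that(1)]]) (simp add: that(2))
  have s'inj: "inj_on (s' i) (carrier (N i))" if "i \<in> {1..n}" for i
    using ss'[OF that] by (rule inj_on_inverseI)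
  define X :: "('a, (nat \<Rightarrow> 'a) set) mor" where "X = \<lparr>branch = N, smap = (\<lambda>i x. s i (e i (Suc i) (s' (Suc i) x)))\<rparr>"
  have X [simp]: "branch X i = N i" "smap X i = (\<lambda>x. s i (e i (Suc i) (s' (Suc i) x)))" for i by (simp_all add: X_def)
  have sm: "smap X i \<in> mod_hom A (branch X (Suc i)) (branch X i)" if i: "i \<in> {1..<n}" for i
  proof -
    have i': "i \<in> {1..n}" "Suc i \<in> {1..n}" "1 \<le> i" "Suc i \<le> n" using i by auto
    show ?thesis unfolding X
      by (rule mod_hom_comp[OF mod_hom_comp[OF s'[OF i'(2)] e_comp_hom] s[OF i'(1)]]) (use i' in auto)
  qed
  have inj: "inj_on (smap X i) (carrier (branch X (Suc i)))" if i: "i \<in> {1..<n}" for i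
  proof -
    have i': "i \<in> {1..n}" "Suc i \<in> {1..n}" "1 \<le> i" "i \<le> Suc i" "Suc i \<le> n" using i by auto
    have lN: "left_module A (N i)" "left_module A (N (Suc i))" using N i' by (auto simp: fg_module_def)
    have "x = \<zero>\<^bsub>N (Suc i)\<^esub>" if x: "x \<in> carrier (N (Suc i))" "s i (e i (Suc i) (s' (Suc i) x)) = \<zero>\<^bsub>N i\<^esub>" for x
    proof -
      have v: "s' (Suc i) x \<in> carrier (comp (Suc i))" by (rule mod_hom_closed[OF s'[OF i'(2)] x(1)])
      hence vV: "s' (Suc i) x \<in> carrier V" "e (Suc i) (Suc i) (s' (Suc i) x) = s' (Suc i) x" by auto
      have "e i (Suc i) (s' (Suc i) x) = s' i \<zero>\<^bsub>N i\<^esub>"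
        using s's[OF i'(1) mod_hom_closed[OF e_comp_hom[OF i'(3-5)] v]] x(2) by simp
      also have "\<dots> = \<zero>\<^bsub>V\<^esub>" using mod_hom_zero[OF lN(1) comp_left_module[OF i'(1)] s'[OF i'(1)]] by simp
      finally have "e (Suc i) (Suc i) (s' (Suc i) x) = \<zero>\<^bsub>V\<^esub>"
        using mon i vV(1) unfolding monic_def e_def by blast
      hence "s' (Suc i) x = \<zero>\<^bsub>comp (Suc i)\<^esub>" using vV(2) by simp
      thus ?thesis using s'inj[OF i'(2)] x(1) unfolding mod_hom_inj_iff[OF lN(2) comp_left_module[OF i'(2)] s'[OF i'(2)]] by blast
    qed
    moreover have "(\<lambda>x. s i (e i (Suc i) (s' (Suc i) x))) \<in> mod_hom A (N (Suc i)) (N i)" using sm[OF i] by simp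
    ultimately show ?thesis unfolding X using mod_hom_inj_iff[OF lN(2,1)] by blast
  qed
  have XS: "X \<in> Smon n A" using N sm inj by (simp add: Smon_def Mor_def)
  interpret TM: tri_mod A n X by (rule Mor_tri_mod[OF A]) (use XS in \<open>simp add: Smon_def\<close>)
  let ?g = "\<lambda>i v. s i (e i i v)"
  let ?H = "\<lambda>v. \<lambda>i\<in>{1..n}. ?g i v"
  have ec: "e i i v \<in> carrier (comp i)" if "i \<in> {1..n}" "v \<in> carrier V" for i v using that by (intro e_in_comp) auto
  have H: "?H \<in> mod_hom (tri_ring n A) V (tri_module n X)"
  proof (rule TM.tri_homI[OF V])
    fix i v assume i: "i \<in> {1..n}" and v: "v \<in> carrier V"
    show "?g i v \<in> carrier (branch X i)" using mod_hom_closed[OF s[OF i] ec[OF i v]] by simp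
    show "?g i (v \<oplus>\<^bsub>V\<^esub> w) = ?g i v \<oplus>\<^bsub>branch X i\<^esub> ?g i w" if "w \<in> carrier V" for w
      using mod_hom_add[OF s[OF i] ec[OF i v] ec[OF i that]] e_add[of i i v w] i v that by simp
    show "?g i (el i i a \<odot>\<^bsub>V\<^esub> v) = a \<odot>\<^bsub>branch X i\<^esub> ?g i v" if "a \<in> carrier A" for a
      using mod_hom_smult[OF s[OF i] that ec[OF i v]] e_el[of i i a v] i v that by simp
  next
    fix i v assume i: "i \<in> {1..<n}" and v: "v \<in> carrier V"
    have "s' (Suc i) (s (Suc i) (e (Suc i) (Suc i) v)) = e (Suc i) (Suc i) v" using i v by (intro s's ec) auto
    moreover have "e i (Suc i) (e (Suc i) (Suc i) v) = e i (Suc i) v" using i v by (intro e_e) auto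
    moreover have "e i i (el i (Suc i) \<one>\<^bsub>A\<^esub> \<odot>\<^bsub>V\<^esub> v) = e i (Suc i) v" using i v e_e[of i i "Suc i" v] by (simp add: e_def)
    ultimately show "?g i (el i (Suc i) \<one>\<^bsub>A\<^esub> \<odot>\<^bsub>V\<^esub> v) = smap X i (?g (Suc i) v)" by simp
  qed
  have lX: "left_module (tri_ring n A) (tri_module n X)" by (rule TM.tri_module_left_module)
  have "inj_on ?H (carrier V)"
    unfolding mod_hom_inj_iff[OF V lX H]
  proof (intro ballI impI)
    fix v assume v: "v \<in> carrier V" and z: "?H v = \<zero>\<^bsub>tri_module n X\<^esub>"
    show "v = \<zero>\<^bsub>V\<^esub>"
    proof (rule eq_zero_of_e[OF v])
      fix i assume i: "i \<in> {1..n}"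
      have "s i (e i i v) = \<zero>\<^bsub>N i\<^esub>" using fun_cong[OF z, of i] i by simp
      hence "e i i v = s' i \<zero>\<^bsub>N i\<^esub>" using s's[OF i ec[OF i v]] by simp
      also have "\<dots> = \<zero>\<^bsub>comp i\<^esub>"
        by (rule mod_hom_zero[OF _ comp_left_module[OF i] s'[OF i]]) (use N[OF i] in \<open>simp add: fg_module_def\<close>)
      finally show "e i i v = \<zero>\<^bsub>V\<^esub>" by simp
    qed
  qed
  moreover have "carrier (tri_module n X) \<subseteq> ?H ` carrier V"
  proof
    fix x assume x: "x \<in> carrier (tri_module n X)"
    have xi: "x i \<in> carrier (N i)" if "i \<in> {1..n}" for i using x that by auto
    have y: "s' i (x i) \<in> carrier (comp i)" if "i \<in> {1..n}" for i by (rule mod_hom_closed[OF s'[OF that] xi[OF that]])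
    hence yV: "s' i (x i) \<in> carrier V" "e i i (s' i (x i)) = s' i (x i)" if "i \<in> {1..n}" for i using that by auto
    \<comment> \<open>The preimage of x is the sum of its transported coordinates; orthogonality of
      the diagonal idempotents isolates each of them again.\<close>
    define v where "v = (\<Oplus>\<^bsub>V\<^esub>i\<in>{1..n}. s' i (x i))"
    have v: "v \<in> carrier V" unfolding v_def using yV(1) by (intro V.M.finsum_closed) blast
    have "e i i v = s' i (x i)" if i: "i \<in> {1..n}" for i
    proof -
      have i': "1 \<le> i" "i \<le> n" using i by auto
      have "e i i v = (\<Oplus>\<^bsub>V\<^esub>j\<in>{1..n}. e i i (s' j (x j)))"
        unfolding v_def
        by (rule additive_finsum[OF V.M.abelian_group_axioms V.M.abelian_group_axioms])
          (use i' yV(1) in \<open>auto simp: e_add e_closed\<close>)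
      also have "\<dots> = (\<Oplus>\<^bsub>V\<^esub>j\<in>{1..n}. if j = i then s' i (x i) else \<zero>\<^bsub>V\<^esub>)"
      proof (intro V.M.finsum_cong' refl Pi_I)
        fix j assume j: "j \<in> {1..n}"
        show "(if j = i then s' i (x i) else \<zero>\<^bsub>V\<^esub>) \<in> carrier V" using yV(1)[OF i] by simp
        show "e i i (s' j (x j)) = (if j = i then s' i (x i) else \<zero>\<^bsub>V\<^esub>)"
        proof (cases "j = i")
          case False
          have "el i i \<one>\<^bsub>A\<^esub> \<otimes>\<^bsub>tri_ring n A\<^esub> el j j \<one>\<^bsub>A\<^esub> = \<zero>\<^bsub>tri_ring n A\<^esub>"
            using False i j el_mult[OF i one_closed, of "el j j \<one>\<^bsub>A\<^esub>" i] el_closed[of j j n "\<one>\<^bsub>A\<^esub>"]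
            by (auto simp: fun_eq_iff el_def simp del: tri_ring_simps(1,5))
          hence "e i i (e j j (s' j (x j))) = \<zero>\<^bsub>V\<^esub>"
            unfolding e_def using V.smult_assoc[OF el_closed el_closed, of i i "\<one>\<^bsub>A\<^esub>" j j "\<one>\<^bsub>A\<^esub>" "s' j (x j)"] i' j yV(1)[OF j]
            by (simp del: tri_ring_simps)
          thus ?thesis using yV(2)[OF j] False by simp
        qed (use yV(2)[OF i] in simp)
      qed
      also have "\<dots> = s' i (x i)" by (rule V.M.finsum_delta[OF _ i yV(1)[OF i]]) simp
      finally show ?thesis .
    qed
    hence "?H v = x" using x ss' xi by (intro extensionalityI[of _ "{1..n}"]) (auto simp: PiE_iff)
    thus "x \<in> ?H ` carrier V" using v by blast
  qed
  moreover have "?H ` carrier V \<subseteq> carrier (tri_module n X)" using mod_hom_closed[OF H] by (rule image_subsetI)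
  ultimately have "bij_betw ?H (carrier V) (carrier (tri_module n X))" unfolding bij_betw_def by blast
  thus ?thesis using XS H unfolding mod_iso_def by blast
qed

text \<open>An element of A acts on the sum of the branches as the diagonal matrix with equal
  entries, so submodules over T_n(A) are A-submodules of that sum.\<close>

lemma (in tri_mod) tri_module_fin_len:
  assumes "\<And>i. i \<in> {1..n} \<Longrightarrow> fin_len A (branch X i)"
  shows "fin_len (tri_ring n A) (tri_module n X)"
proof (rule fin_len_mono[OF fin_len_dsum[OF ring_axioms finite_atLeastAtMost branch assms]])
  let ?S = "dsum {1..n} (branch X)"
  interpret S: left_module A ?S by (rule dsum_left_module[OF ring_axioms branch])
  fix U assume U: "submodule U (tri_ring n A) (tri_module n X)"
  show "submodule U A ?S"
  proof (rule S.submoduleI)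
    show "U \<subseteq> carrier ?S" using submodule_mem[OF U] by auto
    show "\<zero>\<^bsub>?S\<^esub> \<in> U" using submodule_zero[OF U] by simp
    show "x \<oplus>\<^bsub>?S\<^esub> y \<in> U" if "x \<in> U" "y \<in> U" for x y using submodule_add[OF U that] by simp
    fix a x assume a: "a \<in> carrier A" and x: "x \<in> U"
    define d where "d = (\<lambda>i j. if i = j \<and> i \<in> {1..n} then a else \<zero>)"
    have d: "d \<in> carrier (tri_ring n A)" by (rule tri_carrierI) (auto simp: d_def a)
    have xc: "x \<in> carrier (tri_module n X)" by (rule submodule_mem[OF U x])
    have "d \<odot>\<^bsub>tri_module n X\<^esub> x = a \<odot>\<^bsub>?S\<^esub> x"
    proof (rule extensionalityI[of _ "{1..n}"])
      fix i assume i: "i \<in> {1..n}"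
      interpret B: left_module A "branch X i" by (rule branch[OF i])
      have p: "psi i j (x j) \<in> carrier (branch X i)" if "j \<in> {1..n}" for j
        using xc that by (intro mod_hom_closed[OF psi_hom[OF i that]]) auto
      have "(d \<odot>\<^bsub>tri_module n X\<^esub> x) i = (\<Oplus>\<^bsub>branch X i\<^esub>j\<in>{1..n}. d i j \<odot>\<^bsub>branch X i\<^esub> psi i j (x j))"
        by (rule tri_smult[OF d xc i])
      also have "\<dots> = (\<Oplus>\<^bsub>branch X i\<^esub>j\<in>{1..n}. if j = i then a \<odot>\<^bsub>branch X i\<^esub> x i else \<zero>\<^bsub>branch X i\<^esub>)"
        using p p[OF i] i a by (intro B.M.finsum_cong' refl Pi_I) (auto simp: d_def psi_def B.smult_closed)
      also have "\<dots> = a \<odot>\<^bsub>branch X i\<^esub> x i"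
        using p[OF i] by (intro B.M.finsum_delta[OF _ i]) (simp_all add: psi_def B.smult_closed a)
      finally show "(d \<odot>\<^bsub>tri_module n X\<^esub> x) i = (a \<odot>\<^bsub>?S\<^esub> x) i" using i by simp
    qed (use tri_smult_ext[of d x] in simp_all)
    thus "a \<odot>\<^bsub>?S\<^esub> x \<in> U" using submodule_smult[OF U d x] by simp
  qed
qed

lemma fg_iff_fin_len:
  "\<lbrakk>fin_len B (reg B); left_module B X\<rbrakk> \<Longrightarrow> fg_module B X \<longleftrightarrow> fin_len B X"
  unfolding fg_module_def using fg_fin_len fin_len_fin_gen by blast

subsection \<open>Detecting retracts by maps into the cogenerator\<close>

lemma mm_simps [simp]:
  "branch (mm n N) j = dsum {1..n} (\<lambda>i. if j \<le> i then N else N\<lparr>carrier := {\<zero>\<^bsub>N\<^esub>}\<rparr>)"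
  "smap (mm n N) j = (\<lambda>x. \<lambda>i\<in>{1..n}. if j < i then x i else \<zero>\<^bsub>N\<^esub>)"
  by (simp_all add: mm_def mor_dsum_def mi_def)

lemma (in artin_alg) mm_Smon:
  fixes N :: "('a, 'x) module"
  assumes N: "fg_module A N" shows "mm n N \<in> Smon n A"
proof -
  have lN: "left_module A N" using N by (simp add: fg_module_def)
  interpret N: left_module A N by (rule lN)
  have fN: "fin_len A N" using N fg_iff_fin_len[OF reg_fin_len lN] by simp
  let ?N = "\<lambda>j i. if j \<le> i then N else N\<lparr>carrier := {\<zero>\<^bsub>N\<^esub>}\<rparr>"
  note z = submodule_zero_set[OF lN]
  have l: "left_module A (?N j i)" and f: "fin_len A (?N j i)" for j i :: nat
    using lN fN submodule_left_module[OF lN z] fin_len_submodule[OF lN fN z] by simp_all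
  have fg: "fg_module A (branch (mm n N) j)" for j
    unfolding mm_simps
    by (subst fg_iff_fin_len[OF reg_fin_len dsum_left_module[OF A_ring l]]) (rule fin_len_dsum[OF A_ring finite_atLeastAtMost l f])
  have "smap (mm n N) j \<in> mod_hom A (branch (mm n N) (Suc j)) (branch (mm n N) j)" for j
    by (rule mod_homI) (auto simp: PiE_iff fun_eq_iff split: if_splits)
  moreover have "inj_on (smap (mm n N) j) (carrier (branch (mm n N) (Suc j)))" for j
  proof (rule inj_onI)
    fix x y assume x: "x \<in> carrier (branch (mm n N) (Suc j))" and y: "y \<in> carrier (branch (mm n N) (Suc j))"
      and eq: "smap (mm n N) j x = smap (mm n N) j y"
    have "x i = y i" if i: "i \<in> {1..n}" for i
    proof (cases "j < i")
      case True
      thus ?thesis using fun_cong[OF eq, of i] i by simp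
    next
      case False
      thus ?thesis using x y i by (auto simp: PiE_iff dest!: bspec[of _ _ i])
    qed
    thus "x = y" using x y by (intro extensionalityI[of _ "{1..n}"]) (auto simp: PiE_iff)
  qed
  ultimately show ?thesis using fg by (simp add: Smon_def Mor_def del: mm_simps)
qed

context tri_V
begin

lemma monic_e:
  assumes mon: "monic n A V" and "1 \<le> i" "i \<le> j" "j \<le> n" "v \<in> carrier V" "e i j v = \<zero>\<^bsub>V\<^esub>"
  shows "e j j v = \<zero>\<^bsub>V\<^esub>"
  using assms(3-6)
proof (induction j arbitrary: v rule: dec_induct)
  case (step j)
  have w: "e j (Suc j) v \<in> carrier V" using step assms(2) by (intro e_closed) auto
  have "e i j (e j (Suc j) v) = \<zero>\<^bsub>V\<^esub>" using step assms(2) by (subst e_e) auto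
  hence "e j j (e j (Suc j) v) = \<zero>\<^bsub>V\<^esub>" using step.IH[OF _ w] step.prems by simp
  hence "e j (Suc j) v = \<zero>\<^bsub>V\<^esub>" using step assms(2) by (subst (asm) e_e) auto
  moreover have "j \<in> {1..<n}" using step assms(2) by simp
  ultimately show ?case using mon step.prems(2) unfolding monic_def e_def by blast
qed

lemma e_inj:
  assumes "monic n A V" "1 \<le> i" "i \<le> j" "j \<le> n" shows "inj_on (e i j) (carrier (comp j))"
proof -
  have "i \<in> {1..n}" "j \<in> {1..n}" using assms by auto
  thus ?thesis
    unfolding mod_hom_inj_iff[OF comp_left_module[OF \<open>j \<in> {1..n}\<close>] comp_left_module[OF \<open>i \<in> {1..n}\<close>] e_comp_hom[OF assms(2-4)]]
    using monic_e[OF assms] by auto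
qed

text \<open>Homomorphisms from \<open>V\<close> to the \<open>i\<close>-th summand of \<open>mm n N\<close> correspond to maps from the first
  component of \<open>V\<close> to \<open>N\<close> that vanish on the image of the \<open>(i + 1)\<close>-st component.\<close>

lemma mm_hom:
  fixes N :: "('a, 'x) module"
  assumes N: "left_module A N" and M: "tri_mod A n (mm n N)" and i: "i \<in> {1..n}" and h: "h \<in> mod_hom A (comp 1) N"
    and van: "\<And>v. \<lbrakk>i < n; v \<in> carrier V\<rbrakk> \<Longrightarrow> h (e 1 (Suc i) v) = \<zero>\<^bsub>N\<^esub>"
  shows "(\<lambda>v. \<lambda>j\<in>{1..n}. \<lambda>k\<in>{1..n}. if k = i \<and> j \<le> i then h (e 1 j v) else \<zero>\<^bsub>N\<^esub>)
    \<in> mod_hom (tri_ring n A) V (tri_module n (mm n N))"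
proof (rule tri_mod.tri_homI[OF M V])
  interpret N: left_module A N by (rule N)
  have ec: "e 1 j v \<in> carrier (comp 1)" if "j \<in> {1..n}" "v \<in> carrier V" for j v
    using that i by (intro e_in_comp) auto
  note hc = mod_hom_closed[OF h ec]
  let ?g = "\<lambda>j v. \<lambda>k\<in>{1..n}. if k = i \<and> j \<le> i then h (e 1 j v) else \<zero>\<^bsub>N\<^esub>"
  fix j v assume j: "j \<in> {1..n}" and v: "v \<in> carrier V"
  show "?g j v \<in> carrier (branch (mm n N) j)" using hc[OF j v] by auto
  have ea: "h (e 1 j (v \<oplus>\<^bsub>V\<^esub> w)) = h (e 1 j v) \<oplus>\<^bsub>N\<^esub> h (e 1 j w)" if "w \<in> carrier V" for w
    using mod_hom_add[OF h ec[OF j v] ec[OF j that]] e_add[of 1 j v w] j v that by simp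
  show "?g j (v \<oplus>\<^bsub>V\<^esub> w) = ?g j v \<oplus>\<^bsub>branch (mm n N) j\<^esub> ?g j w" if "w \<in> carrier V" for w
    using ea[OF that] by (auto simp: fun_eq_iff)
  fix a assume a: "a \<in> carrier A"
  have "h (e 1 j (el j j a \<odot>\<^bsub>V\<^esub> v)) = a \<odot>\<^bsub>N\<^esub> h (e 1 j v)"
    using mod_hom_smult[OF h a ec[OF j v]] e_el[of 1 j a v] j v a by simp
  thus "?g j (el j j a \<odot>\<^bsub>V\<^esub> v) = a \<odot>\<^bsub>branch (mm n N) j\<^esub> ?g j v" using a by (auto simp: fun_eq_iff)
next
  let ?g = "\<lambda>j v. \<lambda>k\<in>{1..n}. if k = i \<and> j \<le> i then h (e 1 j v) else \<zero>\<^bsub>N\<^esub>"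
  fix j v assume j: "j \<in> {1..<n}" and v: "v \<in> carrier V"
  have "e 1 j (el j (Suc j) \<one> \<odot>\<^bsub>V\<^esub> v) = e 1 (Suc j) v" using e_e[of 1 j "Suc j" v] j v by (simp add: e_def)
  \<comment> \<open>This is the case j = i: the structure map of the i-th summand starts from zero
    there, while the other side is h on the image of component i + 1, where it vanishes by
    hypothesis.\<close>
  moreover have "h (e 1 (Suc j) v) = \<zero>\<^bsub>N\<^esub>" if "j \<le> i" "\<not> Suc j \<le> i" using van[OF _ v] that j by (simp add: le_Suc_eq[of i j] not_less_eq_eq)
  ultimately show "?g j (el j (Suc j) \<one> \<odot>\<^bsub>V\<^esub> v) = smap (mm n N) j (?g (Suc j) v)" by (auto simp: fun_eq_iff)
qed

end

lemma tri_V_e_hom: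
  assumes "tri_V A n V" "tri_V A n W" and f: "f \<in> mod_hom (tri_ring n A) V W"
    and "1 \<le> i" "i \<le> j" "j \<le> n" "v \<in> carrier V"
  shows "f (tri_V.e A V i j v) = tri_V.e A W i j (f v)"
proof -
  interpret V: tri_V A n V by fact
  interpret W: tri_V A n W by fact
  show ?thesis unfolding V.e_def W.e_def by (rule mod_hom_smult[OF f V.el_closed]) (use assms in auto)
qed

context artin_alg_dual
begin

abbreviation cogen :: "nat \<Rightarrow> (nat \<Rightarrow> nat \<Rightarrow> 'a, nat \<Rightarrow> nat \<Rightarrow> 'a \<Rightarrow> 'e) module" where "cogen n \<equiv> tri_module n (mm n D)"

lemma cogen_tri_mod: "tri_mod A n (mm n D)"
  by (rule Mor_tri_mod[OF A_ring]) (use mm_Smon[OF D_fg, of n] in \<open>simp add: Smon_def del: mm_simps\<close>)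

text \<open>Since structure maps are injective, everything can be pushed into the first component,
  where D separates points from submodules. The summand m_n(D), constant with value D, detects
  injectivity and elements outside the image. The summands m_j(D) with j < n compare the
  filtrations: an element of f(V) that lies in step j + 1 of W comes from step j + 1 of V.\<close>

lemma detection:
  fixes V :: "(nat \<Rightarrow> nat \<Rightarrow> 'a, 'v) module" and W :: "(nat \<Rightarrow> nat \<Rightarrow> 'a, 'w) module"
  assumes V: "left_module (tri_ring n A) V" "fin_len (tri_ring n A) V" "monic n A V"
    and W: "left_module (tri_ring n A) W" "fin_len (tri_ring n A) W" "monic n A W"
    and f: "f \<in> mod_hom (tri_ring n A) V W"
    and factor: "\<And>\<phi>. \<phi> \<in> mod_hom (tri_ring n A) V (cogen n) \<Longrightarrow>
      \<exists>g\<in>mod_hom (tri_ring n A) W (cogen n). \<forall>x\<in>carrier V. g (f x) = \<phi> x"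
  shows "inj_on f (carrier V)"
    and "\<And>v. \<lbrakk>v \<in> carrier W; v \<notin> f ` carrier V\<rbrakk> \<Longrightarrow>
      \<exists>h\<in>mod_hom (tri_ring n A) W (cogen n). (\<forall>x\<in>carrier V. h (f x) = \<zero>\<^bsub>cogen n\<^esub>) \<and> h v \<noteq> \<zero>\<^bsub>cogen n\<^esub>"
proof -
  let ?T = "tri_ring n A"
  let ?J = "cogen n"
  interpret V: tri_V A n V by (intro tri_V.intro tri_V_axioms.intro A_ring V(1))
  interpret W: tri_V A n W by (intro tri_V.intro tri_V_axioms.intro A_ring W(1))
  interpret J: tri_mod A n "mm n D" by (rule cogen_tri_mod)
  interpret Dm: left_module A D by (rule D_left_module)
  note lJ = J.tri_module_left_module
  note fe = tri_V_e_hom[OF V.tri_V_axioms W.tri_V_axioms f]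
  have Vfg: "fin_gen A (V.comp i)" and Wfg: "fin_gen A (W.comp i)" if "i \<in> {1..n}" for i
    using fin_len_fin_gen[OF V.comp_left_module V.comp_fin_len] fin_len_fin_gen[OF W.comp_left_module W.comp_fin_len]
      that V(2) W(2) by blast+
  show "inj_on f (carrier V)"
    unfolding mod_hom_inj_iff[OF V(1) W(1) f]
  proof (intro ballI impI, rule ccontr)
    fix x assume x: "x \<in> carrier V" and fx: "f x = \<zero>\<^bsub>W\<^esub>" and "x \<noteq> \<zero>\<^bsub>V\<^esub>"
    then obtain i where i: "i \<in> {1..n}" and "V.e i i x \<noteq> \<zero>\<^bsub>V\<^esub>" using V.eq_zero_of_e by blast
    moreover from i have i': "1 \<le> i" "i \<le> n" "1 \<in> {1..n}" "n \<in> {1..n}" by auto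
    ultimately have nz: "V.e 1 i x \<notin> {\<zero>\<^bsub>V.comp 1\<^esub>}" using V.monic_e[OF V(3) _ _ _ x, of 1 i] by auto
    have ec: "V.e 1 i x \<in> carrier (V.comp 1)" by (rule V.e_in_comp) (use i' x in auto)
    note l1 = V.comp_left_module[OF i'(3)]
    obtain h where h: "h \<in> mod_hom A (V.comp 1) D" "h (V.e 1 i x) \<noteq> \<zero>\<^bsub>D\<^esub>"
      using D_cogenerator[OF l1 Vfg[OF i'(3)] submodule_zero_set[OF l1] ec nz] by blast
    \<comment> \<open>k = n selects the summand m_n(D), for which the vanishing condition of
      \<open>mm_hom\<close> is empty.\<close>
    let ?H = "\<lambda>v. \<lambda>j\<in>{1..n}. \<lambda>k\<in>{1..n}. if k = n \<and> j \<le> n then h (V.e 1 j v) else \<zero>\<^bsub>D\<^esub>"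
    have "?H \<in> mod_hom ?T V ?J" by (rule V.mm_hom[OF D_left_module cogen_tri_mod i'(4) h(1)]) simp
    from factor[OF this] obtain g where g: "g \<in> mod_hom ?T W ?J" "g (f x) = ?H x" using x by blast
    have "?H x i n = \<zero>\<^bsub>?J\<^esub> i n" unfolding g(2)[symmetric] fx mod_hom_zero[OF W(1) lJ g(1)] ..
    thus False using i i' h(2) by (simp del: D_simps)
  qed
  fix v assume v: "v \<in> carrier W" and nv: "v \<notin> f ` carrier V"
  obtain i where i: "i \<in> {1..n}" and ni: "W.e i i v \<notin> f ` carrier V"
  proof (rule ccontr)
    assume "\<not> thesis"
    hence "\<forall>i\<in>{1..n}. \<exists>u\<in>carrier V. W.e i i v = f u" using that by blast
    then obtain u where u: "\<And>i. i \<in> {1..n} \<Longrightarrow> u i \<in> carrier V" "\<And>i. i \<in> {1..n} \<Longrightarrow> W.e i i v = f (u i)" by metis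
    have uP: "u \<in> {1..n} \<rightarrow> carrier V" using u(1) by blast
    have "v = (\<Oplus>\<^bsub>W\<^esub>i\<in>{1..n}. W.e i i v)" by (rule W.sum_e[OF v])
    also have "\<dots> = (\<Oplus>\<^bsub>W\<^esub>i\<in>{1..n}. f (u i))"
      using mod_hom_closed[OF f u(1)] by (intro W.V.M.finsum_cong' refl Pi_I) (auto simp: u(2))
    also have "\<dots> = f (\<Oplus>\<^bsub>V\<^esub>i\<in>{1..n}. u i)" by (rule mod_hom_finsum[OF V(1) W(1) f uP, symmetric])
    finally show False using nv V.V.M.finsum_closed[OF uP] by blast
  qed
  have i': "1 \<le> i" "i \<le> n" "1 \<in> {1..n}" "n \<in> {1..n}" using i by auto
  \<comment> \<open>If the push-forward of e_ii v to the first component were in the image, it could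
    be lifted back along the chain, one structure map at a time, to e_ii v itself, against the
    choice of i.\<close>
  have nw: "W.e 1 i v \<notin> f ` carrier V"
  proof
    assume w: "W.e 1 i v \<in> f ` carrier V"
    have "W.e j i v \<in> f ` carrier V" if "1 \<le> j" "j \<le> i" for j
      using that
    proof (induction j rule: dec_induct)
      case base
      show ?case by (rule w)
    next
      case (step j)
      have j: "1 \<le> j" "j \<le> n" "Suc j \<le> n" "Suc j \<le> i" "j \<le> i" "j \<in> {1..n}" "Suc j \<in> {1..n}" using step i' by auto
      from step.IH obtain x' where x': "x' \<in> carrier V" "W.e j i v = f x'" using j by auto
      define x where "x = V.e j j x'"
      have x: "x \<in> carrier (V.comp j)" "x \<in> carrier V"
        unfolding x_def using j x' V.e_in_comp[of j j x'] by simp_all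
      have "f x = W.e j j (f x')" unfolding x_def by (rule fe[OF j(1) order_refl j(2) x'(1)])
      also have "\<dots> = W.e j i v" unfolding x'(2)[symmetric] by (rule W.e_e[OF j(1) order_refl j(5) i'(2) v])
      finally have fx: "f x = W.e j i v" .
      show ?case
      \<comment> \<open>If x comes from component j + 1 of V, injectivity of the structure map in W
        identifies the images one step higher. If not, D separates x from that component inside the
        first one, and the resulting map into m_j(D) contradicts factorisation.\<close>
      proof (cases "\<exists>y\<in>carrier V. x = V.e j (Suc j) y")
        case True
        then obtain y where y: "y \<in> carrier V" "x = V.e j (Suc j) y" by blast
        have fy: "f (V.e (Suc j) (Suc j) y) = W.e (Suc j) (Suc j) (f y)" using fe[of "Suc j" "Suc j" y] j y by simp
        have fyW: "f y \<in> carrier W" by (rule mod_hom_closed[OF f y(1)])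
        have "W.e j (Suc j) (W.e (Suc j) (Suc j) (f y)) = W.e j (Suc j) (f y)" using j fyW by (simp add: W.e_e)
        also have "\<dots> = W.e j i v" using fe[of j "Suc j" y] j y fx by simp
        also have "\<dots> = W.e j (Suc j) (W.e (Suc j) i v)" using j i' v by (simp add: W.e_e)
        finally have "W.e (Suc j) (Suc j) (f y) = W.e (Suc j) i v"
          by (rule inj_onD[OF W.e_inj[OF W(3) j(1) le_SucI[OF order_refl] j(3)]]) (use j i' fyW v in \<open>auto intro!: W.e_in_comp simp del: W.comp_simps\<close>)
        thus ?thesis using fy V.e_closed[of "Suc j" "Suc j" y] y j by (intro image_eqI[of _ _ "V.e (Suc j) (Suc j) y"]) simp_all
      next
        case False
        let ?U = "V.e 1 (Suc j) ` carrier (V.comp (Suc j))"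
        note l1 = V.comp_left_module[OF i'(3)] and l2 = V.comp_left_module[OF j(7)]
        have "V.e 1 (Suc j) \<in> mod_hom A (V.comp (Suc j)) (V.comp 1)" by (rule V.e_comp_hom) (use j in auto)
        from submodule_image[OF l2 l1 this submodule_carrier[OF l2]] have U: "submodule ?U A (V.comp 1)" .
        have ec: "V.e 1 j x \<in> carrier (V.comp 1)" by (rule V.e_in_comp) (use j x in auto)
        have nU: "V.e 1 j x \<notin> ?U"
        proof
          assume "V.e 1 j x \<in> ?U"
          then obtain y where y: "y \<in> carrier V" "V.e 1 j x = V.e 1 (Suc j) y" by auto
          have "V.e 1 (Suc j) y = V.e 1 j (V.e j (Suc j) y)" using j y by (simp add: V.e_e)
          hence "V.e 1 j x = V.e 1 j (V.e j (Suc j) y)" using y by simp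
          hence "x = V.e j (Suc j) y"
            by (rule inj_onD[OF V.e_inj[OF V(3) order_refl j(1,2)]]) (use j x y in \<open>auto intro!: V.e_in_comp simp del: V.comp_simps\<close>)
          thus False using False y by blast
        qed
        obtain h where h: "h \<in> mod_hom A (V.comp 1) D" "\<And>u. u \<in> ?U \<Longrightarrow> h u = \<zero>\<^bsub>D\<^esub>" "h (V.e 1 j x) \<noteq> \<zero>\<^bsub>D\<^esub>"
          using D_cogenerator[OF l1 Vfg[OF i'(3)] U ec nU] by blast
        let ?H = "\<lambda>v. \<lambda>l\<in>{1..n}. \<lambda>k\<in>{1..n}. if k = j \<and> l \<le> j then h (V.e 1 l v) else \<zero>\<^bsub>D\<^esub>"
        have "?H \<in> mod_hom ?T V ?J"
        proof (rule V.mm_hom[OF D_left_module cogen_tri_mod j(6) h(1)], rule h(2))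
          fix y assume y: "y \<in> carrier V"
          show "V.e 1 (Suc j) y \<in> ?U"
            using y j V.e_e[of 1 "Suc j" "Suc j" y] V.e_in_comp[of "Suc j" "Suc j" y]
            by (intro image_eqI[of _ _ "V.e (Suc j) (Suc j) y"]) simp_all
        qed
        from factor[OF this] obtain g where g: "g \<in> mod_hom ?T W ?J" "g (f x) = ?H x" using x by blast
        let ?u = "W.e (Suc j) i v"
        have u: "?u \<in> carrier W" using j i' v by (intro W.e_closed) auto
        \<comment> \<open>f x is the image of an element under the structure map of W into component
          j. In the summand m_j(D) the structure map into branch j is zero, so this coordinate of g
          (f x) vanishes, although it equals the nonzero value of h.\<close>
        have "f x = A.el j (Suc j) \<one>\<^bsub>A\<^esub> \<odot>\<^bsub>W\<^esub> ?u"
          using fx W.e_e[of j "Suc j" i v] j i' v by (simp add: W.e_def)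
        hence "g (f x) = A.el j (Suc j) \<one>\<^bsub>A\<^esub> \<odot>\<^bsub>?J\<^esub> g ?u"
          using mod_hom_smult[OF g(1) A.el_closed u] j by simp
        hence "?H x j = (A.el j (Suc j) \<one>\<^bsub>A\<^esub> \<odot>\<^bsub>?J\<^esub> g ?u) j" using g(2) by simp
        also have "\<dots> = \<one>\<^bsub>A\<^esub> \<odot>\<^bsub>branch (mm n D) j\<^esub> smap (mm n D) j (g ?u (Suc j))"
          using J.el_smult[OF j(1) _ j(3) A.one_closed mod_hom_closed[OF g(1) u] j(6)] j(1) by (simp add: J.phi_Suc)
        finally have "?H x j j = (\<one>\<^bsub>A\<^esub> \<odot>\<^bsub>branch (mm n D) j\<^esub> smap (mm n D) j (g ?u (Suc j))) j" by simp
        hence "h (V.e 1 j x) = \<one>\<^bsub>A\<^esub> \<odot>\<^bsub>D\<^esub> \<zero>\<^bsub>D\<^esub>" using j by (simp del: D_simps)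
        thus ?thesis using h(3) by (simp del: D_simps)
      qed
    qed
    thus False using ni i' by blast
  qed
  let ?U = "f ` carrier (V.comp 1)"
  note l1 = W.comp_left_module[OF i'(3)] and l2 = V.comp_left_module[OF i'(3)]
  have fc: "f x \<in> carrier (W.comp 1)" if "x \<in> carrier (V.comp 1)" for x
    using that fe[of 1 1 x] mod_hom_closed[OF f, of x] i' by simp
  have f1: "f \<in> mod_hom A (V.comp 1) (W.comp 1)"
  proof (rule mod_homI)
    show "f (x \<oplus>\<^bsub>V.comp 1\<^esub> y) = f x \<oplus>\<^bsub>W.comp 1\<^esub> f y" if "x \<in> carrier (V.comp 1)" "y \<in> carrier (V.comp 1)" for x y
      using that mod_hom_add[OF f, of x y] by simp
    show "f (a \<odot>\<^bsub>V.comp 1\<^esub> x) = a \<odot>\<^bsub>W.comp 1\<^esub> f x" if "a \<in> carrier A" "x \<in> carrier (V.comp 1)" for a x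
      using that mod_hom_smult[OF f A.el_closed, of 1 1 a x] i' by simp
  qed (rule fc)
  note U = submodule_image[OF l2 l1 f1 submodule_carrier[OF l2]]
  have ec: "W.e 1 i v \<in> carrier (W.comp 1)" by (rule W.e_in_comp) (use i' v in auto)
  have "W.e 1 i v \<notin> ?U" using nw by auto
  then obtain h where h: "h \<in> mod_hom A (W.comp 1) D" "\<And>u. u \<in> ?U \<Longrightarrow> h u = \<zero>\<^bsub>D\<^esub>" "h (W.e 1 i v) \<noteq> \<zero>\<^bsub>D\<^esub>"
    using D_cogenerator[OF l1 Wfg[OF i'(3)] U ec] by blast
  \<comment> \<open>With the first component of v outside the image, the separating map h is spread
    over all branches by the constant summand m_n(D).\<close>
  let ?H = "\<lambda>v. \<lambda>j\<in>{1..n}. \<lambda>k\<in>{1..n}. if k = n \<and> j \<le> n then h (W.e 1 j v) else \<zero>\<^bsub>D\<^esub>"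
  have H: "?H \<in> mod_hom ?T W ?J" by (rule W.mm_hom[OF D_left_module cogen_tri_mod i'(4) h(1)]) simp
  have Hf: "?H (f x) = \<zero>\<^bsub>?J\<^esub>" if x: "x \<in> carrier V" for x
  proof -
    have "h (W.e 1 j (f x)) = \<zero>\<^bsub>D\<^esub>" if j: "j \<in> {1..n}" for j
    proof -
      have "f (V.e 1 j x) \<in> ?U" by (intro imageI V.e_in_comp) (use j x in auto)
      moreover have "f (V.e 1 j x) = W.e 1 j (f x)" by (rule fe) (use j x in auto)
      ultimately show ?thesis using h(2) by metis
    qed
    thus ?thesis by (auto simp: fun_eq_iff simp del: D_simps)
  qed
  have Hv: "?H v \<noteq> \<zero>\<^bsub>?J\<^esub>"
  proof
    assume "?H v = \<zero>\<^bsub>?J\<^esub>"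
    hence "?H v i n = \<zero>\<^bsub>?J\<^esub> i n" by (simp only:)
    thus False using i i' h(3) by (simp del: D_simps)
  qed
  show "\<exists>h\<in>mod_hom ?T W ?J. (\<forall>x\<in>carrier V. h (f x) = \<zero>\<^bsub>?J\<^esub>) \<and> h v \<noteq> \<zero>\<^bsub>?J\<^esub>"
    by (rule bexI[OF _ H], rule conjI, rule ballI, erule Hf, rule Hv)
qed

end

subsection \<open>Finite type and bi-generators\<close>

lemma indecomposable_iso:
  fixes X :: "('b, 'm) module" and Y :: "('b, 'k) module"
  assumes X: "left_module B X" and Y: "left_module B Y" and iso: "mod_iso B X Y" and ind: "indecomposable B X"
  shows "indecomposable B Y"
proof -
  obtain g where g: "g \<in> mod_hom B Y X" and bij: "bij_betw g (carrier Y) (carrier X)"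
    using mod_iso_sym[OF X iso] by (auto simp: mod_iso_def)
  have inj: "inj_on g (carrier Y)" and surj: "g ` carrier Y = carrier X" using bij by (auto simp: bij_betw_def)
  have g0: "g \<zero>\<^bsub>Y\<^esub> = \<zero>\<^bsub>X\<^esub>" by (rule mod_hom_zero[OF Y X g])
  have img: "U = {\<zero>\<^bsub>Y\<^esub>} \<longleftrightarrow> g ` U = {\<zero>\<^bsub>X\<^esub>}" if "submodule U B Y" for U
    using inj_on_image_eq_iff[OF inj submodule_subset[OF that] submodule_subset[OF submodule_zero_set[OF Y]]] g0 by simp
  have "U = {\<zero>\<^bsub>Y\<^esub>} \<or> V = {\<zero>\<^bsub>Y\<^esub>}" if UV: "internal_dsum B Y U V" for U V
  proof -
    have sub: "submodule U B Y" "submodule V B Y" and sum: "U <+>\<^bsub>Y\<^esub> V = carrier Y" and int: "U \<inter> V = {\<zero>\<^bsub>Y\<^esub>}"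
      using UV by (auto simp: internal_dsum_def)
    note s = submodule_subset[OF sub(1)] submodule_subset[OF sub(2)]
    have "g (u \<oplus>\<^bsub>Y\<^esub> v) = g u \<oplus>\<^bsub>X\<^esub> g v" if "u \<in> U" "v \<in> V" for u v
      using s that by (intro mod_hom_add[OF g]) auto
    hence "g ` U <+>\<^bsub>X\<^esub> g ` V = g ` (U <+>\<^bsub>Y\<^esub> V)"
      by (simp add: set_add_def set_mult_def image_UN)
    moreover have "g ` U \<inter> g ` V = {\<zero>\<^bsub>X\<^esub>}" using inj_on_image_Int[OF inj s] int g0 by simp
    ultimately have "internal_dsum B X (g ` U) (g ` V)"
      unfolding internal_dsum_def using submodule_image[OF Y X g] sub sum surj by simp
    hence "g ` U = {\<zero>\<^bsub>X\<^esub>} \<or> g ` V = {\<zero>\<^bsub>X\<^esub>}" using ind unfolding indecomposable_def by (elim conjE allE impE)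
    thus ?thesis by (simp only: img[OF sub(1)] img[OF sub(2)])
  qed
  moreover have "carrier Y \<noteq> {\<zero>\<^bsub>Y\<^esub>}"
    using img[OF submodule_carrier[OF Y]] surj ind by (simp add: indecomposable_def)
  ultimately show ?thesis by (simp add: indecomposable_def)
qed

text \<open>The representatives F U need neither belong to the class nor have carriers of its type;
  they will be submodules of \<open>tri_module n M\<close>. An isomorphism class is recovered from
  any representative isomorphic to one of its members.\<close>

lemma finite_typeI:
  fixes \<C> :: "('b, 'm) module set" and F :: "'u \<Rightarrow> ('b, 'k) module"
  assumes C: "\<And>X. X \<in> \<C> \<Longrightarrow> left_module B X" and fin: "finite \<D>"
    and cover: "\<And>X. \<lbrakk>X \<in> \<C>; indecomposable B X\<rbrakk> \<Longrightarrow> \<exists>U\<in>\<D>. mod_iso B X (F U)"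
  shows "finite_type B \<C>"
proof -
  define \<I> where "\<I> = {X \<in> \<C>. indecomposable B X}"
  let ?r = "{(X, Y). X \<in> \<I> \<and> Y \<in> \<I> \<and> mod_iso B X Y}"
  have "\<I> // ?r \<subseteq> (\<lambda>U. {Y \<in> \<I>. mod_iso B Y (F U)}) ` \<D>"
  proof
    fix K assume "K \<in> \<I> // ?r"
    then obtain X where X: "X \<in> \<I>" "K = ?r `` {X}" by (rule quotientE)
    obtain U where U: "U \<in> \<D>" "mod_iso B X (F U)" using cover X(1) by (auto simp: \<I>_def)
    have "mod_iso B X Y \<longleftrightarrow> mod_iso B Y (F U)" if "Y \<in> \<I>" for Y
    proof -
      have l: "left_module B X" "left_module B Y" using X(1) that C by (auto simp: \<I>_def)
      show ?thesis
        using mod_iso_trans[OF mod_iso_sym[OF l(1)] U(2)] mod_iso_sym[OF l(2), of "F U"] mod_iso_trans[OF U(2), of Y] by blast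
    qed
    hence "K = {Y \<in> \<I>. mod_iso B Y (F U)}" using X by auto
    thus "K \<in> (\<lambda>U. {Y \<in> \<I>. mod_iso B Y (F U)}) ` \<D>" using U(1) by blast
  qed
  hence "finite (\<I> // ?r)" by (rule finite_subset) (rule finite_imageI[OF fin])
  thus ?thesis by (simp add: finite_type_def Let_def \<I>_def)
qed

lemma finite_typeE:
  fixes \<C> :: "('b, 'm) module set"
  assumes "finite_type B \<C>"
  obtains l :: nat and X where "\<And>i. i < l \<Longrightarrow> X i \<in> \<C>"
    "\<And>Y. \<lbrakk>Y \<in> \<C>; indecomposable B Y\<rbrakk> \<Longrightarrow> \<exists>i<l. mod_iso B Y (X i)"
proof -
  define \<I> where "\<I> = {X \<in> \<C>. indecomposable B X}"
  let ?r = "{(X, Y). X \<in> \<I> \<and> Y \<in> \<I> \<and> mod_iso B X Y}"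
  have fin: "finite (\<I> // ?r)" using assms by (simp add: finite_type_def Let_def \<I>_def)
  obtain K where K: "bij_betw K {..<card (\<I> // ?r)} (\<I> // ?r)"
    using ex_bij_betw_nat_finite[OF fin] by (auto simp: atLeast0LessThan)
  define X where "X i = (SOME Z. Z \<in> K i)" for i
  have ne: "X i \<in> K i" if "i < card (\<I> // ?r)" for i
  proof -
    have "K i \<in> \<I> // ?r" using K that by (auto simp: bij_betw_def)
    then obtain Y where "Y \<in> \<I>" "K i = ?r `` {Y}" by (rule quotientE)
    hence "Y \<in> K i" using mod_iso_refl by auto
    thus ?thesis unfolding X_def by (rule someI)
  qed
  show ?thesis
  proof (rule that[of "card (\<I> // ?r)" X])
    fix i assume i: "i < card (\<I> // ?r)"
    have "K i \<in> \<I> // ?r" using K i by (auto simp: bij_betw_def)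
    then obtain Y where "Y \<in> \<I>" "K i = ?r `` {Y}" by (rule quotientE)
    thus "X i \<in> \<C>" using ne[OF i] by (auto simp: \<I>_def)
  next
    fix Y assume "Y \<in> \<C>" "indecomposable B Y"
    hence Y: "Y \<in> \<I>" by (simp add: \<I>_def)
    hence "?r `` {Y} \<in> K ` {..<card (\<I> // ?r)}" using quotientI[OF Y, of ?r] K by (simp add: bij_betw_def)
    then obtain i where i: "i < card (\<I> // ?r)" "K i = ?r `` {Y}" by auto
    thus "\<exists>i<card (\<I> // ?r). mod_iso B Y (X i)" using ne[OF i(1)] by auto
  qed
qed

lemma reg_fgproj: "ring B \<Longrightarrow> fgproj B (reg B)"
proof -
  assume B: "ring B"
  have "retract B (reg B) (free B 1)"
    by (rule retractI[OF dinj_hom dsum_proj[of 0]]) (auto simp: reg_left_module[OF B] dinj_def)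
  thus ?thesis by (auto simp: fgproj_def)
qed

text \<open>\<open>generator\<close> speaks about projectives with carriers in
  \<open>fg_mod\<close>; the regular module is carried there to apply it.\<close>

lemma generator_reg_retract:
  fixes M :: "('b, 'm) module"
  assumes B: "ring B" and gen: "generator B M"
  shows "\<exists>k. retract B (reg B) (copies M k)"
proof -
  note lr = reg_left_module[OF B]
  have "fg_module B (reg B)" using fgproj_fin_gen[OF lr reg_fgproj[OF B]] lr by (simp add: fg_module_def)
  then obtain N :: "'b fg_mod" where N: "fg_module B N" "mod_iso B (reg B) N" using fg_module_realised by blast
  have lN: "left_module B N" and lM: "left_module B M" using N(1) gen by (auto simp: fg_module_def generator_def)
  have "fgproj B N" by (rule fgproj_retract[OF iso_imp_retract[OF lN mod_iso_sym[OF lr N(2)]] reg_fgproj[OF B]])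
  hence "in_add B M N" using gen projective_iff_fgproj[OF lN] by (simp add: generator_def)
  then obtain k where "retract B N (copies M k)" using in_add_iff_retract[OF lM lN] by blast
  with retract_trans[OF iso_imp_retract[OF lr N(2)]] show ?thesis by blast
qed

section \<open>The two directions of the equivalence\<close>

context artin_alg_dual
begin

lemma Smon_tri_module:
  fixes X :: "('a, 'x) mor"
  assumes X: "X \<in> Smon n A"
  shows "left_module (tri_ring n A) (tri_module n X)" "fin_len (tri_ring n A) (tri_module n X)" "monic n A (tri_module n X)"
proof -
  have XM: "X \<in> Mor n A" using X by (simp add: Smon_def)
  interpret X: tri_mod A n X by (rule Mor_tri_mod[OF A_ring XM])
  show "left_module (tri_ring n A) (tri_module n X)" by (rule X.tri_module_left_module)
  show "fin_len (tri_ring n A) (tri_module n X)"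
  proof (rule X.tri_module_fin_len)
    fix i assume i: "i \<in> {1..n}"
    hence "fg_module A (branch X i)" using XM by (simp add: Mor_def)
    thus "fin_len A (branch X i)" using fg_iff_fin_len[OF reg_fin_len X.branch[OF i]] by simp
  qed
  show "monic n A (tri_module n X)" by (rule X.monic_tri_module) (use X in \<open>auto simp: Smon_def\<close>)
qed

lemmas cogen_module = Smon_tri_module[OF mm_Smon[OF D_fg]]

lemma copies_module:
  assumes "left_module (tri_ring n A) M" "fin_len (tri_ring n A) M" "monic n A M"
  shows "left_module (tri_ring n A) (copies M k)" "fin_len (tri_ring n A) (copies M k)" "monic n A (copies M k)"
  by (rule copies_left_module[OF assms(1)]
      fin_len_dsum[OF tri_ring_ring finite_lessThan assms(1,2)] monic_dsum[OF assms(3)])+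

text \<open>Puts S_n(A) into add(M). Projectivity comes from \<open>Hom_mod_fgproj\<close>. The
  detection hypothesis there is phrased with M, whereas \<open>detection\<close> is phrased with
  m(D); the retraction of M^l onto m(D) mediates.\<close>

lemma monic_retract_copies:
  fixes M :: "(nat \<Rightarrow> nat \<Rightarrow> 'a, 'm) module" and X :: "(nat \<Rightarrow> nat \<Rightarrow> 'a, 'x) module"
  assumes M: "left_module (tri_ring n A) M" "fin_len (tri_ring n A) M" "monic n A M"
    and gen: "generator (tri_ring n A) M" and J: "in_add (tri_ring n A) M (cogen n)"
    and gd: "gl_dim (End_ring (tri_ring n A) M) \<le> 2"
    and X: "left_module (tri_ring n A) X" "fin_len (tri_ring n A) X" "monic n A X"
  shows "\<exists>k. retract (tri_ring n A) X (copies M k)"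
proof -
  let ?J = "cogen n"
  let ?T = "tri_ring n A"
  note lJ = cogen_module(1)[of n]
  obtain k where k: "retract ?T (reg ?T) (copies M k)" using generator_reg_retract[OF tri_ring_ring gen] by blast
  obtain l i p where ip: "i \<in> mod_hom ?T ?J (copies M l)" "p \<in> mod_hom ?T (copies M l) ?J"
    "\<And>x. x \<in> carrier ?J \<Longrightarrow> p (i x) = x"
    using J unfolding in_add_iff_retract[OF M(1) lJ] retract_def by blast
  show ?thesis
  proof (rule retract_copies_of_Hom_fgproj[OF M(1) X(1) Hom_mod_fgproj[OF M(1) k gd X(1) fin_len_fin_gen[OF X(1,2)] tri_reg_fin_len]])
    fix k f assume f: "f \<in> mod_hom ?T X (copies M k)"
      and fac: "\<And>\<phi>. \<phi> \<in> mod_hom ?T X M \<Longrightarrow> \<exists>g\<in>mod_hom ?T (copies M k) M. \<forall>x\<in>carrier X. g (f x) = \<phi> x"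
    note C = copies_module[OF M, of k]
    \<comment> \<open>A map into m(D) is followed by i into M^l, factored through f coordinate by
      coordinate, and brought back by p.\<close>
    have factor: "\<exists>g\<in>mod_hom ?T (copies M k) ?J. \<forall>x\<in>carrier X. g (f x) = \<phi> x"
      if \<phi>: "\<phi> \<in> mod_hom ?T X ?J" for \<phi>
    proof -
      have "(\<lambda>x. i (\<phi> x) s) \<in> mod_hom ?T X M" if "s \<in> {..<l}" for s
        by (rule mod_hom_comp[OF mod_hom_comp[OF \<phi> ip(1)] dsum_proj[OF that]])
      hence "\<forall>s\<in>{..<l}. \<exists>g\<in>mod_hom ?T (copies M k) M. \<forall>x\<in>carrier X. g (f x) = i (\<phi> x) s" using fac by blast
      then obtain g where g: "\<And>s. s \<in> {..<l} \<Longrightarrow> g s \<in> mod_hom ?T (copies M k) M"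
        and gf: "\<And>s x. \<lbrakk>s \<in> {..<l}; x \<in> carrier X\<rbrakk> \<Longrightarrow> g s (f x) = i (\<phi> x) s" by metis
      let ?g = "\<lambda>v. \<lambda>s\<in>{..<l}. g s v"
      have "?g (f x) = i (\<phi> x)" if x: "x \<in> carrier X" for x
        using mod_hom_closed[OF ip(1) mod_hom_closed[OF \<phi> x]] gf[OF _ x]
        by (intro extensionalityI[of _ "{..<l}"]) (auto simp: PiE_iff)
      moreover have "(\<lambda>v. p (?g v)) \<in> mod_hom ?T (copies M k) ?J"
        by (rule mod_hom_comp[OF mod_hom_dsumI[OF C(1) g] ip(2)])
      ultimately show ?thesis using ip(3) mod_hom_closed[OF \<phi>] by (intro bexI[of _ "\<lambda>v. p (?g v)"]) simp_all
    qed
    show "inj_on f (carrier X) \<and> (\<forall>v\<in>carrier (copies M k). v \<notin> f ` carrier X \<longrightarrow>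
        (\<exists>h\<in>mod_hom ?T (copies M k) M. (\<forall>x\<in>carrier X. h (f x) = \<zero>\<^bsub>M\<^esub>) \<and> h v \<noteq> \<zero>\<^bsub>M\<^esub>))"
    proof (intro conjI ballI impI)
      show "inj_on f (carrier X)" by (rule detection(1)[OF X C f]) (rule factor)
      fix v assume v: "v \<in> carrier (copies M k)" "v \<notin> f ` carrier X"
      have "\<exists>h\<in>mod_hom ?T (copies M k) ?J. (\<forall>x\<in>carrier X. h (f x) = \<zero>\<^bsub>?J\<^esub>) \<and> h v \<noteq> \<zero>\<^bsub>?J\<^esub>"
        by (rule detection(2)[OF X C f _ v]) (rule factor)
      then obtain h where h: "h \<in> mod_hom ?T (copies M k) ?J" "\<And>x. x \<in> carrier X \<Longrightarrow> h (f x) = \<zero>\<^bsub>?J\<^esub>" "h v \<noteq> \<zero>\<^bsub>?J\<^esub>"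
        by (elim bexE conjE) blast
      note i0 = mod_hom_zero[OF lJ copies_left_module[OF M(1)] ip(1)]
      \<comment> \<open>A separating map into m(D) stays nonzero at v after i, so one of its
        coordinates separates with values in M.\<close>
      have "i (h v) \<noteq> \<zero>\<^bsub>copies M l\<^esub>"
        using ip(3)[OF mod_hom_closed[OF h(1) v(1)]] h(3) mod_hom_zero[OF copies_left_module[OF M(1)] lJ ip(2)] by metis
      moreover have "i (h v) \<in> carrier (copies M l)" by (rule mod_hom_closed[OF ip(1) mod_hom_closed[OF h(1) v(1)]])
      ultimately obtain s where s: "s \<in> {..<l}" "i (h v) s \<noteq> \<zero>\<^bsub>M\<^esub>"
        using extensionalityI[of "i (h v)" "{..<l}" "\<zero>\<^bsub>copies M l\<^esub>"] by (auto simp: PiE_iff)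
      show "\<exists>h\<in>mod_hom ?T (copies M k) M. (\<forall>x\<in>carrier X. h (f x) = \<zero>\<^bsub>M\<^esub>) \<and> h v \<noteq> \<zero>\<^bsub>M\<^esub>"
        by (rule bexI[OF _ mod_hom_comp[OF mod_hom_comp[OF h(1) ip(1)] dsum_proj[OF s(1)]]])
          (use s h(2) i0 in \<open>simp del: tri_module_simps mm_simps\<close>)
    qed
  qed
qed

text \<open>\<open>indecomposable_retract_copies\<close> moves an indecomposable X from a power of M
  into M, whose indecomposable retracts fall into finitely many isomorphism classes.\<close>

lemma finite_type_of_bi_generator:
  fixes M :: "('a, 'm) mor"
  assumes M: "bi_generator n A D M" and gd: "gl_dim (End_ring (tri_ring n A) (tri_module n M)) \<le> 2"
  shows "finite_type (tri_ring n A) (tri_module n ` (Smon n A :: ('a, 'x) mor set))"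
proof -
  let ?M = "tri_module n M"
  let ?T = "tri_ring n A"
  have MS: "M \<in> Smon n A" and gen: "generator ?T ?M" and J: "in_add ?T ?M (cogen n)"
    using M by (auto simp: bi_generator_def)
  note m = Smon_tri_module[OF MS]
  obtain \<D> where D: "finite \<D>" "\<And>X :: (nat \<Rightarrow> nat \<Rightarrow> 'a, nat \<Rightarrow> 'x) module. \<lbrakk>left_module ?T X; fin_len ?T X; indecomposable ?T X;
      retract ?T X ?M\<rbrakk> \<Longrightarrow> \<exists>U\<in>\<D>. mod_iso ?T X (?M\<lparr>carrier := U\<rparr>)"
    using indecomposable_retracts_finite[OF m(1,2)] by metis
  show ?thesis
  proof (rule finite_typeI[where F = "\<lambda>U. ?M\<lparr>carrier := U\<rparr>", OF _ D(1)])
    fix X :: "(nat \<Rightarrow> nat \<Rightarrow> 'a, nat \<Rightarrow> 'x) module" assume "X \<in> tri_module n ` Smon n A"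
    then obtain X' where X': "X = tri_module n X'" "X' \<in> Smon n A" by blast
    note x = Smon_tri_module[OF X'(2), folded X'(1)]
    show "left_module ?T X" by (rule x(1))
    assume ind: "indecomposable ?T X"
    obtain k where "retract ?T X (copies ?M k)" using monic_retract_copies[OF m gen J gd x] by blast
    from indecomposable_retract_copies[OF x(1,2) ind m(1) this] show "\<exists>U\<in>\<D>. mod_iso ?T X (?M\<lparr>carrier := U\<rparr>)"
      by (rule D(2)[OF x(1,2) ind])
  qed
qed

lemma bi_generator_of_finite_type:
  assumes ft: "finite_type (tri_ring n A) (tri_module n ` (Smon n A :: ('a, (nat \<Rightarrow> 'a) set) mor set))"
  shows "\<exists>M :: ('a, (nat \<Rightarrow> 'a) set) mor. bi_generator n A D M \<and> gl_dim (End_ring (tri_ring n A) (tri_module n M)) \<le> 2"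
proof -
  let ?T = "tri_ring n A" and ?C = "tri_module n ` (Smon n A :: ('a, (nat \<Rightarrow> 'a) set) mor set)"
  obtain l :: nat and X where X: "\<And>i. i < l \<Longrightarrow> X i \<in> ?C"
    and cover: "\<And>Y. \<lbrakk>Y \<in> ?C; indecomposable ?T Y\<rbrakk> \<Longrightarrow> \<exists>i<l. mod_iso ?T Y (X i)"
    by (rule finite_typeE[OF ft that])
  have x: "left_module ?T (X i)" "fin_len ?T (X i)" "monic n A (X i)" if i: "i \<in> {..<l}" for i
    using Smon_tri_module X[of i] i by auto
  have V: "left_module ?T (dsum {..<l} X)" "fin_len ?T (dsum {..<l} X)" "monic n A (dsum {..<l} X)"
    by (rule dsum_left_module[OF tri_ring_ring x(1)] fin_len_dsum[OF tri_ring_ring finite_lessThan x(1,2)] monic_dsum[OF x(3)]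
        | assumption)+
  \<comment> \<open>The direct sum of representatives is replaced by an isomorphic object of S_n(A)
    whose branches have carriers of the required type.\<close>
  obtain M :: "('a, (nat \<Rightarrow> 'a) set) mor" where M: "M \<in> Smon n A" "mod_iso ?T (dsum {..<l} X) (tri_module n M)"
    using realise_monic[OF A_ring V] by blast
  define N where "N = tri_module n M"
  note m = Smon_tri_module[OF M(1), folded N_def]
  have XM: "retract ?T (X i) N" if "i < l" for i
  proof (rule retract_trans[OF _ iso_imp_retract[OF V(1) M(2), folded N_def]])
    have i: "i \<in> {..<l}" using that by simp
    show "retract ?T (X i) (dsum {..<l} X)" by (rule retractI[OF dinj_hom[OF x(1) i] dsum_proj[OF i]]) (use i in \<open>simp_all add: dinj_def\<close>)
  qed
  \<comment> \<open>The carrier type of W stays general, because the fact serves free modules, m(D)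
    and submodules of powers of N.\<close>
  have ret: "\<exists>k. retract ?T (W\<lparr>carrier := U\<rparr>) (copies N k)"
    if W: "left_module ?T W" "fin_len ?T W" "monic n A W" and U: "submodule U ?T W"
    for W :: "(nat \<Rightarrow> nat \<Rightarrow> 'a, 'w) module" and U
    using W(1,2) U
  proof (induction rule: decompose_induct)
    case zero
    let ?Z = "W\<lparr>carrier := {\<zero>\<^bsub>W\<^esub>}\<rparr>"
    have "left_module ?T ?Z" by (rule submodule_left_module[OF W(1) submodule_zero_set[OF W(1)]])
    from retractI[OF mod_hom_const_zero[OF copies_left_module[OF m(1)]] mod_hom_const_zero[OF this]]
    show ?case by auto
  next
    \<comment> \<open>U satisfies \<open>monic\<close> but has the wrong carrier type for the class;
      it is first realised as an object Y, which is then matched with one of the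
      \<open>X i\<close>.\<close>
    case (indecomposable U)
    note lU = submodule_left_module[OF W(1) indecomposable(1)]
    obtain Y :: "('a, (nat \<Rightarrow> 'a) set) mor" where Y: "Y \<in> Smon n A" "mod_iso ?T (W\<lparr>carrier := U\<rparr>) (tri_module n Y)"
      using realise_monic[OF A_ring lU fin_len_submodule[OF W(1,2) indecomposable(1)] A.monic_submodule[OF W(1) indecomposable(1) W(3)]]
      by blast
    note y = Smon_tri_module[OF Y(1)]
    obtain i where i: "i < l" "mod_iso ?T (tri_module n Y) (X i)"
      using cover indecomposable_iso[OF lU y(1) Y(2) indecomposable(2)] Y(1) by blast
    have "retract ?T N (copies N 1)"
      by (rule retractI[OF dinj_hom dsum_proj[of 0]]) (auto simp: m dinj_def)
    with XM[OF i(1)] have "retract ?T (X i) (copies N 1)" by (rule retract_trans)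
    thus ?case using retract_trans[OF iso_imp_retract[OF lU mod_iso_trans[OF Y(2) i(2)]]] by blast
  next
    case (sum U V U')
    thus ?case using retract_copies_sum[OF W(1) m(1) sum(3,4)] by blast
  qed
  have rets: "\<exists>k. retract ?T W (copies N k)" if "left_module ?T W" "fin_len ?T W" "monic n A W"
    for W :: "(nat \<Rightarrow> nat \<Rightarrow> 'a, 'w) module"
    using ret[OF that submodule_carrier[OF that(1)]] by simp
  have fgN: "fg_module ?T N" using fg_iff_fin_len[OF tri_reg_fin_len m(1)] m(2) by simp
  have "in_add ?T N P" if P: "projective ?T P" for P :: "(nat \<Rightarrow> nat \<Rightarrow> 'a) fg_mod"
  proof -
    have lP: "left_module ?T P" using P by (simp add: projective_def fg_module_def)
    obtain k where k: "retract ?T P (free ?T k)" using P projective_iff_fgproj[OF lP] by (auto simp: fgproj_def)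
    have "left_module ?T (free ?T k)" "fin_len ?T (free ?T k)" "monic n A (free ?T k)"
      by (rule free_left_module[OF tri_ring_ring] fin_len_free[OF tri_ring_ring tri_reg_fin_len] monic_dsum[OF A.monic_reg])+
    from rets[OF this] show ?thesis using retract_trans[OF k] in_add_iff_retract[OF m(1) lP] by blast
  qed
  hence "bi_generator n A D M"
    unfolding bi_generator_def generator_def N_def[symmetric]
    using fgN M(1) rets[OF cogen_module] in_add_iff_retract[OF m(1) cogen_module(1)] by blast
  moreover have "gl_dim (End_ring ?T N) \<le> 2"
  proof (rule gl_dim_End_le_2[OF m(1) tri_End_fin_len[OF m(1)]])
    show "fin_gen ?T N" using fgN by (simp add: fg_module_def)
    show "\<exists>k. retract ?T ((copies N l)\<lparr>carrier := Y\<rparr>) (copies N k)" if "submodule Y ?T (copies N l)" for l Y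
      by (rule ret[OF copies_module[OF m] that])
  qed
  ultimately show ?thesis unfolding N_def by blast
qed

end

theorem theorem5p1:
  fixes R :: "'r ring" and A :: "('r, 'a) module" and E :: "('r, 'e) module" and n :: nat
  assumes "artin_algebra R A"
    and "injective_envelope R (quot_module R (rad R)) E"
    and "n \<ge> 2"
  shows "finite_type (tri_ring n A)
      (tri_module n ` (Smon n A :: ('a, (nat \<Rightarrow> 'a) set) mor set)) \<longleftrightarrow>
    (\<exists>M :: ('a, (nat \<Rightarrow> 'a) set) mor.
      bi_generator n A (duality R A E (regular_right A)) M \<and>
      gl_dim (End_ring (tri_ring n A) (tri_module n M)) \<le> 2)"
proof -
  interpret artin_alg_dual R A E
    by (intro artin_alg_dual.intro artin_alg.intro artin_alg_dual_axioms.intro assms)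
  show ?thesis using finite_type_of_bi_generator bi_generator_of_finite_type by blast
qed

end
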